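(* Let $M$ be a complete smooth Riemannian manifold of dimension $n$ with Levi-Civita connection $\nabla$ and curvature tensor $R$. Let $\gamma:[0,L]\to M$ be a $C^2$ curve parameterized by arc length, and let $T=\gamma'$. (a) Let $\{\gamma_\tau\}_{|\tau|<\epsilon}$ be a rigid variation of $\gamma$, and let $X$ be its variation field. Then there is a skew-symmetric $(1,1)$ tensor $A$ along $\gamma$ (a field of skew-symmetric endomorphisms $A(t)$ of $T_{\gamma(t)}M$) such that $X$ and $A$ satisfy the generalized Jacobi equations $$\nabla_T X = AT \qquad\text{and}\qquad \nabla_T A = R(T,X)$$ along $\gamma$. (b) Conversely, every solution $(X,A)$ of these equations along $\gamma$, with $X$ a vector field along $\gamma$ and $A$ a skew-symmetric $(1,1)$ tensor along $\gamma$, arises from a rigid variation of $\gamma$. That is, there is a rigid variation $\{\gamma_\tau\}$ of $\gamma$, with Bishop frames $T_\tau,(N_2)_\tau,\dots,(N_n)_\tau$, such that $X$ is its variation field and $A$ is the infinitesimal rotation of its Bishop frames.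
   Context: Curvature convention: $R(Y,Z)W=\nabla_Y\nabla_Z W-\nabla_Z\nabla_Y W-\nabla_{[Y,Z]}W$, so $R(T,X)$ is an endomorphism of the tangent space. Bishop frame: let $\gamma:[0,L]\to M$ be a $C^2$ curve parameterized by arc length with $T=\gamma'$. Extend $T_{\gamma(0)}$ to an orthonormal basis $T_{\gamma(0)},N_2,\dots,N_n$ of $T_{\gamma(0)}M$, and extend each $N_i$ along $\gamma$ by parallel translation in the normal bundle of $\gamma$ with respect to the connection induced from $\nabla$. The resulting orthonormal frame $T,N_2,\dots,N_n$ along $\gamma$ is called a Bishop frame along $\gamma$; each $\nabla_T N_i$ is a multiple of $T$. The geodesic curvature functions $\kappa_2,\dots,\kappa_n$ are defined by $\nabla_T T=\sum_{i=2}^n\kappa_i N_i$; then $\nabla_T N_i=-\kappa_i T$. In a complete Riemannian manifold, given an orthonormal basis $T,N_2,\dots,N_n$ of $T_pM$ and continuous functions $\kappa_2,\dots,\kappa_n:[0,L]\to\mathbb{R}$, there is a unique unit-speed $C^2$ curve $[0,L]\to M$ starting at $p$, with a unique extension of the basis to a Bishop frame along it, such that $T$ is the tangent vector of the curve and $\nabla_T T=\sum_{i=2}^n\kappa_i N_i$. Rigid variation: a rigid variation of $\gamma$ is a one-parameter family of curves $\{\gamma_\tau\}$, $|\tau|<\epsilon$, with $\gamma_0=\gamma$, obtained as follows. Let $c:(-\epsilon,\epsilon)\to M$ be a $C^1$ curve with $c(0)=\gamma(0)$. Let $T=\gamma'(0),N_2,\dots,N_n$ be an orthonormal basis of $T_{\gamma(0)}M$.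 Extend it to an orthonormal frame along $c$ in an arbitrary $C^1$ manner, and to a Bishop frame along $\gamma$, with geodesic curvature functions $\kappa_2,\dots,\kappa_n$. For each $\tau$ let $\gamma_\tau:[0,L]\to M$ be the unique curve with Bishop frame $T_\tau,(N_2)_\tau,\dots,(N_n)_\tau$ such that $\gamma_\tau(0)=c(\tau)$, the frame at $\gamma_\tau(0)$ is the chosen frame at $c(\tau)$, $\gamma_\tau'(t)=T_\tau$, and $\nabla_{T_\tau}T_\tau=\sum_{i=2}^n\kappa_i (N_i)_\tau$ (the same functions $\kappa_i$ for all $\tau$). Variation field: $X_{\gamma(t)}=\left.\frac{\partial}{\partial\tau}\right|_{\tau=0}\gamma_\tau(t)$. Infinitesimal rotation of the Bishop frames: the $(1,1)$ tensor along $\gamma$ defined by $T\mapsto \nabla_{\partial/\partial\tau}T_\tau|_{\tau=0}$ and $N_i\mapsto\nabla_{\partial/\partial\tau}(N_i)_\tau|_{\tau=0}$, i.e. the covariant derivative of the frame in the transverse direction. *)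

theory Defs
  imports "HOL-Analysis.Analysis"
begin

section \<open>Differentiability classes\<close>

text \<open>
  This is used for sets S that are open or relatively open in a nondegenerate real interval
  (then derivatives within S are unique, and one-sided at end points of the interval).
\<close>

primrec C_k_on :: "nat \<Rightarrow> 'a::real_normed_vector set \<Rightarrow> ('a \<Rightarrow> 'b::real_normed_vector) \<Rightarrow> bool" where
  "C_k_on 0 S f \<longleftrightarrow> continuous_on S f"
| "C_k_on (Suc k) S f \<longleftrightarrow>
     (\<exists>f'. (\<forall>x\<in>S. (f has_derivative f' x) (at x within S)) \<and> (\<forall>v. C_k_on k S (\<lambda>x. f' x v)))"

definition smooth_on :: "'a::real_normed_vector set \<Rightarrow> ('a \<Rightarrow> 'b::real_normed_vector) \<Rightarrow> bool" where
  "smooth_on S f \<longleftrightarrow> (\<forall>k. C_k_on k S f)"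


section \<open>Smooth manifolds\<close>

text \<open>
  The manifold is the whole type 'm; Hausdorff and second countable are class constraints.
  Its smooth structure is given by a (not necessarily maximal) smooth atlas of charts with values
  in the Euclidean space 'e, so the dimension is DIM('e). Only the values of a chart map
  on its domain matter.
\<close>

type_synonym ('m, 'e) chart = "'m set \<times> ('m \<Rightarrow> 'e)"

abbreviation cdom :: "('m, 'e) chart \<Rightarrow> 'm set" where "cdom \<equiv> fst"
abbreviation cmap :: "('m, 'e) chart \<Rightarrow> 'm \<Rightarrow> 'e" where "cmap \<equiv> snd"
abbreviation cinv :: "('m, 'e) chart \<Rightarrow> 'e \<Rightarrow> 'm" where "cinv c \<equiv> inv_into (cdom c) (cmap c)"

definition smooth_atlas ::
  "('m::{t2_space, second_countable_topology}, 'e::euclidean_space) chart set \<Rightarrow> bool" where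
  "smooth_atlas atl \<longleftrightarrow>
     (\<Union>c\<in>atl. cdom c) = UNIV \<and>
     (\<forall>c\<in>atl. open (cdom c) \<and> open (cmap c ` cdom c) \<and>
        homeomorphism (cdom c) (cmap c ` cdom c) (cmap c) (cinv c)) \<and>
     (\<forall>c\<in>atl. \<forall>d\<in>atl. smooth_on (cmap c ` (cdom c \<inter> cdom d)) (cmap d \<circ> cinv c))"

text \<open>
  Tangent spaces: for every point p one chart around p is singled out (which one is immaterial),
  and a tangent vector at p is represented by its components in that chart, so that every
  tangent space is a copy of 'e. The differential of an arbitrary chart c at p, in this
  identification, is chart_deriv atl c p. The chosen chart varies discontinuously with p, so
  regularity of vector fields must always be expressed through components in a fixed chart.
\<close>

definition pref_chart :: "('m, 'e) chart set \<Rightarrow> 'm \<Rightarrow> ('m, 'e) chart" where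
  "pref_chart atl p = (SOME c. c \<in> atl \<and> p \<in> cdom c)"

definition chart_deriv ::
  "('m, 'e::euclidean_space) chart set \<Rightarrow> ('m, 'e) chart \<Rightarrow> 'm \<Rightarrow> 'e \<Rightarrow> 'e" where
  "chart_deriv atl c p v =
     frechet_derivative (cmap c \<circ> cinv (pref_chart atl p)) (at (cmap (pref_chart atl p) p)) v"

text \<open>coord_field atl c u is the vector field with constant components u in the chart c.\<close>

definition coord_field ::
  "('m, 'e::euclidean_space) chart set \<Rightarrow> ('m, 'e) chart \<Rightarrow> 'e \<Rightarrow> 'm \<Rightarrow> 'e" where
  "coord_field atl c u p = inv (chart_deriv atl c p) u"

definition vf_comp ::
  "('m, 'e::euclidean_space) chart set \<Rightarrow> ('m, 'e) chart \<Rightarrow> ('m \<Rightarrow> 'e) \<Rightarrow> 'e \<Rightarrow> 'e" where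
  "vf_comp atl c Y x = chart_deriv atl c (cinv c x) (Y (cinv c x))"

definition smooth_fun :: "('m, 'e::euclidean_space) chart set \<Rightarrow> 'm set \<Rightarrow> ('m \<Rightarrow> real) \<Rightarrow> bool" where
  "smooth_fun atl U f \<longleftrightarrow> (\<forall>c\<in>atl. smooth_on (cmap c ` (U \<inter> cdom c)) (f \<circ> cinv c))"

definition smooth_vf :: "('m, 'e::euclidean_space) chart set \<Rightarrow> 'm set \<Rightarrow> ('m \<Rightarrow> 'e) \<Rightarrow> bool" where
  "smooth_vf atl U Y \<longleftrightarrow> (\<forall>c\<in>atl. smooth_on (cmap c ` (U \<inter> cdom c)) (vf_comp atl c Y))"

definition dir_deriv :: "('m, 'e::euclidean_space) chart set \<Rightarrow> ('m \<Rightarrow> real) \<Rightarrow> 'm \<Rightarrow> 'e \<Rightarrow> real" where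
  "dir_deriv atl f p v =
     frechet_derivative (f \<circ> cinv (pref_chart atl p)) (at (cmap (pref_chart atl p) p)) v"

definition lie_bracket ::
  "('m, 'e::euclidean_space) chart set \<Rightarrow> ('m \<Rightarrow> 'e) \<Rightarrow> ('m \<Rightarrow> 'e) \<Rightarrow> 'm \<Rightarrow> 'e" where
  "lie_bracket atl Y Z p =
     (let c = pref_chart atl p; x = cmap c p in
        frechet_derivative (vf_comp atl c Z) (at x) (Y p)
      - frechet_derivative (vf_comp atl c Y) (at x) (Z p))"


section \<open>Riemannian metric, Levi-Civita connection, curvature\<close>

definition riemannian_metric ::
  "('m::topological_space, 'e::euclidean_space) chart set \<Rightarrow> ('m \<Rightarrow> 'e \<Rightarrow> 'e \<Rightarrow> real) \<Rightarrow> bool" where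
  "riemannian_metric atl g \<longleftrightarrow>
     (\<forall>p. bilinear (g p) \<and> (\<forall>u v. g p u v = g p v u) \<and> (\<forall>v. v \<noteq> 0 \<longrightarrow> g p v v > 0)) \<and>
     (\<forall>c\<in>atl. \<forall>u v. smooth_fun atl (cdom c) (\<lambda>p. g p (coord_field atl c u p) (coord_field atl c v p)))"

text \<open>
  nab p v W is the covariant derivative at p, in direction of the tangent vector v at p, of a
  vector field W that is smooth near p. Nothing is required of nab on other W.
\<close>

definition affine_connection ::
  "('m::topological_space, 'e::euclidean_space) chart set \<Rightarrow> ('m \<Rightarrow> 'e \<Rightarrow> ('m \<Rightarrow> 'e) \<Rightarrow> 'e) \<Rightarrow> bool" where
  "affine_connection atl nab \<longleftrightarrow>
     (\<forall>U W. open U \<and> smooth_vf atl U W \<longrightarrow>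
        (\<forall>p\<in>U. linear (\<lambda>v. nab p v W)) \<and>
        (\<forall>W'. (\<forall>q\<in>U. W' q = W q) \<longrightarrow> (\<forall>p\<in>U. \<forall>v. nab p v W' = nab p v W)) \<and>
        (\<forall>W'. smooth_vf atl U W' \<longrightarrow>
           (\<forall>p\<in>U. \<forall>v. nab p v (\<lambda>q. W q + W' q) = nab p v W + nab p v W')) \<and>
        (\<forall>f. smooth_fun atl U f \<longrightarrow>
           (\<forall>p\<in>U. \<forall>v. nab p v (\<lambda>q. f q *\<^sub>R W q) = dir_deriv atl f p v *\<^sub>R W p + f p *\<^sub>R nab p v W)) \<and>
        (\<forall>Y. smooth_vf atl U Y \<longrightarrow> smooth_vf atl U (\<lambda>p. nab p (Y p) W)))"

definition levi_civita ::
  "('m::topological_space, 'e::euclidean_space) chart set \<Rightarrow> ('m \<Rightarrow> 'e \<Rightarrow> 'e \<Rightarrow> real) \<Rightarrow>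
   ('m \<Rightarrow> 'e \<Rightarrow> ('m \<Rightarrow> 'e) \<Rightarrow> 'e) \<Rightarrow> bool" where
  "levi_civita atl g nab \<longleftrightarrow>
     affine_connection atl nab \<and>
     (\<forall>U Y Z. open U \<and> smooth_vf atl U Y \<and> smooth_vf atl U Z \<longrightarrow>
        (\<forall>p\<in>U. nab p (Y p) Z - nab p (Z p) Y = lie_bracket atl Y Z p) \<and>
        (\<forall>p\<in>U. \<forall>v. dir_deriv atl (\<lambda>q. g q (Y q) (Z q)) p v
                    = g p (nab p v Y) (Z p) + g p (Y p) (nab p v Z)))"

text \<open>
  The value at p on the vectors u, v, w: extend these to smooth vector fields Y, Z, W near p and
  evaluate the defining formula (the result does not depend on the extensions).
\<close>

definition curvature ::
  "('m::topological_space, 'e::euclidean_space) chart set \<Rightarrow> ('m \<Rightarrow> 'e \<Rightarrow> ('m \<Rightarrow> 'e) \<Rightarrow> 'e) \<Rightarrow>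
   'm \<Rightarrow> 'e \<Rightarrow> 'e \<Rightarrow> 'e \<Rightarrow> 'e" where
  "curvature atl nab p u v w =
     (THE r. \<forall>U Y Z W. open U \<and> p \<in> U \<and>
        smooth_vf atl U Y \<and> smooth_vf atl U Z \<and> smooth_vf atl U W \<and> Y p = u \<and> Z p = v \<and> W p = w \<longrightarrow>
        r = nab p (Y p) (\<lambda>q. nab q (Z q) W) - nab p (Z p) (\<lambda>q. nab q (Y q) W)
            - nab p (lie_bracket atl Y Z p) W)"

text \<open>
  Christoffel symbols at p in the chart c, as a bilinear map on components: the c-components of
  the covariant derivative of the coordinate field with components v in direction u.
\<close>

definition christoffel ::
  "('m, 'e::euclidean_space) chart set \<Rightarrow> ('m \<Rightarrow> 'e \<Rightarrow> ('m \<Rightarrow> 'e) \<Rightarrow> 'e) \<Rightarrow>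
   ('m, 'e) chart \<Rightarrow> 'm \<Rightarrow> 'e \<Rightarrow> 'e \<Rightarrow> 'e" where
  "christoffel atl nab c p u v = chart_deriv atl c p (nab p (coord_field atl c u p) (coord_field atl c v))"


section \<open>Curves and fields along curves\<close>

definition C_k_curve ::
  "('m::topological_space, 'e::euclidean_space) chart set \<Rightarrow> nat \<Rightarrow> real set \<Rightarrow> (real \<Rightarrow> 'm) \<Rightarrow> bool" where
  "C_k_curve atl k I \<gamma> \<longleftrightarrow>
     continuous_on I \<gamma> \<and> (\<forall>c\<in>atl. C_k_on k (I \<inter> \<gamma> -` cdom c) (cmap c \<circ> \<gamma>))"

definition C_k_field_along ::
  "('m, 'e::euclidean_space) chart set \<Rightarrow> nat \<Rightarrow> real set \<Rightarrow> (real \<Rightarrow> 'm) \<Rightarrow> (real \<Rightarrow> 'e) \<Rightarrow> bool" where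
  "C_k_field_along atl k I \<gamma> V \<longleftrightarrow>
     (\<forall>c\<in>atl. C_k_on k (I \<inter> \<gamma> -` cdom c) (\<lambda>s. chart_deriv atl c (\<gamma> s) (V s)))"

text \<open>Derivatives at t are taken within I, hence one-sided if t is an end point of I.\<close>

definition has_velocity ::
  "('m::topological_space, 'e::euclidean_space) chart set \<Rightarrow> real set \<Rightarrow> (real \<Rightarrow> 'm) \<Rightarrow> real \<Rightarrow> 'e \<Rightarrow> bool" where
  "has_velocity atl I \<gamma> t v \<longleftrightarrow>
     continuous (at t within I) \<gamma> \<and>
     (\<forall>c\<in>atl. \<gamma> t \<in> cdom c \<longrightarrow>
        ((cmap c \<circ> \<gamma>) has_vector_derivative chart_deriv atl c (\<gamma> t) v) (at t within I))"

definition velocity ::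
  "('m::topological_space, 'e::euclidean_space) chart set \<Rightarrow> real set \<Rightarrow> (real \<Rightarrow> 'm) \<Rightarrow> real \<Rightarrow> 'e" where
  "velocity atl I \<gamma> t = (THE v. has_velocity atl I \<gamma> t v)"

text \<open>D is the covariant derivative at t of the vector field V along the curve \<open>\<gamma>\<close>.\<close>

definition has_cov_deriv ::
  "('m::topological_space, 'e::euclidean_space) chart set \<Rightarrow> ('m \<Rightarrow> 'e \<Rightarrow> ('m \<Rightarrow> 'e) \<Rightarrow> 'e) \<Rightarrow>
   real set \<Rightarrow> (real \<Rightarrow> 'm) \<Rightarrow> (real \<Rightarrow> 'e) \<Rightarrow> real \<Rightarrow> 'e \<Rightarrow> bool" where
  "has_cov_deriv atl nab I \<gamma> V t D \<longleftrightarrow>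
     (\<exists>v. has_velocity atl I \<gamma> t v \<and>
       (\<forall>c\<in>atl. \<gamma> t \<in> cdom c \<longrightarrow>
         (\<exists>d. ((\<lambda>s. chart_deriv atl c (\<gamma> s) (V s)) has_vector_derivative d) (at t within I) \<and>
              chart_deriv atl c (\<gamma> t) D =
                d + christoffel atl nab c (\<gamma> t) (chart_deriv atl c (\<gamma> t) v) (chart_deriv atl c (\<gamma> t) (V t)))))"

text \<open>
  B is the covariant derivative at t of the field A of endomorphisms along \<open>\<gamma>\<close>, for the
  connection induced on (1,1) tensors: the product rule holds for A applied to any vector
  field V along \<open>\<gamma>\<close>.
\<close>

definition has_cov_deriv_endo ::
  "('m::topological_space, 'e::euclidean_space) chart set \<Rightarrow> ('m \<Rightarrow> 'e \<Rightarrow> ('m \<Rightarrow> 'e) \<Rightarrow> 'e) \<Rightarrow>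
   real set \<Rightarrow> (real \<Rightarrow> 'm) \<Rightarrow> (real \<Rightarrow> 'e \<Rightarrow> 'e) \<Rightarrow> real \<Rightarrow> ('e \<Rightarrow> 'e) \<Rightarrow> bool" where
  "has_cov_deriv_endo atl nab I \<gamma> A t B \<longleftrightarrow>
     (\<forall>V D. has_cov_deriv atl nab I \<gamma> V t D \<longrightarrow>
        has_cov_deriv atl nab I \<gamma> (\<lambda>s. A s (V s)) t (B (V t) + A t D))"


section \<open>Completeness\<close>

definition curve_length ::
  "('m::topological_space, 'e::euclidean_space) chart set \<Rightarrow> ('m \<Rightarrow> 'e \<Rightarrow> 'e \<Rightarrow> real) \<Rightarrow>
   real \<Rightarrow> real \<Rightarrow> (real \<Rightarrow> 'm) \<Rightarrow> real" where
  "curve_length atl g a b \<sigma> =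
     integral {a..b} (\<lambda>t. sqrt (g (\<sigma> t) (velocity atl {a..b} \<sigma> t) (velocity atl {a..b} \<sigma> t)))"

text \<open>
  The infimum is the same as over piecewise continuously differentiable curves, because the
  velocity is allowed to vanish. The distance between different components is infinite.
\<close>

definition riem_dist ::
  "('m::topological_space, 'e::euclidean_space) chart set \<Rightarrow> ('m \<Rightarrow> 'e \<Rightarrow> 'e \<Rightarrow> real) \<Rightarrow> 'm \<Rightarrow> 'm \<Rightarrow> ereal" where
  "riem_dist atl g p q =
     Inf {ereal (curve_length atl g a b \<sigma>) | a b \<sigma>.
            a < b \<and> C_k_curve atl 1 {a..b} \<sigma> \<and> \<sigma> a = p \<and> \<sigma> b = q}"

text \<open>Convergence in the manifold topology is convergence for the Riemannian distance.\<close>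

definition riem_complete ::
  "('m::topological_space, 'e::euclidean_space) chart set \<Rightarrow> ('m \<Rightarrow> 'e \<Rightarrow> 'e \<Rightarrow> real) \<Rightarrow> bool" where
  "riem_complete atl g \<longleftrightarrow>
     (\<forall>x :: nat \<Rightarrow> 'm.
        (\<forall>e>0. \<exists>k. \<forall>i\<ge>k. \<forall>j\<ge>k. riem_dist atl g (x i) (x j) < ereal e) \<longrightarrow> (\<exists>p. x \<longlonglongrightarrow> p))"


section \<open>Bishop frames and rigid variations\<close>

text \<open>
  Frames are indexed by \<open>1, \<dots>, n = DIM('e)\<close>; in a Bishop frame, E 1 is the unit tangent
  field T and \<open>E 2, \<dots>, E n\<close> are the normal fields.
\<close>

definition orthonormal_frame ::
  "('m \<Rightarrow> 'e \<Rightarrow> 'e \<Rightarrow> real) \<Rightarrow> 'm \<Rightarrow> (nat \<Rightarrow> 'e::euclidean_space) \<Rightarrow> bool" where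
  "orthonormal_frame g p E \<longleftrightarrow>
     (\<forall>i\<in>{1..DIM('e)}. \<forall>j\<in>{1..DIM('e)}. g p (E i) (E j) = (if i = j then 1 else 0))"

text \<open>
  The fields E i with \<open>i \<ge> 2\<close> are parallel for the connection induced in the normal bundle, that
  is, the normal part of their covariant derivative vanishes.
\<close>

definition bishop_frame ::
  "('m::topological_space, 'e::euclidean_space) chart set \<Rightarrow> ('m \<Rightarrow> 'e \<Rightarrow> 'e \<Rightarrow> real) \<Rightarrow>
   ('m \<Rightarrow> 'e \<Rightarrow> ('m \<Rightarrow> 'e) \<Rightarrow> 'e) \<Rightarrow> real \<Rightarrow> (real \<Rightarrow> 'm) \<Rightarrow> (nat \<Rightarrow> real \<Rightarrow> 'e) \<Rightarrow> bool" where
  "bishop_frame atl g nab L \<gamma> E \<longleftrightarrow>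
     (\<forall>t\<in>{0..L}.
        has_velocity atl {0..L} \<gamma> t (E 1 t) \<and>
        orthonormal_frame g (\<gamma> t) (\<lambda>i. E i t) \<and>
        (\<forall>i\<in>{2..DIM('e)}. \<exists>a. has_cov_deriv atl nab {0..L} \<gamma> (E i) t (a *\<^sub>R E 1 t)))"

definition geodesic_curvatures ::
  "('m::topological_space, 'e::euclidean_space) chart set \<Rightarrow>
   ('m \<Rightarrow> 'e \<Rightarrow> ('m \<Rightarrow> 'e) \<Rightarrow> 'e) \<Rightarrow> real \<Rightarrow> (real \<Rightarrow> 'm) \<Rightarrow> (nat \<Rightarrow> real \<Rightarrow> 'e) \<Rightarrow>
   (nat \<Rightarrow> real \<Rightarrow> real) \<Rightarrow> bool" where
  "geodesic_curvatures atl nab L \<gamma> E \<kappa> \<longleftrightarrow>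
     (\<forall>t\<in>{0..L}. has_cov_deriv atl nab {0..L} \<gamma> (E 1) t (\<Sum>i\<in>{2..DIM('e)}. \<kappa> i t *\<^sub>R E i t))"

text \<open>
  G \<open>\<tau>\<close> are the varied curves on the interval from 0 to L, and F \<open>\<tau>\<close> are their Bishop frames.
  The case \<open>\<tau> = 0\<close> says that F 0 is a Bishop frame along \<open>\<gamma>\<close> and that \<open>\<kappa>\<close> are its geodesic
  curvature functions.
\<close>

definition rigid_variation ::
  "('m::topological_space, 'e::euclidean_space) chart set \<Rightarrow> ('m \<Rightarrow> 'e \<Rightarrow> 'e \<Rightarrow> real) \<Rightarrow>
   ('m \<Rightarrow> 'e \<Rightarrow> ('m \<Rightarrow> 'e) \<Rightarrow> 'e) \<Rightarrow> real \<Rightarrow> (real \<Rightarrow> 'm) \<Rightarrow>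
   real \<Rightarrow> (real \<Rightarrow> real \<Rightarrow> 'm) \<Rightarrow> (real \<Rightarrow> nat \<Rightarrow> real \<Rightarrow> 'e) \<Rightarrow> bool" where
  "rigid_variation atl g nab L \<gamma> \<epsilon> G F \<longleftrightarrow>
     \<epsilon> > 0 \<and> (\<forall>t\<in>{0..L}. G 0 t = \<gamma> t) \<and>
     (\<exists>c e \<kappa>.
        C_k_curve atl 1 {-\<epsilon><..<\<epsilon>} c \<and> c 0 = \<gamma> 0 \<and>
        (\<forall>i\<in>{1..DIM('e)}. C_k_field_along atl 1 {-\<epsilon><..<\<epsilon>} c (e i)) \<and>
        (\<forall>\<tau>\<in>{-\<epsilon><..<\<epsilon>}. orthonormal_frame g (c \<tau>) (\<lambda>i. e i \<tau>)) \<and>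
        has_velocity atl {0..L} \<gamma> 0 (e 1 0) \<and>
        (\<forall>\<tau>\<in>{-\<epsilon><..<\<epsilon>}.
           C_k_curve atl 2 {0..L} (G \<tau>) \<and> G \<tau> 0 = c \<tau> \<and>
           (\<forall>i\<in>{1..DIM('e)}. F \<tau> i 0 = e i \<tau>) \<and>
           bishop_frame atl g nab L (G \<tau>) (F \<tau>) \<and>
           geodesic_curvatures atl nab L (G \<tau>) (F \<tau>) \<kappa>))"

definition variation_field ::
  "('m::topological_space, 'e::euclidean_space) chart set \<Rightarrow> real \<Rightarrow> real \<Rightarrow>
   (real \<Rightarrow> real \<Rightarrow> 'm) \<Rightarrow> (real \<Rightarrow> 'e) \<Rightarrow> bool" where
  "variation_field atl L \<epsilon> G X \<longleftrightarrow>
     (\<forall>t\<in>{0..L}. has_velocity atl {-\<epsilon><..<\<epsilon>} (\<lambda>\<tau>. G \<tau> t) 0 (X t))"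

definition infinitesimal_rotation ::
  "('m::topological_space, 'e::euclidean_space) chart set \<Rightarrow> ('m \<Rightarrow> 'e \<Rightarrow> ('m \<Rightarrow> 'e) \<Rightarrow> 'e) \<Rightarrow>
   real \<Rightarrow> real \<Rightarrow> (real \<Rightarrow> real \<Rightarrow> 'm) \<Rightarrow> (real \<Rightarrow> nat \<Rightarrow> real \<Rightarrow> 'e) \<Rightarrow> (real \<Rightarrow> 'e \<Rightarrow> 'e) \<Rightarrow> bool" where
  "infinitesimal_rotation atl nab L \<epsilon> G F A \<longleftrightarrow>
     (\<forall>t\<in>{0..L}. \<forall>i\<in>{1..DIM('e)}.
        has_cov_deriv atl nab {-\<epsilon><..<\<epsilon>} (\<lambda>\<tau>. G \<tau> t) (\<lambda>\<tau>. F \<tau> i t) 0 (A t (F 0 i t)))"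


section \<open>Generalized Jacobi equations\<close>

definition skew_field_along ::
  "('m \<Rightarrow> 'e \<Rightarrow> 'e \<Rightarrow> real) \<Rightarrow> real \<Rightarrow> (real \<Rightarrow> 'm) \<Rightarrow> (real \<Rightarrow> 'e::real_vector \<Rightarrow> 'e) \<Rightarrow> bool" where
  "skew_field_along g L \<gamma> A \<longleftrightarrow>
     (\<forall>t\<in>{0..L}. linear (A t) \<and> (\<forall>u v. g (\<gamma> t) (A t u) v = - g (\<gamma> t) u (A t v)))"

definition generalized_jacobi ::
  "('m::topological_space, 'e::euclidean_space) chart set \<Rightarrow> ('m \<Rightarrow> 'e \<Rightarrow> ('m \<Rightarrow> 'e) \<Rightarrow> 'e) \<Rightarrow>
   real \<Rightarrow> (real \<Rightarrow> 'm) \<Rightarrow> (real \<Rightarrow> 'e) \<Rightarrow> (real \<Rightarrow> 'e \<Rightarrow> 'e) \<Rightarrow> bool" where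
  "generalized_jacobi atl nab L \<gamma> X A \<longleftrightarrow>
     (\<forall>t\<in>{0..L}.
        has_cov_deriv atl nab {0..L} \<gamma> X t (A t (velocity atl {0..L} \<gamma> t)) \<and>
        has_cov_deriv_endo atl nab {0..L} \<gamma> A t
          (curvature atl nab (\<gamma> t) (velocity atl {0..L} \<gamma> t) (X t)))"

end

theory Submission
  imports Defs
begin

text \<open>
  A curve together with a Bishop frame \<open>E\<^sub>1 = T, \<dots>, E\<^sub>n\<close> is a solution of the first order system
  \<open>\<gamma>' = E\<^sub>1\<close>, \<open>\<nabla>\<^sub>T E\<^sub>i = \<Sum>\<^sub>j K\<^sub>i\<^sub>j E\<^sub>j\<close> whose coefficient matrix \<open>K\<close> is skew-symmetric and built from the geodesic
  curvatures. A rigid variation changes only the initial values, so \<open>X = \<partial>\<gamma>/\<partial>\<tau>\<close> and \<open>Y\<^sub>i = \<nabla>E\<^sub>i/\<partial>\<tau>\<close> exist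
  and solve the linearized system. By the vanishing of the torsion and the definition of curvature the
  latter reads \<open>\<nabla>\<^sub>T X = Y\<^sub>1\<close>, \<open>\<nabla>\<^sub>T Y\<^sub>i = \<Sum>\<^sub>j K\<^sub>i\<^sub>j Y\<^sub>j + R(T, X) E\<^sub>i\<close>; with \<open>Y\<^sub>i = A E\<^sub>i\<close> these are the generalized
  Jacobi equations. Conversely, a solution \<open>(X, A)\<close> prescribes the derivative of the initial values,
  and solutions with nearby initial values exist on all of \<open>[0, L]\<close> because the base curve does.
  Inner products of frame fields are preserved since \<open>K\<close> is
  skew-symmetric.
\<close>

section \<open>Ordinary differential equations\<close>

text \<open>Frame vectors are stored by components in a chart that jumps from point to point, so the
  frame equation is an ordinary differential equation only inside one fixed chart. Mixed derivatives
  of the two-parameter family are not at hand: the curves are only C^2 in t, and regularity in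
  \<tau> is known a priori only at t = 0. The variational equation is instead found by
  differentiating chart solutions in their initial values; a Gronwall comparison with the linearized
  solution gives the derivative at \<tau> = 0. The linearized system contains derivatives of
  Christoffel symbols, and once the Christoffel correction is removed from the variation of the
  frame they assemble into the curvature. Two facts carry this across charts: solutions starting
  close to the base curve stay in a tube around it, and statements about subintervals with arbitrary
  initial data can be chained by bisection. In the converse, the transverse initial curve and its
  moving orthonormal frame solve a frame equation of the same kind with constant coefficients,
  namely the components of \<open>X\<close> and the skew matrix of \<open>A\<close> at t =
  0.\<close>

lemma norm_le_weighted_gronwall:
  fixes z :: "real \<Rightarrow> 'a::real_normed_vector"
  assumes K: "K \<ge> 0" and e: "e \<ge> 0"
    and der: "\<And>t. t \<in> {a..b} \<Longrightarrow> (z has_vector_derivative z' t) (at t within {a..b})"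
    and bnd: "\<And>t. t \<in> {a..b} \<Longrightarrow> norm (z' t) \<le> K * norm (z t) + e"
    and t: "t \<in> {a..b}"
  shows "norm (z t) \<le> 2 * exp (2 * K * (t - a)) * (norm (z a) + e * (b - a))"
proof -
  \<comment> \<open>Integrating \<open>K\<close> times the weight
    \<open>exp (2 * K * (t - a))\<close> returns half of the weight. At a maximum of the weighted
    norm the term \<open>K * norm (z t)\<close> is therefore absorbed by half of the left side,
    which leaves the factor 2 in the conclusion.\<close>
  define h where "h t = norm (z t) / exp (2 * K * (t - a))" for t
  have contz: "continuous_on {a..b} z"
    by (rule continuous_on_vector_derivative) (rule der)
  have "continuous_on {a..b} h"
    unfolding h_def by (intro continuous_intros contz) auto
  then obtain s where s: "s \<in> {a..b}" and hmax: "\<And>t. t \<in> {a..b} \<Longrightarrow> h t \<le> h s"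
    using continuous_attains_sup[of "{a..b}" h] t by fastforce
  define m where "m = h s"
  have m0: "m \<ge> 0" unfolding m_def h_def by simp
  have zm: "norm (z t) \<le> m * exp (2 * K * (t - a))" if "t \<in> {a..b}" for t
    using hmax[OF that] unfolding m_def by (subst (asm) h_def) (simp add: divide_le_eq)
  have zs: "norm (z s) = m * exp (2 * K * (s - a))"
    by (simp add: m_def h_def)
  define p where "p t = m * exp (2 * K * (t - a)) / 2 + e * t" for t
  have le: "norm (z s - z a) \<le> p s - p a"
  proof (cases "a = s")
    case False
    with s have as: "a < s" by simp
    show ?thesis
    proof (rule differentiable_bound_general[OF as])
      show "continuous_on {a..s} z" using contz s by (auto intro: continuous_on_subset)
      show "continuous_on {a..s} p" unfolding p_def by (intro continuous_intros) auto
      fix x assume x: "a < x" "x < s"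
      show "(z has_vector_derivative z' x) (at x)"
        using der[of x] x s by (simp add: at_within_Icc_at)
      show "(p has_vector_derivative (m * K * exp (2 * K * (x - a)) + e)) (at x)"
        unfolding p_def has_real_derivative_iff_has_vector_derivative[symmetric]
        by (auto intro!: derivative_eq_intros simp: field_simps)
      have "norm (z' x) \<le> K * norm (z x) + e" using bnd[of x] x s by simp
      also have "\<dots> \<le> K * (m * exp (2 * K * (x - a))) + e"
        using zm[of x] x s K by (intro add_right_mono mult_left_mono) auto
      finally show "norm (z' x) \<le> m * K * exp (2 * K * (x - a)) + e" by (simp add: mult_ac)
    qed
  qed simp
  define E where "E = exp (2 * K * (s - a))"
  have E1: "E \<ge> 1" using K s by (simp add: E_def)
  have "norm (z s) \<le> norm (z a) + norm (z s - z a)" by (metis add.commute norm_triangle_sub)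
  then have "m * E \<le> norm (z a) + m * E / 2 - m / 2 + e * (s - a)"
    using le zs by (simp add: p_def E_def algebra_simps)
  moreover have "e * (s - a) \<le> e * (b - a)" using s e by (intro mult_left_mono) auto
  ultimately have "m * E \<le> 2 * (norm (z a) + e * (b - a))" using m0 by argo
  then have "m \<le> 2 * (norm (z a) + e * (b - a))"
    using mult_left_mono[OF E1 m0] by simp
  then have "m * exp (2 * K * (t - a)) \<le> 2 * (norm (z a) + e * (b - a)) * exp (2 * K * (t - a))"
    by (intro mult_right_mono) auto
  with zm[OF t] have "norm (z t) \<le> 2 * (norm (z a) + e * (b - a)) * exp (2 * K * (t - a))"
    by (rule order_trans)
  then show ?thesis by (simp only: mult_ac)
qed

text \<open>The same halving in integral form: it gives the Picard operator the contraction factor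
  1/2 in the weighted supremum norm, whatever the length of the interval.\<close>

lemma norm_integral_le_exp_weight:
  fixes h :: "real \<Rightarrow> 'a::banach"
  assumes "K > 0" "a \<le> t" "continuous_on {a..t} h"
    and "\<And>s. s \<in> {a..t} \<Longrightarrow> norm (h s) \<le> d * (K * exp (2 * K * (s - a)))"
  shows "norm (integral {a..t} h) \<le> d * (exp (2 * K * (t - a)) - 1) / 2"
proof -
  have hi: "((\<lambda>s. d * (K * exp (2 * K * (s - a)))) has_integral
      (d * exp (2 * K * (t - a)) / 2 - d * exp (2 * K * (a - a)) / 2)) {a..t}"
    using assms(2)
    by (intro fundamental_theorem_of_calculus)
      (auto intro!: derivative_eq_intros simp: has_real_derivative_iff_has_vector_derivative[symmetric])
  have "integral {a..t} (\<lambda>s. d * (K * exp (2 * K * (s - a)))) = d * (exp (2 * K * (t - a)) - 1) / 2"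
    unfolding integral_unique[OF hi] by (simp add: right_diff_distrib diff_divide_distrib)
  moreover have "norm (integral {a..t} h) \<le> integral {a..t} (\<lambda>s. d * (K * exp (2 * K * (s - a))))"
    using assms by (intro integral_norm_bound_integral integrable_continuous_real) (auto intro!: continuous_intros)
  ultimately show ?thesis by (simp only:)
qed

text \<open>Banach's fixed point theorem for the deviation from \<open>y0\<close>, rescaled by \<open>exp (2 K (t - a))\<close>.\<close>

lemma ode_solution_in_tube:
  fixes f :: "real \<Rightarrow> 'a::banach \<Rightarrow> 'a"
  assumes ab: "a \<le> b" and K: "K > 0" and r: "r \<ge> 0"
    and cont0: "continuous_on {a..b} y0"
    and contf: "continuous_on (SIGMA t:{a..b}. cball (y0 t) r) (\<lambda>(t, y). f t y)"
    and lip: "\<And>t y w. t \<in> {a..b} \<Longrightarrow> y \<in> cball (y0 t) r \<Longrightarrow> w \<in> cball (y0 t) r \<Longrightarrow>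
                norm (f t y - f t w) \<le> K * norm (y - w)"
    and init: "\<And>t. t \<in> {a..b} \<Longrightarrow>
                norm (\<eta> + integral {a..t} (\<lambda>s. f s (y0 s)) - y0 t) \<le> r * exp (- (2 * K * (b - a))) / 2"
  obtains y where "y a = \<eta>"
    "\<And>t. t \<in> {a..b} \<Longrightarrow> (y has_vector_derivative f t (y t)) (at t within {a..b})"
    "\<And>t. t \<in> {a..b} \<Longrightarrow> y t \<in> cball (y0 t) r"
proof -
  \<comment> \<open>The unknown is rescaled as \<open>y0 + E *\<^sub>R z\<close>. Since
    \<open>E\<close> is at most \<open>exp (2 * K * (b - a))\<close>, this is the radius for which
    \<open>norm z \<le> d\<close> keeps the function in the tube. The hypothesis \<open>init\<close>
    uses up \<open>d / 2\<close>; the contraction estimate fits in the rest.\<close>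
  define d where "d = r * exp (- (2 * K * (b - a)))"
  \<comment> \<open>Bounded continuous functions are taken on the whole real line, so arguments are
    clamped to \<open>{a..b}\<close>; this makes \<open>Q z\<close> continuous and bounded
    everywhere.\<close>
  define cl where "cl s = max a (min b s)" for s :: real
  define E where "E t = exp (2 * K * (t - a))" for t
  have E1: "E t \<ge> 1" if "t \<in> {a..b}" for t using that K by (simp add: E_def)
  have E0: "E t > 0" for t by (simp add: E_def)
  have cl: "cl s \<in> {a..b}" for s using ab by (auto simp: cl_def)
  have cl_id: "cl s = s" if "s \<in> {a..b}" for s using that by (auto simp: cl_def)
  have contcl: "continuous_on S cl" for S unfolding cl_def by (intro continuous_intros)
  have d0: "d \<ge> 0" using r by (simp add: d_def)
  have Ed: "E t * d \<le> r" if "t \<in> {a..b}" for t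
  proof -
    have "E t * exp (- (2 * K * (b - a))) = exp (2 * K * (t - b))"
      unfolding E_def by (simp add: exp_add[symmetric] algebra_simps)
    then have "E t * d = r * exp (2 * K * (t - b))"
      by (simp add: d_def)
    also have "\<dots> \<le> r * 1" using that K r by (intro mult_left_mono) (auto simp: mult_nonneg_nonpos)
    finally show ?thesis by simp
  qed
  define W where "W z t = y0 t + E t *\<^sub>R apply_bcontfun z t" for z t
  define Q where "Q z s = (1 / E (cl s)) *\<^sub>R (\<eta> + integral {a..cl s} (\<lambda>u. f u (W z u)) - y0 (cl s))" for z s
  have W: "W z t \<in> cball (y0 t) r" if "z \<in> cball 0 d" "t \<in> {a..b}" for z t
  proof -
    have "norm (apply_bcontfun z t) \<le> d" using norm_bounded[of z t] that by simp
    then have "E t * norm (apply_bcontfun z t) \<le> E t * d" using E0[of t] by (intro mult_left_mono) auto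
    also note Ed[OF that(2)]
    finally show ?thesis using E0[of t] by (simp add: W_def dist_norm)
  qed
  have contW: "continuous_on {a..b} (W z)" for z
    unfolding W_def E_def by (intro continuous_intros cont0) auto
  have contfW: "continuous_on {a..b} (\<lambda>t. f t (W z t))" if "z \<in> cball 0 d" for z
  proof -
    have "(\<lambda>t. (t, W z t)) ` {a..b} \<subseteq> (SIGMA t:{a..b}. cball (y0 t) r)" using W[OF that] by auto
    from continuous_on_compose2[OF contf continuous_on_Pair[OF continuous_on_id contW] this]
    show ?thesis by simp
  qed
  have contf0: "continuous_on {a..b} (\<lambda>t. f t (y0 t))"
  proof -
    have "(\<lambda>t. (t, y0 t)) ` {a..b} \<subseteq> (SIGMA t:{a..b}. cball (y0 t) r)" using r by auto
    from continuous_on_compose2[OF contf continuous_on_Pair[OF continuous_on_id cont0] this]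
    show ?thesis by simp
  qed
  have diff_bound: "norm (integral {a..t} (\<lambda>u. f u (p u)) - integral {a..t} (\<lambda>u. f u (q u))) \<le> D * (E t - 1) / 2"
    if t: "t \<in> {a..b}" and cp: "continuous_on {a..b} (\<lambda>u. f u (p u))" and cq: "continuous_on {a..b} (\<lambda>u. f u (q u))"
      and pq: "\<And>u. u \<in> {a..b} \<Longrightarrow> p u \<in> cball (y0 u) r" "\<And>u. u \<in> {a..b} \<Longrightarrow> q u \<in> cball (y0 u) r"
        "\<And>u. u \<in> {a..b} \<Longrightarrow> norm (p u - q u) \<le> E u * D" for t p q D
  proof -
    have sub: "{a..t} \<subseteq> {a..b}" using t by auto
    have cs: "continuous_on {a..t} (\<lambda>u. f u (p u))" "continuous_on {a..t} (\<lambda>u. f u (q u))"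
      using continuous_on_subset[OF cp sub] continuous_on_subset[OF cq sub] by auto
    have "norm (integral {a..t} (\<lambda>u. f u (p u) - f u (q u))) \<le> D * (exp (2 * K * (t - a)) - 1) / 2"
    proof (rule norm_integral_le_exp_weight[OF K])
      show "a \<le> t" using t by simp
      show "continuous_on {a..t} (\<lambda>u. f u (p u) - f u (q u))" by (intro continuous_intros cs)
      fix s assume "s \<in> {a..t}"
      then have s: "s \<in> {a..b}" using sub by auto
      have "norm (f s (p s) - f s (q s)) \<le> K * norm (p s - q s)" using lip s pq by auto
      also have "\<dots> \<le> K * (E s * D)" using pq(3)[OF s] K by (intro mult_left_mono) auto
      finally show "norm (f s (p s) - f s (q s)) \<le> D * (K * exp (2 * K * (s - a)))"
        by (simp add: E_def mult_ac)
    qed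
    then show ?thesis
      using integral_diff[OF integrable_continuous_real[OF cs(1)] integrable_continuous_real[OF cs(2)]]
      by (simp add: E_def)
  qed
  have Qbound: "norm (Q z s) \<le> d" if z: "z \<in> cball 0 d" for z s
  proof -
    let ?t = "cl s"
    have t: "?t \<in> {a..b}" by (rule cl)
    have "norm (integral {a..?t} (\<lambda>u. f u (W z u)) - integral {a..?t} (\<lambda>u. f u (y0 u))) \<le> d * (E ?t - 1) / 2"
    proof (rule diff_bound[OF t contfW[OF z] contf0 W[OF z]])
      fix u assume "u \<in> {a..b}"
      have "norm (apply_bcontfun z u) \<le> d" using norm_bounded[of z u] z by simp
      then show "norm (W z u - y0 u) \<le> E u * d" using E0[of u] by (simp add: W_def)
    qed (use r in auto)
    moreover have "norm (\<eta> + integral {a..?t} (\<lambda>s. f s (y0 s)) - y0 ?t) \<le> d / 2"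
      using init[OF t] by (simp add: d_def)
    ultimately have "norm ((integral {a..?t} (\<lambda>u. f u (W z u)) - integral {a..?t} (\<lambda>u. f u (y0 u))) +
        (\<eta> + integral {a..?t} (\<lambda>s. f s (y0 s)) - y0 ?t)) \<le> d * (E ?t - 1) / 2 + d / 2"
      by (rule norm_triangle_mono)
    then have "norm (\<eta> + integral {a..?t} (\<lambda>u. f u (W z u)) - y0 ?t) \<le> d * (E ?t - 1) / 2 + d / 2"
      by (simp add: algebra_simps)
    also have "\<dots> = E ?t * (d / 2)" by (simp add: field_simps)
    finally have "norm (Q z s) \<le> d / 2" using E0[of ?t] unfolding Q_def norm_scaleR
      by (simp add: divide_le_eq mult.commute)
    then show ?thesis using d0 by simp
  qed
  have contQ: "continuous_on UNIV (Q z)" if z: "z \<in> cball 0 d" for z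
  proof -
    have *: "continuous_on {a..b} (\<lambda>t. (1 / E t) *\<^sub>R (\<eta> + integral {a..t} (\<lambda>u. f u (W z u)) - y0 t))"
      unfolding E_def
      by (intro continuous_intros cont0 indefinite_integral_continuous_1 integrable_continuous_real contfW[OF z]) auto
    show ?thesis unfolding Q_def
      by (rule continuous_on_compose2[OF * contcl[of UNIV]]) (use cl in blast)
  qed
  define P where "P z = Bcontfun (Q z)" for z
  have P: "apply_bcontfun (P z) = Q z" if "z \<in> cball 0 d" for z
    unfolding P_def by (rule Bcontfun_inverse) (rule bcontfun_normI[OF contQ[OF that] Qbound[OF that]])
  have "\<exists>!z. z \<in> cball 0 d \<and> P z = z"
  proof (rule Banach_fix)
    show "complete (cball (0::(real, 'a) bcontfun) d)" by (simp add: complete_eq_closed)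
    show "cball (0::(real, 'a) bcontfun) d \<noteq> {}" using d0 by simp
    show "P ` cball 0 d \<subseteq> cball 0 d"
      using P Qbound by (auto intro!: norm_bound)
    fix z w :: "(real, 'a) bcontfun" assume zw: "z \<in> cball 0 d" "w \<in> cball 0 d"
    have "norm (apply_bcontfun (P z - P w) s) \<le> 1 / 2 * norm (z - w)" for s
    proof -
      let ?t = "cl s"
      have t: "?t \<in> {a..b}" by (rule cl)
      have "norm (integral {a..?t} (\<lambda>u. f u (W z u)) - integral {a..?t} (\<lambda>u. f u (W w u))) \<le> norm (z - w) * (E ?t - 1) / 2"
      proof (rule diff_bound[OF t contfW[OF zw(1)] contfW[OF zw(2)] W[OF zw(1)] W[OF zw(2)]])
        fix u assume "u \<in> {a..b}"
        have "norm (apply_bcontfun (z - w) u) \<le> norm (z - w)" by (rule norm_bounded)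
        moreover have "W z u - W w u = E u *\<^sub>R apply_bcontfun (z - w) u"
          by (simp add: W_def algebra_simps)
        ultimately show "norm (W z u - W w u) \<le> E u * norm (z - w)" using E0[of u] by simp
      qed
      then have "1 / E ?t * norm (integral {a..?t} (\<lambda>u. f u (W z u)) - integral {a..?t} (\<lambda>u. f u (W w u)))
          \<le> 1 / E ?t * (norm (z - w) * (E ?t - 1) / 2)"
        using E0[of ?t] by (intro mult_left_mono) auto
      moreover have "apply_bcontfun (P z - P w) s =
          (1 / E ?t) *\<^sub>R (integral {a..?t} (\<lambda>u. f u (W z u)) - integral {a..?t} (\<lambda>u. f u (W w u)))"
        using P zw by (simp add: Q_def algebra_simps)
      ultimately have "norm (apply_bcontfun (P z - P w) s) \<le> 1 / E ?t * (norm (z - w) * (E ?t - 1) / 2)"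
        using E0[of ?t] by (simp only: norm_scaleR) simp
      also have "\<dots> = norm (z - w) / 2 * ((E ?t - 1) / E ?t)" by simp
      also have "\<dots> \<le> norm (z - w) / 2 * 1"
        using E0[of ?t] by (intro mult_left_mono) auto
      finally show ?thesis by simp
    qed
    then show "dist (P z) (P w) \<le> 1 / 2 * dist z w"
      unfolding dist_norm by (rule norm_bound)
  qed auto
  then obtain z where z: "z \<in> cball 0 d" and fixp: "P z = z" by auto
  have Wint: "W z t = \<eta> + integral {a..t} (\<lambda>u. f u (W z u))" if t: "t \<in> {a..b}" for t
    using P[OF z] fixp E0[of t] unfolding W_def[of z t] by (simp add: Q_def cl_id[OF t])
  show thesis
  proof (rule that)
    show "W z a = \<eta>" using Wint[of a] ab by simp
    fix t assume t: "t \<in> {a..b}"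
    show "W z t \<in> cball (y0 t) r" by (rule W[OF z t])
    have "((\<lambda>t. \<eta> + integral {a..t} (\<lambda>u. f u (W z u))) has_vector_derivative 0 + f t (W z t)) (at t within {a..b})"
      by (intro has_vector_derivative_add has_vector_derivative_const integral_has_vector_derivative contfW[OF z] t)
    then show "(W z has_vector_derivative f t (W z t)) (at t within {a..b})"
      by (auto intro: has_vector_derivative_transform[OF t, rotated] simp: Wint)
  qed
qed

text \<open>All constants come from one compact neighbourhood of the trajectory: \<open>K\<close>
  bounds the derivative there, and uniform continuity of the derivative makes the linearization
  error small relative to the distance, uniformly in \<open>t\<close>. Convexity of the balls turns
  derivative bounds into Lipschitz bounds.\<close>

lemma tube_bounds:
  fixes f :: "real \<Rightarrow> 'a::euclidean_space \<Rightarrow> 'a" and f' :: "real \<Rightarrow> 'a \<Rightarrow> 'a \<Rightarrow>\<^sub>L 'a"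
  assumes U: "open U" and y0: "continuous_on {a..b} y0" "y0 ` {a..b} \<subseteq> U"
    and der: "\<And>t y. t \<in> {a..b} \<Longrightarrow> y \<in> U \<Longrightarrow> (f t has_derivative blinfun_apply (f' t y)) (at y)"
    and cont': "continuous_on ({a..b} \<times> U) (\<lambda>(t, y). f' t y)"
  obtains r K where "r > 0" "K > 0" "\<And>t. t \<in> {a..b} \<Longrightarrow> cball (y0 t) r \<subseteq> U"
    "\<And>t y. t \<in> {a..b} \<Longrightarrow> y \<in> cball (y0 t) r \<Longrightarrow> norm (f' t y) \<le> K"
    "\<And>t y w. t \<in> {a..b} \<Longrightarrow> y \<in> cball (y0 t) r \<Longrightarrow> w \<in> cball (y0 t) r \<Longrightarrow>
        norm (f t y - f t w) \<le> K * norm (y - w)"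
    "\<And>e. e > 0 \<Longrightarrow> \<exists>d>0. \<forall>t\<in>{a..b}. \<forall>y\<in>cball (y0 t) d.
        norm (f t y - f t (y0 t) - f' t (y0 t) (y - y0 t)) \<le> e * norm (y - y0 t)"
proof -
  have "compact (y0 ` {a..b})" by (intro compact_continuous_image y0) auto
  from compact_subset_open_imp_cball_epsilon_subset[OF this U y0(2)]
  obtain r where r: "r > 0" "(\<Union>x\<in>y0 ` {a..b}. cball x r) \<subseteq> U" by metis
  \<comment> \<open>Written as a sum of two compact sets, so that its compactness is immediate; it
    contains \<open>cball (y0 t) r\<close> for every \<open>t\<close>.\<close>
  define N where "N = {x + y | x y. x \<in> y0 ` {a..b} \<and> y \<in> cball 0 r}"
  have Nin: "y \<in> N" if "t \<in> {a..b}" "y \<in> cball (y0 t) r" for t y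
  proof -
    have "y = y0 t + (y - y0 t)" "y - y0 t \<in> cball 0 r"
      using that by (auto simp: dist_norm norm_minus_commute)
    then show ?thesis unfolding N_def using that(1) by blast
  qed
  have "N \<subseteq> U"
  proof
    fix z assume "z \<in> N"
    then obtain t y where "t \<in> {a..b}" "z = y0 t + y" "norm y \<le> r" by (auto simp: N_def)
    then have "z \<in> cball (y0 t) r" by (simp add: dist_norm)
    with r(2) \<open>t \<in> {a..b}\<close> show "z \<in> U" by blast
  qed
  have cN: "compact ({a..b} \<times> N)" unfolding N_def
    by (intro compact_Times compact_sums compact_continuous_image y0 compact_cball compact_Icc)
  have contN: "continuous_on ({a..b} \<times> N) (\<lambda>(t, y). f' t y)"
    by (rule continuous_on_subset[OF cont']) (use \<open>N \<subseteq> U\<close> in auto)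
  have "bounded ((\<lambda>(t, y). f' t y) ` ({a..b} \<times> N))"
    by (intro compact_imp_bounded compact_continuous_image cN contN)
  then obtain K where "K > 0" and K: "\<And>t y. t \<in> {a..b} \<Longrightarrow> y \<in> N \<Longrightarrow> norm (f' t y) \<le> K"
    unfolding bounded_pos by auto
  have derN: "(f t has_derivative blinfun_apply (f' t y)) (at y within cball (y0 t) d)"
    if "t \<in> {a..b}" "y \<in> cball (y0 t) d" "d \<le> r" for t y d
  proof (rule has_derivative_at_withinI, rule der[OF that(1)])
    have "y \<in> cball (y0 t) r" using that(2,3) by simp
    then show "y \<in> U" using Nin[OF that(1)] \<open>N \<subseteq> U\<close> by blast
  qed
  have lip: "norm (f t y - f t w) \<le> K * norm (y - w)"
    if "t \<in> {a..b}" "y \<in> cball (y0 t) r" "w \<in> cball (y0 t) r" for t y w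
    by (rule differentiable_bound[where f="f t" and S="cball (y0 t) r" and f'="\<lambda>y. blinfun_apply (f' t y)"])
      (use that derN[OF that(1) _ order_refl] K[OF that(1) Nin[OF that(1)]] in \<open>simp_all add: norm_blinfun.rep_eq[symmetric]\<close>)
  have lin: "\<exists>d>0. \<forall>t\<in>{a..b}. \<forall>y\<in>cball (y0 t) d.
        norm (f t y - f t (y0 t) - f' t (y0 t) (y - y0 t)) \<le> e * norm (y - y0 t)" if "e > 0" for e
  proof -
    have "uniformly_continuous_on ({a..b} \<times> N) (\<lambda>(t, y). f' t y)"
      by (rule compact_uniformly_continuous[OF contN cN])
    then obtain d where d: "d > 0" and
      d2: "\<And>p q. p \<in> {a..b} \<times> N \<Longrightarrow> q \<in> {a..b} \<times> N \<Longrightarrow> dist q p < d \<Longrightarrow>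
        dist (case q of (t, y) \<Rightarrow> f' t y) (case p of (t, y) \<Rightarrow> f' t y) < e"
      using \<open>e > 0\<close> unfolding uniformly_continuous_on_def by metis
    define s where "s = min r (d / 2)"
    have s: "s > 0" "s \<le> r" "s < d" using r d by (auto simp: s_def)
    have "norm (f t y - f t (y0 t) - f' t (y0 t) (y - y0 t)) \<le> e * norm (y - y0 t)"
      if t: "t \<in> {a..b}" and y: "y \<in> cball (y0 t) s" for t y
    proof -
      \<comment> \<open>Subtracting the linear part leaves a function with derivative
        \<open>f' t y - f' t (y0 t)\<close>, which is small on the ball, so the mean value
        inequality applies.\<close>
      have "norm ((f t y - f' t (y0 t) y) - (f t (y0 t) - f' t (y0 t) (y0 t))) \<le> e * norm (y - y0 t)"
      proof (rule differentiable_bound[where S="cball (y0 t) s" and f'="\<lambda>y. blinfun_apply (f' t y - f' t (y0 t))"])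
        fix z assume z: "z \<in> cball (y0 t) s"
        show "((\<lambda>z. f t z - f' t (y0 t) z) has_derivative blinfun_apply (f' t z - f' t (y0 t))) (at z within cball (y0 t) s)"
          using derN[OF t z s(2)] by (auto intro!: derivative_eq_intros simp: blinfun.diff_left)
        have "dist (f' t z) (f' t (y0 t)) < e"
          using d2[of "(t, y0 t)" "(t, z)"] t z s(2,3) Nin[OF t, of z] Nin[OF t, of "y0 t"] r(1)
          by (simp add: dist_Pair_Pair dist_commute)
        then show "onorm (blinfun_apply (f' t z - f' t (y0 t))) \<le> e"
          by (simp add: dist_norm norm_blinfun.rep_eq)
      qed (use y s in auto)
      then show ?thesis by (simp add: blinfun.diff_right algebra_simps)
    qed
    then show ?thesis using s by blast
  qed
  show thesis
  proof (rule that[OF r(1) \<open>K > 0\<close> _ _ lip lin])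
    show "cball (y0 t) r \<subseteq> U" if "t \<in> {a..b}" for t using r(2) that by blast
    show "norm (f' t y) \<le> K" if "t \<in> {a..b}" "y \<in> cball (y0 t) r" for t y
      using K[OF that(1) Nin[OF that]] .
  qed
qed

text \<open>Two Gronwall estimates. The first shows that \<open>y \<tau> - y0\<close> is of order
  \<tau>, by the Lipschitz bound. Hence the linearization error is of smaller order, and the second
  estimate, applied to \<open>y \<tau> - y0 - \<tau> *\<^sub>R \<xi>\<close>, shows the same for
  this remainder.\<close>

lemma ode_differentiable_dependence:
  fixes f :: "real \<Rightarrow> 'a::real_normed_vector \<Rightarrow> 'a" and f' :: "real \<Rightarrow> 'a \<Rightarrow> 'a \<Rightarrow>\<^sub>L 'a"
  assumes K: "K > 0"
    and K': "\<And>t. t \<in> {a..b} \<Longrightarrow> norm (f' t (y0 t)) \<le> K"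
    and lip: "\<And>t y w. t \<in> {a..b} \<Longrightarrow> y \<in> cball (y0 t) r \<Longrightarrow> w \<in> cball (y0 t) r \<Longrightarrow>
        norm (f t y - f t w) \<le> K * norm (y - w)"
    and lin: "\<And>e. e > 0 \<Longrightarrow> \<exists>d>0. \<forall>t\<in>{a..b}. \<forall>y\<in>cball (y0 t) d.
        norm (f t y - f t (y0 t) - f' t (y0 t) (y - y0 t)) \<le> e * norm (y - y0 t)"
    and r: "r \<ge> 0"
    and y0: "\<And>t. t \<in> {a..b} \<Longrightarrow> (y0 has_vector_derivative f t (y0 t)) (at t within {a..b})"
    and \<xi>: "\<And>t. t \<in> {a..b} \<Longrightarrow> (\<xi> has_vector_derivative f' t (y0 t) (\<xi> t)) (at t within {a..b})"
    and y: "\<forall>\<^sub>F \<tau> in at (0::real). \<forall>t\<in>{a..b}.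
        (y \<tau> has_vector_derivative f t (y \<tau> t)) (at t within {a..b}) \<and> y \<tau> t \<in> cball (y0 t) r"
    and base: "\<And>t. t \<in> {a..b} \<Longrightarrow> y 0 t = y0 t"
    and init: "((\<lambda>\<tau>. y \<tau> a) has_vector_derivative \<xi> a) (at 0)"
    and t: "t \<in> {a..b}"
  shows "((\<lambda>\<tau>. y \<tau> t) has_vector_derivative \<xi> t) (at 0)"
proof -
  have a: "a \<in> {a..b}" using t by auto
  define C where "C = 2 * exp (2 * K * (b - a))"
  have C: "2 * exp (2 * K * (s - a)) \<le> C" if "s \<in> {a..b}" for s
    using that K by (simp add: C_def)
  have C0: "C > 0" by (simp add: C_def)
  \<comment> \<open>For \<tau> near 0 the initial displacement is at most
    \<open>M * \<bar>\<tau>\<bar>\<close>; the summand 1 is the error tolerance taken in the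
    definition of the derivative.\<close>
  define M where "M = norm (\<xi> a) + 1"
  have M0: "M > 0" by (simp add: M_def add_nonneg_pos)
  have ini: "\<forall>\<^sub>F \<tau> in at 0. norm (y \<tau> a - y0 a - \<tau> *\<^sub>R \<xi> a) \<le> e * \<bar>\<tau>\<bar>" if "e > 0" for e
  proof -
    have "\<forall>\<^sub>F \<tau> in at 0. norm (y \<tau> a - y 0 a - (\<tau> - 0) *\<^sub>R \<xi> a) \<le> e * norm (\<tau> - 0)"
      using init that unfolding has_vector_derivative_def has_derivative_within_alt2 by auto
    then show ?thesis using base[OF a] by simp
  qed
  have "\<forall>\<^sub>F \<tau> in at 0. norm (y \<tau> t - y0 t - \<tau> *\<^sub>R \<xi> t) \<le> e * \<bar>\<tau>\<bar>" if "e > 0" for e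
  proof -
    define e1 where "e1 = e / (2 * C)"
    \<comment> \<open>Chosen so that the initial error and the error accumulated over the interval
      contribute half of \<open>e\<close> each. The added 1 in \<open>b - a + 1\<close> keeps the
      divisor positive on a one-point interval.\<close>
    define e2 where "e2 = e1 / (C * M * (b - a + 1))"
    have ba: "b - a + 1 > 0" using a by auto
    have e1: "e1 > 0" using that C0 by (simp add: e1_def)
    have e2: "e2 > 0" using e1 C0 M0 ba by (simp add: e2_def)
    obtain d where d: "d > 0" and dlin: "\<And>t y. t \<in> {a..b} \<Longrightarrow> y \<in> cball (y0 t) d \<Longrightarrow>
        norm (f t y - f t (y0 t) - f' t (y0 t) (y - y0 t)) \<le> e2 * norm (y - y0 t)"
      using lin[OF e2] by blast
    have small: "\<forall>\<^sub>F \<tau> in at (0::real). \<bar>\<tau>\<bar> < d / (C * M)"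
      unfolding eventually_at using d C0 M0 by (intro exI[of _ "d / (C * M)"]) simp
    show ?thesis
      using y ini[OF e1] ini[OF zero_less_one] small
    proof eventually_elim
      case (elim \<tau>)
      have dy: "(y \<tau> has_vector_derivative f s (y \<tau> s)) (at s within {a..b})"
        and tube: "y \<tau> s \<in> cball (y0 s) r" if "s \<in> {a..b}" for s using elim(1) that by auto
      have "norm (y \<tau> a - y0 a) \<le> norm (y \<tau> a - y0 a - \<tau> *\<^sub>R \<xi> a) + norm (\<tau> *\<^sub>R \<xi> a)"
        by (metis add.commute norm_triangle_sub)
      also have "\<dots> \<le> M * \<bar>\<tau>\<bar>" using elim(3) by (simp add: M_def algebra_simps)
      finally have ya: "norm (y \<tau> a - y0 a) \<le> M * \<bar>\<tau>\<bar>" .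
      have dev: "norm (y \<tau> s - y0 s) \<le> C * M * \<bar>\<tau>\<bar>" if s: "s \<in> {a..b}" for s
      proof -
        have "norm (y \<tau> s - y0 s) \<le> 2 * exp (2 * K * (s - a)) * (norm (y \<tau> a - y0 a) + 0 * (b - a))"
        proof (rule norm_le_weighted_gronwall[where z="\<lambda>s. y \<tau> s - y0 s", OF _ _ _ _ s])
          fix u assume u: "u \<in> {a..b}"
          show "((\<lambda>s. y \<tau> s - y0 s) has_vector_derivative f u (y \<tau> u) - f u (y0 u)) (at u within {a..b})"
            by (intro has_vector_derivative_diff dy y0 u)
          show "norm (f u (y \<tau> u) - f u (y0 u)) \<le> K * norm (y \<tau> u - y0 u) + 0"
            using lip[OF u tube[OF u]] r by simp
        qed (use K in auto)
        also have "\<dots> \<le> C * (M * \<bar>\<tau>\<bar>)"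
          using C[OF s] ya C0 by (intro mult_mono) auto
        finally show ?thesis by simp
      qed
      have dle: "C * M * \<bar>\<tau>\<bar> \<le> d" using elim(4) C0 M0 by (simp add: field_simps)
      have "norm (y \<tau> t - y0 t - \<tau> *\<^sub>R \<xi> t)
          \<le> 2 * exp (2 * K * (t - a)) * (norm (y \<tau> a - y0 a - \<tau> *\<^sub>R \<xi> a) + (e2 * (C * M * \<bar>\<tau>\<bar>)) * (b - a))"
      proof (rule norm_le_weighted_gronwall[where z="\<lambda>s. y \<tau> s - y0 s - \<tau> *\<^sub>R \<xi> s", OF _ _ _ _ t])
        fix u assume u: "u \<in> {a..b}"
        show "((\<lambda>s. y \<tau> s - y0 s - \<tau> *\<^sub>R \<xi> s) has_vector_derivative
            f u (y \<tau> u) - f u (y0 u) - \<tau> *\<^sub>R f' u (y0 u) (\<xi> u)) (at u within {a..b})"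
          using \<xi>[OF u] dy[OF u] y0[OF u] by (auto intro!: derivative_eq_intros)
        let ?z = "y \<tau> u - y0 u - \<tau> *\<^sub>R \<xi> u"
        have "f u (y \<tau> u) - f u (y0 u) - \<tau> *\<^sub>R f' u (y0 u) (\<xi> u) =
            f' u (y0 u) ?z + (f u (y \<tau> u) - f u (y0 u) - f' u (y0 u) (y \<tau> u - y0 u))"
          by (simp add: blinfun.diff_right blinfun.scaleR_right)
        also have "norm \<dots> \<le> norm (f' u (y0 u)) * norm ?z + e2 * norm (y \<tau> u - y0 u)"
          using dlin[OF u, of "y \<tau> u"] dev[OF u] dle
          by (intro norm_triangle_mono norm_blinfun) (auto simp: dist_norm norm_minus_commute)
        also have "\<dots> \<le> K * norm ?z + e2 * (C * M * \<bar>\<tau>\<bar>)"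
          using K'[OF u] dev[OF u] e2 by (intro add_mono mult_mono mult_left_mono) (auto intro: K less_imp_le)
        finally show "norm (f u (y \<tau> u) - f u (y0 u) - \<tau> *\<^sub>R f' u (y0 u) (\<xi> u)) \<le> K * norm ?z + e2 * (C * M * \<bar>\<tau>\<bar>)" .
      qed (use K e2 C0 M0 in auto)
      also have "\<dots> \<le> C * (e1 * \<bar>\<tau>\<bar> + e2 * (C * M * \<bar>\<tau>\<bar>) * (b - a + 1))"
        using C[OF t] elim(2) C0 e2 M0 a by (intro mult_mono add_mono mult_left_mono) auto
      also have "\<dots> = C * (e1 * \<bar>\<tau>\<bar> + e2 * (C * M * (b - a + 1)) * \<bar>\<tau>\<bar>)" by (simp only: mult_ac)
      also have "e2 * (C * M * (b - a + 1)) = e1" using C0 M0 ba unfolding e2_def by simp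
      also have "C * (e1 * \<bar>\<tau>\<bar> + e1 * \<bar>\<tau>\<bar>) = e * \<bar>\<tau>\<bar>" using C0 by (simp add: e1_def)
      finally show ?case .
    qed
  qed
  then show ?thesis
    unfolding has_vector_derivative_def has_derivative_within_alt2
    by (auto simp: base[OF t] bounded_linear_scaleR_left)
qed

lemma linear_ode_solution:
  fixes B :: "real \<Rightarrow> 'a::banach \<Rightarrow>\<^sub>L 'a"
  assumes "a \<le> b" and B: "continuous_on {a..b} B"
  obtains y where "y a = \<eta>"
    "\<And>t. t \<in> {a..b} \<Longrightarrow> (y has_vector_derivative B t (y t)) (at t within {a..b})"
proof -
  have "bounded (B ` {a..b})" by (intro compact_imp_bounded compact_continuous_image B) auto
  then obtain K where K: "K > 0" "\<And>t. t \<in> {a..b} \<Longrightarrow> norm (B t) \<le> K" unfolding bounded_pos by auto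
  \<comment> \<open>A linear field is Lipschitz with the same constant on every ball, so the tube
    around 0 can be made wide enough for the given initial value to meet the smallness
    condition.\<close>
  define r where "r = 2 * norm \<eta> * exp (2 * K * (b - a))"
  have r: "norm \<eta> \<le> r * exp (- (2 * K * (b - a))) / 2"
    by (simp add: r_def exp_minus)
  show thesis
  proof (rule ode_solution_in_tube[where f="\<lambda>t. blinfun_apply (B t)" and \<eta>=\<eta> and r=r and ?y0.0="\<lambda>_. 0", OF assms(1) K(1)])
    show "continuous_on (SIGMA t:{a..b}. cball 0 r) (\<lambda>(t, y). B t y)"
      unfolding case_prod_beta
      by (intro continuous_intros continuous_on_compose2[OF B]) auto
    fix t y w assume t: "t \<in> {a..b}"
    have "norm (B t (y - w)) \<le> norm (B t) * norm (y - w)" by (rule norm_blinfun)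
    also have "\<dots> \<le> K * norm (y - w)" using K(2)[OF t] by (rule mult_right_mono) auto
    finally show "norm (B t y - B t w) \<le> K * norm (y - w)" by (simp add: blinfun.diff_right)
  qed (use r in \<open>auto simp: r_def intro: that\<close>)
qed

section \<open>Continuously differentiable functions\<close>

declare C_k_on.simps(2) [simp del]

lemma C_k_on_SucE:
  assumes "C_k_on (Suc k) S f"
  obtains f' where "\<And>x. x \<in> S \<Longrightarrow> (f has_derivative f' x) (at x within S)" "\<And>v. C_k_on k S (\<lambda>x. f' x v)"
  using assms unfolding C_k_on.simps by blast

lemma C_k_on_SucI:
  assumes "\<And>x. x \<in> S \<Longrightarrow> (f has_derivative f' x) (at x within S)" "\<And>v. C_k_on k S (\<lambda>x. f' x v)"
  shows "C_k_on (Suc k) S f"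
  using assms unfolding C_k_on.simps by blast

lemma C_k_on_cong:
  assumes "\<And>x. x \<in> S \<Longrightarrow> f x = g x"
  shows "C_k_on k S f \<longleftrightarrow> C_k_on k S g"
proof (cases k)
  case 0 then show ?thesis using assms by (simp cong: continuous_on_cong)
next
  case (Suc n)
  have "(f has_derivative D) (at x within S) \<longleftrightarrow> (g has_derivative D) (at x within S)" if "x \<in> S" for x D
    using has_derivative_transform[OF that, of f g] has_derivative_transform[OF that, of g f] assms by metis
  then show ?thesis unfolding Suc C_k_on.simps by blast
qed

lemma C_k_on_subset: "C_k_on k S f \<Longrightarrow> T \<subseteq> S \<Longrightarrow> C_k_on k T f"
proof (induction k arbitrary: f)
  case (Suc k)
  obtain f' where "\<And>x. x \<in> S \<Longrightarrow> (f has_derivative f' x) (at x within S)" "\<And>v. C_k_on k S (\<lambda>x. f' x v)"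
    by (rule C_k_on_SucE[OF Suc.prems(1)], rule that) blast+
  with Suc.IH Suc.prems(2) show ?case
    by (intro C_k_on_SucI[of _ _ f']) (auto intro: has_derivative_subset)
qed (auto intro: continuous_on_subset)

lemma C_k_on_imp_continuous_on: "C_k_on k S f \<Longrightarrow> continuous_on S f"
  by (cases k) (auto simp: continuous_on_eq_continuous_within elim!: C_k_on_SucE intro: has_derivative_continuous)

lemma C_k_on_Suc_imp: "C_k_on (Suc k) S f \<Longrightarrow> C_k_on k S f"
proof (induction k arbitrary: f)
  case 0 then show ?case using C_k_on_imp_continuous_on[OF 0] by simp
next
  case (Suc k)
  obtain f' where "\<And>x. x \<in> S \<Longrightarrow> (f has_derivative f' x) (at x within S)" "\<And>v. C_k_on (Suc k) S (\<lambda>x. f' x v)"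
    by (rule C_k_on_SucE[OF Suc.prems(1)], rule that) blast+
  with Suc.IH show ?case by (intro C_k_on_SucI[of _ _ f']) auto
qed

lemma C_k_on_const: "C_k_on k S (\<lambda>_. c)"
  by (induction k arbitrary: c) (auto intro!: C_k_on_SucI[of _ _ "\<lambda>_ _. 0"])

lemma C_k_on_bounded_linear_compose:
  assumes "bounded_linear h"
  shows "C_k_on k S f \<Longrightarrow> C_k_on k S (\<lambda>x. h (f x))"
proof (induction k arbitrary: f)
  case 0 then show ?case using assms by (auto intro: bounded_linear.continuous_on)
next
  case (Suc k)
  obtain f' where "\<And>x. x \<in> S \<Longrightarrow> (f has_derivative f' x) (at x within S)" "\<And>v. C_k_on k S (\<lambda>x. f' x v)"
    by (rule C_k_on_SucE[OF Suc.prems(1)], rule that) blast+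
  with Suc.IH show ?case
    by (intro C_k_on_SucI[of _ _ "\<lambda>x v. h (f' x v)"]) (auto intro: bounded_linear.has_derivative[OF assms])
qed

lemma C_k_on_add: "C_k_on k S f \<Longrightarrow> C_k_on k S g \<Longrightarrow> C_k_on k S (\<lambda>x. f x + g x)"
proof (induction k arbitrary: f g)
  case (Suc k)
  obtain f' where "\<And>x. x \<in> S \<Longrightarrow> (f has_derivative f' x) (at x within S)" "\<And>v. C_k_on k S (\<lambda>x. f' x v)"
    by (rule C_k_on_SucE[OF Suc.prems(1)], rule that) blast+
  moreover obtain g' where "\<And>x. x \<in> S \<Longrightarrow> (g has_derivative g' x) (at x within S)" "\<And>v. C_k_on k S (\<lambda>x. g' x v)"
    by (rule C_k_on_SucE[OF Suc.prems(2)], rule that) blast+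
  ultimately show ?case using Suc.IH
    by (intro C_k_on_SucI[of _ _ "\<lambda>x v. f' x v + g' x v"]) (auto intro: has_derivative_add)
qed (auto intro: continuous_on_add)

lemma C_k_on_sum: "(\<And>i. i \<in> I \<Longrightarrow> C_k_on k S (f i)) \<Longrightarrow> C_k_on k S (\<lambda>x. \<Sum>i\<in>I. f i x)"
proof (induction I rule: infinite_finite_induct)
  case (insert i I)
  then show ?case by (simp add: C_k_on_add)
qed (simp_all add: C_k_on_const)

lemma C_k_on_scaleR:
  fixes f :: "'a::real_normed_vector \<Rightarrow> real" and g :: "'a \<Rightarrow> 'b::real_normed_vector"
  shows "C_k_on k S f \<Longrightarrow> C_k_on k S g \<Longrightarrow> C_k_on k S (\<lambda>x. f x *\<^sub>R g x)"
proof (induction k arbitrary: f g)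
  case (Suc k)
  obtain f' where f': "\<And>x. x \<in> S \<Longrightarrow> (f has_derivative f' x) (at x within S)" "\<And>v. C_k_on k S (\<lambda>x. f' x v)"
    by (rule C_k_on_SucE[OF Suc.prems(1)], rule that) blast+
  obtain g' where g': "\<And>x. x \<in> S \<Longrightarrow> (g has_derivative g' x) (at x within S)" "\<And>v. C_k_on k S (\<lambda>x. g' x v)"
    by (rule C_k_on_SucE[OF Suc.prems(2)], rule that) blast+
  show ?case
    by (intro C_k_on_SucI[of _ _ "\<lambda>x v. f x *\<^sub>R g' x v + f' x v *\<^sub>R g x"] has_derivative_scaleR
        C_k_on_add Suc.IH f' g' C_k_on_Suc_imp[OF Suc.prems(1)] C_k_on_Suc_imp[OF Suc.prems(2)])
qed (auto intro: continuous_on_scaleR)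

lemma linear_euclidean_expand:
  fixes h :: "'a::euclidean_space \<Rightarrow> 'b::real_vector"
  assumes "linear h"
  shows "h v = (\<Sum>i\<in>Basis. (v \<bullet> i) *\<^sub>R h i)"
proof -
  have "h (\<Sum>i\<in>Basis. (v \<bullet> i) *\<^sub>R i) = (\<Sum>i\<in>Basis. (v \<bullet> i) *\<^sub>R h i)"
    by (simp add: linear_sum[OF assms] linear_cmul[OF assms])
  then show ?thesis by (simp add: euclidean_representation)
qed

text \<open>\<open>C_k_on\<close> controls derivatives in fixed directions, whereas the chain rule
  differentiates \<open>f\<close> in the moving direction \<open>g' x v\<close>. Expanding this
  direction over \<open>Basis\<close> reduces it to fixed directions with scalar coefficients; hence
  the Euclidean codomain of \<open>g\<close>.\<close>

lemma C_k_on_compose: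
  fixes g :: "'a::real_normed_vector \<Rightarrow> 'b::euclidean_space"
  shows "C_k_on k T f \<Longrightarrow> C_k_on k S g \<Longrightarrow> g ` S \<subseteq> T \<Longrightarrow> C_k_on k S (\<lambda>x. f (g x))"
proof (induction k arbitrary: f)
  case 0 then show ?case by (auto intro: continuous_on_compose2)
next
  case (Suc k)
  obtain f' where f': "\<And>x. x \<in> T \<Longrightarrow> (f has_derivative f' x) (at x within T)" "\<And>v. C_k_on k T (\<lambda>x. f' x v)"
    by (rule C_k_on_SucE[OF Suc.prems(1)], rule that) blast+
  obtain g' where g': "\<And>x. x \<in> S \<Longrightarrow> (g has_derivative g' x) (at x within S)" "\<And>v. C_k_on k S (\<lambda>x. g' x v)"
    by (rule C_k_on_SucE[OF Suc.prems(2)], rule that) blast+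
  have der: "((\<lambda>x. f (g x)) has_derivative (\<lambda>v. f' (g x) (g' x v))) (at x within S)" if x: "x \<in> S" for x
  proof (rule has_derivative_in_compose[OF g'(1)[OF x]])
    have "g x \<in> T" using x Suc.prems(3) by blast
    from has_derivative_subset[OF f'(1)[OF this] Suc.prems(3)]
    show "(f has_derivative f' (g x)) (at (g x) within g ` S)" .
  qed
  have "C_k_on k S (\<lambda>x. f' (g x) (g' x v))" for v
  proof -
    have "C_k_on k S (\<lambda>x. \<Sum>i\<in>Basis. (g' x v \<bullet> i) *\<^sub>R f' (g x) i)"
      by (intro C_k_on_sum C_k_on_scaleR Suc.IH[OF f'(2) C_k_on_Suc_imp[OF Suc.prems(2)] Suc.prems(3)]
          C_k_on_bounded_linear_compose[OF bounded_linear_inner_left] g'(2))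
    moreover have "f' (g x) (g' x v) = (\<Sum>i\<in>Basis. (g' x v \<bullet> i) *\<^sub>R f' (g x) i)" if "x \<in> S" for x
      using has_derivative_linear[OF f'(1), of "g x"] that Suc.prems(3) by (intro linear_euclidean_expand) auto
    ultimately show ?thesis by (simp cong: C_k_on_cong)
  qed
  with der show ?case by (intro C_k_on_SucI[of _ _ "\<lambda>x v. f' (g x) (g' x v)"]) auto
qed

lemma C_k_on_Suc_open:
  assumes "open S" "C_k_on (Suc k) S f"
  shows "x \<in> S \<Longrightarrow> (f has_derivative frechet_derivative f (at x)) (at x)"
    and "C_k_on k S (\<lambda>x. frechet_derivative f (at x) v)"
proof -
  obtain f' where f': "\<And>x. x \<in> S \<Longrightarrow> (f has_derivative f' x) (at x within S)" "\<And>v. C_k_on k S (\<lambda>x. f' x v)"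
    by (rule C_k_on_SucE[OF assms(2)], rule that) blast+
  have d: "(f has_derivative f' x) (at x)" if "x \<in> S" for x
    using f'(1)[OF that] at_within_open[OF that assms(1)] by simp
  then have eq: "frechet_derivative f (at x) = f' x" if "x \<in> S" for x
    using frechet_derivative_at[OF d[OF that]] by simp
  show "(f has_derivative frechet_derivative f (at x)) (at x)" if "x \<in> S" using d[OF that] eq[OF that] by simp
  show "C_k_on k S (\<lambda>x. frechet_derivative f (at x) v)"
    using f'(2)[of v] C_k_on_cong[of S "\<lambda>x. frechet_derivative f (at x) v" "\<lambda>x. f' x v"] eq by simp
qed

section \<open>Smooth functions and the symmetry of second derivatives\<close>

lemma smooth_on_cong: "(\<And>x. x \<in> S \<Longrightarrow> f x = g x) \<Longrightarrow> smooth_on S f \<longleftrightarrow> smooth_on S g"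
  unfolding smooth_on_def using C_k_on_cong by metis

lemma smooth_on_subset: "smooth_on S f \<Longrightarrow> T \<subseteq> S \<Longrightarrow> smooth_on T f"
  unfolding smooth_on_def using C_k_on_subset by blast

lemma smooth_on_const: "smooth_on S (\<lambda>_. c)"
  by (simp add: smooth_on_def C_k_on_const)

lemma smooth_on_add: "smooth_on S f \<Longrightarrow> smooth_on S g \<Longrightarrow> smooth_on S (\<lambda>x. f x + g x)"
  by (simp add: smooth_on_def C_k_on_add)

lemma smooth_on_sum: "(\<And>i. i \<in> I \<Longrightarrow> smooth_on S (f i)) \<Longrightarrow> smooth_on S (\<lambda>x. \<Sum>i\<in>I. f i x)"
  by (simp add: smooth_on_def C_k_on_sum)

lemma smooth_on_scaleR:
  fixes f :: "'a::real_normed_vector \<Rightarrow> real"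
  shows "smooth_on S f \<Longrightarrow> smooth_on S g \<Longrightarrow> smooth_on S (\<lambda>x. f x *\<^sub>R g x)"
  by (simp add: smooth_on_def C_k_on_scaleR)

lemma smooth_on_inner_const: "smooth_on S f \<Longrightarrow> smooth_on S (\<lambda>x. f x \<bullet> b)"
  by (simp add: smooth_on_def C_k_on_bounded_linear_compose[OF bounded_linear_inner_left])

lemma smooth_on_compose:
  fixes g :: "'a::real_normed_vector \<Rightarrow> 'b::euclidean_space"
  shows "smooth_on T f \<Longrightarrow> smooth_on S g \<Longrightarrow> g ` S \<subseteq> T \<Longrightarrow> smooth_on S (\<lambda>x. f (g x))"
  unfolding smooth_on_def using C_k_on_compose by blast

lemma smooth_on_has_derivative:
  assumes "open S" "smooth_on S f" "x \<in> S"
  shows "(f has_derivative frechet_derivative f (at x)) (at x)"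
  using C_k_on_Suc_open(1)[OF assms(1) _ assms(3), of 0 f] assms(2) unfolding smooth_on_def by blast

lemma smooth_on_frechet_derivative:
  assumes "open S" "smooth_on S f"
  shows "smooth_on S (\<lambda>x. frechet_derivative f (at x) v)"
  using C_k_on_Suc_open(2)[OF assms(1)] assms(2) unfolding smooth_on_def by blast

lemma smooth_on_imp_continuous_on: "smooth_on S f \<Longrightarrow> continuous_on S f"
  unfolding smooth_on_def using C_k_on_imp_continuous_on by blast

text \<open>The mean value theorem, first along \<open>u\<close> for the increment in direction
  \<open>v\<close> and then along \<open>v\<close>, evaluates the second difference. Its left side
  is symmetric in \<open>u\<close> and \<open>v\<close>, so exchanging them compares the two orders
  of differentiation.\<close>

lemma second_difference:
  fixes f :: "'a::real_normed_vector \<Rightarrow> real"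
  assumes h: "h > 0"
    and S: "\<And>s t. 0 \<le> s \<Longrightarrow> s \<le> h \<Longrightarrow> 0 \<le> t \<Longrightarrow> t \<le> h \<Longrightarrow> x + s *\<^sub>R u + t *\<^sub>R v \<in> S"
    and f': "\<And>y. y \<in> S \<Longrightarrow> (f has_derivative f' y) (at y)"
    and f'': "\<And>y. y \<in> S \<Longrightarrow> ((\<lambda>y. f' y u) has_derivative f'' y) (at y)"
  obtains s t where "0 < s" "s < h" "0 < t" "t < h"
    "f (x + h *\<^sub>R u + h *\<^sub>R v) - f (x + h *\<^sub>R u) - (f (x + h *\<^sub>R v) - f x) = h * (h * f'' (x + s *\<^sub>R u + t *\<^sub>R v) v)"
proof -
  define p where "p s = f (x + s *\<^sub>R u + h *\<^sub>R v) - f (x + s *\<^sub>R u)" for s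
  have dp: "DERIV p s :> f' (x + s *\<^sub>R u + h *\<^sub>R v) u - f' (x + s *\<^sub>R u) u" if s: "0 \<le> s" "s \<le> h" for s
  proof -
    have in1: "x + s *\<^sub>R u + h *\<^sub>R v \<in> S" and in2: "x + s *\<^sub>R u \<in> S"
      using S[of s h] S[of s 0] s h by auto
    have "((\<lambda>s. f (x + s *\<^sub>R u + h *\<^sub>R v)) has_derivative (\<lambda>d. f' (x + s *\<^sub>R u + h *\<^sub>R v) (d *\<^sub>R u))) (at s)"
      by (rule has_derivative_compose[where f="\<lambda>s. x + s *\<^sub>R u + h *\<^sub>R v", OF _ f'[OF in1]]) (auto intro!: derivative_eq_intros)
    moreover have "((\<lambda>s. f (x + s *\<^sub>R u)) has_derivative (\<lambda>d. f' (x + s *\<^sub>R u) (d *\<^sub>R u))) (at s)"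
      by (rule has_derivative_compose[where f="\<lambda>s. x + s *\<^sub>R u", OF _ f'[OF in2]]) (auto intro!: derivative_eq_intros)
    ultimately have "(p has_derivative (\<lambda>d. f' (x + s *\<^sub>R u + h *\<^sub>R v) (d *\<^sub>R u) - f' (x + s *\<^sub>R u) (d *\<^sub>R u))) (at s)"
      unfolding p_def by (rule has_derivative_diff)
    then show ?thesis unfolding has_field_derivative_def
    proof (rule has_derivative_eq_rhs, intro ext)
      fix d
      have "f' (x + s *\<^sub>R u + h *\<^sub>R v) (d *\<^sub>R u) = d * f' (x + s *\<^sub>R u + h *\<^sub>R v) u"
        "f' (x + s *\<^sub>R u) (d *\<^sub>R u) = d * f' (x + s *\<^sub>R u) u"
        using linear_cmul[OF has_derivative_linear[OF f'[OF in1]]] linear_cmul[OF has_derivative_linear[OF f'[OF in2]]] by auto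
      then show "f' (x + s *\<^sub>R u + h *\<^sub>R v) (d *\<^sub>R u) - f' (x + s *\<^sub>R u) (d *\<^sub>R u) =
          (f' (x + s *\<^sub>R u + h *\<^sub>R v) u - f' (x + s *\<^sub>R u) u) * d"
        by (simp only: mult.commute[of _ d] right_diff_distrib)
    qed
  qed
  from MVT2[OF h dp] obtain s where s: "0 < s" "s < h" "p h - p 0 = (h - 0) * (f' (x + s *\<^sub>R u + h *\<^sub>R v) u - f' (x + s *\<^sub>R u) u)"
    by blast
  define q where "q t = f' (x + s *\<^sub>R u + t *\<^sub>R v) u" for t
  have dq: "DERIV q t :> f'' (x + s *\<^sub>R u + t *\<^sub>R v) v" if t: "0 \<le> t" "t \<le> h" for t
  proof -
    have inS: "x + s *\<^sub>R u + t *\<^sub>R v \<in> S" using S[of s t] s t by auto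
    have "(q has_derivative (\<lambda>d. f'' (x + s *\<^sub>R u + t *\<^sub>R v) (d *\<^sub>R v))) (at t)"
      unfolding q_def
      by (rule has_derivative_compose[where f="\<lambda>t. x + s *\<^sub>R u + t *\<^sub>R v", OF _ f''[OF inS]]) (auto intro!: derivative_eq_intros)
    then show ?thesis unfolding has_field_derivative_def
      by (rule has_derivative_eq_rhs) (auto simp: fun_eq_iff linear_cmul[OF has_derivative_linear[OF f''[OF inS]]])
  qed
  from MVT2[OF h dq] obtain t where t: "0 < t" "t < h" "q h - q 0 = (h - 0) * f'' (x + s *\<^sub>R u + t *\<^sub>R v) v"
    by blast
  show thesis
    by (rule that[OF s(1,2) t(1,2)]) (use s(3) t(3) in \<open>simp add: p_def q_def\<close>)
qed

lemma symmetric_second_derivative_real: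
  fixes f :: "'a::real_normed_vector \<Rightarrow> real"
  assumes S: "open S" "x \<in> S" and f: "smooth_on S f"
  shows "frechet_derivative (\<lambda>y. frechet_derivative f (at y) u) (at x) v =
         frechet_derivative (\<lambda>y. frechet_derivative f (at y) v) (at x) u"
proof -
  define A where "A u v y = frechet_derivative (\<lambda>y. frechet_derivative f (at y) u) (at y) v" for u v y
  have cont: "continuous_on S (A u v)" for u v
    unfolding A_def
    by (intro smooth_on_imp_continuous_on smooth_on_frechet_derivative S f)
  obtain r where r: "r > 0" "ball x r \<subseteq> S" using S open_contains_ball by blast
  define N where "N = norm u + norm v + 1"
  have N: "N > 0" by (simp add: N_def add_nonneg_pos)
  have near: "norm (s *\<^sub>R u + t *\<^sub>R v) \<le> h * N" if "0 \<le> s" "s \<le> h" "0 \<le> t" "t \<le> h" for s t h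
  proof -
    have "norm (s *\<^sub>R u + t *\<^sub>R v) \<le> s * norm u + t * norm v"
      using that by (intro norm_triangle_mono) auto
    also have "\<dots> \<le> h * norm u + h * norm v + h" using that by (intro add_increasing2 add_mono mult_right_mono) auto
    finally show ?thesis by (simp add: N_def algebra_simps)
  qed
  have key: "\<bar>A u v x - A v u x\<bar> < e" if "e > 0" for e
  proof -
    have "\<exists>d>0. \<forall>y. dist y x < d \<longrightarrow> dist (A u' v' y) (A u' v' x) < e / 2" for u' v'
      using cont[of u' v'] \<open>e > 0\<close> S continuous_on_eq_continuous_at[OF S(1)]
      unfolding continuous_at by (metis half_gt_zero tendsto_def continuous_at_eps_delta continuous_at)
    then obtain d1 d2 where d: "d1 > 0" "d2 > 0"
      and d1: "\<And>y. dist y x < d1 \<Longrightarrow> dist (A u v y) (A u v x) < e / 2"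
      and d2: "\<And>y. dist y x < d2 \<Longrightarrow> dist (A v u y) (A v u x) < e / 2" by metis
    define m where "m = min r (min d1 d2)"
    \<comment> \<open>The whole parallelogram with sides \<open>h *\<^sub>R u\<close> and
      \<open>h *\<^sub>R v\<close> then lies within distance \<open>m\<close> of \<open>x\<close>,
      so both evaluation points fall where the second derivatives are within \<open>e / 2\<close> of
      their values at \<open>x\<close>.\<close>
    define h where "h = m / (2 * N)"
    have m: "m > 0" using r d by (simp add: m_def)
    have h: "h > 0" "h * N < m" using m N by (auto simp: h_def)
    have near': "dist (x + s *\<^sub>R u + t *\<^sub>R v) x < m" if "0 \<le> s" "s \<le> h" "0 \<le> t" "t \<le> h" for s t
      using near[OF that] h(2) by (simp add: dist_norm add.assoc)
    have inS: "x + s *\<^sub>R u + t *\<^sub>R v \<in> S" if "0 \<le> s" "s \<le> h" "0 \<le> t" "t \<le> h" for s t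
      using near'[OF that] r(2) by (auto simp: m_def dist_commute)
    have inS': "x + s *\<^sub>R v + t *\<^sub>R u \<in> S" if "0 \<le> s" "s \<le> h" "0 \<le> t" "t \<le> h" for s t
      using inS[OF that(3,4) that(1,2)] by (simp add: add_ac)
    have d': "(f has_derivative frechet_derivative f (at y)) (at y)" if "y \<in> S" for y
      by (rule smooth_on_has_derivative[OF S(1) f that])
    have d'': "((\<lambda>y. frechet_derivative f (at y) u) has_derivative (\<lambda>v. A u v y)) (at y)" if "y \<in> S" for y u
      unfolding A_def
      by (rule smooth_on_has_derivative[OF S(1) smooth_on_frechet_derivative[OF S(1) f] that])
    obtain s t where st: "0 < s" "s < h" "0 < t" "t < h"
      "f (x + h *\<^sub>R u + h *\<^sub>R v) - f (x + h *\<^sub>R u) - (f (x + h *\<^sub>R v) - f x) = h * (h * A u v (x + s *\<^sub>R u + t *\<^sub>R v))"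
      by (rule second_difference[OF h(1) inS d' d''[where u=u]]) auto
    obtain s' t' where st': "0 < s'" "s' < h" "0 < t'" "t' < h"
      "f (x + h *\<^sub>R v + h *\<^sub>R u) - f (x + h *\<^sub>R v) - (f (x + h *\<^sub>R u) - f x) = h * (h * A v u (x + s' *\<^sub>R v + t' *\<^sub>R u))"
      by (rule second_difference[OF h(1) inS' d' d''[where u=v]]) auto
    have comm: "x + h *\<^sub>R v + h *\<^sub>R u = x + h *\<^sub>R u + h *\<^sub>R v" by (simp add: add.assoc add.commute)
    have "h * (h * A u v (x + s *\<^sub>R u + t *\<^sub>R v)) = h * (h * A v u (x + s' *\<^sub>R v + t' *\<^sub>R u))"
      unfolding st(5)[symmetric] st'(5)[symmetric] comm by linarith
    then have "A u v (x + s *\<^sub>R u + t *\<^sub>R v) = A v u (x + t' *\<^sub>R u + s' *\<^sub>R v)" using h by (simp add: add_ac)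
    moreover have "dist (A u v (x + s *\<^sub>R u + t *\<^sub>R v)) (A u v x) < e / 2"
      using d1 near'[of s t] st by (simp add: m_def)
    moreover have "dist (A v u (x + t' *\<^sub>R u + s' *\<^sub>R v)) (A v u x) < e / 2"
      using d2 near'[of t' s'] st' by (simp add: m_def)
    ultimately show ?thesis unfolding dist_real_def by linarith
  qed
  from key[of "\<bar>A u v x - A v u x\<bar>"] have "A u v x = A v u x" by force
  then show ?thesis by (simp add: A_def)
qed

lemma frechet_derivative_inner_const:
  assumes "(f has_derivative f') (at x)"
  shows "frechet_derivative (\<lambda>y. f y \<bullet> b) (at x) = (\<lambda>v. f' v \<bullet> b)"
  using frechet_derivative_at[OF has_derivative_inner_left[OF assms]] by simp

lemma symmetric_second_derivative:
  fixes f :: "'a::real_normed_vector \<Rightarrow> 'b::real_inner"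
  assumes S: "open S" "x \<in> S" and f: "smooth_on S f"
  shows "frechet_derivative (\<lambda>y. frechet_derivative f (at y) u) (at x) v =
         frechet_derivative (\<lambda>y. frechet_derivative f (at y) v) (at x) u" (is "?l = ?r")
proof -
  have "frechet_derivative (\<lambda>y. frechet_derivative f (at y) u) (at x) v \<bullet> b =
        frechet_derivative (\<lambda>y. frechet_derivative (\<lambda>y. f y \<bullet> b) (at y) u) (at x) v" for u v b
  proof -
    have "((\<lambda>y. frechet_derivative f (at y) u \<bullet> b) has_derivative
        (\<lambda>v. frechet_derivative (\<lambda>y. frechet_derivative f (at y) u) (at x) v \<bullet> b)) (at x)"
      by (intro has_derivative_inner_left smooth_on_has_derivative[OF S(1) _ S(2)] smooth_on_frechet_derivative S f)
    then have "((\<lambda>y. frechet_derivative (\<lambda>y. f y \<bullet> b) (at y) u) has_derivative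
        (\<lambda>v. frechet_derivative (\<lambda>y. frechet_derivative f (at y) u) (at x) v \<bullet> b)) (at x)"
      by (rule has_derivative_transform_within_open[OF _ S])
        (simp add: frechet_derivative_inner_const[OF smooth_on_has_derivative[OF S(1) f]])
    from frechet_derivative_at[OF this] show ?thesis by (metis (no_types))
  qed
  then have "?l \<bullet> b = ?r \<bullet> b" for b
    using symmetric_second_derivative_real[OF S smooth_on_inner_const[OF f]] by simp
  then have "(?l - ?r) \<bullet> (?l - ?r) = 0" by (simp add: inner_diff_left)
  then show ?thesis by simp
qed

subsection \<open>Smooth families of bilinear maps\<close>

text \<open>Regularity is asked for fixed arguments, the form in which Christoffel symbols and
  metric coefficients come out of their definitions. In finite dimensions this controls all three
  entries moving at once, as \<open>sb_has_derivative\<close> shows.\<close>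

definition smooth_bilinear_on ::
  "'a::real_normed_vector set \<Rightarrow> ('a \<Rightarrow> 'b::real_normed_vector \<Rightarrow> 'b \<Rightarrow> 'c::real_normed_vector) \<Rightarrow> bool" where
  "smooth_bilinear_on S B \<longleftrightarrow> (\<forall>x\<in>S. bilinear (B x)) \<and> (\<forall>u v. smooth_on S (\<lambda>x. B x u v))"

text \<open>The partial derivative in the base point. For the Christoffel symbols these are the
  first order terms of the curvature.\<close>

definition bil_deriv :: "('a::real_normed_vector \<Rightarrow> 'b \<Rightarrow> 'b \<Rightarrow> 'c::real_normed_vector) \<Rightarrow> 'a \<Rightarrow> 'a \<Rightarrow> 'b \<Rightarrow> 'b \<Rightarrow> 'c" where
  "bil_deriv B x h u v = frechet_derivative (\<lambda>y. B y u v) (at x) h"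

lemma bilinear_euclidean_expand:
  fixes B :: "'a::euclidean_space \<Rightarrow> 'a \<Rightarrow> 'b::real_vector"
  assumes "bilinear B"
  shows "B u v = (\<Sum>i\<in>Basis. \<Sum>j\<in>Basis. ((u \<bullet> i) * (v \<bullet> j)) *\<^sub>R B i j)"
proof -
  have "B u v = (\<Sum>i\<in>Basis. (u \<bullet> i) *\<^sub>R B i v)"
    by (rule linear_euclidean_expand[of "\<lambda>u. B u v"]) (use assms in \<open>simp add: bilinear_def\<close>)
  also have "\<dots> = (\<Sum>i\<in>Basis. (u \<bullet> i) *\<^sub>R (\<Sum>j\<in>Basis. (v \<bullet> j) *\<^sub>R B i j))"
    by (intro sum.cong refl arg_cong2[of _ _ _ _ scaleR] linear_euclidean_expand[of "B _"])
      (use assms in \<open>simp add: bilinear_def\<close>)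
  finally show ?thesis by (simp add: scaleR_sum_right)
qed

context
  fixes S :: "'a::euclidean_space set" and B :: "'a \<Rightarrow> 'b::euclidean_space \<Rightarrow> 'b \<Rightarrow> 'c::real_normed_vector"
  assumes S: "open S" and B: "smooth_bilinear_on S B"
begin

lemma sb_bilinear: "x \<in> S \<Longrightarrow> bilinear (B x)"
  using B by (simp add: smooth_bilinear_on_def)

lemma sb_has_derivative_point: "x \<in> S \<Longrightarrow> ((\<lambda>y. B y u v) has_derivative (\<lambda>h. bil_deriv B x h u v)) (at x)"
  unfolding bil_deriv_def using B smooth_on_has_derivative[OF S, of "\<lambda>y. B y u v" x]
  by (simp add: smooth_bilinear_on_def)

lemma sb_deriv_linear: "x \<in> S \<Longrightarrow> linear (\<lambda>h. bil_deriv B x h u v)"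
  using sb_has_derivative_point has_derivative_linear by blast

lemma sb_deriv_bilinear: 
  assumes x: "x \<in> S" shows "bilinear (bil_deriv B x h)"
proof -
  have add: "bil_deriv B x h u v = D h" if "(F has_derivative D) (at x)" "\<And>y. y \<in> S \<Longrightarrow> F y = B y u v" for F D u v
  proof -
    have "((\<lambda>y. B y u v) has_derivative D) (at x)"
      using has_derivative_transform_within_open[OF that(1) S x] that(2) by auto
    from frechet_derivative_at[OF this] show ?thesis unfolding bil_deriv_def by metis
  qed
  show ?thesis unfolding bilinear_def
  proof (intro conjI allI linearI)
    fix u v v' :: 'b and c :: real
    show "bil_deriv B x h u (v + v') = bil_deriv B x h u v + bil_deriv B x h u v'"
      by (rule add[OF has_derivative_add[OF sb_has_derivative_point[OF x] sb_has_derivative_point[OF x]]])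
        (simp add: bilinear_radd sb_bilinear)
    show "bil_deriv B x h (v + v') u = bil_deriv B x h v u + bil_deriv B x h v' u"
      by (rule add[OF has_derivative_add[OF sb_has_derivative_point[OF x] sb_has_derivative_point[OF x]]])
        (simp add: bilinear_ladd sb_bilinear)
    show "bil_deriv B x h u (c *\<^sub>R v) = c *\<^sub>R bil_deriv B x h u v"
      by (rule add[OF has_derivative_scaleR_right[OF sb_has_derivative_point[OF x]]])
        (simp add: bilinear_rmul sb_bilinear)
    show "bil_deriv B x h (c *\<^sub>R v) u = c *\<^sub>R bil_deriv B x h v u"
      by (rule add[OF has_derivative_scaleR_right[OF sb_has_derivative_point[OF x]]])
        (simp add: bilinear_lmul sb_bilinear)
  qed
qed

lemma sb_deriv_smooth_bilinear: "smooth_bilinear_on S (\<lambda>x. bil_deriv B x h)"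
  unfolding smooth_bilinear_on_def
proof (intro conjI ballI allI)
  fix u v
  show "smooth_on S (\<lambda>x. bil_deriv B x h u v)"
    unfolding bil_deriv_def
    by (rule smooth_on_frechet_derivative[OF S]) (use B in \<open>simp add: smooth_bilinear_on_def\<close>)
qed (rule sb_deriv_bilinear)

text \<open>Near a point \<open>B\<close> is a finite sum of smooth functions of the base point
  times products of coordinates of the arguments, so the rule with three moving entries reduces to
  ordinary product rules.\<close>

lemma sb_has_derivative:
  assumes x: "(x has_derivative x') (at s within I)" "x s \<in> S"
    and u: "(u has_derivative u') (at s within I)" and v: "(v has_derivative v') (at s within I)"
  shows "((\<lambda>s. B (x s) (u s) (v s)) has_derivative
    (\<lambda>d. bil_deriv B (x s) (x' d) (u s) (v s) + B (x s) (u' d) (v s) + B (x s) (u s) (v' d))) (at s within I)"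
proof -
  have "((\<lambda>(x, u, v). \<Sum>i\<in>Basis. \<Sum>j\<in>Basis. ((u \<bullet> i) * (v \<bullet> j)) *\<^sub>R B x i j) has_derivative
     (\<lambda>(dx, du, dv). \<Sum>i\<in>Basis. \<Sum>j\<in>Basis. ((u s \<bullet> i) * (v s \<bullet> j)) *\<^sub>R bil_deriv B (x s) dx i j +
        ((u s \<bullet> i) * (dv \<bullet> j) + (du \<bullet> i) * (v s \<bullet> j)) *\<^sub>R B (x s) i j)) (at (x s, u s, v s))"
    unfolding case_prod_beta
    by (rule derivative_eq_intros has_derivative_compose[OF has_derivative_fst[OF has_derivative_ident] sb_has_derivative_point] refl | simp add: x(2))+
  then have "((\<lambda>(x, u, v). B x u v) has_derivative
     (\<lambda>(dx, du, dv). \<Sum>i\<in>Basis. \<Sum>j\<in>Basis. ((u s \<bullet> i) * (v s \<bullet> j)) *\<^sub>R bil_deriv B (x s) dx i j +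
        ((u s \<bullet> i) * (dv \<bullet> j) + (du \<bullet> i) * (v s \<bullet> j)) *\<^sub>R B (x s) i j)) (at (x s, u s, v s))"
    by (rule has_derivative_transform_within_open[where s="S \<times> UNIV"])
      (use S x(2) in \<open>auto simp: open_Times bilinear_euclidean_expand[OF sb_bilinear, symmetric]\<close>)
  from has_derivative_compose[OF has_derivative_Pair[OF x(1) has_derivative_Pair[OF u v]] this]
  have "((\<lambda>s. B (x s) (u s) (v s)) has_derivative
     (\<lambda>d. \<Sum>i\<in>Basis. \<Sum>j\<in>Basis. ((u s \<bullet> i) * (v s \<bullet> j)) *\<^sub>R bil_deriv B (x s) (x' d) i j +
        ((u s \<bullet> i) * (v' d \<bullet> j) + (u' d \<bullet> i) * (v s \<bullet> j)) *\<^sub>R B (x s) i j)) (at s within I)" by simp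
  then show ?thesis
  proof (rule has_derivative_eq_rhs)
    show "(\<lambda>d. \<Sum>i\<in>Basis. \<Sum>j\<in>Basis. ((u s \<bullet> i) * (v s \<bullet> j)) *\<^sub>R bil_deriv B (x s) (x' d) i j +
        ((u s \<bullet> i) * (v' d \<bullet> j) + (u' d \<bullet> i) * (v s \<bullet> j)) *\<^sub>R B (x s) i j) =
      (\<lambda>d. bil_deriv B (x s) (x' d) (u s) (v s) + B (x s) (u' d) (v s) + B (x s) (u s) (v' d))"
      unfolding bilinear_euclidean_expand[OF sb_deriv_bilinear[OF x(2)], of _ "u s" "v s"]
        bilinear_euclidean_expand[OF sb_bilinear[OF x(2)], of _ "v s"]
        bilinear_euclidean_expand[OF sb_bilinear[OF x(2)], of "u s" "v' _"]
      by (simp add: sum.distrib scaleR_add_left add_ac)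
  qed
qed

lemma sb_continuous_on:
  assumes "continuous_on I x" "x ` I \<subseteq> S" "continuous_on I u" "continuous_on I v"
  shows "continuous_on I (\<lambda>s. B (x s) (u s) (v s))"
proof -
  have "continuous_on I (\<lambda>s. \<Sum>i\<in>Basis. \<Sum>j\<in>Basis. ((u s \<bullet> i) * (v s \<bullet> j)) *\<^sub>R B (x s) i j)"
  proof (intro continuous_intros assms)
    fix i j
    show "continuous_on I (\<lambda>s. B (x s) i j)"
      using B smooth_on_imp_continuous_on continuous_on_compose2[OF _ assms(1,2), of "\<lambda>x. B x i j"]
      unfolding smooth_bilinear_on_def by blast
  qed
  moreover have "B (x s) (u s) (v s) = (\<Sum>i\<in>Basis. \<Sum>j\<in>Basis. ((u s \<bullet> i) * (v s \<bullet> j)) *\<^sub>R B (x s) i j)"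
    if "s \<in> I" for s
    by (rule bilinear_euclidean_expand[OF sb_bilinear]) (use that assms in auto)
  ultimately show ?thesis by (simp cong: continuous_on_cong)
qed

end

lemma sb_deriv_continuous_on:
  fixes S :: "'a::euclidean_space set" and B :: "'a \<Rightarrow> 'b::euclidean_space \<Rightarrow> 'b \<Rightarrow> 'c::real_normed_vector"
  assumes S: "open S" "smooth_bilinear_on S B"
    and x: "continuous_on I x" "x ` I \<subseteq> S" and h: "continuous_on I h"
    and uv: "continuous_on I u" "continuous_on I v"
  shows "continuous_on I (\<lambda>s. bil_deriv B (x s) (h s) (u s) (v s))"
proof -
  have "continuous_on I (\<lambda>s. \<Sum>i\<in>Basis. (h s \<bullet> i) *\<^sub>R bil_deriv B (x s) i (u s) (v s))"
    by (intro continuous_intros h sb_continuous_on[OF S(1) sb_deriv_smooth_bilinear[OF S]] x uv)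
  moreover have "bil_deriv B (x s) (h s) (u s) (v s) = (\<Sum>i\<in>Basis. (h s \<bullet> i) *\<^sub>R bil_deriv B (x s) i (u s) (v s))"
    if "s \<in> I" for s
    using linear_euclidean_expand[OF sb_deriv_linear[OF S]] x that by blast
  ultimately show ?thesis by (simp cong: continuous_on_cong)
qed

section \<open>Charts and the connection\<close>

text \<open>For a transition map \<open>w\<close>, components of vectors change by
  \<open>frechet_derivative w\<close>. Differentiating this along a curve brings in the second
  derivative of \<open>w\<close>, the origin of the non-tensorial part of the Christoffel symbols.
  The same rule serves when a covariant derivative is differentiated again.\<close>

lemma has_derivative_frechet_derivative_apply:
  fixes w :: "'a::euclidean_space \<Rightarrow> 'b::real_normed_vector"
  assumes S: "open S" "smooth_on S w"
    and x: "(x has_derivative x') (at s within I)" "x s \<in> S"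
    and V: "(V has_derivative V') (at s within I)"
  shows "((\<lambda>s. frechet_derivative w (at (x s)) (V s)) has_derivative
    (\<lambda>d. frechet_derivative (\<lambda>y. frechet_derivative w (at y) (V s)) (at (x s)) (x' d) +
         frechet_derivative w (at (x s)) (V' d))) (at s within I)"
proof -
  define W where "W y v = frechet_derivative w (at y) v" for y v
  define W2 where "W2 v h = frechet_derivative (\<lambda>y. W y v) (at (x s)) h" for v h
  have lin: "linear (W y)" if "y \<in> S" for y
    using has_derivative_linear[OF smooth_on_has_derivative[OF S that]] unfolding W_def .
  have d2: "((\<lambda>y. W y v) has_derivative W2 v) (at (x s))" for v
    unfolding W2_def W_def
    by (rule smooth_on_has_derivative[OF S(1) smooth_on_frechet_derivative[OF S] x(2)])
  have W2_expand: "W2 v h = (\<Sum>i\<in>Basis. (v \<bullet> i) *\<^sub>R W2 i h)" for v h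
  proof -
    have "((\<lambda>y. \<Sum>i\<in>Basis. (v \<bullet> i) *\<^sub>R W y i) has_derivative (\<lambda>h. \<Sum>i\<in>Basis. (v \<bullet> i) *\<^sub>R W2 i h)) (at (x s))"
      by (intro has_derivative_sum has_derivative_scaleR_right d2)
    then have "((\<lambda>y. W y v) has_derivative (\<lambda>h. \<Sum>i\<in>Basis. (v \<bullet> i) *\<^sub>R W2 i h)) (at (x s))"
      by (rule has_derivative_transform_within_open[OF _ S(1) x(2)])
        (rule linear_euclidean_expand[OF lin, symmetric])
    from has_derivative_unique[OF this d2] show ?thesis by metis
  qed
  have "((\<lambda>(y, v). \<Sum>i\<in>Basis. (v \<bullet> i) *\<^sub>R W y i) has_derivative
      (\<lambda>(dy, dv). \<Sum>i\<in>Basis. (V s \<bullet> i) *\<^sub>R W2 i dy + (dv \<bullet> i) *\<^sub>R W (x s) i)) (at (x s, V s))"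
    unfolding case_prod_beta
  proof (rule has_derivative_sum)
    fix i :: 'a
    have "((\<lambda>p. W (fst p) i) has_derivative (\<lambda>h. W2 i (fst h))) (at (x s, V s))"
      by (rule has_derivative_compose[where f=fst]) (use d2 in \<open>auto intro!: derivative_eq_intros\<close>)
    moreover have "((\<lambda>p. snd p \<bullet> i) has_derivative (\<lambda>h. snd h \<bullet> i)) (at (x s, V s))"
      by (auto intro!: derivative_eq_intros)
    ultimately show "((\<lambda>p. (snd p \<bullet> i) *\<^sub>R W (fst p) i) has_derivative
        (\<lambda>h. (V s \<bullet> i) *\<^sub>R W2 i (fst h) + (snd h \<bullet> i) *\<^sub>R W (x s) i)) (at (x s, V s))"
      using has_derivative_scaleR by fastforce
  qed
  then have "((\<lambda>(y, v). W y v) has_derivative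
      (\<lambda>(dy, dv). \<Sum>i\<in>Basis. (V s \<bullet> i) *\<^sub>R W2 i dy + (dv \<bullet> i) *\<^sub>R W (x s) i)) (at (x s, V s))"
  proof (rule has_derivative_transform_within_open[where s="S \<times> UNIV"])
    fix p assume "p \<in> S \<times> (UNIV :: 'a set)"
    then show "(case p of (y, v) \<Rightarrow> \<Sum>i\<in>Basis. (v \<bullet> i) *\<^sub>R W y i) = (case p of (y, v) \<Rightarrow> W y v)"
      using linear_euclidean_expand[OF lin] by (auto split: prod.splits)
  qed (use S x in \<open>auto intro: open_Times\<close>)
  from has_derivative_compose[OF has_derivative_Pair[OF x(1) V] this]
  have "((\<lambda>s. W (x s) (V s)) has_derivative
      (\<lambda>d. \<Sum>i\<in>Basis. (V s \<bullet> i) *\<^sub>R W2 i (x' d) + (V' d \<bullet> i) *\<^sub>R W (x s) i)) (at s within I)" by simp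
  moreover have "(\<lambda>d. \<Sum>i\<in>Basis. (V s \<bullet> i) *\<^sub>R W2 i (x' d) + (V' d \<bullet> i) *\<^sub>R W (x s) i) =
      (\<lambda>d. W2 (V s) (x' d) + W (x s) (V' d))"
    by (simp add: sum.distrib W2_expand[symmetric] linear_euclidean_expand[OF lin[OF x(2)], symmetric])
  ultimately show ?thesis unfolding W_def W2_def by simp
qed

locale riemannian_manifold =
  fixes atl :: "('m::{t2_space, second_countable_topology}, 'e::euclidean_space) chart set"
    and g :: "'m \<Rightarrow> 'e \<Rightarrow> 'e \<Rightarrow> real"
    and nab :: "'m \<Rightarrow> 'e \<Rightarrow> ('m \<Rightarrow> 'e) \<Rightarrow> 'e"
  assumes atlas: "smooth_atlas atl" and metric: "riemannian_metric atl g"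
    and lc: "levi_civita atl g nab"
begin

abbreviation "D \<equiv> chart_deriv atl"
abbreviation "cf \<equiv> coord_field atl"
abbreviation "cimg c \<equiv> cmap c ` cdom c"

definition trans_deriv :: "('m, 'e) chart \<Rightarrow> ('m, 'e) chart \<Rightarrow> 'e \<Rightarrow> 'e \<Rightarrow> 'e" where
  "trans_deriv c d x = frechet_derivative (cmap d \<circ> cinv c) (at x)"

section \<open>Transition maps and differentials of charts\<close>

lemma chart_facts:
  assumes "c \<in> atl"
  shows open_cdom: "open (cdom c)" and open_cimg: "open (cimg c)"
    and homeo: "homeomorphism (cdom c) (cimg c) (cmap c) (cinv c)"
proof -
  have "\<forall>c\<in>atl. open (cdom c) \<and> open (cimg c) \<and> homeomorphism (cdom c) (cimg c) (cmap c) (cinv c)"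
    using atlas unfolding smooth_atlas_def by (elim conjE)
  from bspec[OF this assms] show "open (cdom c)" "open (cimg c)"
    "homeomorphism (cdom c) (cimg c) (cmap c) (cinv c)" by - (elim conjE; assumption)+
qed

lemma inj_chart: "c \<in> atl \<Longrightarrow> inj_on (cmap c) (cdom c)"
  by (rule inj_on_inverseI[of _ "cinv c"]) (rule homeomorphism_apply1[OF homeo])

lemma cinv_cmap: "c \<in> atl \<Longrightarrow> p \<in> cdom c \<Longrightarrow> cinv c (cmap c p) = p"
  by (rule homeomorphism_apply1[OF homeo])

lemma cmap_cinv: "x \<in> cimg c \<Longrightarrow> cmap c (cinv c x) = x"
  by (rule f_inv_into_f)

lemma cinv_in: "x \<in> cimg c \<Longrightarrow> cinv c x \<in> cdom c"
  by (rule inv_into_into)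

lemma continuous_cmap: "c \<in> atl \<Longrightarrow> continuous_on (cdom c) (cmap c)"
  and continuous_cinv: "c \<in> atl \<Longrightarrow> continuous_on (cimg c) (cinv c)"
  using homeomorphism_cont1[OF homeo] homeomorphism_cont2[OF homeo] by auto

lemma open_image:
  assumes "c \<in> atl" "open U" "U \<subseteq> cdom c"
  shows "open (cmap c ` U)"
proof -
  have "cmap c ` U = cimg c \<inter> cinv c -` U"
  proof (intro equalityI subsetI)
    fix x assume "x \<in> cimg c \<inter> cinv c -` U"
    then show "x \<in> cmap c ` U" using cmap_cinv[of x c] by (intro image_eqI[of _ _ "cinv c x"]) auto
  qed (use assms cinv_cmap[OF assms(1)] in auto)
  then show ?thesis
    using continuous_open_preimage[OF continuous_cinv open_cimg assms(2)] assms(1) by simp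
qed

lemma pref: "pref_chart atl p \<in> atl" "p \<in> cdom (pref_chart atl p)"
proof -
  have "\<exists>c. c \<in> atl \<and> p \<in> cdom c" using atlas unfolding smooth_atlas_def by blast
  from someI_ex[OF this] show "pref_chart atl p \<in> atl" "p \<in> cdom (pref_chart atl p)"
    unfolding pref_chart_def by auto
qed

lemma ex_chart: obtains c where "c \<in> atl" "p \<in> cdom c"
  using pref by blast

lemma trans_smooth: "c \<in> atl \<Longrightarrow> d \<in> atl \<Longrightarrow> smooth_on (cmap c ` (cdom c \<inter> cdom d)) (cmap d \<circ> cinv c)"
  using atlas unfolding smooth_atlas_def by blast

lemma open_overlap: "c \<in> atl \<Longrightarrow> d \<in> atl \<Longrightarrow> open (cmap c ` (cdom c \<inter> cdom d))"
  by (rule open_image) (auto simp: open_cdom intro: open_Int)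

lemma trans_has_derivative:
  assumes "c \<in> atl" "d \<in> atl" "p \<in> cdom c" "p \<in> cdom d"
  shows "(cmap d \<circ> cinv c has_derivative trans_deriv c d (cmap c p)) (at (cmap c p))"
  unfolding trans_deriv_def
  by (rule smooth_on_has_derivative[OF open_overlap trans_smooth]) (use assms in auto)

lemma trans_linear:
  assumes "c \<in> atl" "d \<in> atl" "p \<in> cdom c" "p \<in> cdom d"
  shows "linear (trans_deriv c d (cmap c p))"
  using has_derivative_linear[OF trans_has_derivative[OF assms]] .

lemma trans_id:
  assumes "c \<in> atl" "p \<in> cdom c"
  shows "trans_deriv c c (cmap c p) v = v"
proof -
  have "((\<lambda>x. x) has_derivative trans_deriv c c (cmap c p)) (at (cmap c p))"
    by (rule has_derivative_transform_within_open[OF trans_has_derivative[OF assms(1,1,2,2)] open_cimg[OF assms(1)]])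
      (use assms cinv_cmap[OF assms(1)] in auto)
  from has_derivative_unique[OF this has_derivative_ident] show ?thesis by metis
qed

lemma trans_cocycle:
  assumes "c \<in> atl" "d \<in> atl" "e \<in> atl" "p \<in> cdom c" "p \<in> cdom d" "p \<in> cdom e"
  shows "trans_deriv d e (cmap d p) (trans_deriv c d (cmap c p) v) = trans_deriv c e (cmap c p) v"
proof -
  let ?U = "cmap c ` (cdom c \<inter> cdom d)"
  have "(cmap d \<circ> cinv c) (cmap c p) = cmap d p" using cinv_cmap assms by simp
  then have "((\<lambda>x. (cmap e \<circ> cinv d) ((cmap d \<circ> cinv c) x)) has_derivative
      (\<lambda>v. trans_deriv d e (cmap d p) (trans_deriv c d (cmap c p) v))) (at (cmap c p))"
    using has_derivative_compose[OF trans_has_derivative[OF assms(1,2,4,5)], of "cmap e \<circ> cinv d" "trans_deriv d e (cmap d p)"]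
      trans_has_derivative[OF assms(2,3,5,6)] by simp
  then have "(cmap e \<circ> cinv c has_derivative
      (\<lambda>v. trans_deriv d e (cmap d p) (trans_deriv c d (cmap c p) v))) (at (cmap c p))"
    by (rule has_derivative_transform_within_open[OF _ open_overlap[OF assms(1,2)]])
      (use assms cinv_cmap in auto)
  from has_derivative_unique[OF this trans_has_derivative[OF assms(1,3,4,6)]] show ?thesis by metis
qed

text \<open>Tangent vectors at \<open>p\<close> are components in the preferred chart, so the
  differential of \<open>c\<close> at \<open>p\<close> is itself the Jacobian of a change of charts.
  Linearity, bijectivity and the change rule all come from the cocycle identity.\<close>

lemma chart_deriv_trans: "D c p = trans_deriv (pref_chart atl p) c (cmap (pref_chart atl p) p)"
  unfolding chart_deriv_def trans_deriv_def by auto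

lemma chart_deriv_change:
  assumes "c \<in> atl" "d \<in> atl" "p \<in> cdom c" "p \<in> cdom d"
  shows "D d p v = trans_deriv c d (cmap c p) (D c p v)"
  unfolding chart_deriv_trans by (rule trans_cocycle[symmetric]) (use assms pref in auto)

lemma chart_deriv_linear: "c \<in> atl \<Longrightarrow> p \<in> cdom c \<Longrightarrow> linear (D c p)"
  unfolding chart_deriv_trans by (rule trans_linear) (use pref in auto)

lemma chart_deriv_pref: "D (pref_chart atl p) p v = v"
  unfolding chart_deriv_trans by (rule trans_id[OF pref])

lemma chart_deriv_bij: 
  assumes "c \<in> atl" "p \<in> cdom c" shows "bij (D c p)"
proof (rule o_bij)
  let ?k = "pref_chart atl p"
  let ?h = "trans_deriv c ?k (cmap c p)"
  show "?h \<circ> D c p = id"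
    using chart_deriv_change[OF assms(1) pref(1) assms(2) pref(2)] chart_deriv_pref by (auto simp: fun_eq_iff)
  show "D c p \<circ> ?h = id"
    unfolding chart_deriv_trans using trans_cocycle[OF assms(1) pref(1) assms(1) assms(2) pref(2) assms(2)] trans_id[OF assms]
    by (auto simp: fun_eq_iff)
qed

lemma D_cf [simp]: "c \<in> atl \<Longrightarrow> p \<in> cdom c \<Longrightarrow> D c p (cf c u p) = u"
  unfolding coord_field_def by (rule surj_f_inv_f) (metis chart_deriv_bij bij_is_surj)

lemma D_inject: "c \<in> atl \<Longrightarrow> p \<in> cdom c \<Longrightarrow> D c p u = D c p v \<longleftrightarrow> u = v"
  using chart_deriv_bij bij_is_inj inj_eq by metis

lemma cf_D [simp]: "c \<in> atl \<Longrightarrow> p \<in> cdom c \<Longrightarrow> cf c (D c p v) p = v"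
  using D_inject D_cf by metis

lemma cf_linear:
  assumes c: "c \<in> atl" "p \<in> cdom c" shows "linear (\<lambda>u. cf c u p)"
proof (rule linearI)
  show "cf c (u + v) p = cf c u p + cf c v p" for u v
    using D_inject[OF c] D_cf[OF c] linear_add[OF chart_deriv_linear[OF c]] by metis
  show "cf c (a *\<^sub>R u) p = a *\<^sub>R cf c u p" for a u
    using D_inject[OF c] D_cf[OF c] linear_cmul[OF chart_deriv_linear[OF c]] by metis
qed

lemma smooth_fun_chartI:
  assumes c: "c \<in> atl" and U: "U \<subseteq> cdom c" and f: "smooth_on (cmap c ` U) (f \<circ> cinv c)"
  shows "smooth_fun atl U f"
  unfolding smooth_fun_def
proof
  fix d assume d: "d \<in> atl"
  have "smooth_on (cmap d ` (U \<inter> cdom d)) (\<lambda>x. (f \<circ> cinv c) ((cmap c \<circ> cinv d) x))"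
    by (rule smooth_on_compose[OF f smooth_on_subset[OF trans_smooth[OF d c]]]) (use U cinv_cmap[OF d] in auto)
  then show "smooth_on (cmap d ` (U \<inter> cdom d)) (f \<circ> cinv d)"
    by (rule iffD1[OF smooth_on_cong, rotated]) (use U cinv_cmap[OF d] cinv_cmap[OF c] in auto)
qed

lemma smooth_vf_subset:
  assumes "smooth_vf atl U f" "V \<subseteq> U"
  shows "smooth_vf atl V f"
  unfolding smooth_vf_def
proof
  fix c assume "c \<in> atl"
  with assms(1) have "smooth_on (cmap c ` (U \<inter> cdom c)) (vf_comp atl c f)"
    unfolding smooth_vf_def by (rule bspec)
  then show "smooth_on (cmap c ` (V \<inter> cdom c)) (vf_comp atl c f)"
    by (rule smooth_on_subset) (rule image_mono, rule Int_mono[OF assms(2) order_refl])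
qed

text \<open>Components in another chart are the Jacobian of the transition map applied to the given
  ones. The Jacobian is expanded over \<open>Basis\<close> because its smoothness is known direction
  by direction.\<close>

lemma smooth_vf_chartI:
  assumes c: "c \<in> atl" and U: "U \<subseteq> cdom c" "open U" and f: "smooth_on (cmap c ` U) (vf_comp atl c Y)"
  shows "smooth_vf atl U Y"
  unfolding smooth_vf_def
proof
  fix d assume d: "d \<in> atl"
  let ?S = "cmap d ` (U \<inter> cdom d)"
  have sub: "(cmap c \<circ> cinv d) ` ?S \<subseteq> cmap c ` U" "(cmap c \<circ> cinv d) ` ?S \<subseteq> cmap c ` (cdom c \<inter> cdom d)"
    using U cinv_cmap[OF d] by auto
  have tr: "smooth_on ?S (cmap c \<circ> cinv d)"
    by (rule smooth_on_subset[OF trans_smooth[OF d c]]) (use U in auto)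
  have "smooth_on ?S (\<lambda>x. \<Sum>i\<in>Basis. (vf_comp atl c Y ((cmap c \<circ> cinv d) x) \<bullet> i) *\<^sub>R
      trans_deriv c d ((cmap c \<circ> cinv d) x) i)"
    unfolding trans_deriv_def
    by (intro smooth_on_sum smooth_on_scaleR smooth_on_inner_const smooth_on_compose[OF f tr sub(1)]
        smooth_on_compose[OF smooth_on_frechet_derivative[OF open_overlap[OF c d] trans_smooth[OF c d]] tr sub(2)])
  then show "smooth_on ?S (vf_comp atl d Y)"
  proof (rule iffD1[OF smooth_on_cong, rotated])
    fix x assume "x \<in> ?S"
    then obtain p where p: "p \<in> U" "p \<in> cdom d" "x = cmap d p" by auto
    then have pc: "p \<in> cdom c" using U by auto
    have "vf_comp atl d Y x = trans_deriv c d (cmap c p) (D c p (Y p))"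
      using chart_deriv_change[OF c d pc p(2)] p cinv_cmap[OF d p(2)] by (simp add: vf_comp_def)
    also have "\<dots> = (\<Sum>i\<in>Basis. (D c p (Y p) \<bullet> i) *\<^sub>R trans_deriv c d (cmap c p) i)"
      by (rule linear_euclidean_expand[OF trans_linear[OF c d pc p(2)]])
    finally show "(\<Sum>i\<in>Basis. (vf_comp atl c Y ((cmap c \<circ> cinv d) x) \<bullet> i) *\<^sub>R
      trans_deriv c d ((cmap c \<circ> cinv d) x) i) = vf_comp atl d Y x"
      using p pc cinv_cmap[OF d] cinv_cmap[OF c] by (simp add: vf_comp_def)
  qed
qed

lemma vf_comp_cmap: "c \<in> atl \<Longrightarrow> p \<in> cdom c \<Longrightarrow> vf_comp atl c Y (cmap c p) = D c p (Y p)"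
  by (simp add: vf_comp_def cinv_cmap)

lemma vf_comp_cf: "c \<in> atl \<Longrightarrow> x \<in> cimg c \<Longrightarrow> vf_comp atl c (cf c u) x = u"
  by (simp add: vf_comp_def cinv_in)

lemma smooth_cf: "c \<in> atl \<Longrightarrow> smooth_vf atl (cdom c) (cf c u)"
  by (rule smooth_vf_chartI[of c])
    (auto simp: open_cdom vf_comp_cf intro: iffD1[OF smooth_on_cong smooth_on_const[of _ u]])

lemma smooth_vf_comp:
  assumes "c \<in> atl" "smooth_vf atl U Y" "U \<subseteq> cdom c"
  shows "smooth_on (cmap c ` U) (vf_comp atl c Y)"
  using assms unfolding smooth_vf_def by (metis inf.absorb_iff1)

lemma smooth_fun_comp:
  assumes "c \<in> atl" "smooth_fun atl U f" "U \<subseteq> cdom c"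
  shows "smooth_on (cmap c ` U) (f \<circ> cinv c)"
  using assms unfolding smooth_fun_def by (metis inf.absorb_iff1)

lemma dir_deriv_chart:
  assumes c: "c \<in> atl" and U: "open U" "U \<subseteq> cdom c" "p \<in> U" and f: "smooth_fun atl U f"
  shows "dir_deriv atl f p v = frechet_derivative (f \<circ> cinv c) (at (cmap c p)) (D c p v)"
proof -
  let ?k = "pref_chart atl p"
  have pc: "p \<in> cdom c" using U by auto
  have "(f \<circ> cinv c has_derivative frechet_derivative (f \<circ> cinv c) (at (cmap c p))) (at ((cmap c \<circ> cinv ?k) (cmap ?k p)))"
    using smooth_on_has_derivative[OF open_image[OF c U(1,2)] smooth_fun_comp[OF c f U(2)], of "cmap c p"]
      cinv_cmap[OF pref] U by simp
  from has_derivative_compose[OF trans_has_derivative[OF pref(1) c pref(2) pc] this]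
  have "((\<lambda>x. (f \<circ> cinv c) ((cmap c \<circ> cinv ?k) x)) has_derivative
      (\<lambda>v. frechet_derivative (f \<circ> cinv c) (at (cmap c p)) (trans_deriv ?k c (cmap ?k p) v))) (at (cmap ?k p))" .
  then have "(f \<circ> cinv ?k has_derivative
      (\<lambda>v. frechet_derivative (f \<circ> cinv c) (at (cmap c p)) (trans_deriv ?k c (cmap ?k p) v))) (at (cmap ?k p))"
    by (rule has_derivative_transform_within_open[OF _ open_overlap[OF pref(1) c]])
      (use pc pref cinv_cmap[OF pref(1)] cinv_cmap[OF c] in auto)
  from frechet_derivative_at[OF this] show ?thesis
    unfolding dir_deriv_def chart_deriv_trans by metis
qed

section \<open>The connection in a chart and its Christoffel symbols\<close>

lemma conn: "affine_connection atl nab"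
  using lc unfolding levi_civita_def by blast

lemma nab_properties:
  assumes "open U" "smooth_vf atl U W"
  shows "\<forall>p\<in>U. linear (\<lambda>v. nab p v W)"
    and "\<forall>W'. (\<forall>q\<in>U. W' q = W q) \<longrightarrow> (\<forall>p\<in>U. \<forall>v. nab p v W' = nab p v W)"
    and "\<forall>W'. smooth_vf atl U W' \<longrightarrow>
      (\<forall>p\<in>U. \<forall>v. nab p v (\<lambda>q. W q + W' q) = nab p v W + nab p v W')"
    and "\<forall>f. smooth_fun atl U f \<longrightarrow>
      (\<forall>p\<in>U. \<forall>v. nab p v (\<lambda>q. f q *\<^sub>R W q) = dir_deriv atl f p v *\<^sub>R W p + f p *\<^sub>R nab p v W)"
    and "\<forall>Y. smooth_vf atl U Y \<longrightarrow> smooth_vf atl U (\<lambda>p. nab p (Y p) W)"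
  using conn[unfolded affine_connection_def, THEN spec, THEN spec, THEN mp, OF conjI[OF assms]]
  by - (elim conjE; assumption)+

lemma nab_linear:
  assumes "open U" "smooth_vf atl U W" "p \<in> U"
  shows "linear (\<lambda>v. nab p v W)"
  by (rule nab_properties(1)[OF assms(1,2), THEN bspec, OF assms(3)])

lemma nab_cong:
  assumes "open U" "smooth_vf atl U W" "p \<in> U" "\<And>q. q \<in> U \<Longrightarrow> W' q = W q"
  shows "nab p v W' = nab p v W"
  by (rule nab_properties(2)[OF assms(1,2), THEN spec, THEN mp, OF ballI[OF assms(4)], THEN bspec, OF _ assms(3), THEN spec])

lemma nab_add:
  assumes "open U" "smooth_vf atl U W" "smooth_vf atl U W'" "p \<in> U"
  shows "nab p v (\<lambda>q. W q + W' q) = nab p v W + nab p v W'"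
  by (rule nab_properties(3)[OF assms(1,2), THEN spec, THEN mp, OF assms(3), THEN bspec, OF assms(4), THEN spec])

lemma nab_scale:
  assumes "open U" "smooth_vf atl U W" "smooth_fun atl U f" "p \<in> U"
  shows "nab p v (\<lambda>q. f q *\<^sub>R W q) = dir_deriv atl f p v *\<^sub>R W p + f p *\<^sub>R nab p v W"
  by (rule nab_properties(4)[OF assms(1,2), THEN spec, THEN mp, OF assms(3), THEN bspec, OF assms(4), THEN spec])

lemma nab_smooth:
  assumes "open U" "smooth_vf atl U W" "smooth_vf atl U Y"
  shows "smooth_vf atl U (\<lambda>p. nab p (Y p) W)"
  by (rule nab_properties(5)[OF assms(1,2), THEN spec, THEN mp, OF assms(3)])

lemma smooth_vf_scale:
  assumes c: "c \<in> atl" "open U" "U \<subseteq> cdom c" and f: "smooth_fun atl U f" and W: "smooth_vf atl U W"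
  shows "smooth_vf atl U (\<lambda>q. f q *\<^sub>R W q)"
proof (rule smooth_vf_chartI[OF c(1,3,2)])
  have "smooth_on (cmap c ` U) (\<lambda>x. (f \<circ> cinv c) x *\<^sub>R vf_comp atl c W x)"
    by (intro smooth_on_scaleR smooth_fun_comp[OF c(1) f c(3)] smooth_vf_comp[OF c(1) W c(3)])
  then show "smooth_on (cmap c ` U) (vf_comp atl c (\<lambda>q. f q *\<^sub>R W q))"
    by (rule iffD1[OF smooth_on_cong, rotated])
      (use c cinv_cmap[OF c(1)] linear_cmul[OF chart_deriv_linear[OF c(1)]] in \<open>auto simp: vf_comp_def subset_iff\<close>)
qed

lemma smooth_vf_add:
  assumes c: "c \<in> atl" "open U" "U \<subseteq> cdom c" and V: "smooth_vf atl U V" and W: "smooth_vf atl U W"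
  shows "smooth_vf atl U (\<lambda>q. V q + W q)"
proof (rule smooth_vf_chartI[OF c(1,3,2)])
  have "smooth_on (cmap c ` U) (\<lambda>x. vf_comp atl c V x + vf_comp atl c W x)"
    by (intro smooth_on_add smooth_vf_comp[OF c(1) V c(3)] smooth_vf_comp[OF c(1) W c(3)])
  then show "smooth_on (cmap c ` U) (vf_comp atl c (\<lambda>q. V q + W q))"
    by (rule iffD1[OF smooth_on_cong, rotated])
      (use c cinv_cmap[OF c(1)] linear_add[OF chart_deriv_linear[OF c(1)]] in \<open>auto simp: vf_comp_def subset_iff\<close>)
qed

lemma smooth_vf_zero:
  assumes c: "c \<in> atl" "open U" "U \<subseteq> cdom c"
  shows "smooth_vf atl U (\<lambda>q. 0)"
proof (rule smooth_vf_chartI[OF c(1,3,2)])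
  show "smooth_on (cmap c ` U) (vf_comp atl c (\<lambda>q. 0))"
    by (rule iffD1[OF smooth_on_cong smooth_on_const[of _ 0]])
      (use c cinv_cmap[OF c(1)] linear_0[OF chart_deriv_linear[OF c(1)]] in \<open>auto simp: vf_comp_def subset_iff\<close>)
qed

lemma smooth_fun_const: "c \<in> atl \<Longrightarrow> U \<subseteq> cdom c \<Longrightarrow> smooth_fun atl U (\<lambda>_. a)"
  by (rule smooth_fun_chartI) (auto simp: comp_def smooth_on_const)

lemma nab_zero:
  assumes c: "c \<in> atl" "open U" "U \<subseteq> cdom c" "p \<in> U"
  shows "nab p v (\<lambda>q. 0) = 0"
  using nab_scale[OF c(2) smooth_vf_zero[OF c(1-3)] smooth_fun_const[OF c(1,3), of 0] c(4), of v]
    dir_deriv_chart[OF c(1-4) smooth_fun_const[OF c(1,3), of 0], of v]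
  by (simp add: comp_def)

text \<open>Smoothness of the partial sum is part of the claim because the induction step uses
  additivity of the connection, which is given for smooth fields.\<close>

lemma nab_expand:
  assumes c: "c \<in> atl" "open U" "U \<subseteq> cdom c" "p \<in> U" and f: "\<And>i. i \<in> J \<Longrightarrow> smooth_fun atl U (f i)"
    and J: "finite J"
  shows "smooth_vf atl U (\<lambda>q. \<Sum>i\<in>J. f i q *\<^sub>R cf c i q) \<and> 
    nab p v (\<lambda>q. \<Sum>i\<in>J. f i q *\<^sub>R cf c i q) =
      (\<Sum>i\<in>J. dir_deriv atl (f i) p v *\<^sub>R cf c i p + f i p *\<^sub>R nab p v (cf c i))"
  using J f
proof (induction J)
  case empty then show ?case using nab_zero[OF c] smooth_vf_zero[OF c(1-3)] by simp
next
  case (insert i J)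
  have s: "smooth_vf atl U (cf c i)" by (rule smooth_vf_subset[OF smooth_cf[OF c(1)] c(3)])
  have fi: "smooth_fun atl U (f i)" using insert by simp
  note fs = smooth_vf_scale[OF c(1-3) fi s]
  have IH: "smooth_vf atl U (\<lambda>q. \<Sum>i\<in>J. f i q *\<^sub>R cf c i q)" using insert by simp
  show ?case
    using insert smooth_vf_add[OF c(1-3) fs IH] nab_add[OF c(2) fs IH c(4)] nab_scale[OF c(2) s fi c(4)] by simp
qed

text \<open>The field is a combination of coordinate fields with smooth coefficients; the Leibniz
  rule yields the derivatives of the coefficients and one Christoffel term per basis vector. These
  terms merge into one as soon as the symbols are known to be linear in the second argument.\<close>

lemma nab_chart_aux:
  assumes c: "c \<in> atl" "open U" "U \<subseteq> cdom c" "p \<in> U" and W: "smooth_vf atl U W"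
  shows "D c p (nab p v W) = frechet_derivative (vf_comp atl c W) (at (cmap c p)) (D c p v)
     + (\<Sum>i\<in>Basis. (D c p (W p) \<bullet> i) *\<^sub>R christoffel atl nab c p (D c p v) i)"
proof -
  define f where "f i q = D c q (W q) \<bullet> i" for i q
  have pc: "p \<in> cdom c" using c by auto
  have f: "smooth_fun atl U (f i)" for i
  proof (rule smooth_fun_chartI[OF c(1,3)])
    have "f i \<circ> cinv c = (\<lambda>x. vf_comp atl c W x \<bullet> i)" by (auto simp: f_def vf_comp_def)
    then show "smooth_on (cmap c ` U) (f i \<circ> cinv c)"
      using smooth_on_inner_const[OF smooth_vf_comp[OF c(1) W c(3)]] by simp
  qed
  have Weq: "W q = (\<Sum>i\<in>Basis. f i q *\<^sub>R cf c i q)" if "q \<in> U" for q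
  proof -
    have q: "q \<in> cdom c" using that c by auto
    have "cf c (D c q (W q)) q = (\<Sum>i\<in>Basis. f i q *\<^sub>R cf c i q)"
      unfolding f_def by (rule linear_euclidean_expand[OF cf_linear[OF c(1) q]])
    then show ?thesis using c q by simp
  qed
  have "nab p v W = nab p v (\<lambda>q. \<Sum>i\<in>Basis. f i q *\<^sub>R cf c i q)"
    using nab_expand[where f=f and J=Basis, OF c f finite_Basis] Weq by (intro nab_cong[OF c(2) _ c(4)]) auto
  also have "\<dots> = (\<Sum>i\<in>Basis. dir_deriv atl (f i) p v *\<^sub>R cf c i p + f i p *\<^sub>R nab p v (cf c i))"
    using nab_expand[where f=f and J=Basis, OF c f finite_Basis] by blast
  finally have "D c p (nab p v W) = (\<Sum>i\<in>Basis. dir_deriv atl (f i) p v *\<^sub>R i + f i p *\<^sub>R D c p (nab p v (cf c i)))"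
    using chart_deriv_linear[OF c(1) pc] D_cf[OF c(1) pc]
    by (simp add: linear_sum linear_add linear_cmul)
  also have "\<dots> = (\<Sum>i\<in>Basis. dir_deriv atl (f i) p v *\<^sub>R i) + (\<Sum>i\<in>Basis. f i p *\<^sub>R D c p (nab p v (cf c i)))"
    by (rule sum.distrib)
  also have "(\<Sum>i\<in>Basis. dir_deriv atl (f i) p v *\<^sub>R i) = frechet_derivative (vf_comp atl c W) (at (cmap c p)) (D c p v)"
  proof -
    have W': "(vf_comp atl c W has_derivative frechet_derivative (vf_comp atl c W) (at (cmap c p))) (at (cmap c p))"
      by (rule smooth_on_has_derivative[OF open_image[OF c(1-3)] smooth_vf_comp[OF c(1) W c(3)]]) (use c in auto)
    have "dir_deriv atl (f i) p v = frechet_derivative (vf_comp atl c W) (at (cmap c p)) (D c p v) \<bullet> i" for i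
    proof -
      have "f i \<circ> cinv c = (\<lambda>x. vf_comp atl c W x \<bullet> i)" by (auto simp: f_def vf_comp_def)
      then show ?thesis
        using dir_deriv_chart[OF c f] frechet_derivative_inner_const[OF W'] by simp
    qed
    then show ?thesis by (simp add: euclidean_representation)
  qed
  finally show ?thesis
    using c(1) pc by (simp add: christoffel_def f_def)
qed

text \<open>Linearity in the second argument is hidden in the definition, where \<open>w\<close>
  enters through a vector field. It follows from the preceding formula for the field with constant
  components \<open>w\<close>, whose derivative term vanishes.\<close>

lemma christoffel_expand:
  assumes c: "c \<in> atl" "p \<in> cdom c"
  shows "christoffel atl nab c p u w = (\<Sum>i\<in>Basis. (w \<bullet> i) *\<^sub>R christoffel atl nab c p u i)"
proof -
  have "(vf_comp atl c (cf c w) has_derivative (\<lambda>_. 0)) (at (cmap c p))"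
    by (rule has_derivative_transform_within_open[OF has_derivative_const[of w] open_cimg[OF c(1)]])
      (use c vf_comp_cf in auto)
  then have "frechet_derivative (vf_comp atl c (cf c w)) (at (cmap c p)) = (\<lambda>_. 0)"
    by (rule frechet_derivative_at[symmetric])
  then show ?thesis
    using nab_chart_aux[OF c(1) open_cdom[OF c(1)] order_refl c(2) smooth_cf[OF c(1)], of "cf c u p" w] c
    by (simp add: christoffel_def)
qed

theorem nab_chart:
  assumes c: "c \<in> atl" "p \<in> cdom c" and U: "open U" "p \<in> U" and W: "smooth_vf atl U W"
  shows "D c p (nab p v W) = frechet_derivative (vf_comp atl c W) (at (cmap c p)) (D c p v)
     + christoffel atl nab c p (D c p v) (D c p (W p))"
  using nab_chart_aux[OF c(1), of "U \<inter> cdom c" p W v] smooth_vf_subset[OF W] assms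
    christoffel_expand[OF c, of "D c p v" "D c p (W p)"]
  by (simp add: open_Int open_cdom)

text \<open>The symbols as functions of the coordinate point, so that the frame equation lives on an
  open subset of a Euclidean space.\<close>

definition Gam :: "('m, 'e) chart \<Rightarrow> 'e \<Rightarrow> 'e \<Rightarrow> 'e \<Rightarrow> 'e" where
  "Gam c x = christoffel atl nab c (cinv c x)"

lemma Gam_cmap: "c \<in> atl \<Longrightarrow> p \<in> cdom c \<Longrightarrow> Gam c (cmap c p) = christoffel atl nab c p"
  by (simp add: Gam_def cinv_cmap)

lemma christoffel_bilinear:
  assumes c: "c \<in> atl" "p \<in> cdom c"
  shows "bilinear (christoffel atl nab c p)"
  unfolding bilinear_def
proof (intro conjI allI)
  fix u v
  have "linear (\<lambda>w. \<Sum>i\<in>Basis. (w \<bullet> i) *\<^sub>R christoffel atl nab c p u i)"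
    by (rule linearI) (simp_all add: inner_add_left scaleR_add_left sum.distrib scaleR_sum_right)
  also have "(\<lambda>w. \<Sum>i\<in>Basis. (w \<bullet> i) *\<^sub>R christoffel atl nab c p u i) = christoffel atl nab c p u"
    by (rule ext) (rule christoffel_expand[OF c, symmetric])
  finally show "linear (christoffel atl nab c p u)" .
  show "linear (\<lambda>u. christoffel atl nab c p u v)"
    unfolding christoffel_def
    using linear_compose[OF linear_compose[OF cf_linear[OF c] nab_linear[OF open_cdom[OF c(1)] smooth_cf[OF c(1)] c(2)]] chart_deriv_linear[OF c]]
    by (simp add: comp_def)
qed

lemma Gam_smooth_bilinear:
  assumes c: "c \<in> atl"
  shows "smooth_bilinear_on (cimg c) (Gam c)"
  unfolding smooth_bilinear_on_def
proof (intro conjI ballI allI)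
  fix x assume "x \<in> cimg c"
  then show "bilinear (Gam c x)" unfolding Gam_def by (intro christoffel_bilinear c cinv_in)
next
  fix u v
  have "smooth_vf atl (cdom c) (\<lambda>p. nab p (cf c u p) (cf c v))"
    by (intro nab_smooth smooth_cf open_cdom c)
  from smooth_vf_comp[OF c this order_refl]
  show "smooth_on (cimg c) (\<lambda>x. Gam c x u v)"
    by (simp add: vf_comp_def[abs_def] Gam_def christoffel_def)
qed

text \<open>Seen in \<open>d\<close>, the coordinate field of \<open>c\<close> has as components the
  Jacobian of the transition map applied to \<open>w\<close>; its derivative is therefore a second
  derivative of that map.\<close>

lemma vf_comp_cf_deriv:
  assumes c: "c \<in> atl" "p \<in> cdom c" and d: "d \<in> atl" "p \<in> cdom d"
  shows "frechet_derivative (vf_comp atl d (cf c w)) (at (cmap d p)) =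
     (\<lambda>h. frechet_derivative (\<lambda>x. trans_deriv c d x w) (at (cmap c p)) (trans_deriv d c (cmap d p) h))"
proof -
  let ?F = "\<lambda>x. trans_deriv c d x w"
  have F: "(?F has_derivative frechet_derivative ?F (at (cmap c p))) (at (cmap c p))"
    unfolding trans_deriv_def
    by (rule smooth_on_has_derivative[OF open_overlap smooth_on_frechet_derivative[OF open_overlap trans_smooth]])
      (use c d in auto)
  have F': "(?F has_derivative frechet_derivative ?F (at (cmap c p))) (at ((cmap c \<circ> cinv d) (cmap d p)))"
    using F cinv_cmap[OF d] by simp
  have "((\<lambda>y. ?F ((cmap c \<circ> cinv d) y)) has_derivative
     (\<lambda>h. frechet_derivative ?F (at (cmap c p)) (trans_deriv d c (cmap d p) h))) (at (cmap d p))"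
    by (rule has_derivative_compose[OF trans_has_derivative[OF d(1) c(1) d(2) c(2)] F'])
  then have "(vf_comp atl d (cf c w) has_derivative
     (\<lambda>h. frechet_derivative ?F (at (cmap c p)) (trans_deriv d c (cmap d p) h))) (at (cmap d p))"
  proof (rule has_derivative_transform_within_open[OF _ open_overlap[OF d(1) c(1)]])
    fix y assume "y \<in> cmap d ` (cdom d \<inter> cdom c)"
    then obtain q where q: "q \<in> cdom d" "q \<in> cdom c" "y = cmap d q" by auto
    then show "?F ((cmap c \<circ> cinv d) y) = vf_comp atl d (cf c w) y"
      using chart_deriv_change[OF c(1) d(1) q(2) q(1)] c d cinv_cmap[OF d(1) q(1)] by (simp add: vf_comp_def)
  qed (use c d in auto)
  then show ?thesis by (rule frechet_derivative_at[symmetric])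
qed

text \<open>Both sides are the components in \<open>d\<close> of the same vector
  \<open>nab p (cf c u p) (cf c w)\<close>. In \<open>d\<close> the field has variable components,
  and their derivative is the inhomogeneous term of the transformation law.\<close>

lemma Gam_change:
  assumes c: "c \<in> atl" "p \<in> cdom c" and d: "d \<in> atl" "p \<in> cdom d"
  shows "trans_deriv c d (cmap c p) (Gam c (cmap c p) u w) =
    frechet_derivative (\<lambda>x. trans_deriv c d x w) (at (cmap c p)) u +
    Gam d (cmap d p) (trans_deriv c d (cmap c p) u) (trans_deriv c d (cmap c p) w)"
proof -
  have DT: "D d p (cf c z p) = trans_deriv c d (cmap c p) z" for z
    using chart_deriv_change[OF c(1) d(1) c(2) d(2)] c by simp
  have "D d p (nab p (cf c u p) (cf c w)) = trans_deriv c d (cmap c p) (Gam c (cmap c p) u w)"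
    using chart_deriv_change[OF c(1) d(1) c(2) d(2)] Gam_cmap[OF c] by (simp add: christoffel_def)
  then show ?thesis
    using nab_chart[OF d open_cdom[OF c(1)] c(2) smooth_cf[OF c(1)], of "cf c u p" w]
      trans_cocycle[OF c(1) d(1) c(1) c(2) d(2) c(2)] trans_id[OF c] vf_comp_cf_deriv[OF c d]
    by (simp add: DT Gam_cmap[OF d])
qed

end

lemma has_vector_derivative_within_bot: "at t within I = bot \<Longrightarrow> (f has_vector_derivative d) (at t within I)"
  by (simp add: has_vector_derivative_def has_derivative_def bounded_linear_scaleR_left)

context riemannian_manifold
begin

section \<open>Torsion and metric compatibility in a chart\<close>

lemma levi_civita_properties:
  assumes "open U" "smooth_vf atl U Y" "smooth_vf atl U Z"
  shows torsion_free: "\<forall>p\<in>U. nab p (Y p) Z - nab p (Z p) Y = lie_bracket atl Y Z p"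
    and metric_compatible: "\<forall>p\<in>U. \<forall>v. dir_deriv atl (\<lambda>q. g q (Y q) (Z q)) p v
                    = g p (nab p v Y) (Z p) + g p (Y p) (nab p v Z)"
  using lc[unfolded levi_civita_def, THEN conjunct2, THEN spec, THEN spec, THEN spec, THEN mp,
      OF conjI[OF assms(1) conjI[OF assms(2,3)]]]
  by - (elim conjE; assumption)+

text \<open>The bracket of coordinate fields of \<open>c\<close>, computed in the preferred chart as
  its definition demands, is an antisymmetrized second derivative of the transition map and hence
  zero; torsion-freeness then gives the symmetry.\<close>

lemma Gam_sym:
  assumes c: "c \<in> atl" "p \<in> cdom c"
  shows "Gam c (cmap c p) u v = Gam c (cmap c p) v u"
proof -
  let ?k = "pref_chart atl p"
  have br: "frechet_derivative (vf_comp atl ?k (cf c v)) (at (cmap ?k p)) (cf c u p) =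
      frechet_derivative (\<lambda>x. trans_deriv c ?k x v) (at (cmap c p)) u" for u v
    using vf_comp_cf_deriv[OF c pref, of v] D_cf[OF c, of u] by (simp add: chart_deriv_trans)
  have "lie_bracket atl (cf c u) (cf c v) p = 0"
    unfolding lie_bracket_def Let_def br unfolding trans_deriv_def
    using symmetric_second_derivative[OF open_overlap[OF c(1) pref(1)] _ trans_smooth[OF c(1) pref(1)], of "cmap c p" p v u]
      c pref by simp
  then have "nab p (cf c u p) (cf c v) = nab p (cf c v p) (cf c u)"
    using torsion_free[OF open_cdom smooth_cf smooth_cf, OF c(1) c(1) c(1), THEN bspec, OF c(2), of u v] by simp
  then show ?thesis by (simp add: Gam_cmap[OF c] christoffel_def)
qed

definition gm :: "('m, 'e) chart \<Rightarrow> 'e \<Rightarrow> 'e \<Rightarrow> 'e \<Rightarrow> real" where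
  "gm c x u v = g (cinv c x) (cf c u (cinv c x)) (cf c v (cinv c x))"

lemma g_bilinear: "bilinear (g p)" and g_sym: "g p u v = g p v u" and g_pos: "v \<noteq> 0 \<Longrightarrow> g p v v > 0"
  using metric unfolding riemannian_metric_def by auto

lemma g_linear: "linear (g p u)" "linear (\<lambda>v. g p v u)"
  using g_bilinear unfolding bilinear_def by auto

lemmas g_simps = linear_add[OF g_linear(1)] linear_add[OF g_linear(2)] linear_diff[OF g_linear(1)]
  linear_diff[OF g_linear(2)] linear_cmul[OF g_linear(1)] linear_cmul[OF g_linear(2)]
  linear_0[OF g_linear(1)] linear_0[OF g_linear(2)] linear_sum[OF g_linear(1)] linear_sum[OF g_linear(2)]
  linear_neg[OF g_linear(1)] linear_neg[OF g_linear(2)]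

lemma gm_smooth_bilinear:
  assumes c: "c \<in> atl"
  shows "smooth_bilinear_on (cimg c) (gm c)"
  unfolding smooth_bilinear_on_def
proof (intro conjI ballI allI)
  fix x assume "x \<in> cimg c"
  then have l: "linear (\<lambda>u. cf c u (cinv c x))" by (intro cf_linear c cinv_in)
  then show "bilinear (gm c x)" unfolding bilinear_def gm_def
    using linear_compose[OF l g_linear(1)] linear_compose[OF l g_linear(2)] by (simp add: comp_def)
next
  fix u v
  have "\<forall>c\<in>atl. \<forall>u v. smooth_fun atl (cdom c) (\<lambda>p. g p (cf c u p) (cf c v p))"
    using metric unfolding riemannian_metric_def by (elim conjE)
  then have "smooth_fun atl (cdom c) (\<lambda>p. g p (cf c u p) (cf c v p))" using c by blast
  from smooth_fun_comp[OF c this order_refl]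
  show "smooth_on (cimg c) (\<lambda>x. gm c x u v)" by (simp add: gm_def comp_def)
qed

lemma g_chart: "c \<in> atl \<Longrightarrow> p \<in> cdom c \<Longrightarrow> g p u v = gm c (cmap c p) (D c p u) (D c p v)"
  by (simp add: gm_def cinv_cmap)

text \<open>Metric compatibility for coordinate fields, whose covariant derivatives are the
  Christoffel symbols.\<close>

lemma gm_deriv:
  assumes c: "c \<in> atl" "p \<in> cdom c"
  shows "bil_deriv (gm c) (cmap c p) h u v =
    gm c (cmap c p) (Gam c (cmap c p) h u) v + gm c (cmap c p) u (Gam c (cmap c p) h v)"
proof -
  have nabcf: "nab p (cf c h p) (cf c u) = cf c (Gam c (cmap c p) h u) p" for u
    using cf_D[OF c, of "nab p (cf c h p) (cf c u)"] by (simp add: Gam_cmap[OF c] christoffel_def)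
  have "\<forall>c\<in>atl. \<forall>u v. smooth_fun atl (cdom c) (\<lambda>p. g p (cf c u p) (cf c v p))"
    using metric unfolding riemannian_metric_def by (elim conjE)
  then have sf: "smooth_fun atl (cdom c) (\<lambda>p. g p (cf c u p) (cf c v p))" using c by blast
  have "bil_deriv (gm c) (cmap c p) h u v = dir_deriv atl (\<lambda>q. g q (cf c u q) (cf c v q)) p (cf c h p)"
    using dir_deriv_chart[OF c(1) open_cdom[OF c(1)] order_refl c(2) sf, of "cf c h p"] c
    by (simp add: bil_deriv_def gm_def comp_def)
  also have "\<dots> = g p (nab p (cf c h p) (cf c u)) (cf c v p) + g p (cf c u p) (nab p (cf c h p) (cf c v))"
    using metric_compatible[OF open_cdom smooth_cf smooth_cf, OF c(1) c(1) c(1), THEN bspec, OF c(2)] by blast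
  finally show ?thesis unfolding nabcf g_chart[OF c] using c by simp
qed

subsection \<open>Curvature in a chart\<close>

text \<open>The classical expression of R(u, v)w through Christoffel symbols, with the sign
  convention used in \<open>curvature\<close>.\<close>

definition Rc :: "('m, 'e) chart \<Rightarrow> 'e \<Rightarrow> 'e \<Rightarrow> 'e \<Rightarrow> 'e \<Rightarrow> 'e" where
  "Rc c x u v w = bil_deriv (Gam c) x u v w - bil_deriv (Gam c) x v u w
     + Gam c x u (Gam c x v w) - Gam c x v (Gam c x u w)"

text \<open>The right side involves the fields only through their values at \<open>p\<close>.
  Everything else cancels: second derivatives of \<open>W\<close> by symmetry, derivatives of
  \<open>Y\<close> and \<open>Z\<close> against the bracket term.\<close>

lemma curvature_formula_chart:
  assumes c: "c \<in> atl" "p \<in> cdom c" and U: "open U" "p \<in> U"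
    and Y: "smooth_vf atl U Y" and Z: "smooth_vf atl U Z" and W: "smooth_vf atl U W"
  shows "D c p (nab p (Y p) (\<lambda>q. nab q (Z q) W) - nab p (Z p) (\<lambda>q. nab q (Y q) W)
            - nab p (lie_bracket atl Y Z p) W) =
     Rc c (cmap c p) (D c p (Y p)) (D c p (Z p)) (D c p (W p))"
proof -
  let ?O = "cmap c ` (U \<inter> cdom c)"
  let ?x = "cmap c p"
  let ?G = "Gam c ?x"
  note Os = open_image[OF c(1) open_Int[OF U(1) open_cdom[OF c(1)]] Int_lower2]
  have xO: "?x \<in> ?O" using c U by auto
  have comp: "smooth_on ?O (vf_comp atl c V)" if "smooth_vf atl U V" for V
    by (rule smooth_vf_comp[OF c(1) smooth_vf_subset[OF that Int_lower1] Int_lower2])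
  define w where "w = vf_comp atl c W"
  note w = comp[OF W, folded w_def]
  define w' where "w' = frechet_derivative w (at ?x)"
  define w'' where "w'' v h = frechet_derivative (\<lambda>y. frechet_derivative w (at y) v) (at ?x) h" for v h
  have w'l: "linear w'"
    unfolding w'_def by (rule has_derivative_linear[OF smooth_on_has_derivative[OF Os w xO]])
  have dw: "(w has_derivative w') (at ?x)" unfolding w'_def by (rule smooth_on_has_derivative[OF Os w xO])
  have wx: "w ?x = D c p (W p)" by (simp add: w_def vf_comp_cmap c)
  \<comment> \<open>Computed for generic fields because it is used a second time with
    \<open>Y\<close> and \<open>Z\<close> exchanged.\<close>
  have inner: "D c p (nab p (Y p) (\<lambda>q. nab q (Z q) W)) =
      w'' z y + w' (z' y) + bil_deriv (Gam c) ?x y z (w ?x) + ?G (z' y) (w ?x) + ?G z (w' y) + ?G y (w' z + ?G z (w ?x))"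
    if Y: "smooth_vf atl U Y" and Z: "smooth_vf atl U Z" and y: "y = D c p (Y p)" and z: "z = D c p (Z p)"
      and z': "z' = frechet_derivative (vf_comp atl c Z) (at ?x)" for Y Z y z z'
  proof -
    note zs = comp[OF Z]
    have dz: "(vf_comp atl c Z has_derivative z') (at ?x)"
      unfolding z' by (rule smooth_on_has_derivative[OF Os zs xO])
    have zx: "vf_comp atl c Z ?x = z" using c by (simp add: z vf_comp_cmap)
    have val: "vf_comp atl c (\<lambda>q. nab q (Z q) W) x = frechet_derivative w (at x) (vf_comp atl c Z x) + Gam c x (vf_comp atl c Z x) (w x)"
      if xq: "x \<in> ?O" for x
    proof -
      obtain q where q: "q \<in> U" "q \<in> cdom c" "x = cmap c q" using xq by blast
      then show ?thesis using nab_chart[OF c(1) q(2) U(1) q(1) W, of "Z q"]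
        by (simp add: vf_comp_cmap c w_def Gam_cmap)
    qed
    have "((\<lambda>x. frechet_derivative w (at x) (vf_comp atl c Z x) + Gam c x (vf_comp atl c Z x) (w x)) has_derivative
      (\<lambda>d. (w'' (vf_comp atl c Z ?x) d + w' (z' d)) + (bil_deriv (Gam c) ?x d (vf_comp atl c Z ?x) (w ?x) + ?G (z' d) (w ?x) + ?G (vf_comp atl c Z ?x) (w' d)))) (at ?x)"
      unfolding w'_def w''_def
      by (intro has_derivative_add has_derivative_frechet_derivative_apply[OF Os w has_derivative_ident xO]
          sb_has_derivative[OF open_cimg[OF c(1)] Gam_smooth_bilinear[OF c(1)] has_derivative_ident] dz dw[unfolded w'_def])
        (use c in auto)
    then have "(vf_comp atl c (\<lambda>q. nab q (Z q) W) has_derivative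
      (\<lambda>d. (w'' z d + w' (z' d)) + (bil_deriv (Gam c) ?x d z (w ?x) + ?G (z' d) (w ?x) + ?G z (w' d)))) (at ?x)"
      unfolding zx by (rule has_derivative_transform_within_open[OF _ Os xO]) (simp add: val)
    from frechet_derivative_at[OF this, symmetric]
    have "D c p (nab p (Y p) (\<lambda>q. nab q (Z q) W)) =
      (w'' z y + w' (z' y)) + (bil_deriv (Gam c) ?x y z (w ?x) + ?G (z' y) (w ?x) + ?G z (w' y)) +
      ?G y (D c p (nab p (Z p) W))"
      using nab_chart[OF c U nab_smooth[OF U(1) W Z], of "Y p"] by (simp add: y Gam_cmap[OF c])
    moreover have "D c p (nab p (Z p) W) = w' z + ?G z (w ?x)"
      using nab_chart[OF c U W, of "Z p"] by (simp add: z w'_def w_def Gam_cmap[OF c] vf_comp_cmap c)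
    ultimately show ?thesis by (simp add: add_ac)
  qed
  define y z y' z' where "y = D c p (Y p)" and "z = D c p (Z p)"
    and "y' = frechet_derivative (vf_comp atl c Y) (at ?x)" and "z' = frechet_derivative (vf_comp atl c Z) (at ?x)"
  have Dl: "linear (D c p)" by (rule chart_deriv_linear[OF c])
  \<comment> \<open>The bracket is defined through the preferred chart; torsion-freeness rewrites it
    by covariant derivatives, whose components in \<open>c\<close> are known.\<close>
  have "D c p (lie_bracket atl Y Z p) = D c p (nab p (Y p) Z - nab p (Z p) Y)"
    using torsion_free[OF U(1) Y Z] U(2) by simp
  also have "\<dots> = (z' y + ?G y z) - (y' z + ?G z y)"
    using nab_chart[OF c U Z, of "Y p"] nab_chart[OF c U Y, of "Z p"]
    by (simp add: linear_diff[OF Dl] y_def z_def y'_def z'_def Gam_cmap[OF c])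
  also have "\<dots> = z' y - y' z" using Gam_sym[OF c, of y z] by simp
  finally have br: "D c p (lie_bracket atl Y Z p) = z' y - y' z" .
  have last: "D c p (nab p (lie_bracket atl Y Z p) W) = w' (z' y - y' z) + ?G (z' y - y' z) (w ?x)"
    using nab_chart[OF c U W, of "lie_bracket atl Y Z p"] by (simp add: br w'_def w_def Gam_cmap[OF c] vf_comp_cmap c)
  have sym: "w'' z y = w'' y z"
    unfolding w''_def by (rule symmetric_second_derivative[OF Os xO w])
  have bil: "bilinear ?G" using sb_bilinear[OF open_cimg Gam_smooth_bilinear, OF c(1) c(1)] c by auto
  show ?thesis
    unfolding linear_diff[OF Dl] last inner[OF Y Z y_def z_def z'_def] inner[OF Z Y z_def y_def y'_def] Rc_def
      y_def[symmetric] z_def[symmetric] wx[symmetric] sym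
    by (simp add: linear_diff[OF w'l] bilinear_lsub[OF bil] bilinear_radd[OF bil])
qed

text \<open>The preceding formula justifies the definite description twice: the value is the same
  for all smooth extensions, and the coordinate fields of \<open>c\<close> supply one extension that
  pins it down.\<close>

lemma curvature_chart:
  assumes c: "c \<in> atl" "p \<in> cdom c"
  shows "D c p (curvature atl nab p u v w) = Rc c (cmap c p) (D c p u) (D c p v) (D c p w)"
proof -
  let ?r = "cf c (Rc c (cmap c p) (D c p u) (D c p v) (D c p w)) p"
  have "curvature atl nab p u v w = ?r"
    unfolding curvature_def
  proof (rule the_equality)
    show "\<forall>U Y Z W. open U \<and> p \<in> U \<and>
        smooth_vf atl U Y \<and> smooth_vf atl U Z \<and> smooth_vf atl U W \<and> Y p = u \<and> Z p = v \<and> W p = w \<longrightarrow>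
        ?r = nab p (Y p) (\<lambda>q. nab q (Z q) W) - nab p (Z p) (\<lambda>q. nab q (Y q) W)
            - nab p (lie_bracket atl Y Z p) W"
    proof (intro allI impI, elim conjE)
      fix U Y Z W assume *: "open U" "p \<in> U" "smooth_vf atl U Y" "smooth_vf atl U Z" "smooth_vf atl U W"
        and e: "Y p = u" "Z p = v" "W p = w"
      show "?r = nab p (Y p) (\<lambda>q. nab q (Z q) W) - nab p (Z p) (\<lambda>q. nab q (Y q) W)
            - nab p (lie_bracket atl Y Z p) W"
        unfolding e[symmetric] curvature_formula_chart[OF c *, symmetric] by (rule cf_D[OF c])
    qed
  next
    fix r assume r: "\<forall>U Y Z W. open U \<and> p \<in> U \<and>
        smooth_vf atl U Y \<and> smooth_vf atl U Z \<and> smooth_vf atl U W \<and> Y p = u \<and> Z p = v \<and> W p = w \<longrightarrow>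
        r = nab p (Y p) (\<lambda>q. nab q (Z q) W) - nab p (Z p) (\<lambda>q. nab q (Y q) W)
            - nab p (lie_bracket atl Y Z p) W"
    let ?C = "\<lambda>u. cf c (D c p u)"
    have e: "?C u p = u" for u using c by simp
    note fs = open_cdom[OF c(1)] c(2) smooth_cf[OF c(1), of "D c p u"] smooth_cf[OF c(1), of "D c p v"] smooth_cf[OF c(1), of "D c p w"]
    have "r = nab p (?C u p) (\<lambda>q. nab q (?C v q) (?C w)) - nab p (?C v p) (\<lambda>q. nab q (?C u q) (?C w))
            - nab p (lie_bracket atl (?C u) (?C v) p) (?C w)"
      by (rule r[THEN spec[of _ "cdom c"], THEN spec, THEN spec, THEN spec, THEN mp]) (intro conjI fs e)
    then have "D c p r = Rc c (cmap c p) (D c p u) (D c p v) (D c p w)"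
      using curvature_formula_chart[OF c fs] by (simp only: e)
    then show "r = ?r" using cf_D[OF c, of r] by simp
  qed
  then show ?thesis using c by simp
qed

subsection \<open>Calculus along curves\<close>

lemma eventually_in_chart:
  assumes "continuous (at t within I) \<gamma>" "open U" "\<gamma> t \<in> U"
  shows "\<forall>\<^sub>F s in at t within I. \<gamma> s \<in> U"
  using assms unfolding continuous_within by (rule topological_tendstoD)

text \<open>One chart suffices: the derivative in any other chart follows from the chain rule for
  the transition map.\<close>

lemma has_velocity_chartI:
  assumes c: "c \<in> atl" and t: "t \<in> I" "\<gamma> t \<in> cdom c" and cont: "continuous (at t within I) \<gamma>"
    and der: "((\<lambda>s. cmap c (\<gamma> s)) has_vector_derivative D c (\<gamma> t) v) (at t within I)"
  shows "has_velocity atl I \<gamma> t v"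
  unfolding has_velocity_def
proof (intro conjI ballI impI cont)
  fix d assume d: "d \<in> atl" "\<gamma> t \<in> cdom d"
  have ev: "\<forall>\<^sub>F s in at t within I. \<gamma> s \<in> cdom c"
    by (rule eventually_in_chart[OF cont open_cdom[OF c] t(2)])
  have "((\<lambda>s. (cmap d \<circ> cinv c) (cmap c (\<gamma> s))) has_derivative
      (\<lambda>h. trans_deriv c d (cmap c (\<gamma> t)) (h *\<^sub>R D c (\<gamma> t) v))) (at t within I)"
    by (rule has_derivative_compose[OF der[unfolded has_vector_derivative_def] trans_has_derivative[OF c d(1) t(2) d(2)]])
  then have "(cmap d \<circ> \<gamma> has_derivative
      (\<lambda>h. trans_deriv c d (cmap c (\<gamma> t)) (h *\<^sub>R D c (\<gamma> t) v))) (at t within I)"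
    by (rule has_derivative_transform_eventually)
      (use t cinv_cmap[OF c] ev in \<open>auto elim: eventually_mono\<close>)
  then show "(cmap d \<circ> \<gamma> has_vector_derivative D d (\<gamma> t) v) (at t within I)"
    unfolding has_vector_derivative_def
    using chart_deriv_change[OF c d(1) t(2) d(2)] linear_cmul[OF trans_linear[OF c d(1) t(2) d(2)]] by simp
qed

lemma has_velocity_chartD:
  assumes "has_velocity atl I \<gamma> t v" "c \<in> atl" "\<gamma> t \<in> cdom c"
  shows "((\<lambda>s. cmap c (\<gamma> s)) has_vector_derivative D c (\<gamma> t) v) (at t within I)"
  using assms unfolding has_velocity_def comp_def by blast

lemma has_velocity_cont: "has_velocity atl I \<gamma> t v \<Longrightarrow> continuous (at t within I) \<gamma>"
  unfolding has_velocity_def by blast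

lemma has_velocity_unique:
  assumes "has_velocity atl I \<gamma> t v" "has_velocity atl I \<gamma> t w" "at t within I \<noteq> bot"
  shows "v = w"
proof -
  obtain c where c: "c \<in> atl" "\<gamma> t \<in> cdom c" using ex_chart .
  have "D c (\<gamma> t) v = D c (\<gamma> t) w"
    by (rule vector_derivative_unique_within[OF assms(3) has_velocity_chartD[OF assms(1) c] has_velocity_chartD[OF assms(2) c]])
  then show ?thesis using D_inject[OF c] by simp
qed

text \<open>The velocity is existentially hidden in \<open>has_cov_deriv\<close>. Uniqueness
  identifies it with the given \<open>v\<close>, except at an isolated point of \<open>I\<close>,
  where every vector is a derivative.\<close>

lemma has_cov_deriv_chartD:
  assumes cov: "has_cov_deriv atl nab I \<gamma> V t E" and v: "has_velocity atl I \<gamma> t v" and c: "c \<in> atl" "\<gamma> t \<in> cdom c"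
  shows "((\<lambda>s. D c (\<gamma> s) (V s)) has_vector_derivative
    (D c (\<gamma> t) E - Gam c (cmap c (\<gamma> t)) (D c (\<gamma> t) v) (D c (\<gamma> t) (V t)))) (at t within I)"
proof (cases "at t within I = bot")
  case False
  obtain v' where v': "has_velocity atl I \<gamma> t v'" and
    d: "\<forall>c\<in>atl. \<gamma> t \<in> cdom c \<longrightarrow>
         (\<exists>d. ((\<lambda>s. D c (\<gamma> s) (V s)) has_vector_derivative d) (at t within I) \<and>
              D c (\<gamma> t) E = d + christoffel atl nab c (\<gamma> t) (D c (\<gamma> t) v') (D c (\<gamma> t) (V t)))"
    using cov unfolding has_cov_deriv_def by blast
  have "v' = v" by (rule has_velocity_unique[OF v' v False])
  then show ?thesis using d[THEN bspec, OF c(1), THEN mp, OF c(2)] by (auto simp: Gam_cmap[OF c])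
qed (rule has_vector_derivative_within_bot)

text \<open>Passing to another chart adds a second derivative of the transition map, and by
  \<open>Gam_change\<close> the Christoffel symbols of the new chart compensate for exactly this
  term.\<close>

lemma has_cov_deriv_chartI:
  assumes v: "has_velocity atl I \<gamma> t v" and c: "c \<in> atl" "\<gamma> t \<in> cdom c" and t: "t \<in> I"
    and der: "((\<lambda>s. D c (\<gamma> s) (V s)) has_vector_derivative
    (D c (\<gamma> t) E - Gam c (cmap c (\<gamma> t)) (D c (\<gamma> t) v) (D c (\<gamma> t) (V t)))) (at t within I)"
  shows "has_cov_deriv atl nab I \<gamma> V t E"
  unfolding has_cov_deriv_def
proof (rule exI[of _ v], intro conjI v ballI impI)
  fix d assume d: "d \<in> atl" "\<gamma> t \<in> cdom d"
  let ?x = "cmap c (\<gamma> t)" and ?V = "D c (\<gamma> t) (V t)" and ?v = "D c (\<gamma> t) v"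
  let ?d = "D c (\<gamma> t) E - Gam c ?x ?v ?V"
  let ?T = "trans_deriv c d"
  have ev: "\<forall>\<^sub>F s in at t within I. \<gamma> s \<in> cdom c \<inter> cdom d"
    by (rule eventually_in_chart[OF has_velocity_cont[OF v] open_Int[OF open_cdom[OF c(1)] open_cdom[OF d(1)]]])
      (use c d in auto)
  have lT: "linear (?T ?x)" by (rule trans_linear[OF c(1) d(1) c(2) d(2)])
  define F where "F = (\<lambda>x. ?T x ?V)"
  have "((\<lambda>s. ?T (cmap c (\<gamma> s)) (D c (\<gamma> s) (V s))) has_derivative
     (\<lambda>h. frechet_derivative F (at ?x) (h *\<^sub>R ?v) + ?T ?x (h *\<^sub>R ?d))) (at t within I)"
    unfolding trans_deriv_def F_def
    by (rule has_derivative_frechet_derivative_apply[OF open_overlap[OF c(1) d(1)] trans_smooth[OF c(1) d(1)]])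
      (use has_velocity_chartD[OF v c] der c d in \<open>auto simp: has_vector_derivative_def\<close>)
  then have "((\<lambda>s. D d (\<gamma> s) (V s)) has_derivative
     (\<lambda>h. frechet_derivative F (at ?x) (h *\<^sub>R ?v) + ?T ?x (h *\<^sub>R ?d))) (at t within I)"
    by (rule has_derivative_transform_eventually)
      (use chart_deriv_change[OF c(1) d(1)] c d t ev in \<open>auto elim!: eventually_mono\<close>)
  moreover have "linear (frechet_derivative F (at ?x))"
  proof -
    have "(F has_derivative frechet_derivative F (at ?x)) (at ?x)"
      unfolding F_def trans_deriv_def
      by (rule smooth_on_has_derivative[OF open_overlap smooth_on_frechet_derivative[OF open_overlap trans_smooth]])
        (use c d in auto)
    then show ?thesis by (rule has_derivative_linear)
  qed
  ultimately have "((\<lambda>s. D d (\<gamma> s) (V s)) has_vector_derivative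
     (frechet_derivative F (at ?x) ?v + ?T ?x ?d)) (at t within I)"
    unfolding has_vector_derivative_def by (simp add: linear_cmul lT scaleR_add_right)
  moreover have "D d (\<gamma> t) E = frechet_derivative F (at ?x) ?v + ?T ?x ?d + Gam d (cmap d (\<gamma> t)) (D d (\<gamma> t) v) (D d (\<gamma> t) (V t))"
    using Gam_change[OF c d, of ?v ?V] chart_deriv_change[OF c(1) d(1) c(2) d(2)]
    by (simp add: linear_diff[OF lT] F_def)
  ultimately show "\<exists>e. ((\<lambda>s. D d (\<gamma> s) (V s)) has_vector_derivative e) (at t within I) \<and>
    D d (\<gamma> t) E = e + christoffel atl nab d (\<gamma> t) (D d (\<gamma> t) v) (D d (\<gamma> t) (V t))"
    by (auto simp: Gam_cmap[OF d])
qed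

lemma has_cov_deriv_velocity:
  assumes "has_cov_deriv atl nab I \<gamma> V t E"
  obtains v where "has_velocity atl I \<gamma> t v"
  using assms unfolding has_cov_deriv_def by blast

lemma has_cov_deriv_unique:
  assumes "has_cov_deriv atl nab I \<gamma> V t E" "has_cov_deriv atl nab I \<gamma> V t E'" "at t within I \<noteq> bot"
  shows "E = E'"
proof -
  obtain c where c: "c \<in> atl" "\<gamma> t \<in> cdom c" using ex_chart .
  obtain v where v: "has_velocity atl I \<gamma> t v" by (rule has_cov_deriv_velocity[OF assms(1)])
  have "D c (\<gamma> t) E - Gam c (cmap c (\<gamma> t)) (D c (\<gamma> t) v) (D c (\<gamma> t) (V t)) =
      D c (\<gamma> t) E' - Gam c (cmap c (\<gamma> t)) (D c (\<gamma> t) v) (D c (\<gamma> t) (V t))"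
    by (rule vector_derivative_unique_within[OF assms(3) has_cov_deriv_chartD[OF assms(1) v c] has_cov_deriv_chartD[OF assms(2) v c]])
  then show ?thesis using D_inject[OF c] by simp
qed

text \<open>By \<open>gm_deriv\<close> the derivative of the metric coefficients cancels the
  Christoffel corrections of both fields.\<close>

lemma has_cov_deriv_metric:
  assumes t: "t \<in> I" and V: "has_cov_deriv atl nab I \<gamma> V t E" and W: "has_cov_deriv atl nab I \<gamma> W t F"
  shows "((\<lambda>s. g (\<gamma> s) (V s) (W s)) has_vector_derivative (g (\<gamma> t) E (W t) + g (\<gamma> t) (V t) F)) (at t within I)"
proof -
  obtain c where c: "c \<in> atl" "\<gamma> t \<in> cdom c" using ex_chart .
  obtain v where v: "has_velocity atl I \<gamma> t v" by (rule has_cov_deriv_velocity[OF V])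
  have ev: "\<forall>\<^sub>F s in at t within I. \<gamma> s \<in> cdom c"
    by (rule eventually_in_chart[OF has_velocity_cont[OF v]]) (use c open_cdom in auto)
  let ?x = "cmap c (\<gamma> t)" and ?V = "D c (\<gamma> t) (V t)" and ?W = "D c (\<gamma> t) (W t)" and ?v = "D c (\<gamma> t) v"
  let ?V' = "D c (\<gamma> t) E - Gam c ?x ?v ?V" and ?W' = "D c (\<gamma> t) F - Gam c ?x ?v ?W"
  have xin: "?x \<in> cimg c" using c by auto
  have bil: "bilinear (gm c ?x)" by (rule sb_bilinear[OF open_cimg gm_smooth_bilinear, OF c(1) c(1) xin])
  have "((\<lambda>s. gm c (cmap c (\<gamma> s)) (D c (\<gamma> s) (V s)) (D c (\<gamma> s) (W s))) has_derivative
    (\<lambda>h. bil_deriv (gm c) ?x (h *\<^sub>R ?v) ?V ?W + gm c ?x (h *\<^sub>R ?V') ?W + gm c ?x ?V (h *\<^sub>R ?W'))) (at t within I)"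
    using has_velocity_chartD[OF v c] has_cov_deriv_chartD[OF V v c] has_cov_deriv_chartD[OF W v c]
    by (intro sb_has_derivative[OF open_cimg[OF c(1)] gm_smooth_bilinear[OF c(1)]] xin)
      (simp_all add: has_vector_derivative_def)
  then have "((\<lambda>s. g (\<gamma> s) (V s) (W s)) has_derivative
    (\<lambda>h. bil_deriv (gm c) ?x (h *\<^sub>R ?v) ?V ?W + gm c ?x (h *\<^sub>R ?V') ?W + gm c ?x ?V (h *\<^sub>R ?W'))) (at t within I)"
    by (rule has_derivative_transform_eventually)
      (use g_chart[OF c(1)] c t ev in \<open>auto elim!: eventually_mono\<close>)
  moreover have "bil_deriv (gm c) ?x (h *\<^sub>R ?v) ?V ?W + gm c ?x (h *\<^sub>R ?V') ?W + gm c ?x ?V (h *\<^sub>R ?W') =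
      h *\<^sub>R (g (\<gamma> t) E (W t) + g (\<gamma> t) (V t) F)" for h
  proof -
    have "bil_deriv (gm c) ?x (h *\<^sub>R ?v) ?V ?W = h * bil_deriv (gm c) ?x ?v ?V ?W"
      using linear_cmul[OF sb_deriv_linear[OF open_cimg[OF c(1)] gm_smooth_bilinear[OF c(1)] xin]] by simp
    then show ?thesis
      unfolding gm_deriv[OF c] g_chart[OF c]
      by (simp add: bilinear_lmul[OF bil] bilinear_rmul[OF bil] bilinear_lsub[OF bil] bilinear_rsub[OF bil] algebra_simps)
  qed
  ultimately show ?thesis unfolding has_vector_derivative_def by simp
qed

end

section \<open>Frames along curves and the linearized frame equation\<close>

text \<open>A finite type with exactly \<open>DIM('e)\<close> elements turns frames into points of
  the Euclidean space \<open>'e ^ 'e frame_index\<close>, in which the differential equation can be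
  posed.\<close>

typedef (overloaded) 'e frame_index = "{1..DIM('e::euclidean_space)}"
  by (rule exI[of _ 1]) (simp add: DIM_positive Suc_leI)

instance frame_index :: (euclidean_space) finite
proof
  have "finite (range (Rep_frame_index :: 'a frame_index \<Rightarrow> nat))"
    by (rule finite_subset[OF image_subsetI[OF Rep_frame_index]]) simp
  then show "finite (UNIV :: 'a frame_index set)"
    by (rule finite_imageD) (simp add: Rep_frame_index_inject inj_on_def)
qed

lemma has_derivative_vec_lambda:
  fixes f :: "'i::finite \<Rightarrow> 'a::real_normed_vector \<Rightarrow> 'b::euclidean_space"
  assumes "\<And>i. (f i has_derivative f' i) F"
  shows "((\<lambda>x. \<chi> i. f i x) has_derivative (\<lambda>h. \<chi> i. f' i h)) F"
proof -
  have eq: "(\<chi> i. z i) = (\<Sum>i\<in>UNIV. axis i (z i))" for z :: "'i \<Rightarrow> 'b"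
    by (simp add: vec_eq_iff axis_def if_distrib sum.delta cong: if_cong)
  have "bounded_linear (axis i :: 'b \<Rightarrow> 'b ^ 'i)" for i
    unfolding linear_conv_bounded_linear[symmetric]
    by (rule linearI) (simp_all add: vec_eq_iff axis_def)
  then show ?thesis unfolding eq
    by (intro has_derivative_sum bounded_linear.has_derivative[OF _ assms]) auto
qed

lemma has_vector_derivative_vec_lambda_iff:
  fixes f :: "'i::finite \<Rightarrow> real \<Rightarrow> 'b::euclidean_space"
  shows "((\<lambda>s. \<chi> i. f i s) has_vector_derivative (\<chi> i. f' i)) F \<longleftrightarrow> (\<forall>i. (f i has_vector_derivative f' i) F)"
proof safe
  fix i assume "((\<lambda>s. \<chi> i. f i s) has_vector_derivative (\<chi> i. f' i)) F"
  from bounded_linear.has_vector_derivative[OF bounded_linear_vec_nth[of i] this]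
  show "(f i has_vector_derivative f' i) F" by simp
next
  assume "\<forall>i. (f i has_vector_derivative f' i) F"
  then have "((\<lambda>s. \<chi> i. f i s) has_derivative (\<lambda>h. \<chi> i. h *\<^sub>R f' i)) F"
    unfolding has_vector_derivative_def by (intro has_derivative_vec_lambda) blast
  then show "((\<lambda>s. \<chi> i. f i s) has_vector_derivative (\<chi> i. f' i)) F"
    unfolding has_vector_derivative_def by (simp add: scaleR_vec_def)
qed

lemma has_vector_derivative_Pair_iff:
  "((\<lambda>s. (f s, h s)) has_vector_derivative (f', h')) (at t within I) \<longleftrightarrow>
    (f has_vector_derivative f') (at t within I) \<and> (h has_vector_derivative h') (at t within I)"
proof safe
  assume *: "((\<lambda>s. (f s, h s)) has_vector_derivative (f', h')) (at t within I)"
  show "(f has_vector_derivative f') (at t within I)" "(h has_vector_derivative h') (at t within I)"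
    using bounded_linear.has_vector_derivative[OF bounded_linear_fst *]
      bounded_linear.has_vector_derivative[OF bounded_linear_snd *] by simp_all
next
  assume "(f has_vector_derivative f') (at t within I)" "(h has_vector_derivative h') (at t within I)"
  then show "((\<lambda>s. (f s, h s)) has_vector_derivative (f', h')) (at t within I)"
    unfolding has_vector_derivative_def using has_derivative_Pair by fastforce
qed

context riemannian_manifold
begin

section \<open>The frame equation as a system in a chart\<close>

definition cstate :: "('m, 'e) chart \<Rightarrow> 'm \<Rightarrow> ('e frame_index \<Rightarrow> 'e) \<Rightarrow> 'e \<times> ('e ^ 'e frame_index)" where
  "cstate c p e = (cmap c p, \<chi> i. D c p (e i))"

text \<open>The coordinate derivative of \<open>cstate\<close> when the point moves with velocity
  \<open>v\<close> and the frame has covariant derivative \<open>e'\<close>; the Christoffel term is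
  the difference between the two kinds of derivative.\<close>

definition ctan :: "('m, 'e) chart \<Rightarrow> 'm \<Rightarrow> ('e frame_index \<Rightarrow> 'e) \<Rightarrow> 'e \<Rightarrow> ('e frame_index \<Rightarrow> 'e) \<Rightarrow> 'e \<times> ('e ^ 'e frame_index)" where
  "ctan c p e v e' = (D c p v, \<chi> i. D c p (e' i) - Gam c (cmap c p) (D c p v) (D c p (e i)))"

definition fld :: "('m, 'e) chart \<Rightarrow> ('e frame_index \<Rightarrow> real) \<Rightarrow> (real \<Rightarrow> 'e frame_index \<Rightarrow> 'e frame_index \<Rightarrow> real) \<Rightarrow>
    real \<Rightarrow> 'e \<times> ('e ^ 'e frame_index) \<Rightarrow> 'e \<times> ('e ^ 'e frame_index)" where
  "fld c k K t y = (\<Sum>j\<in>UNIV. k j *\<^sub>R snd y $ j,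
     \<chi> i. (\<Sum>j\<in>UNIV. K t i j *\<^sub>R snd y $ j) - Gam c (fst y) (\<Sum>j\<in>UNIV. k j *\<^sub>R snd y $ j) (snd y $ i))"

definition dfld :: "('m, 'e) chart \<Rightarrow> ('e frame_index \<Rightarrow> real) \<Rightarrow> (real \<Rightarrow> 'e frame_index \<Rightarrow> 'e frame_index \<Rightarrow> real) \<Rightarrow>
    real \<Rightarrow> 'e \<times> ('e ^ 'e frame_index) \<Rightarrow> 'e \<times> ('e ^ 'e frame_index) \<Rightarrow> 'e \<times> ('e ^ 'e frame_index)" where
  "dfld c k K t y z = (\<Sum>j\<in>UNIV. k j *\<^sub>R snd z $ j,
     \<chi> i. (\<Sum>j\<in>UNIV. K t i j *\<^sub>R snd z $ j) -
       (bil_deriv (Gam c) (fst y) (fst z) (\<Sum>j\<in>UNIV. k j *\<^sub>R snd y $ j) (snd y $ i)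
      + Gam c (fst y) (\<Sum>j\<in>UNIV. k j *\<^sub>R snd z $ j) (snd y $ i)
      + Gam c (fst y) (\<Sum>j\<in>UNIV. k j *\<^sub>R snd y $ j) (snd z $ i)))"

text \<open>The coefficients are kept general for two uses: with \<open>kvec\<close> and
  \<open>Kmat\<close> the solutions are curves with Bishop frames, with other constants they are the
  transverse curves that carry the initial frames.\<close>

definition frame_eq :: "real set \<Rightarrow> (real \<Rightarrow> 'm) \<Rightarrow> ('e frame_index \<Rightarrow> real \<Rightarrow> 'e) \<Rightarrow>
    ('e frame_index \<Rightarrow> real) \<Rightarrow> (real \<Rightarrow> 'e frame_index \<Rightarrow> 'e frame_index \<Rightarrow> real) \<Rightarrow> bool" where
  "frame_eq I \<sigma> E k K \<longleftrightarrow> (\<forall>t\<in>I. has_velocity atl I \<sigma> t (\<Sum>j\<in>UNIV. k j *\<^sub>R E j t) \<and>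
     (\<forall>i. has_cov_deriv atl nab I \<sigma> (E i) t (\<Sum>j\<in>UNIV. K t i j *\<^sub>R E j t)))"

lemma has_cov_deriv_chart_iff:
  assumes "has_velocity atl I \<gamma> t v" "c \<in> atl" "\<gamma> t \<in> cdom c" "t \<in> I"
  shows "has_cov_deriv atl nab I \<gamma> V t E \<longleftrightarrow> ((\<lambda>s. D c (\<gamma> s) (V s)) has_vector_derivative
    (D c (\<gamma> t) E - Gam c (cmap c (\<gamma> t)) (D c (\<gamma> t) v) (D c (\<gamma> t) (V t)))) (at t within I)"
  using has_cov_deriv_chartD[OF _ assms(1-3)] has_cov_deriv_chartI[OF assms] by blast

text \<open>The dictionary between covariant and coordinate derivatives, used both for
  \<open>t\<close> along a curve and for \<tau> across the family.\<close>

lemma tangent_iff: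
  assumes c: "c \<in> atl" "\<sigma> t \<in> cdom c" and t: "t \<in> I" and cont: "continuous (at t within I) \<sigma>"
  shows "has_velocity atl I \<sigma> t v \<and> (\<forall>i. has_cov_deriv atl nab I \<sigma> (E i) t (E' i)) \<longleftrightarrow>
    ((\<lambda>s. cstate c (\<sigma> s) (\<lambda>i. E i s)) has_vector_derivative ctan c (\<sigma> t) (\<lambda>i. E i t) v E') (at t within I)"
  (is "?l \<longleftrightarrow> ?r")
proof
  assume ?l
  then show ?r
    unfolding cstate_def ctan_def has_vector_derivative_Pair_iff has_vector_derivative_vec_lambda_iff
    using has_velocity_chartD[of I \<sigma> t v c] has_cov_deriv_chartD[of I \<sigma> _ t _ v c] c by blast
next
  assume ?r
  then have 1: "((\<lambda>s. cmap c (\<sigma> s)) has_vector_derivative D c (\<sigma> t) v) (at t within I)"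
    and 2: "\<And>i. ((\<lambda>s. D c (\<sigma> s) (E i s)) has_vector_derivative
       D c (\<sigma> t) (E' i) - Gam c (cmap c (\<sigma> t)) (D c (\<sigma> t) v) (D c (\<sigma> t) (E i t))) (at t within I)"
    unfolding cstate_def ctan_def has_vector_derivative_Pair_iff has_vector_derivative_vec_lambda_iff by blast+
  have v: "has_velocity atl I \<sigma> t v" by (rule has_velocity_chartI[OF c(1) t c(2) cont 1])
  show ?l using v has_cov_deriv_chartI[OF v c t 2] by blast
qed

lemma D_sum:
  assumes "c \<in> atl" "p \<in> cdom c"
  shows "D c p (\<Sum>j\<in>J. a j *\<^sub>R e j) = (\<Sum>j\<in>J. a j *\<^sub>R D c p (e j))"
  by (simp add: linear_sum[OF chart_deriv_linear[OF assms]] linear_cmul[OF chart_deriv_linear[OF assms]])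

lemma fld_cstate:
  assumes "c \<in> atl" "p \<in> cdom c"
  shows "ctan c p e (\<Sum>j\<in>UNIV. k j *\<^sub>R e j) (\<lambda>i. \<Sum>j\<in>UNIV. K t i j *\<^sub>R e j) = fld c k K t (cstate c p e)"
  by (simp add: ctan_def fld_def cstate_def D_sum[OF assms])

lemma frame_eq_cont: "frame_eq I \<sigma> E k K \<Longrightarrow> continuous_on I \<sigma>"
  unfolding frame_eq_def continuous_on_eq_continuous_within using has_velocity_cont by blast

lemma frame_eq_chartD:
  assumes "frame_eq I \<sigma> E k K" "t \<in> I" "c \<in> atl" "\<sigma> t \<in> cdom c"
  shows "((\<lambda>s. cstate c (\<sigma> s) (\<lambda>i. E i s)) has_vector_derivative fld c k K t (cstate c (\<sigma> t) (\<lambda>i. E i t))) (at t within I)"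
proof -
  have "continuous (at t within I) \<sigma>"
    using frame_eq_cont[OF assms(1)] assms(2) continuous_on_eq_continuous_within by blast
  from tangent_iff[where E=E, OF assms(3,4,2) this] show ?thesis
    unfolding fld_cstate[OF assms(3,4), symmetric]
    by (rule iffD1) (rule assms(1)[unfolded frame_eq_def, THEN bspec, OF assms(2)])
qed

definition chart_curve :: "('m, 'e) chart \<Rightarrow> (real \<Rightarrow> 'e \<times> ('e ^ 'e frame_index)) \<Rightarrow> real \<Rightarrow> 'm" where
  "chart_curve c y t = cinv c (fst (y t))"

definition chart_frame :: "('m, 'e) chart \<Rightarrow> (real \<Rightarrow> 'e \<times> ('e ^ 'e frame_index)) \<Rightarrow> 'e frame_index \<Rightarrow> real \<Rightarrow> 'e" where
  "chart_frame c y i t = cf c (snd (y t) $ i) (chart_curve c y t)"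

lemma cstate_chart_curve:
  assumes "c \<in> atl" "fst (y t) \<in> cimg c"
  shows "cstate c (chart_curve c y t) (\<lambda>i. chart_frame c y i t) = y t"
  using assms by (simp add: cstate_def chart_frame_def chart_curve_def cmap_cinv cinv_in vec_lambda_eta)

lemma cstate_inject:
  assumes c: "c \<in> atl" "p \<in> cdom c" "q \<in> cdom c" and eq: "cstate c p e = cstate c q e'"
  shows "p = q" "e i = e' i"
proof -
  show "p = q" using eq inj_chart[OF c(1)] c unfolding cstate_def by (auto dest: inj_onD)
  then show "e i = e' i"
    using eq D_inject[OF c(1,2)] unfolding cstate_def by (auto simp: vec_eq_iff)
qed

lemma frame_eq_chartI:
  assumes c: "c \<in> atl"
    and in_chart: "\<And>t. t \<in> I \<Longrightarrow> fst (y t) \<in> cimg c"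
    and y: "\<And>t. t \<in> I \<Longrightarrow> (y has_vector_derivative fld c k K t (y t)) (at t within I)"
  shows "frame_eq I (chart_curve c y) (chart_frame c y) k K"
  unfolding frame_eq_def
proof
  fix t assume t: "t \<in> I"
  have "continuous_on I y"
    unfolding continuous_on_eq_continuous_within using has_vector_derivative_continuous[OF y] by blast
  then have "continuous_on I (chart_curve c y)" unfolding chart_curve_def
    by (intro continuous_on_compose2[OF continuous_cinv[OF c]] continuous_on_fst) (use in_chart in auto)
  then have cont: "continuous (at t within I) (chart_curve c y)"
    using t continuous_on_eq_continuous_within by blast
  have p: "chart_curve c y t \<in> cdom c" using in_chart[OF t] by (simp add: chart_curve_def cinv_in)
  have "((\<lambda>s. cstate c (chart_curve c y s) (\<lambda>i. chart_frame c y i s)) has_vector_derivative fld c k K t (y t)) (at t within I)"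
    using y[OF t] unfolding has_vector_derivative_def
    by (rule has_derivative_transform[OF t, rotated]) (rule cstate_chart_curve[OF c in_chart])
  then show "has_velocity atl I (chart_curve c y) t (\<Sum>j\<in>UNIV. k j *\<^sub>R chart_frame c y j t) \<and>
     (\<forall>i. has_cov_deriv atl nab I (chart_curve c y) (chart_frame c y i) t (\<Sum>j\<in>UNIV. K t i j *\<^sub>R chart_frame c y j t))"
    unfolding tangent_iff[where E="chart_frame c y", OF c p t cont]
      fld_cstate[OF c p, of "\<lambda>i. chart_frame c y i t" k K t] cstate_chart_curve[where y=y and t=t, OF c in_chart[OF t]] .
qed

lemma fld_has_derivative:
  assumes c: "c \<in> atl" and y: "fst y \<in> cimg c"
  shows "(fld c k K t has_derivative dfld c k K t y) (at y)"
proof -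
  have nth: "((\<lambda>y. snd y $ i) has_derivative (\<lambda>z. snd z $ i)) (at y)" for i :: "'e frame_index" and y :: "'e \<times> ('e ^ 'e frame_index)"
    by (intro bounded_linear_imp_has_derivative bounded_linear_compose[OF bounded_linear_vec_nth bounded_linear_snd])
  have lin: "((\<lambda>y. \<Sum>j\<in>UNIV. a j *\<^sub>R snd y $ j) has_derivative (\<lambda>z. \<Sum>j\<in>UNIV. a j *\<^sub>R snd z $ j)) (at y)"
    for a :: "'e frame_index \<Rightarrow> real" and y :: "'e \<times> ('e ^ 'e frame_index)"
    by (intro has_derivative_sum has_derivative_scaleR_right nth)
  have Gd: "((\<lambda>y. Gam c (fst y) (u y) (v y)) has_derivative
      (\<lambda>z. bil_deriv (Gam c) (fst y) (fst z) (u y) (v y) + Gam c (fst y) (u' z) (v y) + Gam c (fst y) (u y) (v' z))) (at y)"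
    if "(u has_derivative u') (at y)" "(v has_derivative v') (at y)" for u v u' v'
    using that by (intro sb_has_derivative[where x=fst, OF open_cimg[OF c] Gam_smooth_bilinear[OF c]] y
        has_derivative_fst has_derivative_ident)
  show ?thesis
    unfolding fld_def[abs_def] dfld_def[abs_def]
    by (intro has_derivative_Pair has_derivative_vec_lambda has_derivative_diff lin nth Gd)
qed

text \<open>\<open>Blinfun\<close> returns the intended operator where \<open>dfld\<close> is
  bounded linear, which is guaranteed over the image of the chart.\<close>

definition bfld where "bfld c k K t y = Blinfun (dfld c k K t y)"

lemma bfld: "c \<in> atl \<Longrightarrow> fst y \<in> cimg c \<Longrightarrow> blinfun_apply (bfld c k K t y) = dfld c k K t y"
  unfolding bfld_def
  by (intro bounded_linear_Blinfun_apply has_derivative_bounded_linear[OF fld_has_derivative])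

lemma fld_continuous:
  assumes c: "c \<in> atl" and K: "\<And>i j. continuous_on I (\<lambda>t. K t i j)"
  shows "continuous_on (I \<times> (cimg c \<times> UNIV)) (\<lambda>(t, y). fld c k K t y)"
proof -
  have K': "continuous_on (I \<times> (cimg c \<times> UNIV)) (\<lambda>p. K (fst p) i j)" for i j
    by (rule continuous_on_compose2[OF K]) (auto intro!: continuous_intros)
  show ?thesis
    unfolding case_prod_beta fld_def
    by (intro continuous_intros K' sb_continuous_on[OF open_cimg[OF c] Gam_smooth_bilinear[OF c]]) auto
qed

lemma bfld_continuous:
  assumes c: "c \<in> atl" and K: "\<And>i j. continuous_on I (\<lambda>t. K t i j)"
  shows "continuous_on (I \<times> (cimg c \<times> UNIV)) (\<lambda>(t, y). bfld c k K t y)"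
proof (rule continuous_on_blinfun_componentwise)
  fix z :: "'e \<times> ('e ^ 'e frame_index)"
  have K': "continuous_on (I \<times> (cimg c \<times> UNIV)) (\<lambda>p. K (fst p) i j)" for i j
    by (rule continuous_on_compose2[OF K]) (auto intro!: continuous_intros)
  have "continuous_on (I \<times> (cimg c \<times> UNIV)) (\<lambda>p. dfld c k K (fst p) (snd p) z)"
    unfolding dfld_def
    by (intro continuous_intros K' sb_continuous_on[OF open_cimg[OF c] Gam_smooth_bilinear[OF c]]
       sb_deriv_continuous_on[OF open_cimg[OF c] Gam_smooth_bilinear[OF c]]) auto
  then show "continuous_on (I \<times> (cimg c \<times> UNIV)) (\<lambda>p. blinfun_apply (case p of (t, y) \<Rightarrow> bfld c k K t y) z)"
    by (rule continuous_on_eq) (auto simp: bfld[OF c])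
qed

text \<open>With Christoffel symbols \<open>\<Gamma>\<close> in a chart, \<open>\<delta>E\<^sub>i = \<nabla>E\<^sub>i - \<Gamma>(X, E\<^sub>i)\<close>; the terms of the linearized
  system that are not tensorial combine to the curvature.\<close>

lemma jacobi_chart:
  assumes c: "c \<in> atl" "\<sigma> t \<in> cdom c" and t: "t \<in> I" and eq: "frame_eq I \<sigma> E k K"
  shows "has_cov_deriv atl nab I \<sigma> X t (\<Sum>j\<in>UNIV. k j *\<^sub>R Y j t) \<and>
    (\<forall>i. has_cov_deriv atl nab I \<sigma> (Y i) t ((\<Sum>j\<in>UNIV. K t i j *\<^sub>R Y j t) +
        curvature atl nab (\<sigma> t) (\<Sum>j\<in>UNIV. k j *\<^sub>R E j t) (X t) (E i t))) \<longleftrightarrow>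
    ((\<lambda>s. ctan c (\<sigma> s) (\<lambda>i. E i s) (X s) (\<lambda>i. Y i s)) has_vector_derivative
       dfld c k K t (cstate c (\<sigma> t) (\<lambda>i. E i t)) (ctan c (\<sigma> t) (\<lambda>i. E i t) (X t) (\<lambda>i. Y i t))) (at t within I)"
proof -
  let ?v = "\<Sum>j\<in>UNIV. k j *\<^sub>R E j t"
  define x where "x = cmap c (\<sigma> t)"
  define e where "e i = D c (\<sigma> t) (E i t)" for i
  define w where "w = (\<Sum>j\<in>UNIV. k j *\<^sub>R e j)"
  define z where "z = D c (\<sigma> t) (X t)"
  define y where "y i = D c (\<sigma> t) (Y i t)" for i
  let ?G = "Gam c x"
  have xin: "x \<in> cimg c" using c by (simp add: x_def)
  have vel: "has_velocity atl I \<sigma> t ?v" and cov: "\<And>i. has_cov_deriv atl nab I \<sigma> (E i) t (\<Sum>j\<in>UNIV. K t i j *\<^sub>R E j t)"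
    using eq t unfolding frame_eq_def by auto
  have Dv: "D c (\<sigma> t) ?v = w" by (simp add: w_def e_def D_sum[OF c])
  have bil: "bilinear ?G" by (rule sb_bilinear[OF open_cimg Gam_smooth_bilinear, OF c(1) c(1) xin])
  note bs = bilinear_ladd[OF bil] bilinear_radd[OF bil] bilinear_lsub[OF bil] bilinear_rsub[OF bil]
  have sym: "?G u v = ?G v u" for u v unfolding x_def by (rule Gam_sym[OF c])
  have gsum: "?G u (\<Sum>j\<in>UNIV. a j *\<^sub>R e j) = (\<Sum>j\<in>UNIV. a j *\<^sub>R ?G u (e j))" for u a
    using bil by (simp add: bilinear_def linear_sum linear_cmul)
  have xd: "((\<lambda>s. cmap c (\<sigma> s)) has_vector_derivative w) (at t within I)"
    using has_velocity_chartD[OF vel c] Dv by simp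
  have ed: "((\<lambda>s. D c (\<sigma> s) (E i s)) has_vector_derivative (\<Sum>j\<in>UNIV. K t i j *\<^sub>R e j) - ?G w (e i)) (at t within I)" for i
    using has_cov_deriv_chartD[OF cov vel c, of i] Dv by (simp add: D_sum[OF c] e_def x_def)
  have Xiff: "has_cov_deriv atl nab I \<sigma> X t (\<Sum>j\<in>UNIV. k j *\<^sub>R Y j t) \<longleftrightarrow>
     ((\<lambda>s. D c (\<sigma> s) (X s)) has_vector_derivative (\<Sum>j\<in>UNIV. k j *\<^sub>R y j) - ?G w z) (at t within I)"
    by (simp only: has_cov_deriv_chart_iff[OF vel c t] Dv) (simp only: D_sum[OF c] y_def x_def z_def)
  have "D c (\<sigma> t) (curvature atl nab (\<sigma> t) ?v (X t) (E i t)) = Rc c x w z (e i)" for i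
    unfolding curvature_chart[OF c] Dv by (simp add: x_def z_def e_def)
  note RD = this
  have Yiff: "has_cov_deriv atl nab I \<sigma> (Y i) t ((\<Sum>j\<in>UNIV. K t i j *\<^sub>R Y j t) + curvature atl nab (\<sigma> t) ?v (X t) (E i t)) \<longleftrightarrow>
     ((\<lambda>s. D c (\<sigma> s) (Y i s)) has_vector_derivative (\<Sum>j\<in>UNIV. K t i j *\<^sub>R y j) + Rc c x w z (e i) - ?G w (y i)) (at t within I)" for i
    by (simp only: has_cov_deriv_chart_iff[OF vel c t] Dv linear_add[OF chart_deriv_linear[OF c]] RD)
      (simp only: D_sum[OF c] y_def x_def)
  define Xd where "Xd = (\<Sum>j\<in>UNIV. k j *\<^sub>R y j) - ?G w z"
  \<comment> \<open>The derivative of the correction \<open>Gam (X, E i)\<close> along the curve. It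
    contains the derivative of \<open>X\<close>, so the equations for \<open>Y i\<close> are
    translated under the equation for \<open>X\<close>, and the equivalence is shown for the whole
    system.\<close>
  define gd where "gd i = bil_deriv (Gam c) x w z (e i) + ?G Xd (e i) + ?G z ((\<Sum>j\<in>UNIV. K t i j *\<^sub>R e j) - ?G w (e i))" for i
  have Gd: "((\<lambda>s. Gam c (cmap c (\<sigma> s)) (D c (\<sigma> s) (X s)) (D c (\<sigma> s) (E i s))) has_vector_derivative gd i) (at t within I)"
    if Xd: "((\<lambda>s. D c (\<sigma> s) (X s)) has_vector_derivative Xd) (at t within I)" for i
  proof -
    have "((\<lambda>s. Gam c (cmap c (\<sigma> s)) (D c (\<sigma> s) (X s)) (D c (\<sigma> s) (E i s))) has_derivative
      (\<lambda>h. bil_deriv (Gam c) x (h *\<^sub>R w) z (e i) + ?G (h *\<^sub>R Xd) (e i) + ?G z (h *\<^sub>R ((\<Sum>j\<in>UNIV. K t i j *\<^sub>R e j) - ?G w (e i))))) (at t within I)"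
      using Xd xd ed[of i] sb_has_derivative[OF open_cimg[OF c(1)] Gam_smooth_bilinear[OF c(1)], of "\<lambda>s. cmap c (\<sigma> s)" _ t I]
        xin unfolding has_vector_derivative_def x_def z_def e_def by blast
    then show ?thesis unfolding has_vector_derivative_def gd_def
      by (simp add: bilinear_lmul[OF bil] bilinear_rmul[OF bil] scaleR_add_right
          linear_cmul[OF sb_deriv_linear[OF open_cimg[OF c(1)] Gam_smooth_bilinear[OF c(1)] xin]])
  qed
  \<comment> \<open>Torsion-freeness enters here: the Christoffel terms \<open>?G z w\<close> and
    \<open>?G w z\<close> agree.\<close>
  have fst_eq: "(\<Sum>j\<in>UNIV. k j *\<^sub>R (y j - ?G z (e j))) = Xd"
    by (simp add: Xd_def scaleR_diff_right sum_subtractf w_def gsum[symmetric] sym)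
  \<comment> \<open>The derivative of \<open>Gam\<close> in direction \<open>z\<close> comes from
    linearizing the field, the one in direction \<open>w\<close> from \<open>gd\<close>; their
    difference and the quadratic terms form \<open>Rc c x w z (e i)\<close>.\<close>
  have snd_eq: "(\<Sum>j\<in>UNIV. K t i j *\<^sub>R (y j - ?G z (e j))) -
       (bil_deriv (Gam c) x z w (e i) + ?G (\<Sum>j\<in>UNIV. k j *\<^sub>R (y j - ?G z (e j))) (e i) + ?G w (y i - ?G z (e i))) =
      (\<Sum>j\<in>UNIV. K t i j *\<^sub>R y j) + Rc c x w z (e i) - ?G w (y i) - gd i" for i
    unfolding fst_eq gd_def Rc_def
    by (simp add: scaleR_diff_right sum_subtractf gsum[symmetric] bs)
  have iff: "((\<lambda>s. ctan c (\<sigma> s) (\<lambda>i. E i s) (X s) (\<lambda>i. Y i s)) has_vector_derivative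
       dfld c k K t (cstate c (\<sigma> t) (\<lambda>i. E i t)) (ctan c (\<sigma> t) (\<lambda>i. E i t) (X t) (\<lambda>i. Y i t))) (at t within I) \<longleftrightarrow>
    ((\<lambda>s. D c (\<sigma> s) (X s)) has_vector_derivative Xd) (at t within I) \<and>
    (\<forall>i. ((\<lambda>s. D c (\<sigma> s) (Y i s) - Gam c (cmap c (\<sigma> s)) (D c (\<sigma> s) (X s)) (D c (\<sigma> s) (E i s))) has_vector_derivative
       (\<Sum>j\<in>UNIV. K t i j *\<^sub>R y j) + Rc c x w z (e i) - ?G w (y i) - gd i) (at t within I))"
    unfolding ctan_def dfld_def cstate_def fst_conv snd_conv has_vector_derivative_Pair_iff has_vector_derivative_vec_lambda_iff
    by (simp add: x_def[symmetric] z_def[symmetric] e_def[symmetric] y_def[symmetric] w_def[symmetric] snd_eq)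
      (simp add: fst_eq)
  show ?thesis unfolding iff Xiff Yiff Xd_def[symmetric]
  proof (intro iffI conjI allI; (elim conjE)?)
    fix i
    assume X: "((\<lambda>s. D c (\<sigma> s) (X s)) has_vector_derivative Xd) (at t within I)"
    { assume "\<forall>i. ((\<lambda>s. D c (\<sigma> s) (Y i s)) has_vector_derivative (\<Sum>j\<in>UNIV. K t i j *\<^sub>R y j) + Rc c x w z (e i) - ?G w (y i)) (at t within I)"
      then show "((\<lambda>s. D c (\<sigma> s) (Y i s) - Gam c (cmap c (\<sigma> s)) (D c (\<sigma> s) (X s)) (D c (\<sigma> s) (E i s))) has_vector_derivative
       (\<Sum>j\<in>UNIV. K t i j *\<^sub>R y j) + Rc c x w z (e i) - ?G w (y i) - gd i) (at t within I)"
        by (intro has_vector_derivative_diff Gd[OF X]) blast }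
    { assume "\<forall>i. ((\<lambda>s. D c (\<sigma> s) (Y i s) - Gam c (cmap c (\<sigma> s)) (D c (\<sigma> s) (X s)) (D c (\<sigma> s) (E i s))) has_vector_derivative
       (\<Sum>j\<in>UNIV. K t i j *\<^sub>R y j) + Rc c x w z (e i) - ?G w (y i) - gd i) (at t within I)"
      from has_vector_derivative_add[OF this[THEN spec, of i] Gd[OF X, of i]]
      show "((\<lambda>s. D c (\<sigma> s) (Y i s)) has_vector_derivative (\<Sum>j\<in>UNIV. K t i j *\<^sub>R y j) + Rc c x w z (e i) - ?G w (y i)) (at t within I)"
        by simp }
  qed
qed

end

section \<open>Families of solutions in one chart\<close>

context riemannian_manifold
begin

definition jacobi_eq :: "real set \<Rightarrow> (real \<Rightarrow> 'm) \<Rightarrow> ('e frame_index \<Rightarrow> real \<Rightarrow> 'e) \<Rightarrow>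
    ('e frame_index \<Rightarrow> real) \<Rightarrow> (real \<Rightarrow> 'e frame_index \<Rightarrow> 'e frame_index \<Rightarrow> real) \<Rightarrow>
    (real \<Rightarrow> 'e) \<Rightarrow> ('e frame_index \<Rightarrow> real \<Rightarrow> 'e) \<Rightarrow> bool" where
  "jacobi_eq I \<sigma> E k K X Y \<longleftrightarrow> (\<forall>t\<in>I. has_cov_deriv atl nab I \<sigma> X t (\<Sum>j\<in>UNIV. k j *\<^sub>R Y j t) \<and>
    (\<forall>i. has_cov_deriv atl nab I \<sigma> (Y i) t ((\<Sum>j\<in>UNIV. K t i j *\<^sub>R Y j t) +
        curvature atl nab (\<sigma> t) (\<Sum>j\<in>UNIV. k j *\<^sub>R E j t) (X t) (E i t))))"

text \<open>Only the filter at 0 matters, so \<open>UNIV\<close> represents every open parameter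
  interval around 0.\<close>

definition has_frame_deriv :: "(real \<Rightarrow> 'm) \<Rightarrow> ('e frame_index \<Rightarrow> real \<Rightarrow> 'e) \<Rightarrow> 'e \<Rightarrow> ('e frame_index \<Rightarrow> 'e) \<Rightarrow> bool" where
  "has_frame_deriv p e X Y \<longleftrightarrow> has_velocity atl UNIV p 0 X \<and> (\<forall>i. has_cov_deriv atl nab UNIV p (e i) 0 (Y i))"

lemma has_frame_deriv_chartD:
  assumes "has_frame_deriv p e X Y" "c \<in> atl" "p 0 \<in> cdom c"
  shows "((\<lambda>\<tau>. cstate c (p \<tau>) (\<lambda>i. e i \<tau>)) has_vector_derivative ctan c (p 0) (\<lambda>i. e i 0) X Y) (at 0)"
  using assms(1) tangent_iff[where I=UNIV and E=e and \<sigma>=p and t=0, OF assms(2,3) UNIV_I, of X Y]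
  unfolding has_frame_deriv_def using has_velocity_cont by blast

text \<open>Convergence of the points in the manifold is recovered through \<open>cinv c\<close>.
  The condition \<open>ev\<close> ensures that coordinates determine the points, since a chart map
  is arbitrary outside its domain.\<close>

lemma has_frame_deriv_chartI:
  assumes c: "c \<in> atl" "p 0 \<in> cdom c" and ev: "\<forall>\<^sub>F \<tau> in at 0. p \<tau> \<in> cdom c"
    and der: "((\<lambda>\<tau>. cstate c (p \<tau>) (\<lambda>i. e i \<tau>)) has_vector_derivative ctan c (p 0) (\<lambda>i. e i 0) X Y) (at 0)"
  shows "has_frame_deriv p e X Y"
proof -
  have "((\<lambda>\<tau>. cmap c (p \<tau>)) has_vector_derivative D c (p 0) X) (at 0)"
    using der unfolding cstate_def ctan_def has_vector_derivative_Pair_iff by blast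
  from has_vector_derivative_continuous[OF this]
  have "((\<lambda>\<tau>. cmap c (p \<tau>)) \<longlongrightarrow> cmap c (p 0)) (at 0)" unfolding continuous_at .
  moreover have "isCont (cinv c) (cmap c (p 0))"
    using continuous_cinv[OF c(1)] c open_cimg[OF c(1)] by (simp add: continuous_on_eq_continuous_at)
  ultimately have "((\<lambda>\<tau>. cinv c (cmap c (p \<tau>))) \<longlongrightarrow> p 0) (at 0)"
    using isCont_tendsto_compose cinv_cmap[OF c] by fastforce
  then have "(p \<longlongrightarrow> p 0) (at 0)"
    by (rule Lim_transform_eventually) (use ev cinv_cmap[OF c(1)] in \<open>auto elim: eventually_mono\<close>)
  then have "continuous (at 0 within UNIV) p" by (simp add: continuous_at)
  from tangent_iff[where E=e and \<sigma>=p and t=0, OF c UNIV_I this] der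
  show ?thesis unfolding has_frame_deriv_def by blast
qed

lemma chart_tube:
  assumes c: "c \<in> atl" and K: "\<And>i j. continuous_on {a..b} (\<lambda>t. K t i j)"
    and base: "frame_eq {a..b} \<gamma> E k K" and in_c: "\<And>t. t \<in> {a..b} \<Longrightarrow> \<gamma> t \<in> cdom c"
    and y0_def: "y0 = (\<lambda>t. cstate c (\<gamma> t) (\<lambda>i. E i t))"
  obtains r M where "r > 0" "M > 0" "\<And>t. t \<in> {a..b} \<Longrightarrow> cball (y0 t) r \<subseteq> cimg c \<times> UNIV"
    "\<And>t. t \<in> {a..b} \<Longrightarrow> norm (bfld c k K t (y0 t)) \<le> M"
    "\<And>t y w. t \<in> {a..b} \<Longrightarrow> y \<in> cball (y0 t) r \<Longrightarrow> w \<in> cball (y0 t) r \<Longrightarrow>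
        norm (fld c k K t y - fld c k K t w) \<le> M * norm (y - w)"
    "\<And>e. e > 0 \<Longrightarrow> \<exists>d>0. \<forall>t\<in>{a..b}. \<forall>y\<in>cball (y0 t) d.
        norm (fld c k K t y - fld c k K t (y0 t) - bfld c k K t (y0 t) (y - y0 t)) \<le> e * norm (y - y0 t)"
    "\<And>t. t \<in> {a..b} \<Longrightarrow> (y0 has_vector_derivative fld c k K t (y0 t)) (at t within {a..b})"
    "continuous_on {a..b} y0"
proof -
  have der: "(y0 has_vector_derivative fld c k K t (y0 t)) (at t within {a..b})" if "t \<in> {a..b}" for t
    unfolding y0_def by (rule frame_eq_chartD[OF base that c in_c[OF that]])
  have cont: "continuous_on {a..b} y0"
    unfolding continuous_on_eq_continuous_within using has_vector_derivative_continuous[OF der] by blast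
  have sub: "y0 ` {a..b} \<subseteq> cimg c \<times> UNIV" using in_c by (auto simp: y0_def cstate_def)
  have op: "open (cimg c \<times> (UNIV :: ('e ^ 'e frame_index) set))" by (intro open_Times open_cimg c open_UNIV)
  show thesis
  proof (rule tube_bounds[OF op cont sub, where f="fld c k K" and f'="bfld c k K"])
    show "(fld c k K t has_derivative blinfun_apply (bfld c k K t y)) (at y)" if "y \<in> cimg c \<times> UNIV" for t y
      using fld_has_derivative[OF c, of y k K t] bfld[OF c, of y k K t] that by auto
    show "continuous_on ({a..b} \<times> cimg c \<times> UNIV) (\<lambda>(t, y). bfld c k K t y)" by (rule bfld_continuous[OF c K])
    fix r M assume r: "(0::real) < r" "(0::real) < M" "\<And>t. t \<in> {a..b} \<Longrightarrow> cball (y0 t) r \<subseteq> cimg c \<times> UNIV"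
      and b: "\<And>t y. t \<in> {a..b} \<Longrightarrow> y \<in> cball (y0 t) r \<Longrightarrow> norm (bfld c k K t y) \<le> M"
      and l: "\<And>t y w. t \<in> {a..b} \<Longrightarrow> y \<in> cball (y0 t) r \<Longrightarrow> w \<in> cball (y0 t) r \<Longrightarrow>
        norm (fld c k K t y - fld c k K t w) \<le> M * norm (y - w)"
      and d: "\<And>e. e > 0 \<Longrightarrow> \<exists>d>0. \<forall>t\<in>{a..b}. \<forall>y\<in>cball (y0 t) d.
        norm (fld c k K t y - fld c k K t (y0 t) - bfld c k K t (y0 t) (y - y0 t)) \<le> e * norm (y - y0 t)"
    show thesis by (rule that[OF r b l d der cont]) (use r(1) in auto)
  qed
qed

text \<open>Serves both directions: the family may have been constructed or be given, and in either
  case the candidate for its derivative is a solution of the linearized system.\<close>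

lemma frame_deriv_in_tube:
  assumes c: "c \<in> atl" and base: "frame_eq {a..b} \<gamma> E k K"
    and in_c: "\<And>t. t \<in> {a..b} \<Longrightarrow> \<gamma> t \<in> cdom c"
    and y0_def: "y0 = (\<lambda>t. cstate c (\<gamma> t) (\<lambda>i. E i t))"
    and tube: "r > 0" "M > 0" 
    "\<And>t. t \<in> {a..b} \<Longrightarrow> norm (bfld c k K t (y0 t)) \<le> M"
    "\<And>t y w. t \<in> {a..b} \<Longrightarrow> y \<in> cball (y0 t) r \<Longrightarrow> w \<in> cball (y0 t) r \<Longrightarrow>
        norm (fld c k K t y - fld c k K t w) \<le> M * norm (y - w)"
    "\<And>e. e > 0 \<Longrightarrow> \<exists>d>0. \<forall>t\<in>{a..b}. \<forall>y\<in>cball (y0 t) d.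
        norm (fld c k K t y - fld c k K t (y0 t) - bfld c k K t (y0 t) (y - y0 t)) \<le> e * norm (y - y0 t)"
    "\<And>t. t \<in> {a..b} \<Longrightarrow> (y0 has_vector_derivative fld c k K t (y0 t)) (at t within {a..b})"
    and jac: "jacobi_eq {a..b} \<gamma> E k K X Y"
    and fam: "\<forall>\<^sub>F \<tau> in at 0. frame_eq {a..b} (G \<tau>) (F \<tau>) k K \<and> (\<forall>t\<in>{a..b}. G \<tau> t \<in> cdom c \<and>
        cstate c (G \<tau> t) (\<lambda>i. F \<tau> i t) \<in> cball (y0 t) r)"
    and G0: "\<And>t. t \<in> {a..b} \<Longrightarrow> G 0 t = \<gamma> t" "\<And>t i. t \<in> {a..b} \<Longrightarrow> F 0 i t = E i t"
    and init: "has_frame_deriv (\<lambda>\<tau>. G \<tau> a) (\<lambda>i \<tau>. F \<tau> i a) (X a) (\<lambda>i. Y i a)"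
    and t: "t \<in> {a..b}"
  shows "has_frame_deriv (\<lambda>\<tau>. G \<tau> t) (\<lambda>i \<tau>. F \<tau> i t) (X t) (\<lambda>i. Y i t)"
proof -
  have a: "a \<in> {a..b}" using t by auto
  define \<xi> where "\<xi> s = ctan c (\<gamma> s) (\<lambda>i. E i s) (X s) (\<lambda>i. Y i s)" for s
  define y where "y \<tau> s = cstate c (G \<tau> s) (\<lambda>i. F \<tau> i s)" for \<tau> s
  have y0in: "fst (y0 s) \<in> cimg c" if "s \<in> {a..b}" for s using in_c[OF that] by (simp add: y0_def cstate_def)
  have base_eq: "y 0 s = y0 s" if "s \<in> {a..b}" for s using G0 that by (simp add: y_def y0_def)
  have "((\<lambda>\<tau>. y \<tau> t) has_vector_derivative \<xi> t) (at 0)"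
  proof (rule ode_differentiable_dependence[where f="fld c k K" and f'="bfld c k K" and K=M and r=r and ?y0.0=y0, OF _ tube(3-5)])
    fix s assume s: "s \<in> {a..b}"
    show "(\<xi> has_vector_derivative blinfun_apply (bfld c k K s (y0 s)) (\<xi> s)) (at s within {a..b})"
      unfolding bfld[OF c y0in[OF s]] unfolding \<xi>_def y0_def
      by (rule iffD1[OF jacobi_chart[OF c in_c[OF s] s base]]) (rule jac[unfolded jacobi_eq_def, THEN bspec, OF s])
  next
    show "\<forall>\<^sub>F \<tau> in at 0. \<forall>t\<in>{a..b}. (y \<tau> has_vector_derivative fld c k K t (y \<tau> t)) (at t within {a..b}) \<and> y \<tau> t \<in> cball (y0 t) r"
      using fam
    proof eventually_elim
      case (elim \<tau>)
      then have fe: "frame_eq {a..b} (G \<tau>) (F \<tau>) k K" by blast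
      show ?case
      proof (intro ballI conjI)
        fix s assume s: "s \<in> {a..b}"
        have Gs: "G \<tau> s \<in> cdom c" using elim s by blast
        show "(y \<tau> has_vector_derivative fld c k K s (y \<tau> s)) (at s within {a..b})"
          unfolding y_def[abs_def] by (rule frame_eq_chartD[OF fe s c Gs])
        show "y \<tau> s \<in> cball (y0 s) r" unfolding y_def using elim s by blast
      qed
    qed
  next
    show "((\<lambda>\<tau>. y \<tau> a) has_vector_derivative \<xi> a) (at 0)"
      using has_frame_deriv_chartD[OF init c] in_c[OF a] G0[OF a] unfolding y_def \<xi>_def by simp
  qed (use tube base_eq t in auto)
  then show ?thesis
    using in_c[OF t] G0[OF t] unfolding y_def \<xi>_def
    by (intro has_frame_deriv_chartI[OF c]) (use fam t in \<open>auto elim: eventually_mono\<close>)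
qed

text \<open>A solution that starts near the base curve cannot leave the chart: up to a first exit time it stays
  in a compact part of the chart domain, which is closed because the manifold is Hausdorff.\<close>

lemma stays_in_tube:
  assumes c: "c \<in> atl" and sol: "frame_eq {a..b} G F k K"
    and r: "r > 0" and M: "M > 0"
    and sub: "\<And>t. t \<in> {a..b} \<Longrightarrow> cball (y0 t) r \<subseteq> cimg c \<times> UNIV"
    and lip: "\<And>t y w. t \<in> {a..b} \<Longrightarrow> y \<in> cball (y0 t) r \<Longrightarrow> w \<in> cball (y0 t) r \<Longrightarrow>
        norm (fld c k K t y - fld c k K t w) \<le> M * norm (y - w)"
    and y0: "\<And>t. t \<in> {a..b} \<Longrightarrow> (y0 has_vector_derivative fld c k K t (y0 t)) (at t within {a..b})"
    and init: "G a \<in> cdom c" "2 * exp (2 * M * (b - a)) * norm (cstate c (G a) (\<lambda>i. F i a) - y0 a) \<le> r / 2"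
    and t: "t \<in> {a..b}"
  shows "G t \<in> cdom c \<and> cstate c (G t) (\<lambda>i. F i t) \<in> cball (y0 t) r"
proof -
  define z where "z t = cstate c (G t) (\<lambda>i. F i t)" for t
  \<comment> \<open>The bound \<open>r / 2\<close> leaves a margin: by continuity a bound by
    \<open>r\<close> persists a little longer, and the Gronwall estimate in \<open>gron\<close>
    improves it to \<open>r / 2\<close> again.\<close>
  define P where "P t \<longleftrightarrow> G t \<in> cdom c \<and> norm (z t - y0 t) \<le> r / 2" for t
  have zd: "(z has_vector_derivative fld c k K t (z t)) (at t within {a..b})" if "t \<in> {a..b}" "G t \<in> cdom c" for t
    unfolding z_def[abs_def] by (rule frame_eq_chartD[OF sol that(1) c that(2)])
  have y0c: "continuous_on {a..b} y0"
    unfolding continuous_on_eq_continuous_within using has_vector_derivative_continuous[OF y0] by blast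
  have gron: "P t" if t: "t \<in> {a..b}" and *: "\<And>u. u \<in> {a..t} \<Longrightarrow> G u \<in> cdom c \<and> norm (z u - y0 u) \<le> r" for t
  proof -
    have "norm (z t - y0 t) \<le> 2 * exp (2 * M * (t - a)) * (norm (z a - y0 a) + 0 * (t - a))"
    proof (rule norm_le_weighted_gronwall[where z="\<lambda>s. z s - y0 s" and b=t])
      fix u assume u: "u \<in> {a..t}"
      then have u': "u \<in> {a..b}" using t by auto
      show "((\<lambda>s. z s - y0 s) has_vector_derivative fld c k K u (z u) - fld c k K u (y0 u)) (at u within {a..t})"
        by (rule has_vector_derivative_within_subset[OF has_vector_derivative_diff[OF zd[OF u'] y0[OF u']]])
          (use * u t in auto)
      show "norm (fld c k K u (z u) - fld c k K u (y0 u)) \<le> M * norm (z u - y0 u) + 0"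
        using lip[OF u', of "z u" "y0 u"] *[OF u] r by (simp add: dist_norm norm_minus_commute)
    qed (use M t in auto)
    also have "\<dots> \<le> 2 * exp (2 * M * (b - a)) * norm (z a - y0 a)"
      using t M by (intro mult_mono) auto
    also have "\<dots> \<le> r / 2" using init(2) by (simp add: z_def)
    finally show ?thesis unfolding P_def using *[of t] t by auto
  qed
  have Pa: "P a"
  proof -
    have "1 * norm (z a - y0 a) \<le> 2 * exp (2 * M * (b - a)) * norm (z a - y0 a)"
    proof (rule mult_right_mono)
      have "1 \<le> exp (2 * M * (b - a))" using M t by simp
      then show "1 \<le> 2 * exp (2 * M * (b - a))" by linarith
    qed simp
    then show ?thesis using init unfolding P_def z_def by simp
  qed
  have Gcont: "(G \<longlongrightarrow> G s) (at s within {a..b})" if "s \<in> {a..b}" for s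
    using frame_eq_cont[OF sol] that unfolding continuous_on_def by blast
  have "\<forall>t\<in>{a..b}. P t"
  proof (rule ccontr)
    assume "\<not> (\<forall>t\<in>{a..b}. P t)"
    define S where "S = {t \<in> {a..b}. \<not> P t}"
    define s where "s = Inf S"
    have S: "S \<noteq> {}" "bdd_below S" using \<open>\<not> (\<forall>t\<in>{a..b}. P t)\<close> by (auto simp: S_def intro: bdd_belowI[of _ a])
    have s: "s \<in> {a..b}"
    proof -
      obtain u where "u \<in> S" using S by blast
      then have "s \<le> u" "u \<le> b" unfolding s_def using S(2) by (auto intro: cInf_lower simp: S_def)
      moreover have "a \<le> s" unfolding s_def by (rule cInf_greatest[OF S(1)]) (auto simp: S_def)
      ultimately show ?thesis by simp
    qed
    have before: "P u" if "u \<in> {a..<s}" for u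
    proof (rule ccontr)
      assume "\<not> P u"
      then have "u \<in> S" using that s by (auto simp: S_def)
      then have "s \<le> u" unfolding s_def by (rule cInf_lower[OF _ S(2)])
      then show False using that by simp
    qed
    \<comment> \<open>\<open>P\<close> is known before \<open>s\<close>, and its validity at
      \<open>s\<close> is obtained as a limit from the left. The chart domain is open, so membership
      of the limit needs the closed set constructed below.\<close>
    have Ps: "P s"
    proof (cases "s = a")
      case True then show ?thesis using Pa by simp
    next
      case False
      then have as: "a < s" using s by simp
      have within: "at s within {a..s} = at_left s" by (rule at_within_Icc_at_left[OF as])
      have sub_s: "{a..s} \<subseteq> {a..b}" using s by auto
      have ev: "\<forall>\<^sub>F u in at_left s. P u"
        unfolding eventually_at_left[OF as] using before as by auto
      \<comment> \<open>The closed neighbourhood of radius \<open>r\<close> of the base curve in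
        coordinates, written as a sum of compact sets; the tube condition places it inside the chart
        image.\<close>
      define C where "C = {x + w | x w. x \<in> (\<lambda>t. fst (y0 t)) ` {a..b} \<and> w \<in> cball 0 r}"
      have CI: "p \<in> C" if "u \<in> {a..b}" "norm (p - fst (y0 u)) \<le> r" for u p
      proof -
        have "p = fst (y0 u) + (p - fst (y0 u))" "p - fst (y0 u) \<in> cball 0 r" using that(2) by simp_all
        then show ?thesis unfolding C_def using that(1) by blast
      qed
      have "compact C" unfolding C_def
        by (intro compact_sums compact_continuous_image continuous_on_fst y0c compact_Icc compact_cball)
      moreover have C: "C \<subseteq> cimg c"
      proof
        fix p assume "p \<in> C"
        then obtain u w where u: "u \<in> {a..b}" "p = fst (y0 u) + w" "norm w \<le> r" by (auto simp: C_def)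
        have "(p, snd (y0 u)) \<in> cball (y0 u) r"
          using u by (simp add: dist_prod_def dist_norm prod_eq_iff[symmetric] split: prod.split)
        then show "p \<in> cimg c" using sub[OF u(1)] by auto
      qed
      ultimately have cl: "closed (cinv c ` C)"
        by (intro compact_imp_closed compact_continuous_image continuous_on_subset[OF continuous_cinv[OF c]])
      have evC: "\<forall>\<^sub>F u in at_left s. G u \<in> cinv c ` C"
      proof -
        have *: "\<forall>\<^sub>F u in at_left s. u \<in> {a..b}"
          unfolding eventually_at_left[OF as] using as s by (intro exI[of _ a]) auto
        show ?thesis using ev *
        proof eventually_elim
          case (elim u)
          have "norm (fst (z u - y0 u)) \<le> norm (z u - y0 u)"
            using norm_fst_le[of "fst (z u - y0 u)" "snd (z u - y0 u)"] by (simp only: prod.collapse)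
          then have "fst (z u) \<in> C" using elim r by (intro CI[OF elim(2)]) (auto simp: P_def)
          then show ?case using elim(1) cinv_cmap[OF c] unfolding P_def z_def cstate_def
            by (metis fst_conv image_eqI)
        qed
      qed
      have "(G \<longlongrightarrow> G s) (at_left s)"
        using tendsto_within_subset[OF Gcont[OF s] sub_s] unfolding within .
      from Lim_in_closed_set[OF cl evC trivial_limit_at_left_real this] have "G s \<in> cinv c ` C" .
      then obtain x where x: "G s = cinv c x" "x \<in> C" by (rule imageE)
      have Gs: "G s \<in> cdom c" unfolding x(1) by (rule cinv_in[OF subsetD[OF C x(2)]])
      have "((\<lambda>u. norm (z u - y0 u)) \<longlongrightarrow> norm (z s - y0 s)) (at_left s)"
        unfolding within[symmetric]
        using has_vector_derivative_continuous[OF zd[OF s Gs]] has_vector_derivative_continuous[OF y0[OF s]]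
        unfolding continuous_within by (intro tendsto_intros tendsto_within_subset[OF _ sub_s])
      then have "norm (z s - y0 s) \<le> r / 2"
        by (rule tendsto_upperbound) (use ev in \<open>auto simp: P_def elim: eventually_mono\<close>)
      with Gs show ?thesis by (simp add: P_def)
    qed
    then have Gs: "G s \<in> cdom c" by (simp add: P_def)
    have "((\<lambda>u. norm (z u - y0 u)) \<longlongrightarrow> norm (z s - y0 s)) (at s within {a..b})"
      using has_vector_derivative_continuous[OF zd[OF s Gs]] has_vector_derivative_continuous[OF y0[OF s]]
      unfolding continuous_within by (intro tendsto_intros)
    then have "\<forall>\<^sub>F u in at s within {a..b}. norm (z u - y0 u) < r"
      by (rule order_tendstoD) (use Ps r in \<open>simp add: P_def\<close>)
    moreover have "\<forall>\<^sub>F u in at s within {a..b}. G u \<in> cdom c"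
      by (rule topological_tendstoD[OF Gcont[OF s] open_cdom[OF c] Gs])
    ultimately have "\<forall>\<^sub>F u in at s within {a..b}. G u \<in> cdom c \<and> norm (z u - y0 u) < r"
      by eventually_elim blast
    then obtain d where d: "d > 0" "\<And>u. u \<in> {a..b} \<Longrightarrow> u \<noteq> s \<Longrightarrow> dist u s < d \<Longrightarrow> G u \<in> cdom c \<and> norm (z u - y0 u) < r"
      unfolding eventually_at by blast
    \<comment> \<open>A failure time so close to \<open>s\<close> that the bound by \<open>r\<close>
      holds on all of \<open>{a..u}\<close>; then \<open>gron\<close> applies at \<open>u\<close>
      and contradicts \<open>u \<in> S\<close>.\<close>
    obtain u where u: "u \<in> S" "u < s + d"
      using cInf_lessD[OF S(1), of "s + d"] d(1) unfolding s_def by auto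
    have su: "s \<le> u" unfolding s_def by (rule cInf_lower[OF u(1) S(2)])
    have "P u"
    proof (rule gron)
      show "u \<in> {a..b}" using u by (simp add: S_def)
      fix v assume v: "v \<in> {a..u}"
      then have vab: "v \<in> {a..b}" using u by (auto simp: S_def)
      consider "v < s" | "v = s" | "v > s" by linarith
      then show "G v \<in> cdom c \<and> norm (z v - y0 v) \<le> r"
      proof cases
        case 1 then show ?thesis using before[of v] v r by (auto simp: P_def)
      next
        case 2 then show ?thesis using Ps r by (auto simp: P_def)
      next
        case 3 then show ?thesis using d(2)[OF vab] u v by (auto simp: dist_real_def)
      qed
    qed
    then show False using u by (simp add: S_def)
  qed
  then show ?thesis using t r by (force simp: P_def z_def dist_norm norm_minus_commute)
qed

text \<open>For small \<tau> the initial values lie near the base solution, and the tube around it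
  provides solutions on the full interval \<open>{a..b}\<close>, with one parameter range for all
  times.\<close>

lemma local_variation_exists:
  assumes c: "c \<in> atl" and ab: "a \<le> b" and K: "\<And>i j. continuous_on {a..b} (\<lambda>t. K t i j)"
    and base: "frame_eq {a..b} \<gamma> E k K" and in_c: "\<And>t. t \<in> {a..b} \<Longrightarrow> \<gamma> t \<in> cdom c"
    and jac: "jacobi_eq {a..b} \<gamma> E k K X Y"
    and init: "has_frame_deriv p e (X a) (\<lambda>i. Y i a)" and p0: "p 0 = \<gamma> a" "\<And>i. e i 0 = E i a"
  obtains \<epsilon> G F where "\<epsilon> > 0"
    "\<And>\<tau>. \<bar>\<tau>\<bar> < \<epsilon> \<Longrightarrow> frame_eq {a..b} (G \<tau>) (F \<tau>) k K"
    "\<And>\<tau>. \<bar>\<tau>\<bar> < \<epsilon> \<Longrightarrow> G \<tau> a = p \<tau>" "\<And>\<tau> i. \<bar>\<tau>\<bar> < \<epsilon> \<Longrightarrow> F \<tau> i a = e i \<tau>"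
    "\<And>t. t \<in> {a..b} \<Longrightarrow> G 0 t = \<gamma> t" "\<And>t i. t \<in> {a..b} \<Longrightarrow> F 0 i t = E i t"
    "\<And>t. t \<in> {a..b} \<Longrightarrow> has_frame_deriv (\<lambda>\<tau>. G \<tau> t) (\<lambda>i \<tau>. F \<tau> i t) (X t) (\<lambda>i. Y i t)"
proof -
  define y0 where "y0 = (\<lambda>t. cstate c (\<gamma> t) (\<lambda>i. E i t))"
  have a: "a \<in> {a..b}" using ab by simp
  obtain r M where r: "r > 0" "M > 0" and sub: "\<And>t. t \<in> {a..b} \<Longrightarrow> cball (y0 t) r \<subseteq> cimg c \<times> UNIV"
    and nb: "\<And>t. t \<in> {a..b} \<Longrightarrow> norm (bfld c k K t (y0 t)) \<le> M"
    and lip: "\<And>t y w. t \<in> {a..b} \<Longrightarrow> y \<in> cball (y0 t) r \<Longrightarrow> w \<in> cball (y0 t) r \<Longrightarrow>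
        norm (fld c k K t y - fld c k K t w) \<le> M * norm (y - w)"
    and lin: "\<And>e. e > 0 \<Longrightarrow> \<exists>d>0. \<forall>t\<in>{a..b}. \<forall>y\<in>cball (y0 t) d.
        norm (fld c k K t y - fld c k K t (y0 t) - bfld c k K t (y0 t) (y - y0 t)) \<le> e * norm (y - y0 t)"
    and y0d: "\<And>t. t \<in> {a..b} \<Longrightarrow> (y0 has_vector_derivative fld c k K t (y0 t)) (at t within {a..b})"
    and y0c: "continuous_on {a..b} y0"
    using chart_tube[OF c K base in_c y0_def] by blast
  define \<eta> where "\<eta> \<tau> = cstate c (p \<tau>) (\<lambda>i. e i \<tau>)" for \<tau>
  have \<eta>0: "\<eta> 0 = y0 a" by (simp add: \<eta>_def y0_def p0)
  have p0c: "p 0 \<in> cdom c" using p0 in_c[OF a] by simp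
  have "(\<eta> \<longlongrightarrow> \<eta> 0) (at 0)"
    using has_vector_derivative_continuous[OF has_frame_deriv_chartD[OF init c p0c]]
    unfolding \<eta>_def[abs_def] continuous_at .
  then have "\<forall>\<^sub>F \<tau> in at 0. dist (\<eta> \<tau>) (\<eta> 0) < r * exp (- (2 * M * (b - a))) / 2"
    by (rule tendstoD) (use r in simp)
  moreover have "\<forall>\<^sub>F \<tau> in at 0. p \<tau> \<in> cdom c"
    using init has_velocity_cont eventually_in_chart[where \<gamma>=p and t=0 and I=UNIV, OF _ open_cdom[OF c] p0c]
    unfolding has_frame_deriv_def by blast
  ultimately have "\<forall>\<^sub>F \<tau> in at 0. p \<tau> \<in> cdom c \<and> dist (\<eta> \<tau>) (\<eta> 0) < r * exp (- (2 * M * (b - a))) / 2"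
    by eventually_elim blast
  then obtain \<epsilon> where e: "\<epsilon> > 0" and "\<And>\<tau>. \<tau> \<noteq> 0 \<Longrightarrow> dist \<tau> 0 < \<epsilon> \<Longrightarrow>
      p \<tau> \<in> cdom c \<and> dist (\<eta> \<tau>) (\<eta> 0) < r * exp (- (2 * M * (b - a))) / 2"
    unfolding eventually_at by auto
  then have near: "p \<tau> \<in> cdom c" "norm (\<eta> \<tau> - y0 a) \<le> r * exp (- (2 * M * (b - a))) / 2" if "\<bar>\<tau>\<bar> < \<epsilon>" for \<tau>
    using that p0c r(1) by (cases "\<tau> = 0"; force simp: \<eta>0 dist_norm)+
  have cf: "continuous_on (SIGMA t:{a..b}. cball (y0 t) r) (\<lambda>(t, y). fld c k K t y)"
    by (rule continuous_on_subset[OF fld_continuous[OF c K]]) (rule Sigma_mono[OF order_refl sub])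
  have ex: "\<exists>y. y a = \<eta> \<tau> \<and> (\<forall>t\<in>{a..b}. (y has_vector_derivative fld c k K t (y t)) (at t within {a..b}) \<and> y t \<in> cball (y0 t) r)"
    if \<tau>: "\<bar>\<tau>\<bar> < \<epsilon>" for \<tau>
  proof (rule ode_solution_in_tube[OF ab r(2) less_imp_le[OF r(1)] y0c cf lip, where \<eta>="\<eta> \<tau>"])
    fix t assume t: "t \<in> {a..b}"
    \<comment> \<open>Since \<open>y0\<close> solves the equation, the defect bounded by the tube
      condition reduces to the initial displacement \<open>\<eta> \<tau> - y0 a\<close>.\<close>
    have "((\<lambda>s. fld c k K s (y0 s)) has_integral (y0 t - y0 a)) {a..t}"
    proof (rule fundamental_theorem_of_calculus)
      fix s assume "s \<in> {a..t}"
      then show "(y0 has_vector_derivative fld c k K s (y0 s)) (at s within {a..t})"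
        by (intro has_vector_derivative_within_subset[OF y0d]) (use t in auto)
    qed (use t in simp)
    then show "norm (\<eta> \<tau> + integral {a..t} (\<lambda>s. fld c k K s (y0 s)) - y0 t) \<le> r * exp (- (2 * M * (b - a))) / 2"
      using near(2)[OF \<tau>] by (simp add: integral_unique)
  qed blast+
  have "\<exists>y. \<forall>\<tau>. \<bar>\<tau>\<bar> < \<epsilon> \<longrightarrow> y \<tau> a = \<eta> \<tau> \<and>
      (\<forall>t\<in>{a..b}. (y \<tau> has_vector_derivative fld c k K t (y \<tau> t)) (at t within {a..b}) \<and> y \<tau> t \<in> cball (y0 t) r)"
    by (rule choice) (use ex in blast)
  then obtain y' where y': "\<And>\<tau>. \<bar>\<tau>\<bar> < \<epsilon> \<Longrightarrow> y' \<tau> a = \<eta> \<tau>"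
    "\<And>\<tau> t. \<bar>\<tau>\<bar> < \<epsilon> \<Longrightarrow> t \<in> {a..b} \<Longrightarrow> (y' \<tau> has_vector_derivative fld c k K t (y' \<tau> t)) (at t within {a..b})"
    "\<And>\<tau> t. \<bar>\<tau>\<bar> < \<epsilon> \<Longrightarrow> t \<in> {a..b} \<Longrightarrow> y' \<tau> t \<in> cball (y0 t) r" by blast
  \<comment> \<open>Inserting the base solution at \<tau> = 0 makes the family contain the base
    curve by construction.\<close>
  define y where "y \<tau> = (if \<tau> = 0 then y0 else y' \<tau>)" for \<tau>
  have y: "y \<tau> a = \<eta> \<tau>" if "\<bar>\<tau>\<bar> < \<epsilon>" for \<tau> using that y'(1) \<eta>0 by (simp add: y_def)
  have yd: "(y \<tau> has_vector_derivative fld c k K t (y \<tau> t)) (at t within {a..b})" if "\<bar>\<tau>\<bar> < \<epsilon>" "t \<in> {a..b}" for \<tau> t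
    using that y'(2) y0d by (simp add: y_def)
  have yt: "y \<tau> t \<in> cball (y0 t) r" if "\<bar>\<tau>\<bar> < \<epsilon>" "t \<in> {a..b}" for \<tau> t
    using y'(3)[OF that] r(1) by (simp add: y_def)
  have yc: "fst (y \<tau> t) \<in> cimg c" if "\<bar>\<tau>\<bar> < \<epsilon>" "t \<in> {a..b}" for \<tau> t
    using sub[OF that(2)] yt[OF that] by auto
  define G where "G \<tau> = chart_curve c (y \<tau>)" for \<tau>
  define F where "F \<tau> = chart_frame c (y \<tau>)" for \<tau>
  have st: "cstate c (G \<tau> t) (\<lambda>i. F \<tau> i t) = y \<tau> t" if "\<bar>\<tau>\<bar> < \<epsilon>" "t \<in> {a..b}" for \<tau> t
    unfolding G_def F_def using cstate_chart_curve[where y="y \<tau>" and t=t, OF c yc[OF that]] .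
  have Gc: "G \<tau> t \<in> cdom c" if "\<bar>\<tau>\<bar> < \<epsilon>" "t \<in> {a..b}" for \<tau> t
    unfolding G_def chart_curve_def using cinv_in[OF yc[OF that]] .
  have fe: "frame_eq {a..b} (G \<tau>) (F \<tau>) k K" if "\<bar>\<tau>\<bar> < \<epsilon>" for \<tau>
    unfolding G_def F_def by (rule frame_eq_chartI[OF c yc[OF that] yd[OF that]])
  have Ga: "G \<tau> a = p \<tau>" "F \<tau> i a = e i \<tau>" if \<tau>: "\<bar>\<tau>\<bar> < \<epsilon>" for \<tau> i
  proof -
    have "cstate c (G \<tau> a) (\<lambda>i. F \<tau> i a) = cstate c (p \<tau>) (\<lambda>i. e i \<tau>)"
      using st[OF \<tau> a] y[OF \<tau>] unfolding \<eta>_def by simp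
    note cstate_inject[OF c Gc[OF \<tau> a] near(1)[OF \<tau>] this]
    then show "G \<tau> a = p \<tau>" "F \<tau> i a = e i \<tau>" by this
  qed
  have G0: "G 0 t = \<gamma> t" "F 0 i t = E i t" if t: "t \<in> {a..b}" for t i
  proof -
    have 0: "\<bar>0\<bar> < \<epsilon>" using e by simp
    have "cstate c (G 0 t) (\<lambda>i. F 0 i t) = cstate c (\<gamma> t) (\<lambda>i. E i t)"
      using st[OF 0 t] unfolding y_def y0_def by simp
    note cstate_inject[OF c Gc[OF 0 t] in_c[OF t] this]
    then show "G 0 t = \<gamma> t" "F 0 i t = E i t" by this
  qed
  have init': "has_frame_deriv (\<lambda>\<tau>. G \<tau> a) (\<lambda>i \<tau>. F \<tau> i a) (X a) (\<lambda>i. Y i a)"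
  proof (rule has_frame_deriv_chartI[OF c])
    show "G 0 a \<in> cdom c" by (rule Gc) (use e a in auto)
    show "\<forall>\<^sub>F \<tau> in at 0. G \<tau> a \<in> cdom c"
      unfolding eventually_at using e Gc[OF _ a] by (intro exI[of _ \<epsilon>]) auto
    have "((\<lambda>\<tau>. cstate c (p \<tau>) (\<lambda>i. e i \<tau>)) has_vector_derivative ctan c (p 0) (\<lambda>i. e i 0) (X a) (\<lambda>i. Y i a)) (at 0)"
      by (rule has_frame_deriv_chartD[OF init c p0c])
    then have "((\<lambda>\<tau>. cstate c (G \<tau> a) (\<lambda>i. F \<tau> i a)) has_vector_derivative ctan c (p 0) (\<lambda>i. e i 0) (X a) (\<lambda>i. Y i a)) (at 0)"
      by (rule has_vector_derivative_transform_within_open[of _ _ _ "{-\<epsilon><..<\<epsilon>}"])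
        (use e Ga in \<open>auto simp: abs_less_iff\<close>)
    then show "((\<lambda>\<tau>. cstate c (G \<tau> a) (\<lambda>i. F \<tau> i a)) has_vector_derivative ctan c (G 0 a) (\<lambda>i. F 0 i a) (X a) (\<lambda>i. Y i a)) (at 0)"
      using Ga[of 0] e by simp
  qed
  show thesis
  proof (rule that[OF e fe Ga G0])
    fix t assume t: "t \<in> {a..b}"
    show "has_frame_deriv (\<lambda>\<tau>. G \<tau> t) (\<lambda>i \<tau>. F \<tau> i t) (X t) (\<lambda>i. Y i t)"
    proof (rule frame_deriv_in_tube[OF c base in_c y0_def r nb lip lin y0d jac _ G0 init' t])
      show "\<forall>\<^sub>F \<tau> in at 0. frame_eq {a..b} (G \<tau>) (F \<tau>) k K \<and> (\<forall>t\<in>{a..b}. G \<tau> t \<in> cdom c \<and>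
        cstate c (G \<tau> t) (\<lambda>i. F \<tau> i t) \<in> cball (y0 t) r)"
        unfolding eventually_at using e fe Gc st yt by (intro exI[of _ \<epsilon>]) (auto simp del: mem_cball)
    qed
  qed
qed

text \<open>Differentiability in \<tau> is given at \<open>a\<close> only. The candidate at later
  times is the solution of the linearized system with these initial data, and the comparison
  estimate identifies it as the derivative.\<close>

lemma local_variation_deriv:
  assumes c: "c \<in> atl" and ab: "a \<le> b" and K: "\<And>i j. continuous_on {a..b} (\<lambda>t. K t i j)"
    and base: "frame_eq {a..b} (G 0) (F 0) k K" and in_c: "\<And>t. t \<in> {a..b} \<Longrightarrow> G 0 t \<in> cdom c"
    and fam: "\<forall>\<^sub>F \<tau> in at 0. frame_eq {a..b} (G \<tau>) (F \<tau>) k K"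
    and init: "has_frame_deriv (\<lambda>\<tau>. G \<tau> a) (\<lambda>i \<tau>. F \<tau> i a) Xa Ya"
  obtains X Y where "jacobi_eq {a..b} (G 0) (F 0) k K X Y"
    "\<And>t. t \<in> {a..b} \<Longrightarrow> has_frame_deriv (\<lambda>\<tau>. G \<tau> t) (\<lambda>i \<tau>. F \<tau> i t) (X t) (\<lambda>i. Y i t)"
proof -
  let ?\<gamma> = "G 0" and ?E = "F 0"
  define y0 where "y0 = (\<lambda>t. cstate c (?\<gamma> t) (\<lambda>i. ?E i t))"
  have a: "a \<in> {a..b}" using ab by simp
  obtain r M where r: "r > 0" "M > 0" and sub: "\<And>t. t \<in> {a..b} \<Longrightarrow> cball (y0 t) r \<subseteq> cimg c \<times> UNIV"
    and nb: "\<And>t. t \<in> {a..b} \<Longrightarrow> norm (bfld c k K t (y0 t)) \<le> M"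
    and lip: "\<And>t y w. t \<in> {a..b} \<Longrightarrow> y \<in> cball (y0 t) r \<Longrightarrow> w \<in> cball (y0 t) r \<Longrightarrow>
        norm (fld c k K t y - fld c k K t w) \<le> M * norm (y - w)"
    and lin: "\<And>e. e > 0 \<Longrightarrow> \<exists>d>0. \<forall>t\<in>{a..b}. \<forall>y\<in>cball (y0 t) d.
        norm (fld c k K t y - fld c k K t (y0 t) - bfld c k K t (y0 t) (y - y0 t)) \<le> e * norm (y - y0 t)"
    and y0d: "\<And>t. t \<in> {a..b} \<Longrightarrow> (y0 has_vector_derivative fld c k K t (y0 t)) (at t within {a..b})"
    and y0c: "continuous_on {a..b} y0"
    using chart_tube[OF c K base in_c y0_def] by blast
  have y0in: "fst (y0 s) \<in> cimg c" if "s \<in> {a..b}" for s using in_c[OF that] by (simp add: y0_def cstate_def)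
  have cB: "continuous_on {a..b} (\<lambda>t. bfld c k K t (y0 t))"
  proof -
    have "(\<lambda>t. (t, y0 t)) ` {a..b} \<subseteq> {a..b} \<times> cimg c \<times> UNIV" using y0in by (simp add: image_subset_iff mem_Times_iff)
    from continuous_on_compose2[OF bfld_continuous[where K=K and k=k, OF c K] continuous_on_Pair[OF continuous_on_id y0c] this]
    show ?thesis by simp
  qed
  obtain \<xi> where \<xi>a: "\<xi> a = ctan c (?\<gamma> a) (\<lambda>i. ?E i a) Xa Ya"
    and \<xi>: "\<And>t. t \<in> {a..b} \<Longrightarrow> (\<xi> has_vector_derivative bfld c k K t (y0 t) (\<xi> t)) (at t within {a..b})"
    using linear_ode_solution[OF ab cB] by blast
  \<comment> \<open>Inverts \<open>ctan\<close>: the Christoffel term is added back to turn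
    coordinate derivatives of the frame vectors into covariant ones.\<close>
  define X where "X t = cf c (fst (\<xi> t)) (?\<gamma> t)" for t
  define Y where "Y i t = cf c (snd (\<xi> t) $ i + Gam c (cmap c (?\<gamma> t)) (fst (\<xi> t)) (D c (?\<gamma> t) (?E i t))) (?\<gamma> t)" for i t
  have ct: "ctan c (?\<gamma> t) (\<lambda>i. ?E i t) (X t) (\<lambda>i. Y i t) = \<xi> t" if "t \<in> {a..b}" for t
    using c in_c[OF that] by (simp add: ctan_def X_def Y_def vec_lambda_eta)
  have jac: "jacobi_eq {a..b} ?\<gamma> ?E k K X Y"
    unfolding jacobi_eq_def
  proof
    fix t assume t: "t \<in> {a..b}"
    have "((\<lambda>s. ctan c (?\<gamma> s) (\<lambda>i. ?E i s) (X s) (\<lambda>i. Y i s)) has_vector_derivative bfld c k K t (y0 t) (\<xi> t)) (at t within {a..b})"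
      using \<xi>[OF t] unfolding has_vector_derivative_def
      by (rule has_derivative_transform[OF t, rotated]) (rule ct)
    then show "has_cov_deriv atl nab {a..b} ?\<gamma> X t (\<Sum>j\<in>UNIV. k j *\<^sub>R Y j t) \<and>
    (\<forall>i. has_cov_deriv atl nab {a..b} ?\<gamma> (Y i) t ((\<Sum>j\<in>UNIV. K t i j *\<^sub>R Y j t) +
        curvature atl nab (?\<gamma> t) (\<Sum>j\<in>UNIV. k j *\<^sub>R ?E j t) (X t) (?E i t)))"
      unfolding jacobi_chart[OF c in_c[OF t] t base] ct[OF t] bfld[OF c y0in[OF t]] unfolding y0_def .
  qed
  have XY: "X a = Xa" "Y i a = Ya i" for i
    using c in_c[OF a] by (simp_all add: X_def Y_def \<xi>a ctan_def)
  have init': "has_frame_deriv (\<lambda>\<tau>. G \<tau> a) (\<lambda>i \<tau>. F \<tau> i a) (X a) (\<lambda>i. Y i a)" using init by (simp add: XY)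
  define \<eta> where "\<eta> \<tau> = cstate c (G \<tau> a) (\<lambda>i. F \<tau> i a)" for \<tau>
  have "(\<eta> \<longlongrightarrow> \<eta> 0) (at 0)"
    using has_vector_derivative_continuous[OF has_frame_deriv_chartD[OF init c in_c[OF a]]]
    unfolding \<eta>_def[abs_def] continuous_at .
  \<comment> \<open>The factor 4 matches the requirement of \<open>stays_in_tube\<close>, where the
    initial distance times \<open>2 * exp (2 * M * (b - a))\<close> must not exceed
    \<open>r / 2\<close>.\<close>
  then have ev1: "\<forall>\<^sub>F \<tau> in at 0. dist (\<eta> \<tau>) (\<eta> 0) < r / (4 * exp (2 * M * (b - a)))"
    by (rule tendstoD) (use r in simp)
  have ev2: "\<forall>\<^sub>F \<tau> in at 0. G \<tau> a \<in> cdom c"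
    using init has_velocity_cont eventually_in_chart[where \<gamma>="\<lambda>\<tau>. G \<tau> a" and t=0 and I=UNIV, OF _ open_cdom[OF c] in_c[OF a]]
    unfolding has_frame_deriv_def by blast
  have tube: "\<forall>\<^sub>F \<tau> in at 0. frame_eq {a..b} (G \<tau>) (F \<tau>) k K \<and> (\<forall>t\<in>{a..b}. G \<tau> t \<in> cdom c \<and>
        cstate c (G \<tau> t) (\<lambda>i. F \<tau> i t) \<in> cball (y0 t) r)"
    using ev1 ev2 fam
  proof eventually_elim
    case (elim \<tau>)
    have "2 * exp (2 * M * (b - a)) * norm (cstate c (G \<tau> a) (\<lambda>i. F \<tau> i a) - y0 a) \<le> r / 2"
      using elim(1) by (simp add: \<eta>_def y0_def dist_norm field_simps)
    then show ?case using stays_in_tube[OF c elim(3) r sub lip y0d elim(2)] elim(3) by blast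
  qed
  show thesis
    by (rule that[OF jac frame_deriv_in_tube[OF c base in_c y0_def r nb lip lin y0d jac tube refl refl init']])
qed

end

section \<open>Families of solutions along the whole curve\<close>

lemma has_vector_derivative_within_Un:
  assumes "(f has_vector_derivative d) (at t within I)" "(f has_vector_derivative d) (at t within J)"
  shows "(f has_vector_derivative d) (at t within I \<union> J)"
  using assms unfolding has_vector_derivative_def has_derivative_within by (auto intro: Lim_Un)

context riemannian_manifold
begin

section \<open>Locality and gluing of derivatives along curves\<close>

lemma has_velocity_at_eq:
  assumes "at t within I = at t within J"
  shows "has_velocity atl I \<gamma> t v \<longleftrightarrow> has_velocity atl J \<gamma> t v"
  unfolding has_velocity_def continuous_within assms ..

lemma has_cov_deriv_at_eq:
  assumes "at t within I = at t within J"
  shows "has_cov_deriv atl nab I \<gamma> V t E \<longleftrightarrow> has_cov_deriv atl nab J \<gamma> V t E"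
  unfolding has_cov_deriv_def has_velocity_at_eq[OF assms] assms ..

lemma has_velocity_subset:
  assumes "has_velocity atl I \<gamma> t v" "J \<subseteq> I"
  shows "has_velocity atl J \<gamma> t v"
  using assms unfolding has_velocity_def
  by (auto intro: continuous_within_subset has_vector_derivative_within_subset)

lemma has_cov_deriv_subset:
  assumes V: "has_cov_deriv atl nab I \<gamma> V t E" and J: "J \<subseteq> I" "t \<in> J"
  shows "has_cov_deriv atl nab J \<gamma> V t E"
proof -
  obtain v where v: "has_velocity atl I \<gamma> t v" by (rule has_cov_deriv_velocity[OF V])
  obtain c where c: "c \<in> atl" "\<gamma> t \<in> cdom c" by (rule ex_chart)
  show ?thesis
    by (rule has_cov_deriv_chartI[OF has_velocity_subset[OF v J(1)] c J(2)
          has_vector_derivative_within_subset[OF has_cov_deriv_chartD[OF V v c] J(1)]])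
qed

lemma has_velocity_cong:
  assumes v: "has_velocity atl I \<gamma> t v" and t: "t \<in> I" and eq: "\<And>s. s \<in> I \<Longrightarrow> \<gamma> s = \<sigma> s"
  shows "has_velocity atl I \<sigma> t v"
proof -
  obtain c where c: "c \<in> atl" "\<gamma> t \<in> cdom c" by (rule ex_chart)
  have "continuous (at t within I) \<sigma>"
    using has_velocity_cont[OF v] t eq unfolding continuous_within
    by (auto intro: Lim_transform_eventually simp: eventually_at_filter)
  moreover have "((\<lambda>s. cmap c (\<sigma> s)) has_vector_derivative D c (\<sigma> t) v) (at t within I)"
    using has_velocity_chartD[OF v c] eq[OF t] unfolding has_vector_derivative_def
    by (auto intro!: has_derivative_transform[OF t, of _ "\<lambda>s. cmap c (\<gamma> s)"] simp: eq)
  ultimately show ?thesis using has_velocity_chartI[OF c(1) t] c eq[OF t] by simp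
qed

lemma has_cov_deriv_cong:
  assumes V: "has_cov_deriv atl nab I \<gamma> V t E" and t: "t \<in> I"
    and eq: "\<And>s. s \<in> I \<Longrightarrow> \<gamma> s = \<sigma> s" "\<And>s. s \<in> I \<Longrightarrow> V s = W s"
  shows "has_cov_deriv atl nab I \<sigma> W t E"
proof -
  obtain v where v: "has_velocity atl I \<gamma> t v" by (rule has_cov_deriv_velocity[OF V])
  obtain c where c: "c \<in> atl" "\<gamma> t \<in> cdom c" by (rule ex_chart)
  have c': "\<sigma> t \<in> cdom c" using c eq t by simp
  show ?thesis
  proof (rule has_cov_deriv_chartI[OF has_velocity_cong[OF v t eq(1)] c(1) c' t])
    show "((\<lambda>s. D c (\<sigma> s) (W s)) has_vector_derivative
      D c (\<sigma> t) E - Gam c (cmap c (\<sigma> t)) (D c (\<sigma> t) v) (D c (\<sigma> t) (W t))) (at t within I)"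
      using has_cov_deriv_chartD[OF V v c] eq[OF t] unfolding has_vector_derivative_def
      by (auto intro!: has_derivative_transform[OF t, of _ "\<lambda>s. D c (\<gamma> s) (V s)"] simp: eq)
  qed
qed

lemma at_within_Icc_split:
  assumes "a \<le> b" "b \<le> (c::real)" "t \<in> {a..c}"
  shows "t < b \<Longrightarrow> at t within {a..c} = at t within {a..b}"
    and "t > b \<Longrightarrow> at t within {a..c} = at t within {b..c}"
proof -
  show "t < b \<Longrightarrow> at t within {a..c} = at t within {a..b}"
    by (rule at_within_nhd[of _ "{..<b}"]) (use assms in auto)
  show "t > b \<Longrightarrow> at t within {a..c} = at t within {b..c}"
    by (rule at_within_nhd[of _ "{b<..}"]) (use assms in auto)
qed

lemma has_velocity_Un:
  assumes 1: "has_velocity atl I \<gamma> t v" "has_velocity atl J \<gamma> t v" and t: "t \<in> I \<union> J"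
  shows "has_velocity atl (I \<union> J) \<gamma> t v"
proof -
  obtain c where c: "c \<in> atl" "\<gamma> t \<in> cdom c" by (rule ex_chart)
  have "continuous (at t within (I \<union> J)) \<gamma>"
    using 1[THEN has_velocity_cont] unfolding continuous_within by (auto intro: Lim_Un)
  then show ?thesis
    by (rule has_velocity_chartI[where \<gamma>=\<gamma> and t=t, OF c(1) t c(2)])
      (intro has_vector_derivative_within_Un 1[THEN has_velocity_chartD] c)
qed

lemma has_cov_deriv_Un:
  assumes v: "has_velocity atl (I \<union> J) \<gamma> t v" and t: "t \<in> I \<union> J"
    and V: "has_cov_deriv atl nab I \<gamma> V t E" "has_cov_deriv atl nab J \<gamma> V t E"
  shows "has_cov_deriv atl nab (I \<union> J) \<gamma> V t E"
proof -
  obtain c where c: "c \<in> atl" "\<gamma> t \<in> cdom c" by (rule ex_chart)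
  show ?thesis
    by (rule has_cov_deriv_chartI[OF v c t])
      (intro has_vector_derivative_within_Un has_cov_deriv_chartD[OF V(1)] has_cov_deriv_chartD[OF V(2)] c
        has_velocity_subset[OF v] Un_upper1 Un_upper2)
qed

text \<open>Away from \<open>b\<close> one piece already describes a neighbourhood. At
  \<open>b\<close> the two one-sided derivatives combine because both equal the same vector
  \<open>v\<close>.\<close>

lemma has_velocity_glue:
  assumes abc: "a \<le> b" "b \<le> (c::real)" "t \<in> {a..c}"
    and 1: "t \<le> b \<Longrightarrow> has_velocity atl {a..b} \<gamma> t v" and 2: "b \<le> t \<Longrightarrow> has_velocity atl {b..c} \<gamma> t v"
  shows "has_velocity atl {a..c} \<gamma> t v"
proof -
  consider "t < b" | "t = b" | "t > b" by linarith
  then show ?thesis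
  proof cases
    case 1 then show ?thesis using assms(4) has_velocity_at_eq[OF at_within_Icc_split(1)[OF abc]] by simp
  next
    case 2 then show ?thesis using has_velocity_Un[OF assms(4,5)] abc by (simp add: ivl_disj_un_two_touch)
  next
    case 3 then show ?thesis using assms(5) has_velocity_at_eq[OF at_within_Icc_split(2)[OF abc]] by simp
  qed
qed

lemma has_cov_deriv_glue:
  assumes abc: "a \<le> b" "b \<le> (c::real)" "t \<in> {a..c}" and v: "has_velocity atl {a..c} \<gamma> t v"
    and 1: "t \<le> b \<Longrightarrow> has_cov_deriv atl nab {a..b} \<gamma> V t E" and 2: "b \<le> t \<Longrightarrow> has_cov_deriv atl nab {b..c} \<gamma> V t E"
  shows "has_cov_deriv atl nab {a..c} \<gamma> V t E"
proof -
  consider "t < b" | "t = b" | "t > b" by linarith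
  then show ?thesis
  proof cases
    case 1 then show ?thesis using assms(5) has_cov_deriv_at_eq[OF at_within_Icc_split(1)[OF abc]] by simp
  next
    case 2
    have "{a..c} = {a..b} \<union> {b..c}" using abc by auto
    then show ?thesis using has_cov_deriv_Un[of "{a..b}" "{b..c}" \<gamma> t v V E] assms(5,6) v 2 abc by simp
  next
    case 3 then show ?thesis using assms(6) has_cov_deriv_at_eq[OF at_within_Icc_split(2)[OF abc]] by simp
  qed
qed

lemma frame_eq_subset: "frame_eq I \<sigma> E k K \<Longrightarrow> J \<subseteq> I \<Longrightarrow> frame_eq J \<sigma> E k K"
  unfolding frame_eq_def using has_velocity_subset has_cov_deriv_subset by blast

lemma frame_eq_cong:
  assumes "frame_eq I \<sigma> E k K" and eq: "\<And>s. s \<in> I \<Longrightarrow> \<sigma> s = \<sigma>' s" "\<And>s i. s \<in> I \<Longrightarrow> E i s = E' i s"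
  shows "frame_eq I \<sigma>' E' k K"
  unfolding frame_eq_def
proof (intro ballI conjI allI)
  fix t assume t: "t \<in> I"
  have s: "(\<Sum>j\<in>UNIV. k j *\<^sub>R E' j t) = (\<Sum>j\<in>UNIV. k j *\<^sub>R E j t)"
    "(\<Sum>j\<in>UNIV. K t i j *\<^sub>R E' j t) = (\<Sum>j\<in>UNIV. K t i j *\<^sub>R E j t)" for i
    using eq(2)[OF t] by simp_all
  show "has_velocity atl I \<sigma>' t (\<Sum>j\<in>UNIV. k j *\<^sub>R E' j t)"
    unfolding s by (rule has_velocity_cong[OF _ t eq(1)]) (use assms(1) t in \<open>simp add: frame_eq_def\<close>)
  show "has_cov_deriv atl nab I \<sigma>' (E' i) t (\<Sum>j\<in>UNIV. K t i j *\<^sub>R E' j t)" for i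
    unfolding s by (rule has_cov_deriv_cong[OF _ t eq]) (use assms(1) t in \<open>simp add: frame_eq_def\<close>)
qed

lemma frame_eq_glue:
  assumes ab: "a \<le> b" "b \<le> (c::real)" and 1: "frame_eq {a..b} \<sigma> E k K" and 2: "frame_eq {b..c} \<sigma> E k K"
  shows "frame_eq {a..c} \<sigma> E k K"
  unfolding frame_eq_def
proof (intro ballI conjI allI)
  fix t assume t: "t \<in> {a..c}"
  show v: "has_velocity atl {a..c} \<sigma> t (\<Sum>j\<in>UNIV. k j *\<^sub>R E j t)"
    by (rule has_velocity_glue[OF ab t]) (use 1 2 t in \<open>auto simp: frame_eq_def\<close>)
  show "has_cov_deriv atl nab {a..c} \<sigma> (E i) t (\<Sum>j\<in>UNIV. K t i j *\<^sub>R E j t)" for i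
    by (rule has_cov_deriv_glue[OF ab t v]) (use 1 2 t in \<open>auto simp: frame_eq_def\<close>)
qed

section \<open>From single charts to the whole interval by bisection\<close>

lemma chart_nhd:
  assumes "continuous_on {0..L} \<gamma>" "x \<in> {0..L::real}"
  obtains c d where "c \<in> atl" "d > 0" "\<And>u. u \<in> {0..L} \<Longrightarrow> \<bar>u - x\<bar> < d \<Longrightarrow> \<gamma> u \<in> cdom c"
proof -
  obtain c where c: "c \<in> atl" "\<gamma> x \<in> cdom c" by (rule ex_chart)
  have "\<forall>\<^sub>F u in at x within {0..L}. \<gamma> u \<in> cdom c"
    using assms by (intro eventually_in_chart open_cdom c) (simp add: continuous_on_eq_continuous_within)
  then obtain d where "d > 0" "\<And>u. u \<in> {0..L} \<Longrightarrow> u \<noteq> x \<Longrightarrow> dist u x < d \<Longrightarrow> \<gamma> u \<in> cdom c"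
    unfolding eventually_at by blast
  then show thesis using that[OF c(1), of d] c(2) unfolding dist_real_def by metis
qed

text \<open>Bisection applied to the statement that differentiability at the left end point
  propagates through the interval. It holds on intervals whose image lies in one chart and is
  inherited by concatenation.\<close>

lemma frame_deriv_everywhere:
  assumes L: "L \<ge> 0" and K: "\<And>i j. continuous_on {0..L} (\<lambda>t. K t i j)"
    and base: "frame_eq {0..L} (G 0) (F 0) k K"
    and fam: "\<forall>\<^sub>F \<tau> in at 0. frame_eq {0..L} (G \<tau>) (F \<tau>) k K"
    and init: "has_frame_deriv (\<lambda>\<tau>. G \<tau> 0) (\<lambda>i \<tau>. F \<tau> i 0) X0 Y0"
    and t: "t \<in> {0..L}"
  shows "\<exists>X Y. has_frame_deriv (\<lambda>\<tau>. G \<tau> t) (\<lambda>i \<tau>. F \<tau> i t) X Y"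
proof -
  define Q where "Q t \<longleftrightarrow> (\<exists>X Y. has_frame_deriv (\<lambda>\<tau>. G \<tau> t) (\<lambda>i \<tau>. F \<tau> i t) X Y)" for t
  have "(0::real) \<le> 0 \<and> L \<le> L \<longrightarrow> Q 0 \<longrightarrow> (\<forall>t\<in>{0..L}. Q t)"
  \<comment> \<open>The local hypothesis of \<open>Bolzano\<close> ranges over intervals that may
    reach beyond \<open>{0..L}\<close>, so the claim is restricted to subintervals.\<close>
  proof (rule Bolzano[OF L, where P="\<lambda>a b. 0 \<le> a \<and> b \<le> L \<longrightarrow> Q a \<longrightarrow> (\<forall>t\<in>{a..b}. Q t)"])
    fix a b c :: real
    assume 1: "0 \<le> a \<and> b \<le> L \<longrightarrow> Q a \<longrightarrow> (\<forall>t\<in>{a..b}. Q t)" and 2: "0 \<le> b \<and> c \<le> L \<longrightarrow> Q b \<longrightarrow> (\<forall>t\<in>{b..c}. Q t)"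
      and ab: "a \<le> b" "b \<le> c"
    show "0 \<le> a \<and> c \<le> L \<longrightarrow> Q a \<longrightarrow> (\<forall>t\<in>{a..c}. Q t)"
    proof (intro impI ballI)
      fix t assume a: "0 \<le> a \<and> c \<le> L" "Q a" "t \<in> {a..c}"
      have Qab: "\<forall>t\<in>{a..b}. Q t" using 1 a ab by auto
      then have "Q b" using ab by simp
      then have "\<forall>t\<in>{b..c}. Q t" using 2 a ab by auto
      with Qab a(3) show "Q t" by (cases "t \<le> b") auto
    qed
  next
    fix x assume x: "0 \<le> x" "x \<le> L"
    obtain c d where c: "c \<in> atl" "d > 0" "\<And>u. u \<in> {0..L} \<Longrightarrow> \<bar>u - x\<bar> < d \<Longrightarrow> G 0 u \<in> cdom c"
      using chart_nhd[OF frame_eq_cont[OF base], of x] x by auto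
    have "Q t" if ab: "a \<le> x" "x \<le> b" "b - a < d" "0 \<le> a" "b \<le> L" and Qa: "Q a" and t: "t \<in> {a..b}" for a b t
    proof -
      obtain Xa Ya where Xa: "has_frame_deriv (\<lambda>\<tau>. G \<tau> a) (\<lambda>i \<tau>. F \<tau> i a) Xa Ya" using Qa unfolding Q_def by blast
      have sub: "{a..b} \<subseteq> {0..L}" using ab by auto
      have fam': "\<forall>\<^sub>F \<tau> in at 0. frame_eq {a..b} (G \<tau>) (F \<tau>) k K"
        using fam by eventually_elim (rule frame_eq_subset[OF _ sub])
      have in_c: "G 0 u \<in> cdom c" if "u \<in> {a..b}" for u
        by (rule c(3)) (use that sub ab in auto)
      show ?thesis
        by (rule local_variation_deriv[OF c(1) order_trans[OF ab(1,2)] continuous_on_subset[OF K sub]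
              frame_eq_subset[OF base sub] in_c fam' Xa]) (use t in \<open>auto simp: Q_def\<close>)
    qed
    then show "\<exists>d>0. \<forall>a b. a \<le> x \<and> x \<le> b \<and> b - a < d \<longrightarrow> 0 \<le> a \<and> b \<le> L \<longrightarrow> Q a \<longrightarrow> (\<forall>t\<in>{a..b}. Q t)"
      using c(2) by blast
  qed
  moreover have "Q 0" using init unfolding Q_def by blast
  ultimately show ?thesis using t unfolding Q_def by blast
qed

lemma has_frame_deriv_unique:
  assumes "has_frame_deriv p e X Y" "has_frame_deriv p e X' Y'"
  shows "X = X'" "Y i = Y' i"
  using assms has_velocity_unique[of UNIV p 0] has_cov_deriv_unique[of UNIV p "e i" 0]
  unfolding has_frame_deriv_def by simp_all

text \<open>Near each time the derivative fields coincide with Jacobi fields constructed in a chart,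
  because derivatives in \<tau> are unique; satisfying the equations at that time depends only on
  such a neighbourhood.\<close>

lemma frame_deriv_jacobi:
  assumes L: "L > 0" and K: "\<And>i j. continuous_on {0..L} (\<lambda>t. K t i j)"
    and base: "frame_eq {0..L} (G 0) (F 0) k K"
    and fam: "\<forall>\<^sub>F \<tau> in at 0. frame_eq {0..L} (G \<tau>) (F \<tau>) k K"
    and XY: "\<And>t. t \<in> {0..L} \<Longrightarrow> has_frame_deriv (\<lambda>\<tau>. G \<tau> t) (\<lambda>i \<tau>. F \<tau> i t) (X t) (\<lambda>i. Y i t)"
  shows "jacobi_eq {0..L} (G 0) (F 0) k K X Y"
  unfolding jacobi_eq_def
proof
  fix x assume x: "x \<in> {0..L}"
  obtain c d where c: "c \<in> atl" "d > 0" "\<And>u. u \<in> {0..L} \<Longrightarrow> \<bar>u - x\<bar> < d \<Longrightarrow> G 0 u \<in> cdom c"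
    using chart_nhd[OF frame_eq_cont[OF base] x] by blast
  \<comment> \<open>The interval around \<open>x\<close> is cut only at the ends of
    \<open>{0..L}\<close>, so that derivatives at \<open>x\<close> within either interval mean the
    same.\<close>
  define a b where "a = max 0 (x - d/2)" and "b = min L (x + d/2)"
  have ab: "a \<le> x" "x \<le> b" "a \<le> b" using x c(2) L by (auto simp: a_def b_def)
  have sub: "{a..b} \<subseteq> {0..L}" by (auto simp: a_def b_def)
  have xab: "x \<in> {a..b}" using ab by simp
  have fam': "\<forall>\<^sub>F \<tau> in at 0. frame_eq {a..b} (G \<tau>) (F \<tau>) k K"
    using fam by eventually_elim (rule frame_eq_subset[OF _ sub])
  have in_c: "G 0 u \<in> cdom c" if "u \<in> {a..b}" for u
    by (rule c(3)) (use that c(2) sub in \<open>auto simp: a_def b_def\<close>)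
  have aL: "a \<in> {0..L}" using sub ab by auto
  obtain X' Y' where jac: "jacobi_eq {a..b} (G 0) (F 0) k K X' Y'"
    and XY': "\<And>t. t \<in> {a..b} \<Longrightarrow> has_frame_deriv (\<lambda>\<tau>. G \<tau> t) (\<lambda>i \<tau>. F \<tau> i t) (X' t) (\<lambda>i. Y' i t)"
    using local_variation_deriv[OF c(1) ab(3) continuous_on_subset[OF K sub]
              frame_eq_subset[OF base sub] in_c fam' XY[OF aL]] by blast
  have eq: "X' t = X t" "Y' i t = Y i t" if "t \<in> {a..b}" for t i
    using has_frame_deriv_unique[OF XY'[OF that] XY] that sub by auto
  have at_eq: "at x within {a..b} = at x within {0..L}"
    by (rule at_within_nhd[of _ "{x - d/2<..<x + d/2}"]) (use c(2) in \<open>auto simp: a_def b_def\<close>)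
  show "has_cov_deriv atl nab {0..L} (G 0) X x (\<Sum>j\<in>UNIV. k j *\<^sub>R Y j x) \<and>
    (\<forall>i. has_cov_deriv atl nab {0..L} (G 0) (Y i) x ((\<Sum>j\<in>UNIV. K x i j *\<^sub>R Y j x) +
        curvature atl nab (G 0 x) (\<Sum>j\<in>UNIV. k j *\<^sub>R F 0 j x) (X x) (F 0 i x)))"
    unfolding has_cov_deriv_at_eq[OF at_eq, symmetric]
  proof (intro conjI allI)
    have "has_cov_deriv atl nab {a..b} (G 0) X' x (\<Sum>j\<in>UNIV. k j *\<^sub>R Y' j x)"
      using jac xab unfolding jacobi_eq_def by blast
    from has_cov_deriv_cong[OF this xab refl eq(1)]
    show "has_cov_deriv atl nab {a..b} (G 0) X x (\<Sum>j\<in>UNIV. k j *\<^sub>R Y j x)" by (simp add: eq(2)[OF xab])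
    fix i
    have "has_cov_deriv atl nab {a..b} (G 0) (Y' i) x ((\<Sum>j\<in>UNIV. K x i j *\<^sub>R Y' j x) +
        curvature atl nab (G 0 x) (\<Sum>j\<in>UNIV. k j *\<^sub>R F 0 j x) (X' x) (F 0 i x))"
      using jac xab unfolding jacobi_eq_def by blast
    from has_cov_deriv_cong[OF this xab refl eq(2)]
    show "has_cov_deriv atl nab {a..b} (G 0) (Y i) x ((\<Sum>j\<in>UNIV. K x i j *\<^sub>R Y j x) +
        curvature atl nab (G 0 x) (\<Sum>j\<in>UNIV. k j *\<^sub>R F 0 j x) (X x) (F 0 i x))"
      by (simp add: eq[OF xab])
  qed
qed

lemma jacobi_eq_subset: "jacobi_eq I \<sigma> E k K X Y \<Longrightarrow> J \<subseteq> I \<Longrightarrow> jacobi_eq J \<sigma> E k K X Y"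
  unfolding jacobi_eq_def using has_cov_deriv_subset by blast

text \<open>The initial data \<open>p\<close> and \<open>e\<close> are kept general because, when
  two pieces are joined, the end values of the first family are the initial data of the
  second.\<close>

definition variation_on where
  "variation_on a b \<gamma> E k K X Y p e \<epsilon> G F \<longleftrightarrow> \<epsilon> > (0::real) \<and>
    (\<forall>\<tau>. \<bar>\<tau>\<bar> < \<epsilon> \<longrightarrow> frame_eq {a..b} (G \<tau>) (F \<tau>) k K \<and> G \<tau> a = p \<tau> \<and> (\<forall>i. F \<tau> i a = e i \<tau>)) \<and>
    (\<forall>t\<in>{a..b}. G 0 t = \<gamma> t \<and> (\<forall>i. F 0 i t = E i t) \<and>
      has_frame_deriv (\<lambda>\<tau>. G \<tau> t) (\<lambda>i \<tau>. F \<tau> i t) (X t) (\<lambda>i. Y i t))"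

lemma variation_on_glue:
  assumes ab: "a \<le> b" "b \<le> (c::real)" and 1: "variation_on a b \<gamma> E k K X Y p e \<epsilon>1 G1 F1"
    and 2: "variation_on b c \<gamma> E k K X Y (\<lambda>\<tau>. G1 \<tau> b) (\<lambda>i \<tau>. F1 \<tau> i b) \<epsilon>2 G2 F2"
  shows "variation_on a c \<gamma> E k K X Y p e (min \<epsilon>1 \<epsilon>2)
    (\<lambda>\<tau> t. if t \<le> b then G1 \<tau> t else G2 \<tau> t) (\<lambda>\<tau> i t. if t \<le> b then F1 \<tau> i t else F2 \<tau> i t)"
  unfolding variation_on_def
proof (intro conjI allI impI ballI)
  show "min \<epsilon>1 \<epsilon>2 > 0" using 1 2 unfolding variation_on_def by simp
  fix \<tau> assume \<tau>: "\<bar>\<tau>\<bar> < min \<epsilon>1 \<epsilon>2"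
  have f1: "frame_eq {a..b} (G1 \<tau>) (F1 \<tau>) k K" "G1 \<tau> a = p \<tau>" "\<And>i. F1 \<tau> i a = e i \<tau>"
    using 1 \<tau> unfolding variation_on_def by auto
  have f2: "frame_eq {b..c} (G2 \<tau>) (F2 \<tau>) k K" "G2 \<tau> b = G1 \<tau> b" "\<And>i. F2 \<tau> i b = F1 \<tau> i b"
    using 2 \<tau> unfolding variation_on_def by auto
  show "frame_eq {a..c} (\<lambda>t. if t \<le> b then G1 \<tau> t else G2 \<tau> t) (\<lambda>i t. if t \<le> b then F1 \<tau> i t else F2 \<tau> i t) k K"
  proof (rule frame_eq_glue[OF ab frame_eq_cong[OF f1(1)] frame_eq_cong[OF f2(1)]])
    fix s i assume "s \<in> {b..c}"
    then have "s = b \<or> \<not> s \<le> b" by auto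
    then show "G2 \<tau> s = (if s \<le> b then G1 \<tau> s else G2 \<tau> s)" "F2 \<tau> i s = (if s \<le> b then F1 \<tau> i s else F2 \<tau> i s)"
      using f2 by auto
  qed auto
  show "(if a \<le> b then G1 \<tau> a else G2 \<tau> a) = p \<tau>" "(if a \<le> b then F1 \<tau> i a else F2 \<tau> i a) = e i \<tau>" for i
    using f1 ab by auto
next
  fix t assume "t \<in> {a..c}"
  then have "t \<le> b \<and> t \<in> {a..b} \<or> \<not> t \<le> b \<and> t \<in> {b..c}" by auto
  then show "(if t \<le> b then G1 0 t else G2 0 t) = \<gamma> t" "(if t \<le> b then F1 0 i t else F2 0 i t) = E i t"
    "has_frame_deriv (\<lambda>\<tau>. if t \<le> b then G1 \<tau> t else G2 \<tau> t) (\<lambda>i \<tau>. if t \<le> b then F1 \<tau> i t else F2 \<tau> i t) (X t) (\<lambda>i. Y i t)" for i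
    using 1 2 unfolding variation_on_def by auto
qed

lemma global_variation_exists:
  assumes L: "L \<ge> 0" and K: "\<And>i j. continuous_on {0..L} (\<lambda>t. K t i j)"
    and base: "frame_eq {0..L} \<gamma> E k K" and jac: "jacobi_eq {0..L} \<gamma> E k K X Y"
    and init: "has_frame_deriv p e (X 0) (\<lambda>i. Y i 0)" "p 0 = \<gamma> 0" "\<And>i. e i 0 = E i 0"
  shows "\<exists>\<epsilon> G F. variation_on 0 L \<gamma> E k K X Y p e \<epsilon> G F"
proof -
  define I where "I a p e \<longleftrightarrow> has_frame_deriv p e (X a) (\<lambda>i. Y i a) \<and> p 0 = \<gamma> a \<and> (\<forall>i. e i 0 = E i a)" for a p e
  define Q where "Q a b \<longleftrightarrow> (\<forall>p e. I a p e \<longrightarrow> (\<exists>\<epsilon> G F. variation_on a b \<gamma> E k K X Y p e \<epsilon> G F))" for a b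
  have "(0::real) \<le> 0 \<and> L \<le> L \<longrightarrow> Q 0 L"
  proof (rule Bolzano[OF L, where P="\<lambda>a b. 0 \<le> a \<and> b \<le> L \<longrightarrow> Q a b"])
    fix a b c :: real
    assume 1: "0 \<le> a \<and> b \<le> L \<longrightarrow> Q a b" and 2: "0 \<le> b \<and> c \<le> L \<longrightarrow> Q b c" and ab: "a \<le> b" "b \<le> c"
    show "0 \<le> a \<and> c \<le> L \<longrightarrow> Q a c"
      unfolding Q_def
    proof (intro impI allI)
      fix p e assume ac: "0 \<le> a \<and> c \<le> L" and I: "I a p e"
      have Qab: "Q a b" and Qbc: "Q b c" using 1 2 ac ab by auto
      obtain \<epsilon>1 G1 F1 where v1: "variation_on a b \<gamma> E k K X Y p e \<epsilon>1 G1 F1"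
        using Qab[unfolded Q_def] I by blast
      then have Ib: "I b (\<lambda>\<tau>. G1 \<tau> b) (\<lambda>i \<tau>. F1 \<tau> i b)" using ab unfolding I_def variation_on_def by auto
      obtain \<epsilon>2 G2 F2 where "variation_on b c \<gamma> E k K X Y (\<lambda>\<tau>. G1 \<tau> b) (\<lambda>i \<tau>. F1 \<tau> i b) \<epsilon>2 G2 F2"
        using Qbc[unfolded Q_def] Ib by blast
      from variation_on_glue[OF ab v1 this] show "\<exists>\<epsilon> G F. variation_on a c \<gamma> E k K X Y p e \<epsilon> G F" by blast
    qed
  next
    fix x assume x: "0 \<le> x" "x \<le> L"
    obtain c d where c: "c \<in> atl" "d > 0" "\<And>u. u \<in> {0..L} \<Longrightarrow> \<bar>u - x\<bar> < d \<Longrightarrow> \<gamma> u \<in> cdom c"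
      using chart_nhd[OF frame_eq_cont[OF base], of x] x by auto
    have "Q a b" if ab: "a \<le> x" "x \<le> b" "b - a < d" "0 \<le> a" "b \<le> L" for a b
      unfolding Q_def
    proof (intro allI impI)
      fix p e assume I: "I a p e"
      then have I': "has_frame_deriv p e (X a) (\<lambda>i. Y i a)" "p 0 = \<gamma> a" "\<And>i. e i 0 = E i a" unfolding I_def by auto
      have sub: "{a..b} \<subseteq> {0..L}" using ab by auto
      have in_c: "\<gamma> u \<in> cdom c" if "u \<in> {a..b}" for u
        by (rule c(3)) (use that sub ab in auto)
      show "\<exists>\<epsilon> G F. variation_on a b \<gamma> E k K X Y p e \<epsilon> G F"
      proof (rule local_variation_exists[OF c(1) order_trans[OF ab(1,2)] continuous_on_subset[OF K sub]
              frame_eq_subset[OF base sub] in_c jacobi_eq_subset[OF jac sub] I'])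
        fix \<epsilon> :: real and G F
        assume "\<epsilon> > 0"
        "\<And>\<tau>. \<bar>\<tau>\<bar> < \<epsilon> \<Longrightarrow> frame_eq {a..b} (G \<tau>) (F \<tau>) k K"
        "\<And>\<tau>. \<bar>\<tau>\<bar> < \<epsilon> \<Longrightarrow> G \<tau> a = p \<tau>" "\<And>\<tau> i. \<bar>\<tau>\<bar> < \<epsilon> \<Longrightarrow> F \<tau> i a = e i \<tau>"
        "\<And>t. t \<in> {a..b} \<Longrightarrow> G 0 t = \<gamma> t" "\<And>t i. t \<in> {a..b} \<Longrightarrow> F 0 i t = E i t"
        "\<And>t. t \<in> {a..b} \<Longrightarrow> has_frame_deriv (\<lambda>\<tau>. G \<tau> t) (\<lambda>i \<tau>. F \<tau> i t) (X t) (\<lambda>i. Y i t)"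
        then have "variation_on a b \<gamma> E k K X Y p e \<epsilon> G F" unfolding variation_on_def by simp
        then show ?thesis by blast
      qed
    qed
    then show "\<exists>d>0. \<forall>a b. a \<le> x \<and> x \<le> b \<and> b - a < d \<longrightarrow> 0 \<le> a \<and> b \<le> L \<longrightarrow> Q a b"
      using c(2) by blast
  qed
  then show ?thesis using init unfolding Q_def I_def by blast
qed

end

section \<open>Bishop frames\<close>

lemma has_derivative_imp_has_vector_derivative:
  assumes "(f has_derivative f') (at t within S)"
  shows "(f has_vector_derivative f' 1) (at t within S)"
proof -
  have "f' = (\<lambda>h. h *\<^sub>R f' 1)"
  proof
    fix h show "f' h = h *\<^sub>R f' 1" using linear_cmul[OF has_derivative_linear[OF assms], of h 1] by simp
  qed
  from has_derivative_eq_rhs[OF assms this] show ?thesis unfolding has_vector_derivative_def .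
qed

lemma range_Rep_frame_index: "range (Rep_frame_index :: 'e::euclidean_space frame_index \<Rightarrow> nat) = {1..DIM('e)}"
  by (rule type_definition.Rep_range[OF type_definition_frame_index])

lemma Rep_frame_index_bounds: "1 \<le> Rep_frame_index (i :: 'e::euclidean_space frame_index)" "Rep_frame_index i \<le> DIM('e)"
  using Rep_frame_index[of i] by auto

lemma inj_Rep_frame_index: "inj Rep_frame_index"
  by (simp add: inj_on_def Rep_frame_index_inject)

lemma sum_frame_index:
  "(\<Sum>j\<in>UNIV. h (Rep_frame_index (j :: 'e::euclidean_space frame_index))) = (\<Sum>i\<in>{1..DIM('e)}. h i)"
  unfolding range_Rep_frame_index[symmetric] by (simp add: sum.reindex[OF inj_Rep_frame_index])

lemma all_frame_index: "(\<forall>i :: 'e::euclidean_space frame_index. P (Rep_frame_index i)) \<longleftrightarrow> (\<forall>i\<in>{1..DIM('e)}. P i)"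
  unfolding range_Rep_frame_index[symmetric] by blast

lemma card_frame_index: "CARD('e::euclidean_space frame_index) = DIM('e)"
  using card_image[OF inj_Rep_frame_index, where ?'a1='e] unfolding range_Rep_frame_index by simp

lemma Icc_1_DIM: "{1..DIM('e::euclidean_space)} = insert 1 {2..DIM('e)}"
  using DIM_positive[where 'a='e] by auto

definition kvec :: "'e::euclidean_space frame_index \<Rightarrow> real" where
  "kvec j = (if Rep_frame_index j = 1 then 1 else 0)"

text \<open>Only the first row and column are nonzero: a normal field of a Bishop frame turns
  towards the tangent alone, and orthonormality forces the coefficient there.\<close>

definition Kmat :: "(nat \<Rightarrow> real \<Rightarrow> real) \<Rightarrow> real \<Rightarrow> 'e::euclidean_space frame_index \<Rightarrow> 'e frame_index \<Rightarrow> real" where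
  "Kmat \<kappa> t i j = (if Rep_frame_index i = 1 then (if Rep_frame_index j = 1 then 0 else \<kappa> (Rep_frame_index j) t)
     else if Rep_frame_index j = 1 then - \<kappa> (Rep_frame_index i) t else 0)"

lemma Kmat_skew: "Kmat \<kappa> t i j = - Kmat \<kappa> t j i"
  by (simp add: Kmat_def)

lemma kvec_sum: "(\<Sum>j\<in>(UNIV :: 'e frame_index set). kvec j *\<^sub>R F (Rep_frame_index j)) = (F 1 :: 'e::euclidean_space)"
proof -
  have "(\<Sum>j\<in>(UNIV :: 'e frame_index set). kvec j *\<^sub>R F (Rep_frame_index j)) =
    (\<Sum>i\<in>{1..DIM('e)}. (if i = 1 then 1 else 0) *\<^sub>R F i)"
    unfolding kvec_def by (rule sum_frame_index[of "\<lambda>i. (if i = 1 then 1 else 0) *\<^sub>R F i"])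
  also have "\<dots> = F 1" unfolding Icc_1_DIM by simp
  finally show ?thesis .
qed

lemma Kmat_sum: "(\<Sum>j\<in>(UNIV :: 'e frame_index set). Kmat \<kappa> t i j *\<^sub>R F (Rep_frame_index j)) =
   (if Rep_frame_index i = 1 then (\<Sum>i\<in>{2..DIM('e)}. \<kappa> i t *\<^sub>R F i) else - \<kappa> (Rep_frame_index i) t *\<^sub>R (F 1 :: 'e::euclidean_space))"
proof -
  let ?h = "\<lambda>j. (if Rep_frame_index i = 1 then (if j = 1 then 0 else \<kappa> j t)
     else if j = 1 then - \<kappa> (Rep_frame_index i) t else 0) *\<^sub>R F j"
  have "(\<Sum>j\<in>(UNIV :: 'e frame_index set). Kmat \<kappa> t i j *\<^sub>R F (Rep_frame_index j)) = (\<Sum>j\<in>{1..DIM('e)}. ?h j)"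
    unfolding Kmat_def by (rule sum_frame_index[of ?h])
  also have "\<dots> = ?h 1 + (\<Sum>j\<in>{2..DIM('e)}. ?h j)" unfolding Icc_1_DIM by simp
  also have "(\<Sum>j\<in>{2..DIM('e)}. ?h j) = (if Rep_frame_index i = 1 then (\<Sum>i\<in>{2..DIM('e)}. \<kappa> i t *\<^sub>R F i) else 0)"
    by (auto intro: sum.cong)
  finally show ?thesis by simp
qed

context riemannian_manifold
begin

section \<open>Orthonormality, and Bishop frames as solutions of the frame equation\<close>

definition orth :: "'m \<Rightarrow> ('e frame_index \<Rightarrow> 'e) \<Rightarrow> bool" where
  "orth p e \<longleftrightarrow> (\<forall>i j. g p (e i) (e j) = (if i = j then 1 else 0))"

lemma orthonormal_frame_iff: "orthonormal_frame g p e \<longleftrightarrow> orth p (\<lambda>i. e (Rep_frame_index i))"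
  unfolding orthonormal_frame_def orth_def all_frame_index[symmetric] Rep_frame_index_inject ..

lemma g_orthogonal_independent:
  assumes A: "finite A" "0 \<notin> A" "\<And>x y. x \<in> A \<Longrightarrow> y \<in> A \<Longrightarrow> x \<noteq> y \<Longrightarrow> g p x y = 0"
  shows "independent A"
proof (rule independent_if_scalars_zero[OF A(1)])
  fix f x assume 0: "(\<Sum>x\<in>A. f x *\<^sub>R x) = 0" and x: "x \<in> A"
  have "0 = g p (\<Sum>x\<in>A. f x *\<^sub>R x) x" by (simp add: 0 g_simps)
  also have "\<dots> = (\<Sum>y\<in>A. f y * g p y x)" by (simp add: g_simps)
  also have "\<dots> = (\<Sum>y\<in>A. if y = x then f x * g p x x else 0)" by (rule sum.cong) (use A(3) x in auto)
  also have "\<dots> = f x * g p x x" using A(1) x by simp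
  finally show "f x = 0" using g_pos[of x p] A(2) x by (metis mult_eq_0_iff less_irrefl)
qed

text \<open>The remainder of the expansion is orthogonal to the whole frame. If it were nonzero,
  there would be one more independent vector than the dimension allows.\<close>

lemma orth_expand:
  assumes o: "orth p e"
  shows "v = (\<Sum>j\<in>UNIV. g p v (e j) *\<^sub>R e j)"
proof (rule ccontr)
  assume neq: "v \<noteq> (\<Sum>j\<in>UNIV. g p v (e j) *\<^sub>R e j)"
  define w where "w = v - (\<Sum>j\<in>UNIV. g p v (e j) *\<^sub>R e j)"
  have ee: "g p (e i) (e j) = (if i = j then 1 else 0)" for i j using o by (simp add: orth_def)
  have w0: "g p w (e i) = 0" for i
    by (simp add: w_def g_simps ee if_distrib sum.delta cong: if_cong)
  have "w \<noteq> 0" using neq by (simp add: w_def)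
  have inj: "inj e"
  proof (rule injI)
    fix i j assume "e i = e j"
    then have "g p (e i) (e j) = 1" using ee[of j j] by simp
    then show "i = j" using ee[of i j] by (simp split: if_splits)
  qed
  have wn: "w \<notin> range e" using w0 ee by (metis rangeE zero_neq_one)
  have "independent (insert w (range e))"
  proof (rule g_orthogonal_independent)
    show "0 \<notin> insert w (range e)" using \<open>w \<noteq> 0\<close> ee g_simps(7) by (metis insert_iff rangeE zero_neq_one)
    show "g p x y = 0" if "x \<in> insert w (range e)" "y \<in> insert w (range e)" "x \<noteq> y" for x y
      using that w0 ee g_sym[of p w] by (auto split: if_splits)
  qed simp
  then have "card (insert w (range e)) \<le> DIM('e)" using independent_bound by blast
  moreover have "card (insert w (range e)) = Suc (DIM('e))"
    using wn by (simp add: card_image[OF inj] card_frame_index)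
  ultimately show False by simp
qed

text \<open>The defect \<open>Z\<close> of the Gram matrix satisfies the linear equation Z' = KZ -
  ZK, because the inhomogeneous term \<open>K t i j + K t j i\<close> vanishes. The sum of the
  squared entries of \<open>Z\<close> then has zero derivative, again by skew-symmetry, and it
  starts at 0.\<close>

lemma orth_preserved:
  assumes sol: "frame_eq {a..b} \<sigma> E k K" and skew: "\<And>t i j. t \<in> {a..b} \<Longrightarrow> K t i j = - K t j i"
    and s: "s \<in> {a..b}" "orth (\<sigma> s) (\<lambda>i. E i s)" and t: "t \<in> {a..b}"
  shows "orth (\<sigma> t) (\<lambda>i. E i t)"
proof -
  define Z where "Z i j t = g (\<sigma> t) (E i t) (E j t) - (if i = j then 1 else 0)" for i j t
  have Zd: "(Z i j has_real_derivative (\<Sum>l\<in>UNIV. K t i l * Z l j t) + (\<Sum>l\<in>UNIV. K t j l * Z i l t)) (at t within {a..b})"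
    if t: "t \<in> {a..b}" for i j t
  proof -
    have c: "has_cov_deriv atl nab {a..b} \<sigma> (E i) t (\<Sum>l\<in>UNIV. K t i l *\<^sub>R E l t)" for i
      using sol t unfolding frame_eq_def by blast
    have "((\<lambda>s. g (\<sigma> s) (E i s) (E j s)) has_real_derivative
       (\<Sum>l\<in>UNIV. K t i l * g (\<sigma> t) (E l t) (E j t)) + (\<Sum>l\<in>UNIV. K t j l * g (\<sigma> t) (E i t) (E l t))) (at t within {a..b})"
      using has_cov_deriv_metric[OF t c c, of i j]
      unfolding has_real_derivative_iff_has_vector_derivative by (simp add: g_simps)
    then have "(Z i j has_real_derivative
       (\<Sum>l\<in>UNIV. K t i l * g (\<sigma> t) (E l t) (E j t)) + (\<Sum>l\<in>UNIV. K t j l * g (\<sigma> t) (E i t) (E l t)) - 0) (at t within {a..b})"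
      unfolding Z_def by (intro DERIV_diff DERIV_const)
    moreover have "(\<Sum>l\<in>UNIV. K t i l * g (\<sigma> t) (E l t) (E j t)) = (\<Sum>l\<in>UNIV. K t i l * Z l j t + (if l = j then K t i j else 0))"
      by (rule sum.cong) (auto simp: Z_def right_diff_distrib)
    moreover have "(\<Sum>l\<in>UNIV. K t j l * g (\<sigma> t) (E i t) (E l t)) = (\<Sum>l\<in>UNIV. K t j l * Z i l t + (if l = i then K t j i else 0))"
      by (rule sum.cong) (auto simp: Z_def right_diff_distrib)
    ultimately show ?thesis using skew[OF t, of i j] by (simp add: sum.distrib)
  qed
  define h where "h t = (\<Sum>i\<in>UNIV. \<Sum>j\<in>UNIV. Z i j t * Z i j t)" for t
  \<comment> \<open>Exchanging the names of \<open>i\<close> and \<open>l\<close> turns the sum into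
    its negative.\<close>
  have zero: "(\<Sum>i\<in>UNIV. \<Sum>j\<in>UNIV. \<Sum>l\<in>UNIV. K t i l * (Z l j t * Z i j t)) = 0" if t: "t \<in> {a..b}" for t
  proof -
    let ?S = "\<Sum>i\<in>UNIV. \<Sum>j\<in>UNIV. \<Sum>l\<in>UNIV. K t i l * (Z l j t * Z i j t)"
    have "?S = (\<Sum>j\<in>UNIV. \<Sum>i\<in>UNIV. \<Sum>l\<in>UNIV. K t i l * (Z l j t * Z i j t))" by (rule sum.swap)
    also have "\<dots> = (\<Sum>j\<in>UNIV. \<Sum>l\<in>UNIV. \<Sum>i\<in>UNIV. K t i l * (Z l j t * Z i j t))"
      by (intro sum.cong refl sum.swap)
    also have "\<dots> = (\<Sum>j\<in>UNIV. \<Sum>l\<in>UNIV. \<Sum>i\<in>UNIV. - (K t l i * (Z i j t * Z l j t)))"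
    proof (intro sum.cong refl)
      fix i j l show "K t i l * (Z l j t * Z i j t) = - (K t l i * (Z i j t * Z l j t))"
        using skew[OF t, of i l] by simp
    qed
    also have "\<dots> = - (\<Sum>j\<in>UNIV. \<Sum>l\<in>UNIV. \<Sum>i\<in>UNIV. K t l i * (Z i j t * Z l j t))"
      by (simp add: sum_negf)
    also have "(\<Sum>j\<in>UNIV. \<Sum>l\<in>UNIV. \<Sum>i\<in>UNIV. K t l i * (Z i j t * Z l j t)) = ?S" by (rule sum.swap)
    finally show ?thesis by simp
  qed
  have Zsym: "Z i j t = Z j i t" for i j t by (simp add: Z_def g_sym)
  have hd: "(h has_real_derivative 0) (at t within {a..b})" if t: "t \<in> {a..b}" for t
  proof -
    have "(h has_real_derivative (\<Sum>i\<in>UNIV. \<Sum>j\<in>UNIV. 2 * (((\<Sum>l\<in>UNIV. K t i l * Z l j t) + (\<Sum>l\<in>UNIV. K t j l * Z i l t)) * Z i j t))) (at t within {a..b})"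
      unfolding h_def by (intro DERIV_sum) (rule DERIV_cong[OF DERIV_mult[OF Zd[OF t] Zd[OF t]]], simp add: algebra_simps)
    moreover have "(\<Sum>i\<in>UNIV. \<Sum>j\<in>UNIV. 2 * (((\<Sum>l\<in>UNIV. K t i l * Z l j t) + (\<Sum>l\<in>UNIV. K t j l * Z i l t)) * Z i j t)) =
      2 * (\<Sum>i\<in>UNIV. \<Sum>j\<in>UNIV. \<Sum>l\<in>UNIV. K t i l * (Z l j t * Z i j t)) + 2 * (\<Sum>i\<in>UNIV. \<Sum>j\<in>UNIV. \<Sum>l\<in>UNIV. K t j l * (Z i l t * Z i j t))"
      by (simp add: distrib_right sum.distrib sum_distrib_left sum_distrib_right mult.assoc)
    moreover have "(\<Sum>i\<in>UNIV. \<Sum>j\<in>UNIV. \<Sum>l\<in>UNIV. K t j l * (Z i l t * Z i j t)) = (\<Sum>i\<in>UNIV. \<Sum>j\<in>UNIV. \<Sum>l\<in>UNIV. K t i l * (Z l j t * Z i j t))"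
      by (subst sum.swap) (simp only: Zsym)
    ultimately show ?thesis using zero[OF t] by simp
  qed
  have "h t = h s"
  proof (rule has_derivative_zero_unique[where f=h and s="{a..b}"])
    show "(h has_derivative (\<lambda>_. 0)) (at x within {a..b})" if "x \<in> {a..b}" for x
      using hd[OF that] unfolding has_field_derivative_def by (simp add: lambda_zero)
  qed (use s t in auto)
  also have "h s = 0" using s(2) by (simp add: h_def Z_def orth_def)
  finally have "\<forall>i\<in>UNIV. (\<Sum>j\<in>UNIV. Z i j t * Z i j t) = 0"
    unfolding h_def by (subst (asm) sum_nonneg_eq_0_iff) (auto intro: sum_nonneg)
  then have "\<forall>i. \<forall>j\<in>UNIV. Z i j t * Z i j t = 0"
    by (subst (asm) sum_nonneg_eq_0_iff) auto
  then show ?thesis by (simp add: Z_def orth_def)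
qed

lemma at_within_Icc_nontrivial:
  assumes L: "(0::real) < L" and t: "t \<in> {0..L}"
  shows "at t within {0..L} \<noteq> bot"
proof -
  have "0 \<in> {0..L}" "L \<in> {0..L}" using L by auto
  then have "{0..L} \<noteq> {x}" for x using L by (metis less_irrefl singletonD)
  with connected_imp_perfect[OF connected_Icc t] show ?thesis by (simp add: trivial_limit_within)
qed

lemma bishop_imp_frame_eq:
  assumes L: "L > 0" and b: "bishop_frame atl g nab L \<gamma> F" and \<kappa>: "geodesic_curvatures atl nab L \<gamma> F \<kappa>"
  shows "frame_eq {0..L} \<gamma> (\<lambda>i. F (Rep_frame_index i)) kvec (Kmat \<kappa>)"
    and "t \<in> {0..L} \<Longrightarrow> orth (\<gamma> t) (\<lambda>i. F (Rep_frame_index i) t)"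
proof -
  have vel: "has_velocity atl {0..L} \<gamma> t (F 1 t)" and o: "orthonormal_frame g (\<gamma> t) (\<lambda>i. F i t)"
    and cov: "\<And>i. i \<in> {2..DIM('e)} \<Longrightarrow> \<exists>a. has_cov_deriv atl nab {0..L} \<gamma> (F i) t (a *\<^sub>R F 1 t)" if "t \<in> {0..L}" for t
    using b that unfolding bishop_frame_def by blast+
  have c1: "has_cov_deriv atl nab {0..L} \<gamma> (F 1) t (\<Sum>i\<in>{2..DIM('e)}. \<kappa> i t *\<^sub>R F i t)" if "t \<in> {0..L}" for t
    using \<kappa> that unfolding geodesic_curvatures_def by blast
  show orth: "orth (\<gamma> t) (\<lambda>i. F (Rep_frame_index i) t)" if "t \<in> {0..L}" for t
    using o[OF that] unfolding orthonormal_frame_iff .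
  \<comment> \<open>The definition of a Bishop frame leaves the multiple of the tangent open;
    differentiating the orthogonality of \<open>F i\<close> and \<open>F 1\<close> determines
    it.\<close>
  have ci: "has_cov_deriv atl nab {0..L} \<gamma> (F i) t (- \<kappa> i t *\<^sub>R F 1 t)" if t: "t \<in> {0..L}" and i: "i \<in> {2..DIM('e)}" for t i
  proof -
    obtain a where a: "has_cov_deriv atl nab {0..L} \<gamma> (F i) t (a *\<^sub>R F 1 t)" using cov[OF t i] by blast
    have gF: "g (\<gamma> s) (F i s) (F j s) = (if i = j then 1 else 0)" if "s \<in> {0..L}" "i \<in> {1..DIM('e)}" "j \<in> {1..DIM('e)}" for i j s
      using o[OF that(1)] that unfolding orthonormal_frame_def by blast
    have one: "1 \<in> {1..DIM('e)}" using DIM_positive[where 'a='e] by auto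
    have "((\<lambda>s. g (\<gamma> s) (F i s) (F 1 s)) has_vector_derivative
        g (\<gamma> t) (a *\<^sub>R F 1 t) (F 1 t) + g (\<gamma> t) (F i t) (\<Sum>j\<in>{2..DIM('e)}. \<kappa> j t *\<^sub>R F j t)) (at t within {0..L})"
      by (rule has_cov_deriv_metric[OF t a c1[OF t]])
    moreover have "g (\<gamma> t) (a *\<^sub>R F 1 t) (F 1 t) = a" using gF[OF t one one] by (simp add: g_simps)
    moreover have "g (\<gamma> t) (F i t) (\<Sum>j\<in>{2..DIM('e)}. \<kappa> j t *\<^sub>R F j t) = \<kappa> i t"
    proof -
      have "g (\<gamma> t) (F i t) (\<Sum>j\<in>{2..DIM('e)}. \<kappa> j t *\<^sub>R F j t) = (\<Sum>j\<in>{2..DIM('e)}. if j = i then \<kappa> i t else 0)"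
        unfolding g_simps by (rule sum.cong) (use gF[OF t] i in auto)
      then show ?thesis using i by simp
    qed
    ultimately have "((\<lambda>s. g (\<gamma> s) (F i s) (F 1 s)) has_vector_derivative a + \<kappa> i t) (at t within {0..L})" by simp
    moreover have "((\<lambda>s. g (\<gamma> s) (F i s) (F 1 s)) has_vector_derivative 0) (at t within {0..L})"
      by (rule has_vector_derivative_transform[OF t, of _ "\<lambda>_. 0"]) (use gF i one in auto)
    ultimately have "a + \<kappa> i t = 0"
      by (rule vector_derivative_unique_within[OF at_within_Icc_nontrivial[OF L t]])
    then have "a = - \<kappa> i t" by simp
    then show ?thesis using a by simp
  qed
  show "frame_eq {0..L} \<gamma> (\<lambda>i. F (Rep_frame_index i)) kvec (Kmat \<kappa>)"
    unfolding frame_eq_def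
  proof (intro ballI conjI allI)
    fix t and i :: "'e frame_index" assume t: "t \<in> {0..L}"
    show "has_velocity atl {0..L} \<gamma> t (\<Sum>j\<in>(UNIV :: 'e frame_index set). kvec j *\<^sub>R F (Rep_frame_index j) t)"
      using vel[OF t] kvec_sum[of "\<lambda>i. F i t"] by simp
    show "has_cov_deriv atl nab {0..L} \<gamma> (F (Rep_frame_index i)) t (\<Sum>j\<in>(UNIV :: 'e frame_index set). Kmat \<kappa> t i j *\<^sub>R F (Rep_frame_index j) t)"
      unfolding Kmat_sum[of \<kappa> t i "\<lambda>i. F i t"]
      using c1[OF t] ci[OF t, of "Rep_frame_index i"] Rep_frame_index_bounds[of i]
      by (cases "Rep_frame_index i = 1") auto
  qed
qed

lemma frame_eq_imp_bishop:
  assumes f: "frame_eq {0..L} \<gamma> (\<lambda>i. F (Rep_frame_index i)) kvec (Kmat \<kappa>)"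
    and o: "\<And>t. t \<in> {0..L} \<Longrightarrow> orth (\<gamma> t) (\<lambda>i. F (Rep_frame_index i) t)"
  shows "bishop_frame atl g nab L \<gamma> F" "geodesic_curvatures atl nab L \<gamma> F \<kappa>"
proof -
  have v: "has_velocity atl {0..L} \<gamma> t (F 1 t)" if "t \<in> {0..L}" for t
  proof -
    have "has_velocity atl {0..L} \<gamma> t (\<Sum>j\<in>(UNIV :: 'e frame_index set). kvec j *\<^sub>R F (Rep_frame_index j) t)"
      using f that unfolding frame_eq_def by blast
    then show ?thesis unfolding kvec_sum[of "\<lambda>i. F i t"] .
  qed
  have "\<forall>i::'e frame_index. has_cov_deriv atl nab {0..L} \<gamma> (F (Rep_frame_index i)) t
     (if Rep_frame_index i = 1 then (\<Sum>i\<in>{2..DIM('e)}. \<kappa> i t *\<^sub>R F i t) else - \<kappa> (Rep_frame_index i) t *\<^sub>R F 1 t)" if "t \<in> {0..L}" for t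
    using f that unfolding frame_eq_def Kmat_sum[of \<kappa> t _ "\<lambda>i. F i t", symmetric] by blast
  note c = this[unfolded all_frame_index[where P="\<lambda>i. has_cov_deriv atl nab {0..L} \<gamma> (F i) _
     (if i = 1 then (\<Sum>i\<in>{2..DIM('e)}. \<kappa> i _ *\<^sub>R F i _) else - \<kappa> i _ *\<^sub>R F 1 _)"]]
  have c1: "has_cov_deriv atl nab {0..L} \<gamma> (F 1) t (\<Sum>i\<in>{2..DIM('e)}. \<kappa> i t *\<^sub>R F i t)" if "t \<in> {0..L}" for t
    using c[OF that, THEN bspec, of 1] Icc_1_DIM[where 'e='e] by auto
  have ci: "has_cov_deriv atl nab {0..L} \<gamma> (F i) t (- \<kappa> i t *\<^sub>R F 1 t)" if "t \<in> {0..L}" "i \<in> {2..DIM('e)}" for t i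
    using c[OF that(1), THEN bspec, of i] that(2) by auto
  show "geodesic_curvatures atl nab L \<gamma> F \<kappa>" unfolding geodesic_curvatures_def using c1 by blast
  show "bishop_frame atl g nab L \<gamma> F" unfolding bishop_frame_def orthonormal_frame_iff
    using v o ci by blast
qed

subsection \<open>Regularity along curves\<close>

text \<open>A bootstrap: the right side of the system is continuous along a solution, so the state
  is C^1; the velocity is a constant combination of the frame, hence C^1 as well, and the curve is
  C^2.\<close>

lemma frame_eq_regular:
  assumes f: "frame_eq I \<sigma> E k K" and K: "\<And>i j. continuous_on I (\<lambda>t. K t i j)"
  shows "C_k_curve atl 2 I \<sigma>" "C_k_field_along atl 1 I \<sigma> (E i)"
proof -
  have key: "C_k_on 1 (I \<inter> \<sigma> -` cdom c) (\<lambda>s. cstate c (\<sigma> s) (\<lambda>i. E i s))" if c: "c \<in> atl" for c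
  proof -
    let ?J = "I \<inter> \<sigma> -` cdom c"
    let ?y = "\<lambda>s. cstate c (\<sigma> s) (\<lambda>i. E i s)"
    have d: "(?y has_vector_derivative fld c k K s (?y s)) (at s within ?J)" if "s \<in> ?J" for s
      using frame_eq_chartD[OF f _ c, of s] that by (auto intro: has_vector_derivative_within_subset)
    have cy: "continuous_on ?J ?y"
      unfolding continuous_on_eq_continuous_within using has_vector_derivative_continuous[OF d] by blast
    have K': "continuous_on ?J (\<lambda>t. K t i j)" for i j by (rule continuous_on_subset[OF K]) auto
    have "(\<lambda>s. (s, ?y s)) ` ?J \<subseteq> ?J \<times> cimg c \<times> UNIV" by (auto simp: cstate_def)
    from continuous_on_compose2[OF fld_continuous[where K=K and k=k, OF c K'] continuous_on_Pair[OF continuous_on_id cy] this]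
    have cf: "continuous_on ?J (\<lambda>s. fld c k K s (?y s))" by simp
    have "C_k_on (Suc 0) ?J ?y"
      by (rule C_k_on_SucI[of _ _ "\<lambda>s h. h *\<^sub>R fld c k K s (?y s)"])
        (use d in \<open>auto simp: has_vector_derivative_def intro!: continuous_intros cf\<close>)
    then show ?thesis by simp
  qed
  have E: "C_k_on 1 (I \<inter> \<sigma> -` cdom c) (\<lambda>s. D c (\<sigma> s) (E i s))" if "c \<in> atl" for c i
    using C_k_on_bounded_linear_compose[OF bounded_linear_compose[OF bounded_linear_vec_nth[of i] bounded_linear_snd] key[OF that]]
    by (simp add: cstate_def)
  show "C_k_field_along atl 1 I \<sigma> (E i)" unfolding C_k_field_along_def using E by blast
  show "C_k_curve atl 2 I \<sigma>"
    unfolding C_k_curve_def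
  proof (intro conjI ballI frame_eq_cont[OF f])
    fix c assume c: "c \<in> atl"
    let ?J = "I \<inter> \<sigma> -` cdom c"
    have "C_k_on (Suc 1) ?J (cmap c \<circ> \<sigma>)"
    proof (rule C_k_on_SucI[of _ _ "\<lambda>s h. h *\<^sub>R (\<Sum>j\<in>UNIV. k j *\<^sub>R D c (\<sigma> s) (E j s))"])
      fix s assume s: "s \<in> ?J"
      have "has_velocity atl I \<sigma> s (\<Sum>j\<in>UNIV. k j *\<^sub>R E j s)" using f s unfolding frame_eq_def by blast
      from has_vector_derivative_within_subset[OF has_velocity_chartD[OF this c] Int_lower1] s
      show "(cmap c \<circ> \<sigma> has_derivative (\<lambda>h. h *\<^sub>R (\<Sum>j\<in>UNIV. k j *\<^sub>R D c (\<sigma> s) (E j s)))) (at s within ?J)"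
        unfolding has_vector_derivative_def comp_def by (simp add: D_sum[OF c])
    qed (intro C_k_on_scaleR C_k_on_const C_k_on_sum E c)
    then show "C_k_on 2 ?J (cmap c \<circ> \<sigma>)" by (simp add: numeral_2_eq_2)
  qed
qed

text \<open>Regularity is defined on the part of \<open>I\<close> that is mapped into a chart,
  velocities on all of \<open>I\<close>. By continuity that part is relatively open, so limits at
  \<open>t\<close> agree.\<close>

lemma at_within_chart_part:
  assumes "continuous_on I \<gamma>" "c \<in> atl" "t \<in> I" "\<gamma> t \<in> cdom c"
  shows "at t within (I \<inter> \<gamma> -` cdom c) = at t within I"
proof -
  obtain T where T: "open T" "T \<inter> I = \<gamma> -` cdom c \<inter> I"
    using assms(1) open_cdom[OF assms(2)] unfolding continuous_on_open_invariant by blast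
  show ?thesis by (rule at_within_nhd[of _ T]) (use T assms in auto)
qed

lemma C_k_curve_velocity:
  assumes \<gamma>: "C_k_curve atl (Suc k) I \<gamma>" and t: "t \<in> I"
  shows "\<exists>v. has_velocity atl I \<gamma> t v"
proof -
  obtain c where c: "c \<in> atl" "\<gamma> t \<in> cdom c" by (rule ex_chart)
  have cont: "continuous_on I \<gamma>" using \<gamma> unfolding C_k_curve_def by blast
  let ?J = "I \<inter> \<gamma> -` cdom c"
  have "C_k_on (Suc k) ?J (cmap c \<circ> \<gamma>)" using \<gamma> c unfolding C_k_curve_def by blast
  then obtain f' where f': "(cmap c \<circ> \<gamma> has_derivative f') (at t within ?J)"
    using t c by (auto elim!: C_k_on_SucE)
  then have "(cmap c \<circ> \<gamma> has_derivative f') (at t within I)"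
    unfolding at_within_chart_part[OF cont c(1) t c(2)] .
  then have "((\<lambda>s. cmap c (\<gamma> s)) has_vector_derivative f' 1) (at t within I)"
    unfolding comp_def by (rule has_derivative_imp_has_vector_derivative)
  then have "((\<lambda>s. cmap c (\<gamma> s)) has_vector_derivative D c (\<gamma> t) (cf c (f' 1) (\<gamma> t))) (at t within I)"
    using c by simp
  moreover have "continuous (at t within I) \<gamma>" using cont t by (simp add: continuous_on_eq_continuous_within)
  ultimately show ?thesis using has_velocity_chartI[where \<gamma>=\<gamma> and t=t, OF c(1) t c(2)] by blast
qed

lemma C1_field_has_cov_deriv:
  assumes cont: "continuous_on I \<gamma>" and t: "t \<in> I" and v: "has_velocity atl I \<gamma> t v"
    and T: "C_k_field_along atl 1 I \<gamma> T"
  shows "\<exists>N. has_cov_deriv atl nab I \<gamma> T t N"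
proof -
  obtain c where c: "c \<in> atl" "\<gamma> t \<in> cdom c" by (rule ex_chart)
  let ?J = "I \<inter> \<gamma> -` cdom c"
  have "C_k_on (Suc 0) ?J (\<lambda>s. D c (\<gamma> s) (T s))" using T c unfolding C_k_field_along_def by simp
  then obtain f' where f': "((\<lambda>s. D c (\<gamma> s) (T s)) has_derivative f') (at t within ?J)"
    using t c by (auto elim!: C_k_on_SucE)
  have "((\<lambda>s. D c (\<gamma> s) (T s)) has_vector_derivative f' 1) (at t within I)"
    using f' unfolding at_within_chart_part[OF cont c(1) t c(2)] by (rule has_derivative_imp_has_vector_derivative)
  then have "has_cov_deriv atl nab I \<gamma> T t (cf c (f' 1 + Gam c (cmap c (\<gamma> t)) (D c (\<gamma> t) v) (D c (\<gamma> t) (T t))) (\<gamma> t))"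
    using c by (intro has_cov_deriv_chartI[OF v c t]) simp
  then show ?thesis by blast
qed

lemma velocity_field_C1:
  assumes L: "L > 0" and \<gamma>: "C_k_curve atl 2 {0..L} \<gamma>" and T: "\<And>t. t \<in> {0..L} \<Longrightarrow> has_velocity atl {0..L} \<gamma> t (T t)"
  shows "C_k_field_along atl 1 {0..L} \<gamma> T"
  unfolding C_k_field_along_def
proof
  fix c assume c: "c \<in> atl"
  have cont: "continuous_on {0..L} \<gamma>" using \<gamma> unfolding C_k_curve_def by blast
  let ?J = "{0..L} \<inter> \<gamma> -` cdom c"
  have "C_k_on (Suc 1) ?J (cmap c \<circ> \<gamma>)" using \<gamma> c unfolding C_k_curve_def by (simp add: numeral_2_eq_2)
  then obtain f' where f': "\<And>t. t \<in> ?J \<Longrightarrow> (cmap c \<circ> \<gamma> has_derivative f' t) (at t within ?J)"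
    and C: "\<And>v. C_k_on 1 ?J (\<lambda>x. f' x v)" by (rule C_k_on_SucE) blast
  have "f' t 1 = D c (\<gamma> t) (T t)" if t: "t \<in> ?J" for t
  proof -
    have t': "t \<in> {0..L}" "\<gamma> t \<in> cdom c" using t by auto
    have at: "at t within ?J = at t within {0..L}" by (rule at_within_chart_part[OF cont c t'])
    have "((\<lambda>s. cmap c (\<gamma> s)) has_vector_derivative f' t 1) (at t within {0..L})"
      using f'[OF t] unfolding at comp_def
      by (rule has_derivative_imp_has_vector_derivative)
    then show ?thesis
      using vector_derivative_unique_within[OF at_within_Icc_nontrivial[OF L t'(1)]] has_velocity_chartD[OF T[OF t'(1)] c t'(2)] by blast
  qed
  from iffD1[OF C_k_on_cong[OF this] C[of 1]] show "C_k_on 1 ?J (\<lambda>s. D c (\<gamma> s) (T s))" .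
qed

lemma C1_field_cov_deriv:
  assumes L: "L > 0" and cont: "continuous_on {0..L} \<gamma>"
    and v: "\<And>t. t \<in> {0..L} \<Longrightarrow> has_velocity atl {0..L} \<gamma> t (v t)" and cv: "C_k_field_along atl 0 {0..L} \<gamma> v"
    and T: "C_k_field_along atl 1 {0..L} \<gamma> T"
  obtains N where "\<And>t. t \<in> {0..L} \<Longrightarrow> has_cov_deriv atl nab {0..L} \<gamma> T t (N t)" "C_k_field_along atl 0 {0..L} \<gamma> N"
proof -
  have "\<exists>N. has_cov_deriv atl nab {0..L} \<gamma> T t N" if t: "t \<in> {0..L}" for t
    by (rule C1_field_has_cov_deriv[OF cont t v[OF t] T])
  then obtain N where N: "\<And>t. t \<in> {0..L} \<Longrightarrow> has_cov_deriv atl nab {0..L} \<gamma> T t (N t)" by metis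
  have "C_k_field_along atl 0 {0..L} \<gamma> N"
    unfolding C_k_field_along_def
  proof
    fix c assume c: "c \<in> atl"
    let ?J = "{0..L} \<inter> \<gamma> -` cdom c"
    have "C_k_on (Suc 0) ?J (\<lambda>s. D c (\<gamma> s) (T s))" using T c unfolding C_k_field_along_def by simp
    then obtain f' where f': "\<And>t. t \<in> ?J \<Longrightarrow> ((\<lambda>s. D c (\<gamma> s) (T s)) has_derivative f' t) (at t within ?J)"
      and C: "\<And>v. C_k_on 0 ?J (\<lambda>x. f' x v)" by (rule C_k_on_SucE) blast
    have eq: "f' t 1 + Gam c (cmap c (\<gamma> t)) (D c (\<gamma> t) (v t)) (D c (\<gamma> t) (T t)) = D c (\<gamma> t) (N t)" if t: "t \<in> ?J" for t
    proof -
      have t': "t \<in> {0..L}" "\<gamma> t \<in> cdom c" using t by auto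
      have at: "at t within ?J = at t within {0..L}" by (rule at_within_chart_part[OF cont c t'])
      have "((\<lambda>s. D c (\<gamma> s) (T s)) has_vector_derivative f' t 1) (at t within {0..L})"
        using f'[OF t] unfolding at 
      by (rule has_derivative_imp_has_vector_derivative)
      from vector_derivative_unique_within[OF at_within_Icc_nontrivial[OF L t'(1)] this has_cov_deriv_chartD[OF N v c t'(2)]] t'
      show ?thesis by simp
    qed
    have "continuous_on ?J (\<lambda>t. f' t 1 + Gam c (cmap c (\<gamma> t)) (D c (\<gamma> t) (v t)) (D c (\<gamma> t) (T t)))"
    proof (intro continuous_on_add sb_continuous_on[OF open_cimg[OF c] Gam_smooth_bilinear[OF c]])
      show "continuous_on ?J (\<lambda>t. f' t 1)" using C[of 1] by simp
      show "continuous_on ?J (\<lambda>t. cmap c (\<gamma> t))"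
        by (rule continuous_on_compose2[OF continuous_cmap[OF c] continuous_on_subset[OF cont]]) auto
      show "continuous_on ?J (\<lambda>t. D c (\<gamma> t) (v t))" using cv c unfolding C_k_field_along_def by simp
      show "continuous_on ?J (\<lambda>t. D c (\<gamma> t) (T t))"
        using T c C_k_on_imp_continuous_on unfolding C_k_field_along_def by blast
    qed auto
    then have "continuous_on ?J (\<lambda>s. D c (\<gamma> s) (N s))" by (rule continuous_on_eq) (rule eq)
    then show "C_k_on 0 ?J (\<lambda>s. D c (\<gamma> s) (N s))" by simp
  qed
  with N show thesis by (rule that)
qed

section \<open>Continuity of fields along curves and existence of Bishop frames\<close>

lemma C_k_field_imp_0: "C_k_field_along atl k I \<gamma> V \<Longrightarrow> C_k_field_along atl 0 I \<gamma> V"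
  unfolding C_k_field_along_def using C_k_on_imp_continuous_on by auto

lemma metric_continuous:
  assumes cont: "continuous_on I \<gamma>" and V: "C_k_field_along atl 0 I \<gamma> V" and W: "C_k_field_along atl 0 I \<gamma> W"
  shows "continuous_on I (\<lambda>t. g (\<gamma> t) (V t) (W t))"
  unfolding continuous_on_eq_continuous_within
proof
  fix t assume t: "t \<in> I"
  obtain c where c: "c \<in> atl" "\<gamma> t \<in> cdom c" by (rule ex_chart)
  let ?J = "I \<inter> \<gamma> -` cdom c"
  have "continuous_on ?J (\<lambda>t. gm c (cmap c (\<gamma> t)) (D c (\<gamma> t) (V t)) (D c (\<gamma> t) (W t)))"
  proof (intro sb_continuous_on[OF open_cimg[OF c(1)] gm_smooth_bilinear[OF c(1)]])
    show "continuous_on ?J (\<lambda>t. cmap c (\<gamma> t))"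
      by (rule continuous_on_compose2[OF continuous_cmap[OF c(1)] continuous_on_subset[OF cont]]) auto
  qed (use V W c in \<open>auto simp: C_k_field_along_def\<close>)
  then have "continuous_on ?J (\<lambda>t. g (\<gamma> t) (V t) (W t))"
    by (rule continuous_on_eq) (use g_chart[OF c(1)] in auto)
  then show "continuous (at t within I) (\<lambda>t. g (\<gamma> t) (V t) (W t))"
    using t c unfolding continuous_on_eq_continuous_within continuous_within at_within_chart_part[OF cont c(1) t c(2), symmetric] by auto
qed

text \<open>Applied to frame fields, where a covariant derivative at each time is all that is
  known.\<close>

lemma cov_deriv_field_continuous:
  assumes "\<And>t. t \<in> I \<Longrightarrow> has_cov_deriv atl nab I \<gamma> V t (E t)"
  shows "C_k_field_along atl 0 I \<gamma> V"
  unfolding C_k_field_along_def C_k_on.simps continuous_on_eq_continuous_within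
proof (intro ballI)
  fix c t assume c: "c \<in> atl" and t: "t \<in> I \<inter> \<gamma> -` cdom c"
  then have t': "t \<in> I" "\<gamma> t \<in> cdom c" by auto
  obtain v where v: "has_velocity atl I \<gamma> t v" by (rule has_cov_deriv_velocity[OF assms[OF t'(1)]])
  have "continuous (at t within I) (\<lambda>s. D c (\<gamma> s) (V s))"
    by (rule has_vector_derivative_continuous[OF has_cov_deriv_chartD[OF assms[OF t'(1)] v c t'(2)]])
  then show "continuous (at t within (I \<inter> \<gamma> -` cdom c)) (\<lambda>s. D c (\<gamma> s) (V s))"
    by (rule continuous_within_subset) auto
qed

text \<open>With \<open>N\<close> the acceleration of \<gamma> this is Fermi-Walker transport. The
  equation is linear in \<open>V\<close>, so the chart solution exists on the whole
  interval.\<close>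

lemma linear_field_local:
  assumes c: "c \<in> atl" and ab: "a \<le> b" and in_c: "\<And>t. t \<in> {a..b} \<Longrightarrow> \<gamma> t \<in> cdom c"
    and T: "\<And>t. t \<in> {a..b} \<Longrightarrow> has_velocity atl {a..b} \<gamma> t (T t)"
    and cT: "continuous_on {a..b} (\<lambda>t. D c (\<gamma> t) (T t))" and cN: "continuous_on {a..b} (\<lambda>t. D c (\<gamma> t) (N t))"
  shows "\<exists>V. V a = v \<and> (\<forall>t\<in>{a..b}. has_cov_deriv atl nab {a..b} \<gamma> V t (g (\<gamma> t) (T t) (V t) *\<^sub>R N t - g (\<gamma> t) (N t) (V t) *\<^sub>R T t))"
proof -
  define x where "x t = cmap c (\<gamma> t)" for t
  define h where "h t w = gm c (x t) (D c (\<gamma> t) (T t)) w *\<^sub>R D c (\<gamma> t) (N t)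
     - gm c (x t) (D c (\<gamma> t) (N t)) w *\<^sub>R D c (\<gamma> t) (T t) - Gam c (x t) (D c (\<gamma> t) (T t)) w" for t w
  have cont: "continuous_on {a..b} \<gamma>"
    unfolding continuous_on_eq_continuous_within using has_velocity_cont[OF T] by blast
  have x: "continuous_on {a..b} x" "x ` {a..b} \<subseteq> cimg c"
    unfolding x_def using in_c by (auto intro: continuous_on_compose2[OF continuous_cmap[OF c] cont])
  have bl: "bounded_linear (h t)" if t: "t \<in> {a..b}" for t
    unfolding linear_conv_bounded_linear[symmetric]
  proof -
    have "x t \<in> cimg c" using x(2) t by blast
    then have "bilinear (gm c (x t))" "bilinear (Gam c (x t))"
      using sb_bilinear[OF open_cimg[OF c] gm_smooth_bilinear[OF c]] sb_bilinear[OF open_cimg[OF c] Gam_smooth_bilinear[OF c]] by auto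
    then show "linear (h t)"
      unfolding h_def by (intro linearI)
        (simp_all add: bilinear_radd bilinear_rmul algebra_simps scaleR_diff_right)
  qed
  have h: "blinfun_apply (Blinfun (h t)) = h t" if "t \<in> {a..b}" for t
    by (rule bounded_linear_Blinfun_apply[OF bl[OF that]])
  have "continuous_on {a..b} (\<lambda>t. Blinfun (h t))"
  proof (rule continuous_on_blinfun_componentwise)
    fix w
    have "continuous_on {a..b} (\<lambda>t. h t w)"
      unfolding h_def
      by (intro continuous_intros cT cN x sb_continuous_on[OF open_cimg[OF c] gm_smooth_bilinear[OF c]]
          sb_continuous_on[OF open_cimg[OF c] Gam_smooth_bilinear[OF c]])
    then show "continuous_on {a..b} (\<lambda>t. blinfun_apply (Blinfun (h t)) w)"
      by (rule continuous_on_eq) (simp add: h)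
  qed
  then obtain y where y: "y a = D c (\<gamma> a) v" "\<And>t. t \<in> {a..b} \<Longrightarrow> (y has_vector_derivative Blinfun (h t) (y t)) (at t within {a..b})"
    using linear_ode_solution[OF ab] by blast
  define V where "V t = cf c (y t) (\<gamma> t)" for t
  have DV: "D c (\<gamma> t) (V t) = y t" if "t \<in> {a..b}" for t using c in_c[OF that] by (simp add: V_def)
  have "has_cov_deriv atl nab {a..b} \<gamma> V t (g (\<gamma> t) (T t) (V t) *\<^sub>R N t - g (\<gamma> t) (N t) (V t) *\<^sub>R T t)" if t: "t \<in> {a..b}" for t
  proof (rule has_cov_deriv_chartI[OF T[OF t] c in_c[OF t] t])
    have eq: "h t (y t) = D c (\<gamma> t) (g (\<gamma> t) (T t) (V t) *\<^sub>R N t - g (\<gamma> t) (N t) (V t) *\<^sub>R T t) -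
       Gam c (cmap c (\<gamma> t)) (D c (\<gamma> t) (T t)) (D c (\<gamma> t) (V t))"
      using chart_deriv_linear[OF c in_c[OF t]]
      by (simp add: h_def DV[OF t] x_def g_chart[OF c in_c[OF t]] linear_diff linear_cmul)
    show "((\<lambda>s. D c (\<gamma> s) (V s)) has_vector_derivative
       D c (\<gamma> t) (g (\<gamma> t) (T t) (V t) *\<^sub>R N t - g (\<gamma> t) (N t) (V t) *\<^sub>R T t) -
       Gam c (cmap c (\<gamma> t)) (D c (\<gamma> t) (T t)) (D c (\<gamma> t) (V t))) (at t within {a..b})"
      unfolding eq[symmetric] using y(2)[OF t] unfolding h[OF t]
      by (rule has_vector_derivative_transform[OF t, rotated]) (rule DV)
  qed
  moreover have "V a = v" using y(1) c in_c[of a] ab by (simp add: V_def)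
  ultimately show ?thesis by blast
qed

lemma linear_field_exists:
  assumes L: "L \<ge> 0" and T: "\<And>t. t \<in> {0..L} \<Longrightarrow> has_velocity atl {0..L} \<gamma> t (T t)"
    and cT: "C_k_field_along atl 0 {0..L} \<gamma> T" and cN: "C_k_field_along atl 0 {0..L} \<gamma> N"
  shows "\<exists>V. V 0 = v \<and> (\<forall>t\<in>{0..L}. has_cov_deriv atl nab {0..L} \<gamma> V t (g (\<gamma> t) (T t) (V t) *\<^sub>R N t - g (\<gamma> t) (N t) (V t) *\<^sub>R T t))"
proof -
  define S where "S t w = g (\<gamma> t) (T t) w *\<^sub>R N t - g (\<gamma> t) (N t) w *\<^sub>R T t" for t w
  \<comment> \<open>The initial vector is arbitrary, so that the end value of one piece can start
    the next.\<close>
  define Q where "Q a b \<longleftrightarrow> (\<forall>v. \<exists>V. V a = v \<and> (\<forall>t\<in>{a..b}. has_cov_deriv atl nab {a..b} \<gamma> V t (S t (V t))))" for a b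
  have cont: "continuous_on {0..L} \<gamma>"
    unfolding continuous_on_eq_continuous_within using has_velocity_cont[OF T] by blast
  have "(0::real) \<le> 0 \<and> L \<le> L \<longrightarrow> Q 0 L"
  proof (rule Bolzano[OF L, where P="\<lambda>a b. 0 \<le> a \<and> b \<le> L \<longrightarrow> Q a b"])
    fix a b c :: real
    assume 1: "0 \<le> a \<and> b \<le> L \<longrightarrow> Q a b" and 2: "0 \<le> b \<and> c \<le> L \<longrightarrow> Q b c" and ab: "a \<le> b" "b \<le> c"
    show "0 \<le> a \<and> c \<le> L \<longrightarrow> Q a c"
    proof
      assume ac: "0 \<le> a \<and> c \<le> L"
      then have q: "Q a b" "Q b c" using 1 2 ab by auto
      show "Q a c" unfolding Q_def
      proof
        fix v
        obtain V1 where V1: "V1 a = v" "\<And>t. t \<in> {a..b} \<Longrightarrow> has_cov_deriv atl nab {a..b} \<gamma> V1 t (S t (V1 t))"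
          using q(1) unfolding Q_def by blast
        obtain V2 where V2: "V2 b = V1 b" "\<And>t. t \<in> {b..c} \<Longrightarrow> has_cov_deriv atl nab {b..c} \<gamma> V2 t (S t (V2 t))"
          using q(2) unfolding Q_def by blast
        define V where "V t = (if t \<le> b then V1 t else V2 t)" for t
        have e1: "V1 t = V t" if "t \<in> {a..b}" for t using that by (simp add: V_def)
        have e2: "V2 t = V t" if "t \<in> {b..c}" for t
        proof -
          have "t = b \<or> \<not> t \<le> b" using that by auto
          then show ?thesis using V2(1) by (auto simp: V_def)
        qed
        have "has_cov_deriv atl nab {a..c} \<gamma> V t (S t (V t))" if t: "t \<in> {a..c}" for t
        proof (rule has_cov_deriv_glue[OF ab t])
          show "has_velocity atl {a..c} \<gamma> t (T t)"
            by (rule has_velocity_subset[OF T]) (use t ac in auto)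
          show "has_cov_deriv atl nab {a..b} \<gamma> V t (S t (V t))" if "t \<le> b"
          proof -
            have t': "t \<in> {a..b}" using that t by simp
            from has_cov_deriv_cong[OF V1(2)[OF t'] t' refl e1] show ?thesis by (simp add: e1[OF t'])
          qed
          show "has_cov_deriv atl nab {b..c} \<gamma> V t (S t (V t))" if "b \<le> t"
          proof -
            have t': "t \<in> {b..c}" using that t by simp
            from has_cov_deriv_cong[OF V2(2)[OF t'] t' refl e2] show ?thesis by (simp add: e2[OF t'])
          qed
        qed
        moreover have "V a = v" using V1 ab by (simp add: V_def)
        ultimately show "\<exists>V. V a = v \<and> (\<forall>t\<in>{a..c}. has_cov_deriv atl nab {a..c} \<gamma> V t (S t (V t)))" by blast
      qed
    qed
  next
    fix x assume x: "0 \<le> x" "x \<le> L"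
    obtain c d where c: "c \<in> atl" "d > 0" "\<And>u. u \<in> {0..L} \<Longrightarrow> \<bar>u - x\<bar> < d \<Longrightarrow> \<gamma> u \<in> cdom c"
      using chart_nhd[OF cont, of x] x by auto
    have "Q a b" if ab: "a \<le> x" "x \<le> b" "b - a < d" "0 \<le> a" "b \<le> L" for a b
      unfolding Q_def S_def
    proof
      fix v
      have sub: "{a..b} \<subseteq> {0..L}" using ab by auto
      have in_c: "\<gamma> u \<in> cdom c" if "u \<in> {a..b}" for u
        by (rule c(3)) (use that sub ab in auto)
      have sub': "{a..b} \<subseteq> {0..L} \<inter> \<gamma> -` cdom c" using sub in_c by auto
      have cc: "continuous_on {a..b} (\<lambda>t. D c (\<gamma> t) (W t))" if "C_k_field_along atl 0 {0..L} \<gamma> W" for W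
        by (rule continuous_on_subset[OF _ sub']) (use that c in \<open>simp add: C_k_field_along_def\<close>)
      show "\<exists>V. V a = v \<and> (\<forall>t\<in>{a..b}. has_cov_deriv atl nab {a..b} \<gamma> V t (g (\<gamma> t) (T t) (V t) *\<^sub>R N t - g (\<gamma> t) (N t) (V t) *\<^sub>R T t))"
        by (rule linear_field_local[OF c(1) order_trans[OF ab(1,2)] in_c has_velocity_subset[OF T sub] cc[OF cT] cc[OF cN]])
          (use sub in auto)
    qed
    then show "\<exists>d>0. \<forall>a b. a \<le> x \<and> x \<le> b \<and> b - a < d \<longrightarrow> 0 \<le> a \<and> b \<le> L \<longrightarrow> Q a b"
      using c(2) by blast
  qed
  then show ?thesis unfolding Q_def S_def by simp
qed

text \<open>Gram-Schmidt one vector at a time. The induction starts with one vector so that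
  \<open>v\<close> stays first, and a new direction exists while there are fewer vectors than the
  dimension.\<close>

lemma orth_extend:
  assumes v: "g p v v = 1"
  obtains e where "orth p e" "\<And>i. Rep_frame_index i = 1 \<Longrightarrow> e i = v"
proof -
  have "\<exists>f. f 1 = v \<and> (\<forall>i\<in>{1..Suc m}. \<forall>j\<in>{1..Suc m}. g p (f i) (f j) = (if i = j then 1 else 0))"
    if "Suc m \<le> DIM('e)" for m
    using that
  proof (induction m)
    case 0 then show ?case using v by (intro exI[of _ "\<lambda>_. v"]) auto
  next
    case (Suc m)
    then obtain f where f: "f 1 = v" "\<And>i j. i \<in> {1..Suc m} \<Longrightarrow> j \<in> {1..Suc m} \<Longrightarrow> g p (f i) (f j) = (if i = j then 1 else 0)"
      by force
    have "dim (f ` {1..Suc m}) \<le> card (f ` {1..Suc m})" by (rule dim_le_card') simp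
    also have "\<dots> \<le> Suc m" using card_image_le[of "{1..Suc m}" f] by simp
    also have "\<dots> < DIM('e)" using Suc.prems by simp
    finally have "span (f ` {1..Suc m}) \<noteq> UNIV" by (metis dim_UNIV dim_span less_irrefl)
    then obtain w where w: "w \<notin> span (f ` {1..Suc m})" by blast
    define u where "u = w - (\<Sum>i\<in>{1..Suc m}. g p w (f i) *\<^sub>R f i)"
    have "u \<noteq> 0"
    proof
      assume "u = 0"
      then have "w = (\<Sum>i\<in>{1..Suc m}. g p w (f i) *\<^sub>R f i)" by (simp add: u_def)
      also have "\<dots> \<in> span (f ` {1..Suc m})" by (intro span_sum span_scale span_base) auto
      finally show False using w by simp
    qed
    then have pos: "g p u u > 0" by (rule g_pos)
    have uf: "g p u (f j) = 0" if j: "j \<in> {1..Suc m}" for j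
    proof -
      have "(\<Sum>i\<in>{1..Suc m}. g p w (f i) * g p (f i) (f j)) = (\<Sum>i\<in>{1..Suc m}. if i = j then g p w (f j) else 0)"
        by (rule sum.cong) (use f(2) j in auto)
      also have "\<dots> = g p w (f j)" using j by simp
      finally show ?thesis by (simp add: u_def g_simps)
    qed
    define u' where "u' = (1 / sqrt (g p u u)) *\<^sub>R u"
    have uu: "g p u' u' = 1" using pos by (simp add: u'_def g_simps)
    have uf': "g p u' (f j) = 0" "g p (f j) u' = 0" if "j \<in> {1..Suc m}" for j
      using uf[OF that] g_sym[of p "f j" u'] by (simp_all add: u'_def g_simps)
    define f' where "f' i = (if i = Suc (Suc m) then u' else f i)" for i
    have "g p (f' i) (f' j) = (if i = j then 1 else 0)" if "i \<in> {1..Suc (Suc m)}" "j \<in> {1..Suc (Suc m)}" for i j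
      using that f(2)[of i j] uf'[of i] uf'[of j] uu by (cases "i = Suc (Suc m)"; cases "j = Suc (Suc m)") (auto simp: f'_def)
    then show ?case using f(1) by (intro exI[of _ f']) (auto simp: f'_def)
  qed
  from this[of "DIM('e) - 1"] obtain f where f: "f 1 = v" "\<And>i j. i \<in> {1..DIM('e)} \<Longrightarrow> j \<in> {1..DIM('e)} \<Longrightarrow> g p (f i) (f j) = (if i = j then 1 else 0)"
    using DIM_positive[where 'a='e] by auto
  show thesis
  proof (rule that[of "\<lambda>i. f (Rep_frame_index i)"])
    show "orth p (\<lambda>i. f (Rep_frame_index i))"
      unfolding orth_def using f(2)[OF Rep_frame_index Rep_frame_index] by (simp add: Rep_frame_index_inject)
  qed (use f(1) in simp)
qed

lemma zero_deriv_const: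
  fixes f :: "real \<Rightarrow> real"
  assumes "\<And>t. t \<in> {0..L} \<Longrightarrow> (f has_vector_derivative 0) (at t within {0..L})" "t \<in> {0..L}"
  shows "f t = f 0"
  by (rule has_derivative_zero_unique[where f=f and s="{0..L}"])
    (use assms in \<open>auto simp: has_vector_derivative_def\<close>)

text \<open>All fields of a Bishop frame solve \<open>\<nabla>\<^sub>T V = g(T, V) N - g(N, V) T\<close> with \<open>N = \<nabla>\<^sub>T T\<close>; the operator on the
  right is skew-symmetric, so solutions of this linear equation keep their inner products.\<close>

lemma bishop_frame_exists:
  assumes L: "L > 0" and \<gamma>: "C_k_curve atl 2 {0..L} \<gamma>"
    and T: "\<And>t. t \<in> {0..L} \<Longrightarrow> has_velocity atl {0..L} \<gamma> t (T t)"
    and unit: "\<And>t. t \<in> {0..L} \<Longrightarrow> g (\<gamma> t) (T t) (T t) = 1"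
  obtains F \<kappa> where "frame_eq {0..L} \<gamma> (\<lambda>i. F (Rep_frame_index i)) kvec (Kmat \<kappa>)"
    "\<And>t. t \<in> {0..L} \<Longrightarrow> orth (\<gamma> t) (\<lambda>i. F (Rep_frame_index i) t)"
    "\<And>i. continuous_on {0..L} (\<kappa> i)" "\<And>t. t \<in> {0..L} \<Longrightarrow> F 1 t = T t"
proof -
  have cont: "continuous_on {0..L} \<gamma>" using \<gamma> unfolding C_k_curve_def by blast
  have T1: "C_k_field_along atl 1 {0..L} \<gamma> T" by (rule velocity_field_C1[OF L \<gamma> T])
  note T0 = C_k_field_imp_0[OF T1]
  obtain N where N: "\<And>t. t \<in> {0..L} \<Longrightarrow> has_cov_deriv atl nab {0..L} \<gamma> T t (N t)" and N0: "C_k_field_along atl 0 {0..L} \<gamma> N"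
    using C1_field_cov_deriv[OF L cont T T0 T1] by blast
  have zero: "0 \<in> {0..L}" using L by simp
  obtain e where e: "orth (\<gamma> 0) e" "\<And>i. Rep_frame_index i = 1 \<Longrightarrow> e i = T 0"
    using orth_extend[OF unit[OF zero]] by blast
  have "\<forall>i. \<exists>V. V 0 = e i \<and> (\<forall>t\<in>{0..L}. has_cov_deriv atl nab {0..L} \<gamma> V t (g (\<gamma> t) (T t) (V t) *\<^sub>R N t - g (\<gamma> t) (N t) (V t) *\<^sub>R T t))"
    by (intro allI linear_field_exists[OF less_imp_le[OF L] T T0 N0])
  then obtain E where E0: "\<And>i. E i 0 = e i" and
    E: "\<And>i t. t \<in> {0..L} \<Longrightarrow> has_cov_deriv atl nab {0..L} \<gamma> (E i) t (g (\<gamma> t) (T t) (E i t) *\<^sub>R N t - g (\<gamma> t) (N t) (E i t) *\<^sub>R T t)"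
    by metis
  have orth: "orth (\<gamma> t) (\<lambda>i. E i t)" if t: "t \<in> {0..L}" for t
    unfolding orth_def
  proof (intro allI)
    fix i j
    have "((\<lambda>s. g (\<gamma> s) (E i s) (E j s)) has_vector_derivative 0) (at t within {0..L})" if t: "t \<in> {0..L}" for t
      using has_cov_deriv_metric[OF t E[OF t] E[OF t], of i j]
      by (simp add: g_simps g_sym[of "\<gamma> t" "E i t"] mult.commute)
    from zero_deriv_const[OF this t]
    show "g (\<gamma> t) (E i t) (E j t) = (if i = j then 1 else 0)" using e(1) by (simp add: E0 orth_def)
  qed
  have NT: "g (\<gamma> t) (N t) (T t) = 0" if t: "t \<in> {0..L}" for t
  proof -
    have "((\<lambda>s. g (\<gamma> s) (T s) (T s)) has_vector_derivative g (\<gamma> t) (N t) (T t) + g (\<gamma> t) (T t) (N t)) (at t within {0..L})"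
      by (rule has_cov_deriv_metric[OF t N[OF t] N[OF t]])
    moreover have "((\<lambda>s. g (\<gamma> s) (T s) (T s)) has_vector_derivative 0) (at t within {0..L})"
      by (rule has_vector_derivative_transform[OF t, of _ "\<lambda>_. 1"]) (use unit in auto)
    ultimately have "g (\<gamma> t) (N t) (T t) + g (\<gamma> t) (T t) (N t) = 0"
      by (rule vector_derivative_unique_within[OF at_within_Icc_nontrivial[OF L t]])
    then show ?thesis using g_sym[of "\<gamma> t" "T t" "N t"] by simp
  qed
  \<comment> \<open>\<open>E i\<close> and \<open>T\<close> agree at 0, and their inner product is
    constant, hence 1 throughout; for two unit vectors this forces equality.\<close>
  have ET: "E i t = T t" if i: "Rep_frame_index i = 1" and t: "t \<in> {0..L}" for i t
  proof -
    have "((\<lambda>s. g (\<gamma> s) (E i s) (T s)) has_vector_derivative 0) (at t within {0..L})" if t: "t \<in> {0..L}" for t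
      using has_cov_deriv_metric[OF t E[OF t] N[OF t], of i]
      by (simp add: g_simps NT[OF t] unit[OF t] g_sym[of "\<gamma> t" "E i t"])
    from zero_deriv_const[OF this t] have "g (\<gamma> t) (E i t) (T t) = 1"
      using unit[OF zero] e(2)[OF i] by (simp add: E0)
    then have "g (\<gamma> t) (E i t - T t) (E i t - T t) = 0"
      using orth[OF t] unit[OF t] g_sym[of "\<gamma> t" "T t" "E i t"] by (simp add: g_simps orth_def)
    then show ?thesis using g_pos[of "E i t - T t" "\<gamma> t"] by (metis less_irrefl right_minus_eq)
  qed
  define F where "F i t = E (Abs_frame_index i) t" for i t
  have F: "F (Rep_frame_index i) = E i" for i by (simp add: F_def[abs_def] Rep_frame_index_inverse)
  define \<kappa> where "\<kappa> i t = g (\<gamma> t) (N t) (F i t)" for i t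
  have one: "Rep_frame_index (Abs_frame_index 1 :: 'e frame_index) = 1"
    by (rule Abs_frame_index_inverse) (use DIM_positive[where 'a='e] in auto)
  have F1: "F 1 t = T t" if "t \<in> {0..L}" for t unfolding F_def by (rule ET[OF one that])
  show thesis
  proof (rule that[of F \<kappa>])
    show "orth (\<gamma> t) (\<lambda>i. F (Rep_frame_index i) t)" if "t \<in> {0..L}" for t using orth[OF that] by (simp add: F)
    show "F 1 t = T t" if "t \<in> {0..L}" for t by (rule F1[OF that])
    show "continuous_on {0..L} (\<kappa> i)" for i
      unfolding \<kappa>_def[abs_def] F_def
      by (rule metric_continuous[OF cont N0 cov_deriv_field_continuous[OF E]])
    show "frame_eq {0..L} \<gamma> (\<lambda>i. F (Rep_frame_index i)) kvec (Kmat \<kappa>)"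
      unfolding frame_eq_def
    proof (intro ballI conjI allI)
      fix t and i :: "'e frame_index" assume t: "t \<in> {0..L}"
      show "has_velocity atl {0..L} \<gamma> t (\<Sum>j\<in>(UNIV :: 'e frame_index set). kvec j *\<^sub>R F (Rep_frame_index j) t)"
        unfolding kvec_sum[of "\<lambda>i. F i t"] F1[OF t] by (rule T[OF t])
      have "g (\<gamma> t) (T t) (E i t) *\<^sub>R N t - g (\<gamma> t) (N t) (E i t) *\<^sub>R T t =
        (\<Sum>j\<in>(UNIV :: 'e frame_index set). Kmat \<kappa> t i j *\<^sub>R F (Rep_frame_index j) t)"
      proof (cases "Rep_frame_index i = 1")
        case True
        \<comment> \<open>The acceleration of a unit speed curve has no tangential component, so the
          expansion over the frame leaves only the normal fields, with coefficients
          \<kappa>.\<close>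
        have "N t = (\<Sum>j\<in>UNIV. g (\<gamma> t) (N t) (E j t) *\<^sub>R E j t)" by (rule orth_expand[OF orth[OF t]])
        also have "\<dots> = (\<Sum>j\<in>(UNIV :: 'e frame_index set). \<kappa> (Rep_frame_index j) t *\<^sub>R F (Rep_frame_index j) t)"
          by (simp add: \<kappa>_def F)
        also have "\<dots> = (\<Sum>i\<in>{1..DIM('e)}. \<kappa> i t *\<^sub>R F i t)"
          by (rule sum_frame_index[of "\<lambda>i. \<kappa> i t *\<^sub>R F i t"])
        also have "\<dots> = (\<Sum>i\<in>{2..DIM('e)}. \<kappa> i t *\<^sub>R F i t)"
          unfolding Icc_1_DIM using NT[OF t] F1[OF t] by (simp add: \<kappa>_def)
        finally show ?thesis
          unfolding Kmat_sum[of \<kappa> t i "\<lambda>i. F i t"] using True ET[OF True t] unit[OF t] NT[OF t] by simp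
      next
        case False
        have "g (\<gamma> t) (T t) (E i t) = 0"
          using orth[OF t] ET[OF one t] False one unfolding orth_def by metis
        then show ?thesis
          unfolding Kmat_sum[of \<kappa> t i "\<lambda>i. F i t"] using False F1[OF t] by (simp add: \<kappa>_def F)
      qed
      then show "has_cov_deriv atl nab {0..L} \<gamma> (F (Rep_frame_index i)) t
          (\<Sum>j\<in>(UNIV :: 'e frame_index set). Kmat \<kappa> t i j *\<^sub>R F (Rep_frame_index j) t)"
        using E[OF t, of i] by (simp add: F)
    qed
  qed
qed

text \<open>Local existence from a single point: the tube is taken around the constant curve, and
  the time interval is shortened until the drift away from it fits.\<close>

lemma autonomous_solution:
  assumes c: "c \<in> atl" and p: "p \<in> cdom c"
  obtains h y where "h > 0" "y 0 = cstate c p e" "\<And>t. t \<in> {0..h} \<Longrightarrow> fst (y t) \<in> cimg c"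
    "\<And>t. t \<in> {0..h} \<Longrightarrow> (y has_vector_derivative fld c k (\<lambda>_. A) t (y t)) (at t within {0..h})"
proof -
  let ?\<eta> = "cstate c p e"
  let ?f = "fld c k (\<lambda>_. A)"
  have ft: "?f t = ?f 0" for t by (simp add: fld_def[abs_def])
  have op: "open (cimg c \<times> (UNIV :: ('e ^ 'e frame_index) set))" by (intro open_Times open_cimg c open_UNIV)
  have \<eta>: "?\<eta> \<in> cimg c \<times> UNIV" using p by (simp add: cstate_def)
  have c\<eta>: "continuous_on {0..1::real} (\<lambda>_. ?\<eta>)" and sub0: "(\<lambda>_::real. ?\<eta>) ` {0..1} \<subseteq> cimg c \<times> UNIV"
    using \<eta> by auto
  have ex: "\<exists>r M. r > 0 \<and> M > 0 \<and> cball ?\<eta> r \<subseteq> cimg c \<times> UNIV \<and>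
      (\<forall>y\<in>cball ?\<eta> r. \<forall>w\<in>cball ?\<eta> r. norm (?f 0 y - ?f 0 w) \<le> M * norm (y - w))"
  proof (rule tube_bounds[OF op c\<eta> sub0, where f="?f" and f'="bfld c k (\<lambda>_. A)"])
    show "(?f t has_derivative blinfun_apply (bfld c k (\<lambda>_. A) t y)) (at y)" if "y \<in> cimg c \<times> UNIV" for t y
      using fld_has_derivative[OF c, of y k "\<lambda>_. A" t] bfld[OF c, of y k "\<lambda>_. A" t] that by auto
    show "continuous_on ({0..1} \<times> cimg c \<times> UNIV) (\<lambda>(t, y). bfld c k (\<lambda>_. A) t y)"
      by (rule bfld_continuous[OF c]) auto
    fix r M :: real
    assume r: "0 < r" "0 < M" and s: "\<And>t::real. t \<in> {0..1} \<Longrightarrow> cball ?\<eta> r \<subseteq> cimg c \<times> UNIV"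
      and l: "\<And>t y w. t \<in> {0..1} \<Longrightarrow> y \<in> cball ?\<eta> r \<Longrightarrow> w \<in> cball ?\<eta> r \<Longrightarrow> norm (?f t y - ?f t w) \<le> M * norm (y - w)"
    have z: "0 \<in> {0..1::real}" by simp
    show ?thesis using r s[OF z] l[OF z] by blast
  qed
  then obtain r M where r: "r > 0" "M > 0" and sub: "cball ?\<eta> r \<subseteq> cimg c \<times> UNIV"
    and lip: "\<And>y w. y \<in> cball ?\<eta> r \<Longrightarrow> w \<in> cball ?\<eta> r \<Longrightarrow> norm (?f 0 y - ?f 0 w) \<le> M * norm (y - w)" by blast
  \<comment> \<open>Up to time \<open>h\<close> the drift is at most
    \<open>h * norm (?f 0 ?\<eta>)\<close>. The bound \<open>h \<le> 1\<close> lets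
    \<open>exp (- (2 * M))\<close> stand in for the weight of the actual interval, and the added 1
    keeps the divisor positive.\<close>
  define h where "h = min 1 (r * exp (- (2 * M)) / (2 * (norm (?f 0 ?\<eta>) + 1)))"
  have nf: "norm (?f 0 ?\<eta>) + 1 > 0" by (simp add: add_nonneg_pos)
  have h: "h > 0" "h \<le> 1" using r nf by (auto simp: h_def)
  have "h * norm (?f 0 ?\<eta>) \<le> h * (norm (?f 0 ?\<eta>) + 1)" using h by (intro mult_left_mono) auto
  also have "\<dots> \<le> r * exp (- (2 * M)) / (2 * (norm (?f 0 ?\<eta>) + 1)) * (norm (?f 0 ?\<eta>) + 1)"
    using nf by (intro mult_right_mono) (auto simp: h_def)
  also have "\<dots> = r * exp (- (2 * M)) / 2"
  proof -
    have "x / (2 * z) * z = x / 2" if "z \<noteq> 0" for x z :: real using that by simp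
    then show ?thesis using nf by (metis less_irrefl)
  qed
  also have "\<dots> \<le> r * exp (- (2 * M * (h - 0))) / 2" using h r by simp
  finally have small: "h * norm (?f 0 ?\<eta>) \<le> r * exp (- (2 * M * (h - 0))) / 2" .
  have cf: "continuous_on (SIGMA t:{0..h}. cball ?\<eta> r) (\<lambda>(t, y). ?f t y)"
    by (rule continuous_on_subset[OF fld_continuous[OF c]]) (use sub in auto)
  obtain y where y: "y 0 = ?\<eta>"
    "\<And>t. t \<in> {0..h} \<Longrightarrow> (y has_vector_derivative ?f t (y t)) (at t within {0..h})"
    "\<And>t. t \<in> {0..h} \<Longrightarrow> y t \<in> cball ?\<eta> r"
  proof (rule ode_solution_in_tube[OF less_imp_le[OF h(1)] r(2) less_imp_le[OF r(1)] _ cf, where \<eta>="?\<eta>"])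
    show "norm (?f t y - ?f t w) \<le> M * norm (y - w)" if "y \<in> cball ?\<eta> r" "w \<in> cball ?\<eta> r" for t y w
      using lip[OF that] unfolding ft[of t] .
    fix t assume t: "t \<in> {0..h}"
    have "(\<lambda>s. ?f s ?\<eta>) = (\<lambda>_. ?f 0 ?\<eta>)" by (rule ext) (rule fun_cong[OF ft])
    then have "norm (?\<eta> + integral {0..t} (\<lambda>s. ?f s ?\<eta>) - ?\<eta>) = t * norm (?f 0 ?\<eta>)"
      using t by simp
    also have "\<dots> \<le> h * norm (?f 0 ?\<eta>)" using t by (intro mult_right_mono) auto
    also note small
    finally show "norm (?\<eta> + integral {0..t} (\<lambda>s. ?f s ?\<eta>) - ?\<eta>) \<le> r * exp (- (2 * M * (h - 0))) / 2" .
  qed auto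
  show thesis
  proof (rule that[OF h(1) y(1) _ y(2)])
    show "fst (y t) \<in> cimg c" if "t \<in> {0..h}" for t
      using subsetD[OF sub y(3)[OF that]] by (simp add: mem_Times_iff)
  qed
qed

text \<open>A transverse curve whose velocity and frame derivatives at 0 have the prescribed
  components \<open>k\<close> and \<open>A\<close>. Taking it from the frame equation makes
  regularity and, for skew \<open>A\<close>, orthonormality available. The open interval fits the
  definition of a rigid variation, the closed one the lemma on preserved inner products.\<close>

lemma initial_frame_curve:
  obtains h \<sigma> E where "h > 0" "frame_eq {-h<..<h} \<sigma> E k (\<lambda>_. A)" "\<sigma> 0 = p" "\<And>i. E i 0 = e i"
    "frame_eq {-h..h} \<sigma> E k (\<lambda>_. A)"
proof -
  obtain c where c: "c \<in> atl" "p \<in> cdom c" by (rule ex_chart)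
  obtain h1 y1 where 1: "h1 > 0" "y1 0 = cstate c p e" "\<And>t. t \<in> {0..h1} \<Longrightarrow> fst (y1 t) \<in> cimg c"
    "\<And>t. t \<in> {0..h1} \<Longrightarrow> (y1 has_vector_derivative fld c k (\<lambda>_. A) t (y1 t)) (at t within {0..h1})"
    using autonomous_solution[OF c] by blast
  obtain h2 y2 where 2: "h2 > 0" "y2 0 = cstate c p e" "\<And>t. t \<in> {0..h2} \<Longrightarrow> fst (y2 t) \<in> cimg c"
    "\<And>t. t \<in> {0..h2} \<Longrightarrow> (y2 has_vector_derivative fld c (\<lambda>j. - k j) (\<lambda>_ i j. - A i j) t (y2 t)) (at t within {0..h2})"
    using autonomous_solution[OF c] by blast
  define h where "h = min h1 h2"
  have h: "h > 0" using 1 2 by (simp add: h_def)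
  define y where "y t = (if 0 \<le> t then y1 t else y2 (- t))" for t
  \<comment> \<open>The field is linear in its coefficients, so changing their signs reverses time:
    the backward half of the curve is a forward solution for \<open>- k\<close> and
    \<open>- A\<close>.\<close>
  have neg: "fld c (\<lambda>j. - k j) (\<lambda>_ i j. - A i j) t z = - fld c k (\<lambda>_. A) s z" if z: "fst z \<in> cimg c" for t s z
  proof -
    have "bilinear (Gam c (fst z))" by (rule sb_bilinear[OF open_cimg[OF c(1)] Gam_smooth_bilinear[OF c(1)] z])
    then show ?thesis by (simp add: fld_def sum_negf bilinear_lneg vec_eq_iff)
  qed
  have yin: "fst (y t) \<in> cimg c" if "t \<in> {-h..h}" for t
    using that 1(3)[of t] 2(3)[of "- t"] by (auto simp: y_def h_def)
  have right: "(y has_vector_derivative fld c k (\<lambda>_. A) t (y t)) (at t within {0..h})" if t: "t \<in> {0..h}" for t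
  proof -
    have "(y1 has_vector_derivative fld c k (\<lambda>_. A) t (y1 t)) (at t within {0..h})"
      by (rule has_vector_derivative_within_subset[OF 1(4)]) (use t in \<open>auto simp: h_def\<close>)
    then have "(y has_vector_derivative fld c k (\<lambda>_. A) t (y1 t)) (at t within {0..h})"
      by (rule has_vector_derivative_transform[OF t, rotated]) (simp add: y_def)
    then show ?thesis using t by (simp add: y_def)
  qed
  have left: "(y has_vector_derivative fld c k (\<lambda>_. A) t (y t)) (at t within {-h..0})" if t: "t \<in> {-h..0}" for t
  proof -
    have t2: "- t \<in> {0..h2}" using t by (auto simp: h_def)
    have yt: "y s = y2 (- s)" if "s \<in> {-h..0}" for s
      using that 1(2) 2(2) by (cases "s = 0") (auto simp: y_def)
    have "((\<lambda>s. y2 (- s)) has_derivative (\<lambda>d. (- d) *\<^sub>R fld c (\<lambda>j. - k j) (\<lambda>_ i j. - A i j) (- t) (y2 (- t)))) (at t within {-h..0})"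
    proof (rule has_derivative_in_compose2[where g=y2 and t="{0..h2}"
          and g'="\<lambda>x d. d *\<^sub>R fld c (\<lambda>j. - k j) (\<lambda>_ i j. - A i j) x (y2 x)" and f="\<lambda>s. - s"])
      show "(y2 has_derivative (\<lambda>d. d *\<^sub>R fld c (\<lambda>j. - k j) (\<lambda>_ i j. - A i j) x (y2 x))) (at x within {0..h2})" if "x \<in> {0..h2}" for x
        using 2(4)[OF that] unfolding has_vector_derivative_def .
      show "((\<lambda>s. - s) has_derivative (\<lambda>d. - d)) (at t within {-h..0})" by (intro has_derivative_minus has_derivative_ident)
    qed (use t in \<open>auto simp: h_def\<close>)
    then have "((\<lambda>s. y2 (- s)) has_vector_derivative fld c k (\<lambda>_. A) t (y2 (- t))) (at t within {-h..0})"
      unfolding has_vector_derivative_def neg[OF 2(3)[OF t2], of "- t" t] by simp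
    then have "(y has_vector_derivative fld c k (\<lambda>_. A) t (y2 (- t))) (at t within {-h..0})"
      by (rule has_vector_derivative_transform[OF t, rotated]) (rule yt)
    then show ?thesis by (simp add: yt[OF t])
  qed
  have d: "(y has_vector_derivative fld c k (\<lambda>_. A) t (y t)) (at t within {-h..h})" if t: "t \<in> {-h..h}" for t
  proof -
    have h0: "-h \<le> 0" "0 \<le> h" using h by auto
    consider "t < 0" | "t = 0" | "t > 0" by linarith
    then show ?thesis
    proof cases
      case 1 then show ?thesis using left[of t] t at_within_Icc_split(1)[OF h0 t] by simp
    next
      case 2
      have "{-h..h} = {-h..0} \<union> {0..h}" using h by auto
      then show ?thesis using has_vector_derivative_within_Un[OF left right, of t] 2 h by simp
    next
      case 3 then show ?thesis using right[of t] t at_within_Icc_split(2)[OF h0 t] by simp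
    qed
  qed
  have fe: "frame_eq {-h..h} (chart_curve c y) (chart_frame c y) k (\<lambda>_. A)"
    by (rule frame_eq_chartI[OF c(1) yin d])
  have y0: "y 0 = cstate c p e" using 1(2) by (simp add: y_def)
  have "chart_curve c y 0 = p" using cinv_cmap[OF c] by (simp add: chart_curve_def y0 cstate_def)
  moreover from this have "chart_frame c y i 0 = e i" for i using c by (simp add: chart_frame_def y0 cstate_def)
  moreover have "frame_eq {-h<..<h} (chart_curve c y) (chart_frame c y) k (\<lambda>_. A)"
    by (rule frame_eq_subset[OF fe]) auto
  ultimately show thesis using that[OF h] fe by blast
qed

end

section \<open>Rigid variations\<close>

context riemannian_manifold
begin

lemma curvature_linear: "linear (curvature atl nab p u v)"
proof -
  obtain c where c: "c \<in> atl" "p \<in> cdom c" by (rule ex_chart)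
  have x: "cmap c p \<in> cimg c" using c by simp
  have bil: "bilinear (Gam c (cmap c p))" "\<And>h. bilinear (bil_deriv (Gam c) (cmap c p) h)"
    using sb_bilinear[OF open_cimg[OF c(1)] Gam_smooth_bilinear[OF c(1)] x]
      sb_deriv_bilinear[OF open_cimg[OF c(1)] Gam_smooth_bilinear[OF c(1)] x] by auto
  note l = chart_deriv_linear[OF c]
  show ?thesis
  proof (rule linearI)
    show "curvature atl nab p u v (w + w') = curvature atl nab p u v w + curvature atl nab p u v w'" for w w'
      by (rule iffD1[OF D_inject[OF c]], unfold linear_add[OF l] curvature_chart[OF c] Rc_def)
        (simp add: bilinear_radd bil)
    show "curvature atl nab p u v (a *\<^sub>R w) = a *\<^sub>R curvature atl nab p u v w" for a w
      by (rule iffD1[OF D_inject[OF c]], unfold linear_cmul[OF l] curvature_chart[OF c] Rc_def)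
        (simp add: bilinear_rmul bil algebra_simps)
  qed
qed

lemma has_cov_deriv_sum_scaleR:
  assumes t: "t \<in> I" and v: "has_velocity atl I \<gamma> t v"
    and \<phi>: "\<And>j. j \<in> J \<Longrightarrow> (\<phi> j has_vector_derivative \<phi>' j) (at t within I)"
    and Y: "\<And>j. j \<in> J \<Longrightarrow> has_cov_deriv atl nab I \<gamma> (Y j) t (Y' j)"
  shows "has_cov_deriv atl nab I \<gamma> (\<lambda>s. \<Sum>j\<in>J. \<phi> j s *\<^sub>R Y j s) t (\<Sum>j\<in>J. \<phi>' j *\<^sub>R Y j t + \<phi> j t *\<^sub>R Y' j)"
proof -
  obtain c where c: "c \<in> atl" "\<gamma> t \<in> cdom c" by (rule ex_chart)
  have ev: "\<forall>\<^sub>F s in at t within I. \<gamma> s \<in> cdom c"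
    by (rule eventually_in_chart[OF has_velocity_cont[OF v] open_cdom[OF c(1)] c(2)])
  let ?G = "Gam c (cmap c (\<gamma> t)) (D c (\<gamma> t) v)"
  have bil: "linear ?G" using sb_bilinear[OF open_cimg Gam_smooth_bilinear, OF c(1) c(1), of "cmap c (\<gamma> t)"] c
    by (simp add: bilinear_def)
  note l = chart_deriv_linear[OF c]
  have eq: "(\<Sum>j\<in>J. \<phi> j s *\<^sub>R D c (\<gamma> s) (Y j s)) = D c (\<gamma> s) (\<Sum>j\<in>J. \<phi> j s *\<^sub>R Y j s)" if "\<gamma> s \<in> cdom c" for s
    by (rule D_sum[OF c(1) that, symmetric])
  have "((\<lambda>s. \<Sum>j\<in>J. \<phi> j s *\<^sub>R D c (\<gamma> s) (Y j s)) has_vector_derivative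
     (\<Sum>j\<in>J. \<phi> j t *\<^sub>R (D c (\<gamma> t) (Y' j) - ?G (D c (\<gamma> t) (Y j t))) + \<phi>' j *\<^sub>R D c (\<gamma> t) (Y j t))) (at t within I)"
    by (intro has_vector_derivative_sum has_vector_derivative_scaleR has_cov_deriv_chartD[OF Y v c])
      (use \<phi> in \<open>auto simp: has_real_derivative_iff_has_vector_derivative\<close>)
  then have "((\<lambda>s. D c (\<gamma> s) (\<Sum>j\<in>J. \<phi> j s *\<^sub>R Y j s)) has_vector_derivative
     (\<Sum>j\<in>J. \<phi> j t *\<^sub>R (D c (\<gamma> t) (Y' j) - ?G (D c (\<gamma> t) (Y j t))) + \<phi>' j *\<^sub>R D c (\<gamma> t) (Y j t))) (at t within I)"
    unfolding has_vector_derivative_def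
  proof (rule has_derivative_transform_eventually[OF _ _ _ t])
    show "\<forall>\<^sub>F s in at t within I. (\<Sum>j\<in>J. \<phi> j s *\<^sub>R D c (\<gamma> s) (Y j s)) = D c (\<gamma> s) (\<Sum>j\<in>J. \<phi> j s *\<^sub>R Y j s)"
      using ev by eventually_elim (rule eq)
  qed (rule eq[OF c(2)])
  moreover have "(\<Sum>j\<in>J. \<phi> j t *\<^sub>R (D c (\<gamma> t) (Y' j) - ?G (D c (\<gamma> t) (Y j t))) + \<phi>' j *\<^sub>R D c (\<gamma> t) (Y j t)) =
    D c (\<gamma> t) (\<Sum>j\<in>J. \<phi>' j *\<^sub>R Y j t + \<phi> j t *\<^sub>R Y' j) - ?G (D c (\<gamma> t) (\<Sum>j\<in>J. \<phi> j t *\<^sub>R Y j t))"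
    by (simp add: linear_sum[OF l] linear_add[OF l] linear_cmul[OF l] linear_sum[OF bil] linear_cmul[OF bil]
        sum.distrib sum_subtractf scaleR_diff_right)
  ultimately show ?thesis by (intro has_cov_deriv_chartI[OF v c t]) simp
qed

lemma velocity_eq:
  assumes "has_velocity atl I \<gamma> t v" "at t within I \<noteq> bot"
  shows "velocity atl I \<gamma> t = v"
  unfolding velocity_def
  by (rule the_equality[where P="has_velocity atl I \<gamma> t", OF assms(1)]) (rule has_velocity_unique[OF _ assms])

lemma Kmat_continuous:
  assumes "\<And>i. i \<in> {2..DIM('e)} \<Longrightarrow> continuous_on I (\<kappa> i)"
  shows "continuous_on I (\<lambda>t. Kmat \<kappa> t (i :: 'e frame_index) j)"
proof -
  have "Rep_frame_index l \<noteq> 1 \<Longrightarrow> continuous_on I (\<kappa> (Rep_frame_index l))" for l :: "'e frame_index"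
    by (rule assms) (use Rep_frame_index_bounds[of l] in auto)
  then show ?thesis unfolding Kmat_def
    by (cases "Rep_frame_index i = 1"; cases "Rep_frame_index j = 1") (auto intro!: continuous_intros)
qed

text \<open>The hypothesis on \<open>Y\<close> is what differentiating the orthonormality of a
  family of frames yields. \<open>A\<close> is the linear map that sends each frame vector to its
  derivative, and it inherits skew-symmetry from the matrix of \<open>Y\<close>.\<close>

lemma rotation_properties:
  assumes o: "orth p E" and Y: "\<And>i j. g p (Y i) (E j) = - g p (E i) (Y j)"
  defines "A \<equiv> \<lambda>w. \<Sum>j\<in>UNIV. g p w (E j) *\<^sub>R Y j"
  shows "linear A" "A (E i) = Y i" "g p (A u) v = - g p u (A v)"
proof -
  show "linear A" unfolding A_def
    by (rule linearI) (simp_all add: g_simps scaleR_add_left sum.distrib scaleR_sum_right)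
  have "A (E i) = (\<Sum>j\<in>UNIV. if j = i then Y j else 0)"
    unfolding A_def by (rule sum.cong) (use o in \<open>auto simp: orth_def\<close>)
  then show "A (E i) = Y i" by simp
  have "g p (A u) v = g p (A u) (\<Sum>l\<in>UNIV. g p v (E l) *\<^sub>R E l)" by (subst orth_expand[OF o, of v]) (rule refl)
  also have "\<dots> = (\<Sum>l\<in>UNIV. \<Sum>j\<in>UNIV. g p v (E l) * (g p u (E j) * g p (Y j) (E l)))"
    by (simp add: A_def g_simps sum_distrib_left)
  also have "\<dots> = (\<Sum>l\<in>UNIV. \<Sum>j\<in>UNIV. - (g p v (E l) * (g p u (E j) * g p (E j) (Y l))))"
    by (subst Y) simp
  also have "\<dots> = - (\<Sum>l\<in>UNIV. g p v (E l) * (\<Sum>j\<in>UNIV. g p u (E j) * g p (E j) (Y l)))"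
    by (simp add: sum_negf sum_distrib_left)
  also have "\<dots> = - (\<Sum>l\<in>UNIV. g p v (E l) * g p u (Y l))"
  proof -
    have "(\<Sum>j\<in>UNIV. g p u (E j) * g p (E j) (Y l)) = g p u (Y l)" for l
    proof -
      have "g p u (Y l) = g p (\<Sum>j\<in>UNIV. g p u (E j) *\<^sub>R E j) (Y l)" by (subst orth_expand[OF o, of u]) (rule refl)
      also have "\<dots> = (\<Sum>j\<in>UNIV. g p u (E j) * g p (E j) (Y l))" by (simp add: g_simps)
      finally show ?thesis by simp
    qed
    then show ?thesis by simp
  qed
  also have "\<dots> = - g p u (A v)" by (simp add: A_def g_simps)
  finally show "g p (A u) v = - g p u (A v)" .
qed

text \<open>In the expansion of \<open>\<nabla>(A V)\<close> over the frame, the terms with \<open>K\<close> cancel by skew-symmetry.\<close>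

lemma rotation_cov_deriv:
  assumes f: "frame_eq I \<gamma> E k K" and skew: "\<And>i j. K t i j = - K t j i" and t: "t \<in> I"
    and o: "orth (\<gamma> t) (\<lambda>i. E i t)" and jac: "jacobi_eq I \<gamma> E k K X Y"
    and A: "\<And>s w. A s w = (\<Sum>j\<in>UNIV. g (\<gamma> s) w (E j s) *\<^sub>R Y j s)"
  shows "has_cov_deriv_endo atl nab I \<gamma> A t (curvature atl nab (\<gamma> t) (\<Sum>j\<in>UNIV. k j *\<^sub>R E j t) (X t))"
  unfolding has_cov_deriv_endo_def
proof (intro allI impI)
  fix V W assume V: "has_cov_deriv atl nab I \<gamma> V t W"
  let ?R = "curvature atl nab (\<gamma> t) (\<Sum>j\<in>UNIV. k j *\<^sub>R E j t) (X t)"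
  let ?g = "g (\<gamma> t)"
  have vel: "has_velocity atl I \<gamma> t (\<Sum>j\<in>UNIV. k j *\<^sub>R E j t)" and E: "\<And>i. has_cov_deriv atl nab I \<gamma> (E i) t (\<Sum>j\<in>UNIV. K t i j *\<^sub>R E j t)"
    using f t unfolding frame_eq_def by auto
  have Y: "has_cov_deriv atl nab I \<gamma> (Y i) t ((\<Sum>j\<in>UNIV. K t i j *\<^sub>R Y j t) + ?R (E i t))" for i
    using jac t unfolding jacobi_eq_def by blast
  have "has_cov_deriv atl nab I \<gamma> (\<lambda>s. \<Sum>j\<in>UNIV. g (\<gamma> s) (V s) (E j s) *\<^sub>R Y j s) t
    (\<Sum>j\<in>UNIV. (?g W (E j t) + ?g (V t) (\<Sum>l\<in>UNIV. K t j l *\<^sub>R E l t)) *\<^sub>R Y j t +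
       ?g (V t) (E j t) *\<^sub>R ((\<Sum>l\<in>UNIV. K t j l *\<^sub>R Y l t) + ?R (E j t)))"
    by (rule has_cov_deriv_sum_scaleR[OF t vel has_cov_deriv_metric[OF t V E] Y])
  also have "(\<Sum>j\<in>UNIV. (?g W (E j t) + ?g (V t) (\<Sum>l\<in>UNIV. K t j l *\<^sub>R E l t)) *\<^sub>R Y j t +
       ?g (V t) (E j t) *\<^sub>R ((\<Sum>l\<in>UNIV. K t j l *\<^sub>R Y l t) + ?R (E j t))) =
    A t W + ?R (V t) + ((\<Sum>j\<in>UNIV. \<Sum>l\<in>UNIV. (K t j l * ?g (V t) (E l t)) *\<^sub>R Y j t) +
      (\<Sum>j\<in>UNIV. \<Sum>l\<in>UNIV. (?g (V t) (E j t) * K t j l) *\<^sub>R Y l t))"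
  proof -
    have "?R (V t) = ?R (\<Sum>j\<in>UNIV. ?g (V t) (E j t) *\<^sub>R E j t)" by (subst orth_expand[OF o, of "V t"]) (rule refl)
    also have "\<dots> = (\<Sum>j\<in>UNIV. ?g (V t) (E j t) *\<^sub>R ?R (E j t))"
      by (simp add: linear_sum[OF curvature_linear] linear_cmul[OF curvature_linear])
    finally show ?thesis
      by (simp add: A g_simps scaleR_add_left scaleR_add_right sum.distrib scaleR_sum_left scaleR_sum_right)
  qed
  also have "(\<Sum>j\<in>UNIV. \<Sum>l\<in>UNIV. (?g (V t) (E j t) * K t j l) *\<^sub>R Y l t) =
      - (\<Sum>j\<in>UNIV. \<Sum>l\<in>UNIV. (K t j l * ?g (V t) (E l t)) *\<^sub>R Y j t)"
  proof -
    have "(\<Sum>j\<in>UNIV. \<Sum>l\<in>UNIV. (?g (V t) (E j t) * K t j l) *\<^sub>R Y l t) =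
      (\<Sum>l\<in>UNIV. \<Sum>j\<in>UNIV. (?g (V t) (E j t) * K t j l) *\<^sub>R Y l t)" by (rule sum.swap)
    also have "\<dots> = (\<Sum>l\<in>UNIV. \<Sum>j\<in>UNIV. - ((K t l j * ?g (V t) (E j t)) *\<^sub>R Y l t))"
    proof (intro sum.cong refl)
      fix l j
      show "(?g (V t) (E j t) * K t j l) *\<^sub>R Y l t = - ((K t l j * ?g (V t) (E j t)) *\<^sub>R Y l t)"
        using skew[of j l] by (simp add: mult.commute)
    qed
    finally show ?thesis by (simp add: sum_negf)
  qed
  finally show "has_cov_deriv atl nab I \<gamma> (\<lambda>s. A s (V s)) t (?R (V t) + A t W)"
    by (simp add: A add.commute)
qed

section \<open>The two directions of the correspondence\<close>

lemma at_0_within: "(0::real) < \<epsilon> \<Longrightarrow> at 0 within {-\<epsilon><..<\<epsilon>} = at 0"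
  by (rule at_within_open) auto

lemma rigid_variation_imp_jacobi:
  assumes L: "L > 0" and rv: "rigid_variation atl g nab L \<gamma> \<epsilon> G F"
  shows "\<exists>X. variation_field atl L \<epsilon> G X \<and>
              (\<exists>A. skew_field_along g L \<gamma> A \<and> generalized_jacobi atl nab L \<gamma> X A)"
proof -
  have \<epsilon>: "\<epsilon> > 0" and G0: "\<And>t. t \<in> {0..L} \<Longrightarrow> G 0 t = \<gamma> t"
    using rv unfolding rigid_variation_def by auto
  obtain c e \<kappa> where c: "C_k_curve atl 1 {-\<epsilon><..<\<epsilon>} c"
    and e: "\<And>i. i \<in> {1..DIM('e)} \<Longrightarrow> C_k_field_along atl 1 {-\<epsilon><..<\<epsilon>} c (e i)"
    and fam: "\<forall>\<tau>\<in>{-\<epsilon><..<\<epsilon>}.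
           C_k_curve atl 2 {0..L} (G \<tau>) \<and> G \<tau> 0 = c \<tau> \<and>
           (\<forall>i\<in>{1..DIM('e)}. F \<tau> i 0 = e i \<tau>) \<and>
           bishop_frame atl g nab L (G \<tau>) (F \<tau>) \<and>
           geodesic_curvatures atl nab L (G \<tau>) (F \<tau>) \<kappa>"
    using rv unfolding rigid_variation_def by blast
  let ?I = "{-\<epsilon><..<\<epsilon>}"
  have zI: "0 \<in> ?I" using \<epsilon> by simp
  define E where "E \<tau> i = F \<tau> (Rep_frame_index (i :: 'e frame_index))" for \<tau> i
  have fe: "frame_eq {0..L} (G \<tau>) (E \<tau>) kvec (Kmat \<kappa>)" and orth: "t \<in> {0..L} \<Longrightarrow> orth (G \<tau> t) (\<lambda>i. E \<tau> i t)"
    if "\<tau> \<in> ?I" for \<tau> t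
    using bishop_imp_frame_eq[OF L, of "G \<tau>" "F \<tau>" \<kappa>] fam that unfolding E_def by blast+
  have E1: "(\<Sum>j\<in>UNIV. kvec j *\<^sub>R E 0 j t) = F 0 1 t" for t
    unfolding E_def by (rule kvec_sum[of "\<lambda>i. F 0 i t"])
  have C2: "C_k_curve atl 2 {0..L} (G 0)" using fam zI by blast
  have cont: "continuous_on {0..L} (G 0)" using C2 unfolding C_k_curve_def by blast
  have T: "has_velocity atl {0..L} (G 0) t (F 0 1 t)" if "t \<in> {0..L}" for t
    using fe[OF zI] that E1 unfolding frame_eq_def by metis
  \<comment> \<open>Continuity of \<kappa> is not part of \<open>geodesic_curvatures\<close>. It is
    recovered from the C^2 regularity of the base curve, since \<kappa> consists of the components
    of the continuous acceleration in the frame.\<close>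
  have kap: "continuous_on {0..L} (\<kappa> i)" if i: "i \<in> {2..DIM('e)}" for i
  proof -
    note T1 = velocity_field_C1[OF L C2 T]
    obtain N where N: "\<And>t. t \<in> {0..L} \<Longrightarrow> has_cov_deriv atl nab {0..L} (G 0) (F 0 1) t (N t)"
      and N0: "C_k_field_along atl 0 {0..L} (G 0) N"
      using C1_field_cov_deriv[OF L cont T C_k_field_imp_0[OF T1] T1] by blast
    have "\<forall>t\<in>{0..L}. has_cov_deriv atl nab {0..L} (G 0) (F 0 i) t (SOME D. has_cov_deriv atl nab {0..L} (G 0) (F 0 i) t D)"
    proof
      fix t assume "t \<in> {0..L}"
      then have "\<exists>D. has_cov_deriv atl nab {0..L} (G 0) (F 0 i) t D"
        using fam zI i unfolding bishop_frame_def by blast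
      then show "has_cov_deriv atl nab {0..L} (G 0) (F 0 i) t (SOME D. has_cov_deriv atl nab {0..L} (G 0) (F 0 i) t D)"
        by (rule someI_ex)
    qed
    then have F0: "C_k_field_along atl 0 {0..L} (G 0) (F 0 i)" by (intro cov_deriv_field_continuous) blast
    have "continuous_on {0..L} (\<lambda>t. g (G 0 t) (N t) (F 0 i t))" by (rule metric_continuous[OF cont N0 F0])
    moreover have "g (G 0 t) (N t) (F 0 i t) = \<kappa> i t" if t: "t \<in> {0..L}" for t
    proof -
      have "has_cov_deriv atl nab {0..L} (G 0) (F 0 1) t (\<Sum>i\<in>{2..DIM('e)}. \<kappa> i t *\<^sub>R F 0 i t)"
        using fam zI t unfolding geodesic_curvatures_def by blast
      then have Nt: "N t = (\<Sum>i\<in>{2..DIM('e)}. \<kappa> i t *\<^sub>R F 0 i t)"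
        using has_cov_deriv_unique[OF N[OF t] _ at_within_Icc_nontrivial[OF L t]] by blast
      have o: "orthonormal_frame g (G 0 t) (\<lambda>i. F 0 i t)" using fam zI t unfolding bishop_frame_def by blast
      have "g (G 0 t) (N t) (F 0 i t) = (\<Sum>j\<in>{2..DIM('e)}. if j = i then \<kappa> i t else 0)"
        unfolding Nt g_simps by (rule sum.cong) (use o i in \<open>auto simp: orthonormal_frame_def\<close>)
      then show ?thesis using i by simp
    qed
    ultimately show ?thesis by (rule continuous_on_eq)
  qed
  note K = Kmat_continuous[OF kap]
  have ev: "\<forall>\<^sub>F \<tau> in at 0. frame_eq {0..L} (G \<tau>) (E \<tau>) kvec (Kmat \<kappa>)"
    unfolding eventually_at using \<epsilon> fe by (intro exI[of _ \<epsilon>]) (auto simp: abs_less_iff)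
  \<comment> \<open>The C^1 conditions on the initial curve and its frame supply the derivatives at
    t = 0 from which all others are propagated.\<close>
  have init: "\<exists>X Y. has_frame_deriv (\<lambda>\<tau>. G \<tau> 0) (\<lambda>i \<tau>. E \<tau> i 0) X Y"
  proof -
    have c': "C_k_curve atl (Suc 0) ?I c" using c by simp
    obtain v where v: "has_velocity atl ?I c 0 v" using C_k_curve_velocity[OF c' zI] by blast
    have contc: "continuous_on ?I c" using c unfolding C_k_curve_def by blast
    have "\<exists>N. has_cov_deriv atl nab ?I c (e (Rep_frame_index i)) 0 N" for i :: "'e frame_index"
      by (rule C1_field_has_cov_deriv[OF contc zI v e[OF Rep_frame_index]])
    then obtain N where N: "\<And>i :: 'e frame_index. has_cov_deriv atl nab ?I c (e (Rep_frame_index i)) 0 (N i)" by metis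
    have cG: "c \<tau> = G \<tau> 0" "e (Rep_frame_index i) \<tau> = E \<tau> i 0" if "\<tau> \<in> ?I" for \<tau> and i :: "'e frame_index"
      using fam that Rep_frame_index[of i] unfolding E_def by auto
    have "has_velocity atl UNIV (\<lambda>\<tau>. G \<tau> 0) 0 v"
      using has_velocity_cong[OF v zI, of "\<lambda>\<tau>. G \<tau> 0"] cG(1) has_velocity_at_eq[OF at_0_within[OF \<epsilon>]] by blast
    moreover have "has_cov_deriv atl nab UNIV (\<lambda>\<tau>. G \<tau> 0) (\<lambda>\<tau>. E \<tau> i 0) 0 (N i)" for i
      using has_cov_deriv_cong[OF N zI, of "\<lambda>\<tau>. G \<tau> 0" i "\<lambda>\<tau>. E \<tau> i 0"] cG has_cov_deriv_at_eq[OF at_0_within[OF \<epsilon>]] by blast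
    ultimately show ?thesis unfolding has_frame_deriv_def by blast
  qed
  then obtain X0 Y0 where init: "has_frame_deriv (\<lambda>\<tau>. G \<tau> 0) (\<lambda>i \<tau>. E \<tau> i 0) X0 Y0" by blast
  have "\<forall>t. \<exists>X Y. t \<in> {0..L} \<longrightarrow> has_frame_deriv (\<lambda>\<tau>. G \<tau> t) (\<lambda>i \<tau>. E \<tau> i t) X Y"
    using frame_deriv_everywhere[OF less_imp_le[OF L] K fe[OF zI] ev init] by blast
  then obtain X Y' where XY': "\<And>t. t \<in> {0..L} \<Longrightarrow> has_frame_deriv (\<lambda>\<tau>. G \<tau> t) (\<lambda>i \<tau>. E \<tau> i t) (X t) (Y' t)" by metis
  define Y where "Y i t = Y' t i" for i t
  have XY: "has_frame_deriv (\<lambda>\<tau>. G \<tau> t) (\<lambda>i \<tau>. E \<tau> i t) (X t) (\<lambda>i. Y i t)" if "t \<in> {0..L}" for t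
    using XY'[OF that] by (simp add: Y_def)
  have jac0: "jacobi_eq {0..L} (G 0) (E 0) kvec (Kmat \<kappa>) X Y"
    by (rule frame_deriv_jacobi[OF L K fe[OF zI] ev XY])
  have vf: "variation_field atl L \<epsilon> G X"
    unfolding variation_field_def has_velocity_at_eq[OF at_0_within[OF \<epsilon>]]
    using XY unfolding has_frame_deriv_def by blast
  have feg: "frame_eq {0..L} \<gamma> (E 0) kvec (Kmat \<kappa>)"
    by (rule frame_eq_cong[OF fe[OF zI]]) (use G0 in auto)
  have jac: "jacobi_eq {0..L} \<gamma> (E 0) kvec (Kmat \<kappa>) X Y"
    unfolding jacobi_eq_def
  proof (intro ballI conjI allI)
    fix t i assume t: "t \<in> {0..L}"
    show "has_cov_deriv atl nab {0..L} \<gamma> X t (\<Sum>j\<in>UNIV. kvec j *\<^sub>R Y j t)"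
      by (rule has_cov_deriv_cong[of _ "G 0" X]) (use jac0 t G0 in \<open>auto simp: jacobi_eq_def\<close>)
    show "has_cov_deriv atl nab {0..L} \<gamma> (Y i) t ((\<Sum>j\<in>UNIV. Kmat \<kappa> t i j *\<^sub>R Y j t) +
        curvature atl nab (\<gamma> t) (\<Sum>j\<in>UNIV. kvec j *\<^sub>R E 0 j t) (X t) (E 0 i t))"
      unfolding G0[OF t, symmetric]
      by (rule has_cov_deriv_cong[of _ "G 0" "Y i"]) (use jac0 t G0 in \<open>auto simp: jacobi_eq_def\<close>)
  qed
  have orthg: "orth (\<gamma> t) (\<lambda>i. E 0 i t)" if "t \<in> {0..L}" for t using orth[OF zI that] G0[OF that] by simp
  \<comment> \<open>The frames are orthonormal for every \<tau>, so their inner products have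
    derivative 0 in \<tau>.\<close>
  have Yskew: "g (\<gamma> t) (Y i t) (E 0 j t) = - g (\<gamma> t) (E 0 i t) (Y j t)" if t: "t \<in> {0..L}" for t i j
  proof -
    have cY: "has_cov_deriv atl nab UNIV (\<lambda>\<tau>. G \<tau> t) (\<lambda>\<tau>. E \<tau> i t) 0 (Y i t)" for i
      using XY[OF t] unfolding has_frame_deriv_def by blast
    have "((\<lambda>\<tau>. g (G \<tau> t) (E \<tau> i t) (E \<tau> j t)) has_vector_derivative
        g (G 0 t) (Y i t) (E 0 j t) + g (G 0 t) (E 0 i t) (Y j t)) (at 0)"
      by (rule has_cov_deriv_metric[OF UNIV_I cY cY])
    moreover have "((\<lambda>\<tau>. g (G \<tau> t) (E \<tau> i t) (E \<tau> j t)) has_vector_derivative 0) (at 0)"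
      by (rule has_vector_derivative_transform_within_open[of "\<lambda>_. if i = j then 1 else 0" _ _ ?I])
        (use orth t zI in \<open>auto simp: orth_def\<close>)
    ultimately have "g (G 0 t) (Y i t) (E 0 j t) + g (G 0 t) (E 0 i t) (Y j t) = 0"
      by (rule vector_derivative_unique_at)
    then show ?thesis using G0[OF t] by simp
  qed
  define A where "A t w = (\<Sum>j\<in>UNIV. g (\<gamma> t) w (E 0 j t) *\<^sub>R Y j t)" for t w
  note rot = rotation_properties[where E="\<lambda>i. E 0 i t" and Y="\<lambda>i. Y i t" and p="\<gamma> t" for t, OF orthg Yskew, folded A_def]
  have "skew_field_along g L \<gamma> A"
    unfolding skew_field_along_def using rot(1,3) by blast
  moreover have "generalized_jacobi atl nab L \<gamma> X A"
    unfolding generalized_jacobi_def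
  proof (intro ballI conjI)
    fix t assume t: "t \<in> {0..L}"
    have "has_velocity atl {0..L} \<gamma> t (\<Sum>j\<in>UNIV. kvec j *\<^sub>R E 0 j t)"
      using feg t unfolding frame_eq_def by blast
    then have vel: "velocity atl {0..L} \<gamma> t = (\<Sum>j\<in>UNIV. kvec j *\<^sub>R E 0 j t)"
      by (rule velocity_eq[OF _ at_within_Icc_nontrivial[OF L t]])
    have "A t (\<Sum>j\<in>UNIV. kvec j *\<^sub>R E 0 j t) = (\<Sum>j\<in>UNIV. kvec j *\<^sub>R Y j t)"
      using rot(1)[OF t t] rot(2)[OF t t] by (simp add: linear_sum linear_cmul)
    then show "has_cov_deriv atl nab {0..L} \<gamma> X t (A t (velocity atl {0..L} \<gamma> t))"
      using jac t unfolding vel jacobi_eq_def by simp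
    show "has_cov_deriv_endo atl nab {0..L} \<gamma> A t (curvature atl nab (\<gamma> t) (velocity atl {0..L} \<gamma> t) (X t))"
      unfolding vel by (rule rotation_cov_deriv[where A=A, OF feg Kmat_skew t orthg[OF t] jac A_def])
  qed
  ultimately show ?thesis using vf by blast
qed

lemma jacobi_imp_rigid_variation:
  assumes L: "L > 0" and \<gamma>: "C_k_curve atl 2 {0..L} \<gamma>"
    and unit: "\<And>t. t \<in> {0..L} \<Longrightarrow> g (\<gamma> t) (velocity atl {0..L} \<gamma> t) (velocity atl {0..L} \<gamma> t) = 1"
    and skew: "skew_field_along g L \<gamma> A" and gj: "generalized_jacobi atl nab L \<gamma> X A"
  shows "\<exists>\<epsilon> G F. rigid_variation atl g nab L \<gamma> \<epsilon> G F \<and>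
               variation_field atl L \<epsilon> G X \<and> infinitesimal_rotation atl nab L \<epsilon> G F A"
proof -
  define T where "T = velocity atl {0..L} \<gamma>"
  have T: "has_velocity atl {0..L} \<gamma> t (T t)" if t: "t \<in> {0..L}" for t
  proof -
    have "C_k_curve atl (Suc 1) {0..L} \<gamma>" using \<gamma> by (simp add: numeral_2_eq_2)
    then obtain v where v: "has_velocity atl {0..L} \<gamma> t v" using C_k_curve_velocity[OF _ t] by blast
    then show ?thesis using velocity_eq[OF v at_within_Icc_nontrivial[OF L t]] unfolding T_def by simp
  qed
  have z: "0 \<in> {0..L}" using L by simp
  obtain F0 \<kappa> where fe: "frame_eq {0..L} \<gamma> (\<lambda>i. F0 (Rep_frame_index i)) kvec (Kmat \<kappa>)"
    and orth: "\<And>t. t \<in> {0..L} \<Longrightarrow> orth (\<gamma> t) (\<lambda>i. F0 (Rep_frame_index i) t)"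
    and kap: "\<And>i. continuous_on {0..L} (\<kappa> i)" and F1: "\<And>t. t \<in> {0..L} \<Longrightarrow> F0 1 t = T t"
    using bishop_frame_exists[OF L \<gamma> T unit[folded T_def]] by blast
  define E where "E i = F0 (Rep_frame_index (i :: 'e frame_index))" for i
  note fe = fe[folded E_def] and orth = orth[folded E_def]
  have K: "continuous_on {0..L} (\<lambda>t. Kmat \<kappa> t (i :: 'e frame_index) j)" for i j by (rule Kmat_continuous[OF kap])
  have lin: "linear (A t)" and sk: "g (\<gamma> t) (A t u) v = - g (\<gamma> t) u (A t v)" if "t \<in> {0..L}" for t u v
    using skew that unfolding skew_field_along_def by blast+
  define Y where "Y i t = A t (E i t)" for i t
  have kT: "(\<Sum>j\<in>UNIV. kvec j *\<^sub>R E j t) = T t" if "t \<in> {0..L}" for t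
    using kvec_sum[of "\<lambda>i. F0 i t"] F1[OF that] by (simp add: E_def)
  have jac: "jacobi_eq {0..L} \<gamma> E kvec (Kmat \<kappa>) X Y"
    unfolding jacobi_eq_def
  proof (intro ballI conjI allI)
    fix t i assume t: "t \<in> {0..L}"
    have AK: "A t (\<Sum>j\<in>UNIV. a j *\<^sub>R E j t) = (\<Sum>j\<in>UNIV. a j *\<^sub>R Y j t)" for a
      by (simp add: linear_sum[OF lin[OF t]] linear_cmul[OF lin[OF t]] Y_def)
    have "has_cov_deriv atl nab {0..L} \<gamma> X t (A t (T t))" using gj t unfolding generalized_jacobi_def T_def by blast
    then show "has_cov_deriv atl nab {0..L} \<gamma> X t (\<Sum>j\<in>UNIV. kvec j *\<^sub>R Y j t)"
      using AK[of kvec] kT[OF t] by simp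
    \<comment> \<open>Evaluating the tensor equation on the frame field \<open>E i\<close> gives the
      linearized equation for \<open>Y i\<close>.\<close>
    have "has_cov_deriv_endo atl nab {0..L} \<gamma> A t (curvature atl nab (\<gamma> t) (T t) (X t))"
      using gj t unfolding generalized_jacobi_def T_def by blast
    moreover have "has_cov_deriv atl nab {0..L} \<gamma> (E i) t (\<Sum>j\<in>UNIV. Kmat \<kappa> t i j *\<^sub>R E j t)"
      using fe t unfolding frame_eq_def by blast
    ultimately have "has_cov_deriv atl nab {0..L} \<gamma> (\<lambda>s. A s (E i s)) t
        (curvature atl nab (\<gamma> t) (T t) (X t) (E i t) + A t (\<Sum>j\<in>UNIV. Kmat \<kappa> t i j *\<^sub>R E j t))"
      unfolding has_cov_deriv_endo_def by blast
    then show "has_cov_deriv atl nab {0..L} \<gamma> (Y i) t ((\<Sum>j\<in>UNIV. Kmat \<kappa> t i j *\<^sub>R Y j t) +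
        curvature atl nab (\<gamma> t) (\<Sum>j\<in>UNIV. kvec j *\<^sub>R E j t) (X t) (E i t))"
      unfolding kT[OF t] AK Y_def[abs_def] by (simp add: add.commute)
  qed
  \<comment> \<open>Components of \<open>X 0\<close> and of the images of the frame vectors under
    \<open>A 0\<close>. As constant coefficients of the transverse frame equation they prescribe the
    required derivatives at \<tau> = 0, and the skewness of \<open>a\<close> keeps the transverse
    frames orthonormal.\<close>
  define x where "x j = g (\<gamma> 0) (X 0) (E j 0)" for j
  define a where "a i j = g (\<gamma> 0) (Y i 0) (E j 0)" for i j
  have a_skew: "a i j = - a j i" for i j
    unfolding a_def Y_def using sk[OF z, of "E i 0" "E j 0"] g_sym[of "\<gamma> 0" "E i 0"] by simp
  obtain h \<sigma> W where h: "h > 0" and fo: "frame_eq {-h<..<h} \<sigma> W x (\<lambda>_. a)"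
    and \<sigma>0: "\<sigma> 0 = \<gamma> 0" and W0: "\<And>i. W i 0 = E i 0" and fc: "frame_eq {-h..h} \<sigma> W x (\<lambda>_. a)"
    using initial_frame_curve[of x a "\<gamma> 0" "\<lambda>i. E i 0"] by blast
  have orthW: "orth (\<sigma> \<tau>) (\<lambda>i. W i \<tau>)" if "\<tau> \<in> {-h..h}" for \<tau>
    by (rule orth_preserved[OF fc a_skew _ _ that, of 0]) (use h \<sigma>0 W0 orth[OF z] in simp_all)
  have init: "has_frame_deriv \<sigma> W (X 0) (\<lambda>i. Y i 0)"
  proof -
    have h0: "0 \<in> {-h<..<h}" using h by simp
    have "has_velocity atl {-h<..<h} \<sigma> 0 (\<Sum>j\<in>UNIV. x j *\<^sub>R W j 0)"
      "\<And>i. has_cov_deriv atl nab {-h<..<h} \<sigma> (W i) 0 (\<Sum>j\<in>UNIV. a i j *\<^sub>R W j 0)"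
      using fo h0 unfolding frame_eq_def by blast+
    moreover have "(\<Sum>j\<in>UNIV. x j *\<^sub>R W j 0) = X 0"
      unfolding x_def W0 by (rule orth_expand[OF orth[OF z], symmetric])
    moreover have "(\<Sum>j\<in>UNIV. a i j *\<^sub>R W j 0) = Y i 0" for i
      unfolding a_def W0 by (rule orth_expand[OF orth[OF z], symmetric])
    ultimately show ?thesis
      unfolding has_frame_deriv_def has_velocity_at_eq[OF at_0_within[OF h]] has_cov_deriv_at_eq[OF at_0_within[OF h]] by simp
  qed
  obtain \<epsilon> G F where var: "variation_on 0 L \<gamma> E kvec (Kmat \<kappa>) X Y \<sigma> W \<epsilon> G F"
    using global_variation_exists[OF less_imp_le[OF L] K fe jac init \<sigma>0 W0] by blast
  \<comment> \<open>Both ranges are respected: the transverse frames are controlled up to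
    \<open>h\<close>, the family of curves up to \<epsilon>.\<close>
  define \<epsilon>' where "\<epsilon>' = min \<epsilon> h"
  have \<epsilon>': "\<epsilon>' > 0" using var h unfolding variation_on_def \<epsilon>'_def by simp
  have v1: "frame_eq {0..L} (G \<tau>) (F \<tau>) kvec (Kmat \<kappa>)" "G \<tau> 0 = \<sigma> \<tau>" "F \<tau> i 0 = W i \<tau>" if "\<tau> \<in> {-\<epsilon>'<..<\<epsilon>'}" for \<tau> i
    using var that unfolding variation_on_def \<epsilon>'_def by auto
  have v2: "G 0 t = \<gamma> t" "F 0 i t = E i t" "has_frame_deriv (\<lambda>\<tau>. G \<tau> t) (\<lambda>i \<tau>. F \<tau> i t) (X t) (\<lambda>i. Y i t)"
    if "t \<in> {0..L}" for t i
    using var that unfolding variation_on_def by auto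
  have sub: "{-\<epsilon>'<..<\<epsilon>'} \<subseteq> {-h<..<h}" "{-\<epsilon>'<..<\<epsilon>'} \<subseteq> {-h..h}" by (auto simp: \<epsilon>'_def)
  \<comment> \<open>Back to frames indexed by natural numbers; outside the range from 1 to
    \<open>DIM('e)\<close> these are unspecified choices among the frame fields.\<close>
  define F' where "F' \<tau> i = F \<tau> (Abs_frame_index i)" for \<tau> i
  define e' where "e' i = W (Abs_frame_index i)" for i
  have F': "F' \<tau> (Rep_frame_index i) = F \<tau> i" and e': "e' (Rep_frame_index i) = W i" for \<tau> i
    by (simp_all add: F'_def e'_def Rep_frame_index_inverse)
  have one: "Rep_frame_index (Abs_frame_index 1 :: 'e frame_index) = 1"
    by (rule Abs_frame_index_inverse) (use DIM_positive[where 'a='e] in auto)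
  have "rigid_variation atl g nab L \<gamma> \<epsilon>' G F'"
    unfolding rigid_variation_def
  proof (intro conjI exI[of _ \<sigma>] exI[of _ e'] exI[of _ \<kappa>] ballI \<epsilon>' \<sigma>0)
    show "G 0 t = \<gamma> t" if "t \<in> {0..L}" for t by (rule v2(1)[OF that])
    note fs = frame_eq_subset[OF fo sub(1)]
    have "C_k_curve atl 2 {-\<epsilon>'<..<\<epsilon>'} \<sigma>" by (rule frame_eq_regular(1)[OF fs]) auto
    then show "C_k_curve atl 1 {-\<epsilon>'<..<\<epsilon>'} \<sigma>"
      unfolding C_k_curve_def numeral_2_eq_2 One_nat_def using C_k_on_Suc_imp by blast
    show "C_k_field_along atl 1 {-\<epsilon>'<..<\<epsilon>'} \<sigma> (e' i)" for i
      unfolding e'_def by (rule frame_eq_regular(2)[OF fs]) auto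
    show "has_velocity atl {0..L} \<gamma> 0 (e' 1 0)"
      using T[OF z] F1[OF z] by (simp add: e'_def W0 E_def one[simplified])
  next
    fix \<tau> assume \<tau>: "\<tau> \<in> {-\<epsilon>'<..<\<epsilon>'}"
    have \<tau>h: "\<tau> \<in> {-h..h}" using \<tau> sub by blast
    show "orthonormal_frame g (\<sigma> \<tau>) (\<lambda>i. e' i \<tau>)"
      unfolding orthonormal_frame_iff e' by (rule orthW[OF \<tau>h])
    show "C_k_curve atl 2 {0..L} (G \<tau>)" by (rule frame_eq_regular(1)[OF v1(1)[OF \<tau>] K])
    show "G \<tau> 0 = \<sigma> \<tau>" by (rule v1(2)[OF \<tau>])
    show "F' \<tau> i 0 = e' i \<tau>" for i using v1(3)[OF \<tau>] by (simp add: F'_def e'_def)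
    have o: "orth (G \<tau> t) (\<lambda>i. F' \<tau> (Rep_frame_index i) t)" if t: "t \<in> {0..L}" for t
      unfolding F' by (rule orth_preserved[OF v1(1)[OF \<tau>] Kmat_skew z _ t]) (use orthW[OF \<tau>h] v1(2,3)[OF \<tau>] in simp)
    have f': "frame_eq {0..L} (G \<tau>) (\<lambda>i. F' \<tau> (Rep_frame_index i)) kvec (Kmat \<kappa>)"
      unfolding F' by (rule v1(1)[OF \<tau>])
    show "bishop_frame atl g nab L (G \<tau>) (F' \<tau>)" "geodesic_curvatures atl nab L (G \<tau>) (F' \<tau>) \<kappa>"
      by (rule frame_eq_imp_bishop[OF f' o], assumption)+
  qed
  moreover have "variation_field atl L \<epsilon>' G X"
    unfolding variation_field_def has_velocity_at_eq[OF at_0_within[OF \<epsilon>']]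
    using v2(3) unfolding has_frame_deriv_def by blast
  moreover have "infinitesimal_rotation atl nab L \<epsilon>' G F' A"
    unfolding infinitesimal_rotation_def has_cov_deriv_at_eq[OF at_0_within[OF \<epsilon>']]
  proof (intro ballI)
    fix t i assume t: "t \<in> {0..L}"
    have "has_cov_deriv atl nab UNIV (\<lambda>\<tau>. G \<tau> t) (\<lambda>\<tau>. F \<tau> (Abs_frame_index i) t) 0 (Y (Abs_frame_index i) t)"
      using v2(3)[OF t] unfolding has_frame_deriv_def by blast
    then show "has_cov_deriv atl nab UNIV (\<lambda>\<tau>. G \<tau> t) (\<lambda>\<tau>. F' \<tau> i t) 0 (A t (F' 0 i t))"
      by (simp add: F'_def Y_def v2(2)[OF t])
  qed
  ultimately show ?thesis by blast
qed

end

theorem theorem3p2: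
  fixes atl :: "('m::{t2_space, second_countable_topology}, 'e::euclidean_space) chart set"
    and g :: "'m \<Rightarrow> 'e \<Rightarrow> 'e \<Rightarrow> real"
    and nab :: "'m \<Rightarrow> 'e \<Rightarrow> ('m \<Rightarrow> 'e) \<Rightarrow> 'e"
    and L :: real and \<gamma> :: "real \<Rightarrow> 'm"
  assumes "smooth_atlas atl" and "riemannian_metric atl g" and "riem_complete atl g"
    and "levi_civita atl g nab"
    and "L > 0" and "C_k_curve atl 2 {0..L} \<gamma>"
    and "\<And>t. t \<in> {0..L} \<Longrightarrow>
           g (\<gamma> t) (velocity atl {0..L} \<gamma> t) (velocity atl {0..L} \<gamma> t) = 1"
  shows "(\<forall>\<epsilon> G F. rigid_variation atl g nab L \<gamma> \<epsilon> G F \<longrightarrow>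
            (\<exists>X. variation_field atl L \<epsilon> G X \<and>
              (\<exists>A. skew_field_along g L \<gamma> A \<and> generalized_jacobi atl nab L \<gamma> X A))) \<and>
         (\<forall>X A. skew_field_along g L \<gamma> A \<and> generalized_jacobi atl nab L \<gamma> X A \<longrightarrow>
            (\<exists>\<epsilon> G F. rigid_variation atl g nab L \<gamma> \<epsilon> G F \<and>
               variation_field atl L \<epsilon> G X \<and> infinitesimal_rotation atl nab L \<epsilon> G F A))"
proof -
  interpret riemannian_manifold atl g nab
    using assms(1,2,4) by unfold_locales
  show ?thesis
    using rigid_variation_imp_jacobi[OF assms(5)] jacobi_imp_rigid_variation[OF assms(5,6,7)] by blast
qed

end
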